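(* Let $s\in\mathbb{R}$ and $k>s$. (1) Let $\Phi\subset W_2^s(\mathbb{R}^d)$ be finite and let $k>0$. The stationary FSI ladder $(S^h)_{h>0}$ with $S^h=\{g(\cdot/h):g\in S_\Phi(W_2^s)\}$ provides approximation order $k$ in $W_2^s(\mathbb{R}^d)$ if and only if there exists a neighborhood $\Omega$ of $0$ such that the function $$\omega\mapsto\frac{1}{|\omega|^{2k-2s}}\inf_{v\in\mathbb{C}^\Phi}\frac{v^*G^0_{\Phi,s}(\omega)v}{v^*G_{\Phi,s}(\omega)v}$$ belongs to $L_\infty(\Omega)$, where $$G_{\Phi,s}=\sum_{\alpha\in2\pi\mathbb{Z}^d}\widehat\Phi(\cdot+\alpha)\widehat\Phi^*(\cdot+\alpha)|\cdot+\alpha|^{2s},\qquad G^0_{\Phi,s}=\sum_{\alpha\in2\pi\mathbb{Z}^d\setminus\{0\}}\widehat\Phi(\cdot+\alpha)\widehat\Phi^*(\cdot+\alpha)|\cdot+\alpha|^{2s}.$$ (2) Let $\Phi_h\subset W_2^s(\mathbb{R}^d)$ be finite for each $h>0$ and let $k\ge0$. The nonstationary FSI ladder $(S^h)_{h>0}$ with $S^h=\{g(\cdot/h):g\in S_{\Phi_h}(W_2^s)\}$ provides approximation order $k$ in $W_2^s(\mathbb{R}^d)$ if and only if there exist a neighborhood $\Omega$ of $0$ and $h_0>0$ such that the collection of functions $$\omega\mapsto\frac{1}{(|\omega|^2+h^2)^{k-s}}\inf_{v}\frac{v^*G^0_{\Phi_h,s,h}(\omega)v}{v^*G_{\Phi_h,s,h}(\omega)v},\qquad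 0<h<h_0,$$ is bounded in $L_\infty(\Omega)$, where $$G_{\Phi_h,s,h}(\omega)=\sum_{\alpha\in2\pi\mathbb{Z}^d}\widehat{\Phi_h}(\omega+\alpha)\widehat{\Phi_h}^*(\omega+\alpha)(|\omega+\alpha|^2+h^2)^s,$$ $$G^0_{\Phi_h,s,h}(\omega)=\sum_{\alpha\in2\pi\mathbb{Z}^d\setminus\{0\}}\widehat{\Phi_h}(\omega+\alpha)\widehat{\Phi_h}^*(\omega+\alpha)(|\omega+\alpha|^2+h^2)^s.$$
   Context: $|\cdot|$ is the Euclidean norm; $\widehat f(\omega)=\int f(x)e^{-i\omega\cdot x}dx$. For $s\in\mathbb{R}$, $W_2^s=W_2^s(\mathbb{R}^d)$ is the space of tempered distributions $f$ with $\widehat f$ locally in $L_2(\mathbb{R}^d)$ and $\|f\|_{W_2^s}^2=\int_{\mathbb{R}^d}(1+|\omega|)^{2s}|\widehat f(\omega)|^2d\omega<\infty$. For finite $\Phi\subset W_2^s$, $S_\Phi(W_2^s)$ is the smallest closed subspace of $W_2^s$ that contains $\Phi$ and is invariant under integer translations (a finitely generated shift-invariant, FSI, space). $\Phi$ is identified with the column vector of its elements, $\widehat\Phi$ is the vector of their Fourier transforms, and $\mathbb{C}^\Phi$ denotes complex vectors indexed by $\Phi$. Approximation order: for $k>s$, a family (ladder) $(S^h)_{h>0}$ of closed subspaces of $W_2^s$, with $S^h$ invariant under translations by $h\mathbb{Z}^d$, provides approximation order $k$ in $W_2^s$ if there is a constant $C$ with $\inf_{g\in S^h}\|f-g\|_{W_2^s}\le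 Ch^{k-s}\|f\|_{W_2^k}$ for every $f\in W_2^k(\mathbb{R}^d)$ and $h>0$. *)

theory Defs
  imports "HOL-Analysis.Analysis" "HOL-Probability.Essential_Supremum"
begin

section \<open>Schwartz functions and tempered distributions\<close>

fun partials :: "'d list \<Rightarrow> (real^'d::finite \<Rightarrow> complex) \<Rightarrow> real^'d \<Rightarrow> complex" where
  "partials [] \<phi> = \<phi>"
| "partials (j # js) \<phi> = (\<lambda>x. frechet_derivative (partials js \<phi>) (at x) (axis j 1))"

text \<open>Since all iterated partial derivatives are required to be differentiable, this is
  smoothness together with rapid decay of all derivatives.\<close>

definition schwartz :: "(real^'d::finite \<Rightarrow> complex) set" where
  "schwartz = {\<phi>. \<forall>js. (\<forall>x. partials js \<phi> differentiable (at x)) \<and>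
                       (\<forall>m::nat. \<exists>C. \<forall>x. norm x ^ m * cmod (partials js \<phi> x) \<le> C)}"

definition schwartz_seminorm :: "nat \<Rightarrow> 'd list \<Rightarrow> (real^'d::finite \<Rightarrow> complex) \<Rightarrow> real" where
  "schwartz_seminorm m js \<phi> = (SUP x. norm x ^ m * cmod (partials js \<phi> x))"

definition test_functions :: "(real^'d::finite \<Rightarrow> complex) set" where
  "test_functions = {\<phi> \<in> schwartz. bounded {x. \<phi> x \<noteq> 0}}"

type_synonym 'd dist = "(real^'d \<Rightarrow> complex) \<Rightarrow> complex"

text \<open>A tempered distribution is a continuous linear functional on the Schwartz space. As a
  total HOL function it is normalised to vanish on arguments that are not Schwartz functions,
  so that equality of distributions is equality in HOL.\<close>

definition tempered :: "'d::finite dist set" where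
  "tempered = {T.
     (\<forall>\<phi>. \<phi> \<notin> schwartz \<longrightarrow> T \<phi> = 0) \<and>
     (\<forall>\<phi>\<in>schwartz. \<forall>\<psi>\<in>schwartz. T (\<lambda>x. \<phi> x + \<psi> x) = T \<phi> + T \<psi>) \<and>
     (\<forall>c. \<forall>\<phi>\<in>schwartz. T (\<lambda>x. c * \<phi> x) = c * T \<phi>) \<and>
     (\<exists>C N. \<forall>\<phi>\<in>schwartz.
        cmod (T \<phi>) \<le> C * (\<Sum>m\<le>N. \<Sum>js\<in>{js. length js \<le> N}. schwartz_seminorm m js \<phi>))}"

definition fourier :: "(real^'d::finite \<Rightarrow> complex) \<Rightarrow> real^'d \<Rightarrow> complex" where
  "fourier \<phi> \<omega> = (LINT x|lborel. \<phi> x * exp (- (\<i> * complex_of_real (\<omega> \<bullet> x))))"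

definition dist_fourier :: "'d::finite dist \<Rightarrow> 'd dist" where
  "dist_fourier T = (\<lambda>\<phi>. if \<phi> \<in> schwartz then T (fourier \<phi>) else 0)"

definition dist_zero :: "'d::finite dist" where
  "dist_zero = (\<lambda>\<phi>. 0)"

definition dist_add :: "'d::finite dist \<Rightarrow> 'd dist \<Rightarrow> 'd dist" where
  "dist_add T U = (\<lambda>\<phi>. T \<phi> + U \<phi>)"

definition dist_scale :: "complex \<Rightarrow> 'd::finite dist \<Rightarrow> 'd dist" where
  "dist_scale c T = (\<lambda>\<phi>. c * T \<phi>)"

definition dist_diff :: "'d::finite dist \<Rightarrow> 'd dist \<Rightarrow> 'd dist" where
  "dist_diff T U = (\<lambda>\<phi>. T \<phi> - U \<phi>)"

text \<open>For a function \<open>g\<close> regarded as a distribution, \<open>dist_translate a g\<close> is \<open>g (x - a)\<close> and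
  \<open>dist_dilate h g\<close> is \<open>g (x / h)\<close>; the formulas are the corresponding changes of variables
  in the pairing with a Schwartz function.\<close>

definition dist_translate :: "real^'d::finite \<Rightarrow> 'd dist \<Rightarrow> 'd dist" where
  "dist_translate a T = (\<lambda>\<phi>. T (\<lambda>x. \<phi> (x + a)))"

definition dist_dilate :: "real \<Rightarrow> 'd::finite dist \<Rightarrow> 'd dist" where
  "dist_dilate h T = (\<lambda>\<phi>. T (\<lambda>x. complex_of_real (h ^ CARD('d)) * \<phi> (h *\<^sub>R x)))"

section \<open>The spaces \<open>W s\<close>\<close>

definition locally_L2 :: "(real^'d::finite \<Rightarrow> complex) \<Rightarrow> bool" where
  "locally_L2 F \<longleftrightarrow> F \<in> borel_measurable lborel \<and>
     (\<forall>K. compact K \<longrightarrow> set_integrable lborel K (\<lambda>\<omega>. (cmod (F \<omega>))\<^sup>2))"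

definition represented_by :: "'d::finite dist \<Rightarrow> (real^'d \<Rightarrow> complex) \<Rightarrow> bool" where
  "represented_by T F \<longleftrightarrow>
     locally_L2 F \<and> (\<forall>\<phi>\<in>test_functions. T \<phi> = (LINT \<omega>|lborel. F \<omega> * \<phi> \<omega>))"

text \<open>The Fourier transform of \<open>f\<close> as a function, when it is locally square integrable. It is
  determined up to a null set, and one representative is chosen.\<close>

definition hat :: "'d::finite dist \<Rightarrow> real^'d \<Rightarrow> complex" where
  "hat f = (SOME F. represented_by (dist_fourier f) F)"

definition W :: "real \<Rightarrow> 'd::finite dist set" where
  "W s = {f \<in> tempered. (\<exists>F. represented_by (dist_fourier f) F) \<and>
            integrable lborel (\<lambda>\<omega>. (1 + norm \<omega>) powr (2 * s) * (cmod (hat f \<omega>))\<^sup>2)}"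

definition W_norm :: "real \<Rightarrow> 'd::finite dist \<Rightarrow> real" where
  "W_norm s f = sqrt (LINT \<omega>|lborel. (1 + norm \<omega>) powr (2 * s) * (cmod (hat f \<omega>))\<^sup>2)"

definition closed_W_subspace :: "real \<Rightarrow> 'd::finite dist set \<Rightarrow> bool" where
  "closed_W_subspace s V \<longleftrightarrow>
     V \<subseteq> W s \<and> dist_zero \<in> V \<and>
     (\<forall>f\<in>V. \<forall>g\<in>V. dist_add f g \<in> V) \<and>
     (\<forall>c. \<forall>f\<in>V. dist_scale c f \<in> V) \<and>
     (\<forall>f\<in>W s. (\<forall>e>0. \<exists>g\<in>V. W_norm s (dist_diff f g) < e) \<longrightarrow> f \<in> V)"

definition integer_lattice :: "(real^'d::finite) set" where
  "integer_lattice = {a. \<forall>j. a $ j \<in> \<int>}"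

definition shift_invariant :: "real \<Rightarrow> 'd::finite dist set \<Rightarrow> bool" where
  "shift_invariant h V \<longleftrightarrow> (\<forall>a\<in>integer_lattice. \<forall>f\<in>V. dist_translate (h *\<^sub>R a) f \<in> V)"

definition fsi_space :: "real \<Rightarrow> 'd::finite dist set \<Rightarrow> 'd dist set" where
  "fsi_space s \<Phi> = \<Inter>{V. closed_W_subspace s V \<and> shift_invariant 1 V \<and> \<Phi> \<subseteq> V}"

section \<open>Approximation order\<close>

text \<open>Only the values of a ladder at positive parameters matter.\<close>

definition ladder :: "real \<Rightarrow> (real \<Rightarrow> 'd::finite dist set) \<Rightarrow> bool" where
  "ladder s S \<longleftrightarrow> (\<forall>h>0. closed_W_subspace s (S h) \<and> shift_invariant h (S h))"

definition approximation_order ::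
  "real \<Rightarrow> real \<Rightarrow> (real \<Rightarrow> 'd::finite dist set) \<Rightarrow> bool" where
  "approximation_order s k S \<longleftrightarrow> ladder s S \<and>
     (\<exists>C. \<forall>f\<in>W k. \<forall>h>0.
        (INF g\<in>S h. W_norm s (dist_diff f g)) \<le> C * h powr (k - s) * W_norm k f)"

section \<open>Gramians\<close>

definition dual_lattice :: "(real^'d::finite) set" where
  "dual_lattice = (\<lambda>a. (2 * pi) *\<^sub>R a) ` integer_lattice"

text \<open>The entry at \<open>(\<phi>, \<psi>)\<close> of the sum, over the frequencies in \<open>A\<close>, of the column vector
  of Fourier transforms times its conjugate transpose, with weight \<open>w\<close>. For generators in
  \<open>W s\<close> and the weights used below the series converges absolutely for almost all \<open>\<omega>\<close>.\<close>

definition gramian ::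
  "(real^'d::finite) set \<Rightarrow> (real^'d \<Rightarrow> real) \<Rightarrow> real^'d \<Rightarrow> 'd dist \<Rightarrow> 'd dist \<Rightarrow> complex" where
  "gramian A w \<omega> \<phi> \<psi> =
     (\<Sum>\<^sub>\<infinity>\<alpha>\<in>A. hat \<phi> (\<omega> + \<alpha>) * cnj (hat \<psi> (\<omega> + \<alpha>)) * complex_of_real (w (\<omega> + \<alpha>)))"

text \<open>The number \<open>v\<^sup>* G v\<close>, which is real because the matrix is Hermitian. Only the values
  of \<open>v\<close> on \<open>\<Phi>\<close> matter.\<close>

definition hermitian_form ::
  "'d dist set \<Rightarrow> ('d dist \<Rightarrow> 'd dist \<Rightarrow> complex) \<Rightarrow> ('d::finite dist \<Rightarrow> complex) \<Rightarrow> real" where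
  "hermitian_form \<Phi> G v = Re (\<Sum>\<phi>\<in>\<Phi>. \<Sum>\<psi>\<in>\<Phi>. cnj (v \<phi>) * G \<phi> \<psi> * v \<psi>)"

text \<open>The infimum of \<open>v\<^sup>* G\<^sup>0 v / v\<^sup>* G v\<close> over those \<open>v\<close> for which the quotient is
  defined. If there is none, that is, if \<open>G\<close> vanishes at \<open>\<omega>\<close>, the infimum is \<open>\<infinity>\<close>; the value
  \<open>0\<close> that division by zero has in HOL would be wrong here, as then even the zero space
  would satisfy any condition that bounds this function.\<close>

definition gramian_ratio ::
  "'d::finite dist set \<Rightarrow> (real^'d \<Rightarrow> real) \<Rightarrow> real^'d \<Rightarrow> ennreal" where
  "gramian_ratio \<Phi> w \<omega> =
     (let G = gramian dual_lattice w \<omega>; G0 = gramian (dual_lattice - {0}) w \<omega>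
      in INF v\<in>{v. hermitian_form \<Phi> G v \<noteq> 0}.
           ennreal (hermitian_form \<Phi> G0 v / hermitian_form \<Phi> G v))"

definition stationary_quotient ::
  "real \<Rightarrow> real \<Rightarrow> 'd::finite dist set \<Rightarrow> real^'d \<Rightarrow> ennreal" where
  "stationary_quotient s k \<Phi> \<omega> =
     ennreal (1 / norm \<omega> powr (2 * k - 2 * s)) *
     gramian_ratio \<Phi> (\<lambda>x. norm x powr (2 * s)) \<omega>"

definition nonstationary_quotient ::
  "real \<Rightarrow> real \<Rightarrow> real \<Rightarrow> 'd::finite dist set \<Rightarrow> real^'d \<Rightarrow> ennreal" where
  "nonstationary_quotient s k h \<Phi> \<omega> =
     ennreal (1 / ((norm \<omega>)\<^sup>2 + h\<^sup>2) powr (k - s)) *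
     gramian_ratio \<Phi> (\<lambda>x. ((norm x)\<^sup>2 + h\<^sup>2) powr s) \<omega>"

end

theory Submission
  imports Defs "HOL-Probability.Sinc_Integral" "HOL-Probability.Characteristic_Functions"
begin

text \<open>
  The problem is moved to the frequency domain. Rescaling the frequencies by \<open>h\<close> turns the norms of order
  \<open>s\<close> and \<open>k\<close> into weighted \<open>L\<^sub>2\<close> norms with the squared weights \<open>(|x|\<^sup>2 + h\<^sup>2)\<^sup>s\<close> and \<open>(|x|\<^sup>2 + h\<^sup>2)\<^sup>k\<close>, up to constants that
  do not depend on \<open>h\<close> and powers of \<open>h\<close> that cancel against the one in the definition of the order. Hence the ladder
  provides approximation order \<open>k\<close> if and only if every function \<open>F(x) = hat f(x / h)\<close> can be approximated by Fourier
  transforms of elements of the undilated shift-invariant space with an error, in the first weight, of at most a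
  constant times the energy of \<open>F\<close> in the second weight (\<open>approximation_order_iff_energy\<close>).

  Next the problem decouples into one problem for each fiber \<open>\<omega> + 2\<pi>\<int>\<^sup>d\<close>, where \<open>\<omega>\<close> ranges over the cube \<open>(-\<pi>,\<pi>]\<^sup>d\<close>. On the
  one hand, the restriction of \<open>hat g\<close> to almost every fiber is a limit of linear combinations of the restrictions of
  the generators, for every \<open>g\<close> in the space (\<open>fsi_space_fibers\<close>). On the other hand, combinations of the
  generators with arbitrary bounded Borel \<open>2\<pi>\<close>-periodic coefficients belong to the closure of the space
  (\<open>approximable_reduce\<close>, which goes from trigonometric polynomials via Stone-Weierstrass to Borel functions).
  Outside the cube the first weight is at most the second, so that only the part of \<open>F\<close> inside the cube matters, and on
  each fiber that part is a multiple of the unit vector \<open>e\<^sub>0\<close> at \<open>\<alpha> = 0\<close>. Thus order \<open>k\<close> means that the squared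
  distance of \<open>e\<^sub>0\<close> from the span of the generators on the fiber through \<open>\<omega>\<close>, in the first weight, is at most a constant times
  \<open>(|\<omega>|\<^sup>2 + h\<^sup>2)\<^sup>k\<close>, for all \<open>h\<close> and almost all \<open>\<omega>\<close> in the cube. That this suffices is \<open>fsi_approximation\<close>. That it is necessary
  is \<open>ratio_necessary\<close>, where the order condition is tested on functions whose Fourier transforms are
  indicators of Borel sets; these exist by Fourier inversion (\<open>fourier_preimage_of_indicator\<close>).

  On one fiber the problem is finite dimensional. Put \<open>W = (|\<omega>|\<^sup>2 + h\<^sup>2)\<^sup>s\<close>, let \<open>x\<close> be the value of \<open>v\<^sup>* \<Phi>\<close> at \<open>\<omega>\<close> and
  \<open>C = v\<^sup>* G\<^sup>0 v\<close>, so that \<open>v\<^sup>* G v = W |x|\<^sup>2 + C\<close>. The squared distance of \<open>e\<^sub>0\<close> from the line spanned by the combination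
  \<open>v\<^sup>* \<Phi>\<close> is the minimum of \<open>W |1 - t x|\<^sup>2 + |t|\<^sup>2 C\<close> over complex \<open>t\<close>, which is \<open>W C / (W |x|\<^sup>2 + C)\<close>. The squared distance from
  the whole span is therefore \<open>W min(1, r)\<close>, where \<open>r\<close> is the infimum of the quotients \<open>v\<^sup>* G\<^sup>0 v / v\<^sup>* G v\<close>
  (\<open>ratio_le_fiber_error\<close>, \<open>fiber_error_lt_of_ratio\<close>). Order \<open>k\<close> has become the condition
  \<open>min(1, r) \<le> K (|\<omega>|\<^sup>2 + h\<^sup>2)\<^sup>k\<^sup>-\<^sup>s\<close> for all \<open>h\<close> and almost all \<open>\<omega>\<close> in the cube (\<open>approximation_order_iff_ratio\<close>).

  Where \<open>(\<omega>,h)\<close> is bounded away from the origin this holds trivially for large \<open>K\<close>, and near the origin the minimum is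
  \<open>r\<close>. That proves the nonstationary part (\<open>nonstationary_condition_iff\<close>). In the stationary part the weight
  \<open>|x|\<^sup>2\<close> replaces \<open>|x|\<^sup>2 + h\<^sup>2\<close>. If \<open>h\<close> is comparable with \<open>|\<omega>|\<close>, then the two agree on the whole fiber up to a factor, which
  derives the stationary condition from the family of conditions for all \<open>h\<close>. For larger \<open>h\<close> they differ only at
  \<open>\<alpha> = 0\<close>, where a small ratio makes the corresponding term dominant and \<open>k \<ge> 0\<close> gives the monotonicity needed to
  replace \<open>|\<omega>|\<^sup>2\<^sup>k\<close> by \<open>(|\<omega>|\<^sup>2 + h\<^sup>2)\<^sup>k\<close> (\<open>stationary_condition_iff\<close>).\<close>

section \<open>Schwartz functions\<close>

definition partial_deriv :: "'d \<Rightarrow> (real^'d::finite \<Rightarrow> complex) \<Rightarrow> real^'d \<Rightarrow> complex" where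
  "partial_deriv j f = (\<lambda>x. frechet_derivative f (at x) (axis j 1))"

lemma partial_deriv_eq: "(\<And>x. (f has_derivative f' x) (at x)) \<Longrightarrow> partial_deriv j f = (\<lambda>x. f' x (axis j 1))"
  unfolding partial_deriv_def by (metis frechet_derivative_at)

lemma partials_Cons: "partials (j # js) f = partial_deriv j (partials js f)"
  by (simp add: partial_deriv_def)

lemma partials_snoc: "partials (js @ [j]) f = partials js (partial_deriv j f)"
  by (induction js) (simp_all add: partial_deriv_def)

text \<open>The class \<open>schwartz\<close> is the largest class of rapidly decreasing differentiable functions
  that is closed under partial derivatives. Membership is therefore proved below by exhibiting an
  invariant class: one that is large enough to contain the partial derivatives of its members, for
  instance all sums \<open>x\<^sub>i f + g\<close> when the function of interest is \<open>x\<^sub>i f\<close>.\<close>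

definition rapid :: "(real^'d::finite \<Rightarrow> complex) \<Rightarrow> bool" where
  "rapid f \<longleftrightarrow> (\<forall>m::nat. \<exists>C. \<forall>x. norm x ^ m * cmod (f x) \<le> C)"

lemma schwartz_coinduct:
  assumes "f \<in> X"
    and "\<And>g x. g \<in> X \<Longrightarrow> g differentiable (at x)"
    and "\<And>g. g \<in> X \<Longrightarrow> rapid g"
    and "\<And>g j. g \<in> X \<Longrightarrow> partial_deriv j g \<in> X"
  shows "f \<in> schwartz"
proof -
  have "partials js f \<in> X" for js
  proof (induction js)
    case (Cons j js)
    then show ?case using assms(4) by (simp add: partials_Cons del: partials.simps)
  qed (use assms in simp)
  then show ?thesis using assms(2,3) unfolding schwartz_def rapid_def by blast
qed

lemma schwartz_differentiable: "f \<in> schwartz \<Longrightarrow> f differentiable (at x)"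
  unfolding schwartz_def by (metis (mono_tags, lifting) mem_Collect_eq partials.simps(1))

lemma schwartz_rapid: "f \<in> schwartz \<Longrightarrow> rapid f"
  unfolding schwartz_def rapid_def by (auto dest!: spec[of _ "[]"])

lemma schwartz_partial_deriv: "f \<in> schwartz \<Longrightarrow> partial_deriv j f \<in> schwartz"
  unfolding schwartz_def by (auto simp: partials_snoc[symmetric])

lemma schwartz_partials: "f \<in> schwartz \<Longrightarrow> partials js f \<in> schwartz"
  by (induction js) (simp_all add: partials_Cons schwartz_partial_deriv del: partials.simps(2))

lemma schwartz_has_derivative:
  "f \<in> schwartz \<Longrightarrow> (f has_derivative frechet_derivative f (at x)) (at x)"
  using schwartz_differentiable frechet_derivative_works by blast

lemma schwartz_continuous: "f \<in> schwartz \<Longrightarrow> continuous_on UNIV f"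
  by (meson schwartz_differentiable differentiable_imp_continuous_within continuous_at_imp_continuous_on)

lemma schwartz_measurable [measurable]: "f \<in> schwartz \<Longrightarrow> f \<in> borel_measurable borel"
  by (intro borel_measurable_continuous_onI schwartz_continuous)

text \<open>The weight \<open>1 + |x|\<close> is better behaved than \<open>|x|\<close>: its powers are increasing in the exponent and
  bounded below by \<open>1\<close>, so that bounds can be multiplied without treating small \<open>x\<close> separately.\<close>

lemma rapid_iff: "rapid f \<longleftrightarrow> (\<forall>m::nat. \<exists>C\<ge>0. \<forall>x. (1 + norm x) ^ m * cmod (f x) \<le> C)"
proof
  assume R: "rapid f"
  show "\<forall>m::nat. \<exists>C\<ge>0. \<forall>x. (1 + norm x) ^ m * cmod (f x) \<le> C"
  proof
    fix m :: nat
    have "\<forall>i. \<exists>C. \<forall>x. norm x ^ i * cmod (f x) \<le> C" using R by (simp add: rapid_def)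
    then obtain C where C: "\<And>i x. norm x ^ i * cmod (f x) \<le> C i" by metis
    have C0: "C i \<ge> 0" for i using C[of 0 i] by (smt (verit) mult_nonneg_nonneg norm_ge_zero zero_le_power)
    have "(1 + norm x) ^ m * cmod (f x) \<le> (\<Sum>i\<le>m. of_nat (m choose i) * C i)" for x
    proof -
      have "(1 + norm x) ^ m = (\<Sum>i\<le>m. of_nat (m choose i) * norm x ^ i)"
        using binomial_ring[of "norm x" 1 m] by (simp add: add.commute)
      then have "(1 + norm x) ^ m * cmod (f x) = (\<Sum>i\<le>m. of_nat (m choose i) * (norm x ^ i * cmod (f x)))"
        by (simp add: sum_distrib_right mult.assoc)
      also have "\<dots> \<le> (\<Sum>i\<le>m. of_nat (m choose i) * C i)"
        by (intro sum_mono mult_left_mono C) auto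
      finally show ?thesis .
    qed
    moreover have "(\<Sum>i\<le>m. of_nat (m choose i) * C i) \<ge> 0" by (intro sum_nonneg mult_nonneg_nonneg C0) auto
    ultimately show "\<exists>C\<ge>0. \<forall>x. (1 + norm x) ^ m * cmod (f x) \<le> C" by blast
  qed
next
  assume R: "\<forall>m::nat. \<exists>C\<ge>0. \<forall>x. (1 + norm x) ^ m * cmod (f x) \<le> C"
  show "rapid f" unfolding rapid_def
  proof
    fix m :: nat
    obtain C where "\<forall>x. (1 + norm x) ^ m * cmod (f x) \<le> C" using R by blast
    moreover have "norm x ^ m * cmod (f x) \<le> (1 + norm x) ^ m * cmod (f x)" for x
      by (intro mult_right_mono power_mono) auto
    ultimately show "\<exists>C. \<forall>x. norm x ^ m * cmod (f x) \<le> C" by (meson order_trans)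
  qed
qed

lemma rapid_add: assumes "rapid f" "rapid g" shows "rapid (\<lambda>x. f x + g x)"
  unfolding rapid_def
proof
  fix m :: nat
  obtain A B where "\<And>x. norm x ^ m * cmod (f x) \<le> A" "\<And>x. norm x ^ m * cmod (g x) \<le> B"
    using assms unfolding rapid_def by blast
  then have "norm x ^ m * cmod (f x + g x) \<le> A + B" for x
    using mult_left_mono[OF norm_triangle_ineq[of "f x" "g x"], of "norm x ^ m"]
    by (smt (verit) distrib_left norm_ge_zero zero_le_power)
  then show "\<exists>C. \<forall>x. norm x ^ m * cmod (f x + g x) \<le> C" by blast
qed

lemma rapid_bound: assumes "rapid f" "\<And>x. cmod (g x) \<le> K * (1 + norm x) ^ n * cmod (f x)" "K \<ge> 0" shows "rapid g"
  unfolding rapid_iff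
proof
  fix m :: nat
  obtain A where A: "A \<ge> 0" "\<And>x. (1 + norm x) ^ (m + n) * cmod (f x) \<le> A"
    using assms unfolding rapid_iff by blast
  have "(1 + norm x) ^ m * cmod (g x) \<le> K * A" for x
  proof -
    have "(1 + norm x) ^ m * cmod (g x) \<le> (1 + norm x) ^ m * (K * (1 + norm x) ^ n * cmod (f x))"
      by (intro mult_left_mono assms) auto
    also have "\<dots> = K * ((1 + norm x) ^ (m + n) * cmod (f x))" by (simp add: power_add)
    also have "\<dots> \<le> K * A" by (intro mult_left_mono A assms)
    finally show ?thesis .
  qed
  then show "\<exists>C\<ge>0. \<forall>x. (1 + norm x) ^ m * cmod (g x) \<le> C" using A(1) assms(3) by (intro exI[of _ "K * A"]) auto
qed

lemma rapid_scale: "rapid f \<Longrightarrow> rapid (\<lambda>x. c * f x)"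
  by (rule rapid_bound[where K="cmod c" and n=0 and f=f]) (auto simp: norm_mult)

lemma schwartz_lin:
  fixes f g :: "real^'d::finite \<Rightarrow> complex"
  assumes "f \<in> schwartz" "g \<in> schwartz"
  shows "(\<lambda>x. c * f x + e * g x) \<in> schwartz"
proof (rule schwartz_coinduct)
  let ?X = "{\<lambda>x. c * f x + e * g x | f g. f \<in> schwartz \<and> g \<in> schwartz}"
  show "(\<lambda>x. c * f x + e * g x) \<in> ?X" using assms by blast
  fix u j assume "u \<in> ?X"
  then obtain f g where u: "u = (\<lambda>x. c * f x + e * g x)" and fg: "f \<in> schwartz" "g \<in> schwartz" by blast
  have d: "(u has_derivative (\<lambda>v. c * frechet_derivative f (at x) v + e * frechet_derivative g (at x) v)) (at x)" for x
    unfolding u by (intro derivative_intros schwartz_has_derivative fg)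
  then show "u differentiable (at x)" for x by (auto simp: differentiable_def)
  have "rapid (\<lambda>x. c * f x)" "rapid (\<lambda>x. e * g x)" by (intro rapid_scale schwartz_rapid fg)+
  then show "rapid u" unfolding u by (rule rapid_add)
  show "partial_deriv j u \<in> ?X" unfolding partial_deriv_eq[OF d] using schwartz_partial_deriv[OF fg(1), of j] schwartz_partial_deriv[OF fg(2), of j]
    by (intro CollectI exI[of _ "partial_deriv j f"] exI[of _ "partial_deriv j g"]) (simp add: partial_deriv_def)
qed

lemma schwartz_add: "f \<in> schwartz \<Longrightarrow> g \<in> schwartz \<Longrightarrow> (\<lambda>x. f x + g x) \<in> schwartz"
  using schwartz_lin[of f g 1 1] by simp

lemma schwartz_scale: "f \<in> schwartz \<Longrightarrow> (\<lambda>x. c * f x) \<in> schwartz"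
  using schwartz_lin[of f f c 0] by simp

lemma schwartz_zero: "(\<lambda>x. 0) \<in> schwartz"
  by (rule schwartz_coinduct[of _ "{\<lambda>x. 0}"]) (auto simp: rapid_def partial_deriv_eq[OF has_derivative_const])

text \<open>The characters of \<open>\<real>\<^sup>d\<close> with the sign that they have in the Fourier integral. Translation by \<open>a\<close>
  multiplies a Fourier transform by \<open>character a\<close>.\<close>

abbreviation character :: "'a::real_inner \<Rightarrow> 'a \<Rightarrow> complex" where
  "character a x \<equiv> exp (- (\<i> * complex_of_real (a \<bullet> x)))"

lemma has_derivative_character:
  fixes a :: "'a::real_inner"
  shows "((\<lambda>x. character a x) has_derivative
     (\<lambda>v. character a x * (- (\<i> * complex_of_real (a \<bullet> v))))) (at x)"
proof -
  have "((\<lambda>x. - (\<i> * complex_of_real (a \<bullet> x))) has_derivative (\<lambda>v. - (\<i> * complex_of_real (a \<bullet> v)))) (at x)"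
    by (auto intro!: derivative_eq_intros)
  from has_derivative_compose[OF this DERIV_exp[THEN has_field_derivative_imp_has_derivative]] show ?thesis by (simp add: mult.commute)
qed

lemma schwartz_modulate:
  assumes "f \<in> schwartz"
  shows "(\<lambda>x. f x * character a x) \<in> schwartz"
proof (rule schwartz_coinduct)
  let ?E = "\<lambda>x. character a x"
  let ?X = "{\<lambda>x. f x * ?E x | f. f \<in> schwartz}"
  show "(\<lambda>x. f x * ?E x) \<in> ?X" using assms by blast
  fix u j assume "u \<in> ?X"
  then obtain f where u: "u = (\<lambda>x. f x * ?E x)" and f: "f \<in> schwartz" by blast
  have d: "(u has_derivative (\<lambda>v. f x * (?E x * (- (\<i> * complex_of_real (a \<bullet> v)))) + frechet_derivative f (at x) v * ?E x)) (at x)" for x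
    unfolding u
    by (rule has_derivative_mult[OF schwartz_has_derivative[OF f] has_derivative_character])
  then show "u differentiable (at x)" for x by (auto simp: differentiable_def)
  show "rapid u" using schwartz_rapid[OF f]
    by (rule rapid_bound[where K=1 and n=0]) (auto simp: u norm_mult)
  have "partial_deriv j u = (\<lambda>x. (1 * partial_deriv j f x + (- (\<i> * complex_of_real (a $ j))) * f x) * ?E x)"
    unfolding partial_deriv_eq[OF d] unfolding partial_deriv_def by (auto simp: inner_axis algebra_simps)
  then show "partial_deriv j u \<in> ?X"
    using schwartz_lin[OF schwartz_partial_deriv[OF f, of j] f, of 1 "- (\<i> * complex_of_real (a $ j))"]
    by (intro CollectI exI[of _ "\<lambda>x. 1 * partial_deriv j f x + (- (\<i> * complex_of_real (a $ j))) * f x"]) simp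
qed

lemma schwartz_coord:
  assumes "f \<in> schwartz"
  shows "(\<lambda>x. complex_of_real (x $ i) * f x) \<in> schwartz"
proof (rule schwartz_coinduct)
  let ?X = "{\<lambda>x. complex_of_real (x $ i) * f x + g x | f g. f \<in> schwartz \<and> g \<in> schwartz}"
  show "(\<lambda>x. complex_of_real (x $ i) * f x) \<in> ?X" using assms schwartz_zero by force
  fix u j assume "u \<in> ?X"
  then obtain f g where u: "u = (\<lambda>x. complex_of_real (x $ i) * f x + g x)"
    and fg: "f \<in> schwartz" "g \<in> schwartz" by blast
  have d: "(u has_derivative (\<lambda>v. (complex_of_real (x $ i) * frechet_derivative f (at x) v + complex_of_real (v $ i) * f x)
       + frechet_derivative g (at x) v)) (at x)" for x
    unfolding u
    by (rule derivative_eq_intros schwartz_has_derivative fg refl bounded_linear.has_derivative[OF bounded_linear_vec_nth] | simp add: algebra_simps)+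
  then show "u differentiable (at x)" for x by (auto simp: differentiable_def)
  have "rapid (\<lambda>x. complex_of_real (x $ i) * f x)" using schwartz_rapid[OF fg(1)]
  proof (rule rapid_bound[where K=1 and n=1])
    fix x :: "real^'a"
    have "\<bar>x $ i\<bar> \<le> 1 + norm x" using component_le_norm_cart[of x i] by linarith
    then show "cmod (complex_of_real (x $ i) * f x) \<le> 1 * (1 + norm x) ^ 1 * cmod (f x)"
      by (simp add: norm_mult mult_right_mono)
  qed simp
  then show "rapid u" unfolding u by (rule rapid_add[OF _ schwartz_rapid[OF fg(2)]])
  have "partial_deriv j u = (\<lambda>x. complex_of_real (x $ i) * partial_deriv j f x + (complex_of_real (axis j 1 $ i) * f x + 1 * partial_deriv j g x))"
    unfolding partial_deriv_eq[OF d] unfolding partial_deriv_def by (auto simp: algebra_simps)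
  then show "partial_deriv j u \<in> ?X"
    using schwartz_lin[OF fg(1) schwartz_partial_deriv[OF fg(2), of j], of "complex_of_real (axis j 1 $ i)" 1] schwartz_partial_deriv[OF fg(1), of j]
    by (intro CollectI exI[of _ "partial_deriv j f"] exI[of _ "\<lambda>x. complex_of_real (axis j 1 $ i) * f x + 1 * partial_deriv j g x"]) simp
qed

text \<open>Translations and dilations are treated together, with a constant factor, because the class of all
  \<open>c f(h x + a)\<close> with fixed \<open>h\<close> and \<open>a\<close> is closed under partial derivatives.\<close>

lemma schwartz_affine_partial_deriv:
  assumes "f \<in> schwartz"
  shows "partial_deriv j (\<lambda>x. c * f (h *\<^sub>R x + a)) = (\<lambda>x. (c * of_real h) * partial_deriv j f (h *\<^sub>R x + a))"
    and "(\<lambda>x. c * f (h *\<^sub>R x + a)) differentiable (at x)"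
proof -
  have "((\<lambda>x. f (h *\<^sub>R x + a)) has_derivative (\<lambda>v. frechet_derivative f (at (h *\<^sub>R x + a)) (h *\<^sub>R v))) (at x)" for x
    by (rule has_derivative_compose[where g=f and f="\<lambda>x. h *\<^sub>R x + a"])
       (auto intro!: derivative_eq_intros schwartz_has_derivative assms)
  from has_derivative_mult_right[OF this, of c]
  have d: "((\<lambda>x. c * f (h *\<^sub>R x + a)) has_derivative (\<lambda>v. c * frechet_derivative f (at (h *\<^sub>R x + a)) (h *\<^sub>R v))) (at x)" for x by simp
  then show "(\<lambda>x. c * f (h *\<^sub>R x + a)) differentiable (at x)" by (auto simp: differentiable_def)
  have "linear (frechet_derivative f (at y))" for y
    using linear_frechet_derivative schwartz_differentiable[OF assms] by blast
  then have "frechet_derivative f (at y) (h *\<^sub>R v) = h *\<^sub>R frechet_derivative f (at y) v" for y v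
    by (rule linear_scale)
  then show "partial_deriv j (\<lambda>x. c * f (h *\<^sub>R x + a)) = (\<lambda>x. (c * of_real h) * partial_deriv j f (h *\<^sub>R x + a))"
    unfolding partial_deriv_eq[OF d] unfolding partial_deriv_def by (simp only: scaleR_conv_of_real[where 'a=complex] mult.assoc)
qed

lemma schwartz_affine:
  assumes "f \<in> schwartz" "h > 0"
  shows "(\<lambda>x. c * f (h *\<^sub>R x + a)) \<in> schwartz"
proof (rule schwartz_coinduct)
  let ?X = "{\<lambda>x. c * f (h *\<^sub>R x + a) | c f. f \<in> schwartz}"
  show "(\<lambda>x. c * f (h *\<^sub>R x + a)) \<in> ?X" using assms by blast
  fix u j assume "u \<in> ?X"
  then obtain c f where u: "u = (\<lambda>x. c * f (h *\<^sub>R x + a))" and f: "f \<in> schwartz" by blast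
  show "u differentiable (at x)" for x unfolding u by (rule schwartz_affine_partial_deriv[OF f])
  show "partial_deriv j u \<in> ?X" unfolding u schwartz_affine_partial_deriv(1)[OF f] using schwartz_partial_deriv[OF f] by blast
  show "rapid u" unfolding rapid_iff
  proof
    fix m
    obtain A where A: "A \<ge> 0" "\<And>x. (1 + norm x) ^ m * cmod (f x) \<le> A"
      using schwartz_rapid[OF f] unfolding rapid_iff by blast
    define B where "B = (1 + 1 / h) * (1 + norm a)"
    have B: "1 + norm x \<le> B * (1 + norm (h *\<^sub>R x + a))" for x
    proof -
      have "norm (h *\<^sub>R x) \<le> norm (h *\<^sub>R x + a) + norm a" by (metis add_diff_cancel_right' norm_triangle_ineq4)
      then have "norm x \<le> (norm (h *\<^sub>R x + a) + norm a) / h" using assms(2) by (simp add: field_simps)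
      also have "\<dots> \<le> (1 / h) * ((1 + norm a) * (1 + norm (h *\<^sub>R x + a)))"
        using assms(2) by (simp add: field_simps)
      finally have 1: "norm x \<le> (1 / h) * ((1 + norm a) * (1 + norm (h *\<^sub>R x + a)))" .
      have 2: "1 \<le> (1 + norm a) * (1 + norm (h *\<^sub>R x + a))"
        using mult_mono[of 1 "1 + norm a" 1 "1 + norm (h *\<^sub>R x + a)"] by simp
      have "B * (1 + norm (h *\<^sub>R x + a)) = (1 + norm a) * (1 + norm (h *\<^sub>R x + a)) + (1 / h) * ((1 + norm a) * (1 + norm (h *\<^sub>R x + a)))"
        unfolding B_def by (simp add: distrib_right)
      with 1 2 show ?thesis by linarith
    qed
    have B0: "B \<ge> 0" unfolding B_def using assms(2) by simp
    have "(1 + norm x) ^ m * cmod (u x) \<le> B ^ m * (cmod c * A)" for x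
    proof -
      have "(1 + norm x) ^ m * cmod (u x) \<le> (B * (1 + norm (h *\<^sub>R x + a))) ^ m * (cmod c * cmod (f (h *\<^sub>R x + a)))"
        unfolding u norm_mult by (intro mult_mono power_mono B) (auto simp: B0)
      also have "\<dots> = B ^ m * (cmod c * ((1 + norm (h *\<^sub>R x + a)) ^ m * cmod (f (h *\<^sub>R x + a))))"
        by (simp add: power_mult_distrib)
      also have "\<dots> \<le> B ^ m * (cmod c * A)" by (intro mult_left_mono A) (auto simp: B0)
      finally show ?thesis .
    qed
    then show "\<exists>C\<ge>0. \<forall>x. (1 + norm x) ^ m * cmod (u x) \<le> C" using A(1) B0 by (intro exI[of _ "B ^ m * (cmod c * A)"]) auto
  qed
qed

section \<open>Lebesgue integrals of rapidly decreasing functions\<close>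

lemma nn_integral_lborel_affine:
  fixes f :: "'a::euclidean_space \<Rightarrow> ennreal"
  assumes [measurable]: "f \<in> borel_measurable borel" and c: "c \<noteq> 0"
  shows "(\<integral>\<^sup>+x. f x \<partial>lborel) = ennreal (\<bar>c\<bar> ^ DIM('a)) * (\<integral>\<^sup>+x. f (t + c *\<^sub>R x) \<partial>lborel)"
  by (subst lborel_affine[OF c, of t])
     (simp add: nn_integral_density nn_integral_distr nn_integral_cmult)

lemma integrable_lborel_affine:
  fixes f :: "'a::euclidean_space \<Rightarrow> 'b :: {banach, second_countable_topology}"
  assumes f: "integrable lborel f" and c: "c \<noteq> 0"
  shows "integrable lborel (\<lambda>x. f (t + c *\<^sub>R x))"
  using f f[THEN borel_measurable_integrable] c unfolding integrable_iff_bounded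
  by (subst (asm) nn_integral_lborel_affine[where c=c and t=t]) (auto simp: ennreal_mult_less_top)

lemma integral_lborel_affine:
  fixes f :: "'a::euclidean_space \<Rightarrow> 'b :: {banach, second_countable_topology}"
  assumes f: "integrable lborel f" and c: "c \<noteq> 0"
  shows "(LINT x|lborel. f x) = \<bar>c\<bar> ^ DIM('a) *\<^sub>R (LINT x|lborel. f (t + c *\<^sub>R x))"
  using f f[THEN borel_measurable_integrable] integrable_lborel_affine[OF f c, of t]
  by (subst lborel_affine[OF c, of t])
     (simp add: integral_density integral_distr)

lemma AE_lborel_affine:
  fixes P :: "'a::euclidean_space \<Rightarrow> bool"
  assumes "AE x in lborel. P x" and c: "c \<noteq> 0"
  shows "AE x in lborel. P (t + c *\<^sub>R x)"
proof -
  obtain N where "{x \<in> space lborel. \<not> P x} \<subseteq> N" "emeasure lborel N = 0" "N \<in> sets lborel"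
    using AE_E[OF assms(1)] by blast
  then have N: "N \<in> null_sets lborel" "{x. \<not> P x} \<subseteq> N" by (auto simp: null_sets_def)
  then have [measurable]: "N \<in> sets borel" by auto
  have "ennreal (\<bar>c\<bar> ^ DIM('a)) * (\<integral>\<^sup>+x. indicator N (t + c *\<^sub>R x) \<partial>lborel) = (\<integral>\<^sup>+x. indicator N x \<partial>lborel)"
    using nn_integral_lborel_affine[of "indicator N" c t] c by simp
  also have "\<dots> = 0" using N(1) by auto
  finally have "(\<integral>\<^sup>+x. indicator N (t + c *\<^sub>R x) \<partial>lborel) = 0" using c by simp
  then have "AE x in lborel. indicator N (t + c *\<^sub>R x) = (0::ennreal)" by (subst (asm) nn_integral_0_iff_AE) auto
  then show ?thesis by (rule AE_mp) (use N(2) in \<open>auto simp: indicator_def\<close>)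
qed

lemma
  fixes g :: "'d::finite \<Rightarrow> real \<Rightarrow> 'b::{real_normed_field,banach,second_countable_topology}"
  assumes g: "\<And>j. integrable lborel (g j)"
  shows lborel_product_integrable: "integrable lborel (\<lambda>x::real^'d. \<Prod>j\<in>UNIV. g j (x $ j))"
    and lborel_product_integral: "(LINT x|lborel. (\<Prod>j\<in>UNIV. g j ((x::real^'d) $ j))) = (\<Prod>j\<in>UNIV. LINT t|lborel. g j t)"
proof -
  let ?b = "\<lambda>j::'d. axis j (1::real)"
  have inj: "inj ?b" by (auto simp: inj_def axis_eq_axis)
  have B: "(Basis :: (real^'d) set) = range ?b" by (auto simp: Basis_vec_def)
  define G where "G b = g (inv ?b b)" for b
  have G: "G (?b j) = g j" for j unfolding G_def using inv_f_f[OF inj] by simp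
  have mg [measurable]: "g j \<in> borel_measurable borel" for j using g[of j] by auto
  have mG: "G b \<in> borel_measurable borel" for b unfolding G_def by measurable
  have *: "(\<Prod>j\<in>UNIV. g j (x $ j)) = (\<Prod>b\<in>Basis. G b (x \<bullet> b))" for x :: "real^'d"
    unfolding B by (subst prod.reindex[OF inj]) (simp add: G cart_eq_inner_axis)
  interpret product_sigma_finite "\<lambda>_. lborel :: real measure" ..
  have Gi: "integrable lborel (G b)" for b unfolding G_def using g by simp
  let ?T = "\<lambda>f. \<Sum>b\<in>Basis. f b *\<^sub>R b :: real^'d"
  have T: "(\<Prod>b\<in>Basis. G b (?T f \<bullet> b)) = (\<Prod>b\<in>Basis. G b (f b))" for f
    by (intro prod.cong) auto
  have meas: "(\<lambda>x::real^'d. \<Prod>b\<in>Basis. G b (x \<bullet> b)) \<in> borel_measurable borel"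
    using mG by (auto intro!: borel_measurable_prod measurable_compose[OF _ mG])
  have mT: "?T \<in> measurable (\<Pi>\<^sub>M b\<in>Basis. lborel) borel" by measurable
  show "integrable lborel (\<lambda>x::real^'d. \<Prod>j\<in>UNIV. g j (x $ j))"
    unfolding * lborel_eq[where 'a="real^'d"]
    by (subst integrable_distr_eq[OF mT meas]) (unfold T, intro product_integrable_prod Gi, simp)
  have "(LINT x|lborel. (\<Prod>j\<in>UNIV. g j ((x::real^'d) $ j))) = (\<Prod>b\<in>(Basis :: (real^'d) set). LINT t|lborel. G b t)"
    unfolding * lborel_eq[where 'a="real^'d"]
    by (subst integral_distr[OF mT meas]) (unfold T, subst product_integral_prod, auto intro: Gi)
  also have "\<dots> = (\<Prod>j\<in>UNIV. LINT t|lborel. g j t)"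
    unfolding B by (subst prod.reindex[OF inj]) (simp add: G)
  finally show "(LINT x|lborel. (\<Prod>j\<in>UNIV. g j ((x::real^'d) $ j))) = (\<Prod>j\<in>UNIV. LINT t|lborel. g j t)" .
qed

lemma integrable_Cauchy_weight:
  "integrable lborel (\<lambda>x::real. 1 / (1 + x\<^sup>2))"
proof -
  have "set_integrable lborel (einterval (- \<infinity>) \<infinity>) (\<lambda>x::real. inverse (1 + x\<^sup>2))"
    by (rule integrable_inverse_1_plus_square)
  then show ?thesis by (simp add: set_integrable_def einterval_def inverse_eq_divide)
qed

text \<open>Since \<open>(1 + |x|)\<^sup>2 \<ge> 1 + x\<^sub>j\<^sup>2\<close> for every coordinate, the function is dominated by the product of the
  one-dimensional functions \<open>1 / (1 + t\<^sup>2)\<close>, whose integral factorises.\<close>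

lemma integrable_decay:
  "integrable lborel (\<lambda>x::real^'d::finite. 1 / (1 + norm x) ^ (2 * CARD('d)))"
proof (rule Bochner_Integration.integrable_bound)
  show "integrable lborel (\<lambda>x::real^'d. \<Prod>j\<in>UNIV. 1 / (1 + (x $ j)\<^sup>2))"
    using lborel_product_integrable[of "\<lambda>j::'d. \<lambda>t. 1 / (1 + t\<^sup>2)"] integrable_Cauchy_weight by blast
  have "norm (1 / (1 + norm x) ^ (2 * CARD('d))) \<le> norm (\<Prod>j\<in>UNIV. 1 / (1 + (x $ j)\<^sup>2))" for x :: "real^'d"
  proof -
    have "1 + (x $ j)\<^sup>2 \<le> (1 + norm x)\<^sup>2" for j
    proof -
      have "(x $ j)\<^sup>2 \<le> (norm x)\<^sup>2" using component_le_norm_cart[of x j] by (simp add: abs_le_square_iff[symmetric])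
      then show ?thesis by (simp add: power2_eq_square algebra_simps) (smt (verit) norm_ge_zero)
    qed
    then have "1 / (1 + norm x)\<^sup>2 \<le> 1 / (1 + (x $ j)\<^sup>2)" for j
      by (intro divide_left_mono mult_pos_pos zero_less_power) (simp_all add: add_pos_nonneg add_nonneg_pos)
    then have "(\<Prod>j\<in>(UNIV::'d set). 1 / (1 + norm x)\<^sup>2) \<le> (\<Prod>j\<in>(UNIV::'d set). 1 / (1 + (x $ j)\<^sup>2))"
      by (intro prod_mono) (simp add: \<open>\<And>j. 1 / (1 + norm x)\<^sup>2 \<le> 1 / (1 + (x $ j)\<^sup>2)\<close>)
    moreover have "(\<Prod>j\<in>(UNIV::'d set). 1 / (1 + norm x)\<^sup>2) = 1 / (1 + norm x) ^ (2 * CARD('d))"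
      by (simp add: power_divide power_mult)
    ultimately show ?thesis by (simp add: abs_of_nonneg prod_nonneg)
  qed
  then show "AE x in lborel. norm (1 / (1 + norm x) ^ (2 * CARD('d))) \<le> norm (\<Prod>j\<in>UNIV. 1 / (1 + ((x::real^'d) $ j)\<^sup>2))" by simp
qed measurable

lemma rapid_integrable:
  fixes f :: "real^'d::finite \<Rightarrow> complex"
  assumes "rapid f" "f \<in> borel_measurable borel"
  shows "integrable lborel f"
proof -
  obtain C where C: "C \<ge> 0" "\<And>x. (1 + norm x) ^ (2 * CARD('d)) * cmod (f x) \<le> C"
    using assms(1) unfolding rapid_iff by blast
  show ?thesis
  proof (rule Bochner_Integration.integrable_bound)
    show "integrable lborel (\<lambda>x::real^'d. C * (1 / (1 + norm x) ^ (2 * CARD('d))))"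
      by (intro integrable_mult_right integrable_decay)
    have "norm (f x) \<le> norm (C * (1 / (1 + norm x) ^ (2 * CARD('d))))" for x
    proof -
      have "(1 + norm x) ^ (2 * CARD('d)) > 0" by (intro zero_less_power) (simp add: add_pos_nonneg)
      then show ?thesis using C(2)[of x] C(1) by (simp add: field_simps)
    qed
    then show "AE x in lborel. norm (f x) \<le> norm (C * (1 / (1 + norm x) ^ (2 * CARD('d))))" by simp
  qed (use assms in simp)
qed

lemma schwartz_integrable: "f \<in> schwartz \<Longrightarrow> integrable lborel f"
  by (intro rapid_integrable schwartz_rapid schwartz_measurable)

lemma integrable_character:
  "integrable lborel f \<Longrightarrow> integrable lborel (\<lambda>x::real^'d::finite. f x * character a x)"
  by (rule Bochner_Integration.integrable_bound[of lborel f])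
     (auto simp: norm_mult intro!: borel_measurable_times dest: borel_measurable_integrable)

lemma schwartz_integrable_norm_power:
  fixes f :: "real^'d::finite \<Rightarrow> complex"
  assumes "f \<in> schwartz" shows "integrable lborel (\<lambda>x. norm x ^ m * cmod (f x))"
proof -
  have "integrable lborel (\<lambda>x. complex_of_real (norm x ^ m) * f x)"
  proof (rule rapid_integrable)
    show "rapid (\<lambda>x. complex_of_real (norm x ^ m) * f x)"
      by (rule rapid_bound[OF schwartz_rapid[OF assms], of _ 1 m])
         (auto simp: norm_mult norm_power intro!: mult_right_mono power_mono)
    have [measurable]: "f \<in> borel_measurable borel" using assms by simp
    show "(\<lambda>x. complex_of_real (norm x ^ m) * f x) \<in> borel_measurable borel" by measurable
  qed
  from integrable_norm[OF this] show ?thesis by (simp add: norm_mult norm_power)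
qed

lemma character_add: "character (a + b) x = character a x * character b x"
  by (simp add: inner_add_left exp_add[symmetric] algebra_simps)

section \<open>The Fourier transform of Schwartz functions\<close>

lemma cmod_exp_linear: "cmod (exp (- (\<i> * complex_of_real t)) - 1 + \<i> * t) \<le> t\<^sup>2"
proof -
  have "cmod (exp (- (\<i> * complex_of_real t)) - (1 - \<i> * complex_of_real t)) * 2 \<le> t * t"
    using iexp_approx1[of "-t" 1] by (simp add: power2_eq_square)
  then show ?thesis by (simp add: power2_eq_square algebra_simps) (smt (verit) norm_ge_zero)
qed

text \<open>The estimate \<open>|e\<^sup>-\<^sup>i\<^sup>t - 1 + i t| \<le> t\<^sup>2\<close> bounds the error of the linear approximation by \<open>|v|\<^sup>2\<close> times
  the finite integral of \<open>|x|\<^sup>2 |f(x)|\<close>, so that the derivative under the integral sign comes with an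
  explicit remainder.\<close>

lemma fourier_has_derivative:
  fixes f :: "real^'d::finite \<Rightarrow> complex"
  assumes f: "f \<in> schwartz"
  shows "(fourier f has_derivative (\<lambda>v. \<Sum>j\<in>UNIV. complex_of_real (v $ j) * fourier (\<lambda>x. - \<i> * (complex_of_real (x $ j) * f x)) \<omega>)) (at \<omega>)"
    (is "(_ has_derivative ?D) _")
proof (rule has_derivativeI_sandwich[of 1])
  let ?e = "\<lambda>a x. character a (x::real^'d)"
  let ?g = "\<lambda>j x. - \<i> * (complex_of_real (x $ j) * f x)"
  define K where "K = (LINT x|lborel. norm x ^ 2 * cmod (f x))"
  show "bounded_linear ?D"
    by (intro bounded_linear_sum bounded_linear_mult_const bounded_linear_compose[OF bounded_linear_of_real] bounded_linear_vec_nth)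
  have g: "?g j \<in> schwartz" for j by (intro schwartz_scale schwartz_coord f)
  fix y assume y: "y \<in> UNIV" "y \<noteq> \<omega>"
  define v where "v = y - \<omega>"
  have i1: "integrable lborel (\<lambda>x. f x * ?e a x)" for a by (intro integrable_character schwartz_integrable f)
  have i2: "integrable lborel (\<lambda>x. ?g j x * ?e a x)" for a j by (intro integrable_character schwartz_integrable g)
  have Deq: "?D v = (LINT x|lborel. (\<Sum>j\<in>UNIV. complex_of_real (v $ j) * (?g j x * ?e \<omega> x)))"
    unfolding fourier_def using i2 by (subst Bochner_Integration.integral_sum) (auto intro!: integrable_mult_right)
  have "fourier f y - fourier f \<omega> - ?D v = (LINT x|lborel. f x * ?e y x - f x * ?e \<omega> x - (\<Sum>j\<in>UNIV. complex_of_real (v $ j) * (?g j x * ?e \<omega> x)))"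
    unfolding Deq unfolding fourier_def using i1 i2
    by (subst Bochner_Integration.integral_diff Bochner_Integration.integral_diff,
        auto intro!: Bochner_Integration.integrable_diff Bochner_Integration.integrable_sum integrable_mult_right)+
  also have "\<dots> = (LINT x|lborel. f x * ?e \<omega> x * (?e v x - 1 + \<i> * complex_of_real (v \<bullet> x)))"
  proof (rule Bochner_Integration.integral_cong[OF refl])
    fix x
    have "y = \<omega> + v" by (simp add: v_def)
    then have ey: "?e y x = ?e \<omega> x * ?e v x" using character_add[of \<omega> v x] by simp
    have "(\<Sum>j\<in>UNIV. complex_of_real (v $ j) * (?g j x * ?e \<omega> x)) = - \<i> * complex_of_real (v \<bullet> x) * f x * ?e \<omega> x"
      by (simp add: inner_vec_def sum_distrib_left sum_distrib_right sum_negf algebra_simps)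
    then show "f x * ?e y x - f x * ?e \<omega> x - (\<Sum>j\<in>UNIV. complex_of_real (v $ j) * (?g j x * ?e \<omega> x)) = f x * ?e \<omega> x * (?e v x - 1 + \<i> * complex_of_real (v \<bullet> x))"
      unfolding ey by (simp add: algebra_simps)
  qed
  also have "cmod \<dots> \<le> (LINT x|lborel. (norm v)\<^sup>2 * (norm x ^ 2 * cmod (f x)))"
  proof (rule Bochner_Integration.integral_norm_bound_integral)
    show "integrable lborel (\<lambda>x. (norm v)\<^sup>2 * (norm x ^ 2 * cmod (f x)))"
      by (intro integrable_mult_right schwartz_integrable_norm_power f)
    have bd: "cmod (f x * ?e \<omega> x * (?e v x - 1 + \<i> * complex_of_real (v \<bullet> x))) \<le> (norm v)\<^sup>2 * (norm x ^ 2 * cmod (f x))" for x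
    proof -
      have "cmod (?e v x - 1 + \<i> * complex_of_real (v \<bullet> x)) \<le> (v \<bullet> x)\<^sup>2" by (rule cmod_exp_linear)
      also have "\<dots> \<le> (norm v * norm x)\<^sup>2" using Cauchy_Schwarz_ineq2[of v x] by (metis abs_ge_zero power2_abs power_mono)
      finally have "cmod (f x) * cmod (?e v x - 1 + \<i> * complex_of_real (v \<bullet> x)) \<le> cmod (f x) * (norm v * norm x)\<^sup>2"
        by (intro mult_left_mono) auto
      then show ?thesis by (simp add: norm_mult power_mult_distrib mult.commute mult.left_commute)
    qed
    then show "norm (f x * ?e \<omega> x * (?e v x - 1 + \<i> * complex_of_real (v \<bullet> x))) \<le> (norm v)\<^sup>2 * (norm x ^ 2 * cmod (f x))" for x .
    have [measurable]: "f \<in> borel_measurable borel" using f by simp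
    show "integrable lborel (\<lambda>x. f x * ?e \<omega> x * (?e v x - 1 + \<i> * complex_of_real (v \<bullet> x)))"
      by (rule Bochner_Integration.integrable_bound[OF \<open>integrable lborel (\<lambda>x. (norm v)\<^sup>2 * (norm x ^ 2 * cmod (f x)))\<close>])
         (use bd in \<open>auto intro: order_trans\<close>)
  qed
  also have "\<dots> = K * (norm v)\<^sup>2" unfolding K_def by simp
  finally show "norm (fourier f y - fourier f \<omega> - ?D (y - \<omega>)) / norm (y - \<omega>) \<le> K * norm (y - \<omega>)"
    using y by (simp add: v_def power2_eq_square field_simps)
next
  show "((\<lambda>y. K * norm (y - \<omega>)) \<longlongrightarrow> 0) (at \<omega>)" for K :: real
    by (auto intro!: tendsto_eq_intros)
qed simp

lemma partial_deriv_fourier: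
  assumes "f \<in> schwartz"
  shows "partial_deriv j (fourier f) = fourier (\<lambda>x. - \<i> * (complex_of_real (x $ j) * f x))"
  unfolding partial_deriv_eq[OF fourier_has_derivative[OF assms]]
proof
  fix \<omega>
  have "(\<Sum>i\<in>UNIV. complex_of_real (axis j 1 $ i) * fourier (\<lambda>x. - \<i> * (complex_of_real (x $ i) * f x)) \<omega>)
     = (\<Sum>i\<in>UNIV. if j = i then fourier (\<lambda>x. - \<i> * (complex_of_real (x $ i) * f x)) \<omega> else 0)"
    by (intro sum.cong) (auto simp: axis_def)
  then show "(\<Sum>i\<in>UNIV. complex_of_real (axis j 1 $ i) * fourier (\<lambda>x. - \<i> * (complex_of_real (x $ i) * f x)) \<omega>) = fourier (\<lambda>x. - \<i> * (complex_of_real (x $ j) * f x)) \<omega>" by simp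
qed

lemma character_shift: "character a (x - b) = character a x * exp (\<i> * complex_of_real (a \<bullet> b))"
  by (simp add: inner_diff_right exp_add[symmetric] algebra_simps)

lemma fourier_translate:
  fixes f :: "real^'d::finite \<Rightarrow> complex"
  assumes f: "integrable lborel f"
  shows "fourier (\<lambda>x. f (b + x)) \<omega> = exp (\<i> * complex_of_real (\<omega> \<bullet> b)) * fourier f \<omega>"
proof -
  let ?e = "\<lambda>a x. character a (x::real^'d)"
  have "fourier f \<omega> * exp (\<i> * complex_of_real (\<omega> \<bullet> b)) = (LINT x|lborel. f x * ?e \<omega> (x - b))"
    unfolding fourier_def character_shift by (simp add: mult.assoc[symmetric])
  also have "\<dots> = (LINT x|lborel. f (b + x) * ?e \<omega> x)"
  proof -
    have "integrable lborel (\<lambda>x. f x * ?e \<omega> (x - b))"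
      unfolding character_shift mult.assoc[symmetric] by (intro integrable_mult_left integrable_character f)
    from integral_lborel_affine[OF this, of 1 b] show ?thesis by simp
  qed
  finally show ?thesis by (simp add: fourier_def mult.commute)
qed

text \<open>The mean value theorem bounds the difference by the derivative at an intermediate point of the segment,
  and moving by at most one unit changes \<open>1 + |x|\<close> by a factor of at most \<open>2\<close>. This supplies the
  integrable majorant for difference quotients.\<close>

lemma schwartz_segment_bound:
  fixes f :: "real^'d::finite \<Rightarrow> complex"
  assumes f: "f \<in> schwartz"
  obtains C where "C \<ge> 0" "\<And>x t. 0 < t \<Longrightarrow> t \<le> 1 \<Longrightarrow> cmod (f (t *\<^sub>R axis j 1 + x) - f x) \<le> t * (C / (1 + norm x) ^ (2 * CARD('d)))"
proof -
  let ?N = "2 * CARD('d)"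
  obtain C where C: "C \<ge> 0" "\<And>x. (1 + norm x) ^ ?N * cmod (partial_deriv j f x) \<le> C"
    using schwartz_rapid[OF schwartz_partial_deriv[OF f, of j]] unfolding rapid_iff by blast
  have "cmod (f (t *\<^sub>R axis j 1 + x) - f x) \<le> t * ((2 ^ ?N * C) / (1 + norm x) ^ ?N)" if t: "0 < t" "t \<le> 1" for x :: "real^'d" and t :: real
  proof -
    let ?p = "\<lambda>s. s *\<^sub>R axis j 1 + x"
    have d: "((\<lambda>s. f (?p s)) has_derivative (\<lambda>v. frechet_derivative f (at (?p s)) (v *\<^sub>R axis j 1))) (at s)" for s
      by (rule has_derivative_compose[where g=f and f="?p"])
         (auto intro!: derivative_eq_intros schwartz_has_derivative f)
    have "continuous_on {0..t} (\<lambda>s. f (?p s))"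
      by (intro continuous_at_imp_continuous_on ballI has_derivative_continuous[OF d])
    from mvt_general[OF t(1) this d] obtain s where s: "s \<in> {0<..<t}"
      and le: "cmod (f (?p t) - f (?p 0)) \<le> cmod (frechet_derivative f (at (?p s)) ((t - 0) *\<^sub>R axis j 1))" by blast
    have "linear (frechet_derivative f (at y))" for y
      using linear_frechet_derivative schwartz_differentiable[OF f] by blast
    then have eq: "cmod (frechet_derivative f (at (?p s)) ((t - 0) *\<^sub>R axis j 1)) = t * cmod (partial_deriv j f (?p s))"
      using t by (simp add: linear_scale partial_deriv_def)
    have "norm x \<le> norm (?p s) + norm (s *\<^sub>R (axis j 1 :: real^'d))"
      by (metis add_diff_cancel_left' norm_triangle_ineq4)
    moreover have "norm (s *\<^sub>R (axis j 1 :: real^'d)) \<le> 1" using s t by (simp add: norm_axis_1)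
    ultimately have "1 + norm x \<le> 2 * (1 + norm (?p s))" by (smt (verit) norm_ge_zero)
    then have "(1 + norm x) ^ ?N \<le> (2 * (1 + norm (?p s))) ^ ?N" by (intro power_mono) auto
    then have "(1 + norm x) ^ ?N * cmod (partial_deriv j f (?p s)) \<le> (2 * (1 + norm (?p s))) ^ ?N * cmod (partial_deriv j f (?p s))"
      by (intro mult_right_mono) auto
    also have "\<dots> = 2 ^ ?N * ((1 + norm (?p s)) ^ ?N * cmod (partial_deriv j f (?p s)))" by (simp only: power_mult_distrib mult.assoc)
    also have "\<dots> \<le> 2 ^ ?N * C" by (intro mult_left_mono C) auto
    finally have b: "(1 + norm x) ^ ?N * cmod (partial_deriv j f (?p s)) \<le> 2 ^ ?N * C" .
    have "(1 + norm x) ^ ?N > 0" by (intro zero_less_power) (simp add: add_pos_nonneg)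
    with b have "cmod (partial_deriv j f (?p s)) \<le> (2 ^ ?N * C) / (1 + norm x) ^ ?N" by (simp add: field_simps)
    then have "t * cmod (partial_deriv j f (?p s)) \<le> t * ((2 ^ ?N * C) / (1 + norm x) ^ ?N)" using t by (intro mult_left_mono) auto
    with le eq show ?thesis by simp
  qed
  then show ?thesis using C(1) by (intro that[of "2 ^ ?N * C"]) auto
qed

text \<open>Integration by parts is replaced by the translation invariance of the integral: the transform of a
  difference quotient of \<open>f\<close> in direction \<open>j\<close> is the transform of \<open>f\<close> times a difference quotient of
  \<open>exp (i \<omega>\<^sub>j t)\<close> at \<open>t = 0\<close>, and both sides converge.\<close>

lemma fourier_partial_deriv:
  fixes f :: "real^'d::finite \<Rightarrow> complex"
  assumes f: "f \<in> schwartz"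
  shows "fourier (partial_deriv j f) \<omega> = \<i> * complex_of_real (\<omega> $ j) * fourier f \<omega>"
proof -
  let ?e = "\<lambda>x. character \<omega> (x::real^'d)"
  let ?t = "\<lambda>n. inverse (real (Suc n))"
  let ?a = "axis j 1 :: real^'d"
  let ?q = "\<lambda>n x. (f (?t n *\<^sub>R ?a + x) - f x) /\<^sub>R ?t n * ?e x"
  obtain C where C: "C \<ge> 0" "\<And>x t. 0 < t \<Longrightarrow> t \<le> 1 \<Longrightarrow> cmod (f (t *\<^sub>R ?a + x) - f x) \<le> t * (C / (1 + norm x) ^ (2 * CARD('d)))"
    using schwartz_segment_bound[OF f, of j] by blast
  have [measurable]: "f \<in> borel_measurable borel" "partial_deriv j f \<in> borel_measurable borel"
    using schwartz_measurable[OF f] schwartz_measurable[OF schwartz_partial_deriv[OF f]] by auto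
  have t0: "?t \<longlonglongrightarrow> 0" by (rule LIMSEQ_inverse_real_of_nat)
  have tat: "filterlim ?t (at 0) sequentially" using t0 by (auto simp: filterlim_at)
  have lim: "(\<lambda>n. LINT x|lborel. ?q n x) \<longlonglongrightarrow> (LINT x|lborel. partial_deriv j f x * ?e x)"
  proof (rule integral_dominated_convergence)
    show "integrable lborel (\<lambda>x::real^'d. C * (1 / (1 + norm x) ^ (2 * CARD('d))))"
      by (intro integrable_mult_right integrable_decay)
    show "AE x in lborel. norm (?q n x) \<le> C * (1 / (1 + norm x) ^ (2 * CARD('d)))" for n
    proof (rule AE_I2)
      fix x
      have t: "?t n > 0" "?t n \<le> 1" by (auto simp: inverse_le_1_iff)
      have "norm (?q n x) = cmod (f (?t n *\<^sub>R ?a + x) - f x) / ?t n"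
        by (simp add: norm_mult divide_inverse mult.commute del: of_nat_Suc)
      also have "\<dots> \<le> (?t n * (C / (1 + norm x) ^ (2 * CARD('d)))) / ?t n"
        using t by (intro divide_right_mono C(2)) simp_all
      finally show "norm (?q n x) \<le> C * (1 / (1 + norm x) ^ (2 * CARD('d)))"
        using t by (simp del: of_nat_Suc)
    qed
    show "AE x in lborel. (\<lambda>n. ?q n x) \<longlonglongrightarrow> partial_deriv j f x * ?e x"
    proof (rule AE_I2, rule tendsto_mult_right)
      fix x
      have d: "((\<lambda>s. f (s *\<^sub>R ?a + x)) has_derivative (\<lambda>v. frechet_derivative f (at x) (v *\<^sub>R ?a))) (at 0)"
        by (rule has_derivative_compose[where g=f and f="\<lambda>s. s *\<^sub>R ?a + x", THEN has_derivative_eq_rhs])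
           (auto intro!: derivative_eq_intros schwartz_has_derivative f)
      have "linear (frechet_derivative f (at x))"
        using linear_frechet_derivative schwartz_differentiable[OF f] by blast
      then have s: "frechet_derivative f (at x) (v *\<^sub>R ?a) = v *\<^sub>R partial_deriv j f x" for v by (simp add: linear_scale partial_deriv_def)
      have "((\<lambda>h. norm (f (h *\<^sub>R ?a + x) - f x - h *\<^sub>R partial_deriv j f x) / norm h) \<longlongrightarrow> 0) (at 0)"
        using d unfolding has_derivative_at s by simp
      from filterlim_compose[OF this tat]
      have 0: "(\<lambda>n. norm (f (?t n *\<^sub>R ?a + x) - f x - ?t n *\<^sub>R partial_deriv j f x) / norm (?t n)) \<longlonglongrightarrow> 0" .
      have "norm (f (?t n *\<^sub>R ?a + x) - f x - ?t n *\<^sub>R partial_deriv j f x) / norm (?t n) = norm ((f (?t n *\<^sub>R ?a + x) - f x) /\<^sub>R ?t n - partial_deriv j f x)" for n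
      proof -
        have "(f (?t n *\<^sub>R ?a + x) - f x) /\<^sub>R ?t n - partial_deriv j f x = (f (?t n *\<^sub>R ?a + x) - f x - ?t n *\<^sub>R partial_deriv j f x) /\<^sub>R ?t n"
          by (simp add: algebra_simps del: of_nat_Suc)
        then show ?thesis by (simp del: of_nat_Suc add: divide_inverse mult.commute)
      qed
      with 0 have "(\<lambda>n. norm ((f (?t n *\<^sub>R ?a + x) - f x) /\<^sub>R ?t n - partial_deriv j f x)) \<longlonglongrightarrow> 0" by (simp del: of_nat_Suc)
      then show "(\<lambda>n. (f (?t n *\<^sub>R ?a + x) - f x) /\<^sub>R ?t n) \<longlonglongrightarrow> partial_deriv j f x"
        by (simp only: LIM_zero_iff tendsto_norm_zero_iff)
    qed
  qed measurable
  have q: "(LINT x|lborel. ?q n x) = (exp (\<i> * complex_of_real (\<omega> $ j) * ?t n) - 1) / ?t n * fourier f \<omega>" for n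
  proof -
    have fi: "integrable lborel f" using f by (rule schwartz_integrable)
    have fi': "integrable lborel (\<lambda>x. f (?t n *\<^sub>R ?a + x))" using integrable_lborel_affine[OF fi, of 1 "?t n *\<^sub>R ?a"] by simp
    have "(LINT x|lborel. ?q n x) = (LINT x|lborel. (f (?t n *\<^sub>R ?a + x) * ?e x - f x * ?e x) /\<^sub>R ?t n)"
      by (simp add: algebra_simps)
    also have "\<dots> = (fourier (\<lambda>x. f (?t n *\<^sub>R ?a + x)) \<omega> - fourier f \<omega>) /\<^sub>R ?t n"
      unfolding fourier_def
      by (subst integral_scaleR_right, subst Bochner_Integration.integral_diff) (intro integrable_character fi fi' refl)+
    also have "fourier (\<lambda>x. f (?t n *\<^sub>R ?a + x)) \<omega> = exp (\<i> * complex_of_real (\<omega> $ j) * ?t n) * fourier f \<omega>"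
      by (subst fourier_translate[OF fi]) (simp add: cart_eq_inner_axis[symmetric] mult.commute mult.left_commute)
    finally show ?thesis by (simp add: scaleR_conv_of_real field_simps del: of_nat_Suc)
  qed
  have "((\<lambda>z. exp (\<i> * complex_of_real (\<omega> $ j) * z)) has_field_derivative \<i> * complex_of_real (\<omega> $ j)) (at 0)"
    by (auto intro!: derivative_eq_intros)
  then have "((\<lambda>h. (exp (\<i> * complex_of_real (\<omega> $ j) * h) - 1) / h) \<longlongrightarrow> \<i> * complex_of_real (\<omega> $ j)) (at 0)"
    by (simp add: DERIV_def)
  moreover have "filterlim (\<lambda>n. complex_of_real (?t n)) (at 0) sequentially"
    using tendsto_of_real[OF t0, where 'a=complex] by (auto simp: filterlim_at simp del: of_nat_Suc)
  ultimately have "(\<lambda>n. (exp (\<i> * complex_of_real (\<omega> $ j) * ?t n) - 1) / ?t n) \<longlonglongrightarrow> \<i> * complex_of_real (\<omega> $ j)"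
    by (rule filterlim_compose)
  then have "(\<lambda>n. LINT x|lborel. ?q n x) \<longlonglongrightarrow> \<i> * complex_of_real (\<omega> $ j) * fourier f \<omega>"
    unfolding q by (rule tendsto_mult_right)
  from LIMSEQ_unique[OF lim this] show ?thesis unfolding fourier_def .
qed

lemma cmod_fourier_le: "cmod (fourier f \<omega>) \<le> (LINT x|lborel. cmod (f x))"
  unfolding fourier_def by (rule order_trans[OF integral_norm_bound]) (simp add: norm_mult)

lemma fourier_schwartz:
  fixes f :: "real^'d::finite \<Rightarrow> complex"
  assumes "f \<in> schwartz"
  shows "fourier f \<in> schwartz"
proof (rule schwartz_coinduct)
  let ?X = "fourier ` (schwartz :: (real^'d \<Rightarrow> complex) set)"
  show "fourier f \<in> ?X" using assms by blast
  have dec: "\<exists>C. \<forall>x. norm x ^ m * cmod (fourier f x) \<le> C" if "f \<in> schwartz" for m and f :: "real^'d \<Rightarrow> complex"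
    using that
  proof (induction m arbitrary: f)
    case 0
    then show ?case using cmod_fourier_le by auto
  next
    case (Suc m)
    have "\<forall>j. \<exists>C. \<forall>x. norm x ^ m * cmod (fourier (partial_deriv j f) x) \<le> C"
      using Suc.IH[OF schwartz_partial_deriv[OF Suc.prems]] by blast
    then obtain C where C: "\<And>j x. norm x ^ m * cmod (fourier (partial_deriv j f) x) \<le> C j" by metis
    have "norm x ^ Suc m * cmod (fourier f x) \<le> (\<Sum>j\<in>UNIV. C j)" for x :: "real^'d"
    proof -
      have "norm x ^ Suc m * cmod (fourier f x) \<le> norm x ^ m * ((\<Sum>j\<in>UNIV. \<bar>x $ j\<bar>) * cmod (fourier f x))"
        using mult_right_mono[OF norm_le_l1_cart[of x], of "norm x ^ m * cmod (fourier f x)"] by (simp add: algebra_simps)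
      also have "\<dots> = (\<Sum>j\<in>UNIV. norm x ^ m * cmod (fourier (partial_deriv j f) x))"
        by (simp add: fourier_partial_deriv[OF Suc.prems] norm_mult sum_distrib_left sum_distrib_right mult.assoc)
      also have "\<dots> \<le> (\<Sum>j\<in>UNIV. C j)" by (intro sum_mono C)
      finally show ?thesis .
    qed
    then show ?case by blast
  qed
  fix u j assume "u \<in> ?X"
  then obtain f where u: "u = fourier f" and f: "f \<in> schwartz" by blast
  show "u differentiable (at x)" for x unfolding u using fourier_has_derivative[OF f] by (auto simp: differentiable_def)
  show "rapid u" unfolding u rapid_def using dec[OF f] by blast
  show "partial_deriv j u \<in> ?X" unfolding u partial_deriv_fourier[OF f] by (intro imageI schwartz_scale schwartz_coord f)
qed

section \<open>Fourier inversion\<close>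

definition gauss :: "real^'d::finite \<Rightarrow> real" where
  "gauss x = exp (- (norm x)\<^sup>2 / 2)"

lemma gauss_bounds: "0 \<le> gauss x" "gauss x \<le> 1" unfolding gauss_def by auto

lemma gauss_measurable [measurable]: "gauss \<in> borel_measurable borel" unfolding gauss_def by measurable

lemma gauss_character_1d:
  shows "integrable lborel (\<lambda>t::real. complex_of_real (exp (- t\<^sup>2 / 2)) * exp (- (\<i> * complex_of_real (a * t))))"
    and "(LINT t|lborel. complex_of_real (exp (- t\<^sup>2 / 2)) * exp (- (\<i> * complex_of_real (a * t)))) = complex_of_real (sqrt (2 * pi) * exp (- a\<^sup>2 / 2))"
proof -
  have d: "exp (- t\<^sup>2 / 2) = sqrt (2 * pi) * std_normal_density t" for t
    by (simp add: std_normal_density_def)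
  have i0: "integrable lborel (\<lambda>t. std_normal_density t)" by (rule integrable_normal_density) simp
  have i: "integrable lborel (\<lambda>t. complex_of_real (std_normal_density t) * exp (- (\<i> * complex_of_real (a * t))))"
    by (rule Bochner_Integration.integrable_bound[OF i0]) (auto simp: norm_mult)
  have "integrable lborel (\<lambda>t. complex_of_real (sqrt (2 * pi)) * (complex_of_real (std_normal_density t) * exp (- (\<i> * complex_of_real (a * t)))))"
    by (intro integrable_mult_right i)
  then show "integrable lborel (\<lambda>t::real. complex_of_real (exp (- t\<^sup>2 / 2)) * exp (- (\<i> * complex_of_real (a * t))))"
    unfolding d by (simp add: mult.assoc)
  have "complex_of_real (exp (- a\<^sup>2 / 2)) = char std_normal_distribution (- a)"
    unfolding char_std_normal_distribution by simp
  also have "\<dots> = (LINT t|lborel. complex_of_real (std_normal_density t) * exp (- (\<i> * complex_of_real (a * t))))"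
    unfolding char_def by (subst integral_density) (auto simp: scaleR_conv_of_real)
  finally have "(LINT t|lborel. complex_of_real (sqrt (2 * pi)) * (complex_of_real (std_normal_density t) * exp (- (\<i> * complex_of_real (a * t))))) = complex_of_real (sqrt (2 * pi)) * complex_of_real (exp (- a\<^sup>2 / 2))"
    by (simp only: integral_mult_right_zero)
  then show "(LINT t|lborel. complex_of_real (exp (- t\<^sup>2 / 2)) * exp (- (\<i> * complex_of_real (a * t)))) = complex_of_real (sqrt (2 * pi) * exp (- a\<^sup>2 / 2))"
    unfolding d by (simp add: mult.assoc)
qed

lemma gauss_product:
  fixes x a :: "real^'d::finite"
  shows "complex_of_real (gauss x) * character a x = (\<Prod>j\<in>UNIV. complex_of_real (exp (- (x$j)\<^sup>2 / 2)) * exp (- (\<i> * complex_of_real (a$j * x$j))))"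
proof -
  have "- (norm x)\<^sup>2 / 2 = (\<Sum>j\<in>UNIV. - (x$j)\<^sup>2 / 2)"
    by (simp add: norm_vec_def L2_set_def sum_nonneg sum_divide_distrib sum_negf)
  then have "gauss x = (\<Prod>j\<in>UNIV. exp (- (x$j)\<^sup>2 / 2))" unfolding gauss_def by (simp add: exp_sum)
  moreover have "character a x = (\<Prod>j\<in>UNIV. exp (- (\<i> * complex_of_real (a$j * x$j))))"
    by (simp add: inner_vec_def exp_sum[symmetric] sum_distrib_left sum_negf)
  ultimately show ?thesis by (simp add: prod.distrib)
qed

lemma gauss_fourier:
  fixes a :: "real^'d::finite"
  shows "integrable lborel (\<lambda>x::real^'d. complex_of_real (gauss x) * character a x)"
    and "(LINT x|lborel. complex_of_real (gauss x) * character a x) = complex_of_real (sqrt (2 * pi) ^ CARD('d) * gauss a)"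
proof -
  let ?g = "\<lambda>j t. complex_of_real (exp (- t\<^sup>2 / 2)) * exp (- (\<i> * complex_of_real (a$j * t)))"
  show "integrable lborel (\<lambda>x::real^'d. complex_of_real (gauss x) * character a x)"
    unfolding gauss_product by (rule lborel_product_integrable[of ?g]) (rule gauss_character_1d)
  have "(LINT x|lborel. complex_of_real (gauss x) * character a x) = (\<Prod>j\<in>UNIV. LINT t|lborel. ?g j t)"
    unfolding gauss_product by (rule lborel_product_integral[of ?g]) (rule gauss_character_1d)
  also have "\<dots> = (\<Prod>j\<in>UNIV. complex_of_real (sqrt (2 * pi)) * complex_of_real (exp (- (a$j)\<^sup>2 / 2)))"
    unfolding gauss_character_1d by simp
  also have "\<dots> = complex_of_real (sqrt (2 * pi)) ^ CARD('d) * complex_of_real (gauss a)"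
    using gauss_product[of a 0] by (simp add: prod.distrib)
  finally show "(LINT x|lborel. complex_of_real (gauss x) * character a x) = complex_of_real (sqrt (2 * pi) ^ CARD('d) * gauss a)" by simp
qed

lemma gauss_integrable: "integrable lborel (gauss :: real^'d::finite \<Rightarrow> real)"
proof -
  have "integrable lborel (\<lambda>x::real^'d. complex_of_real (gauss x))" using gauss_fourier(1)[of 0] by simp
  from integrable_norm[OF this] show ?thesis by (simp add: gauss_bounds)
qed

lemma gauss_integral: "(LINT x|lborel. complex_of_real (gauss (x::real^'d::finite))) = complex_of_real (sqrt (2 * pi) ^ CARD('d))"
  using gauss_fourier(2)[of "0::real^'d"] by (simp add: gauss_def)

text \<open>The integrand on the left without the Gaussian factor is in general not integrable jointly in both
  variables of the double integral; the factor makes Fubini applicable. The inner integral is then the transform of a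
  Gaussian, which is a Gaussian again.\<close>

lemma fourier_regularized:
  fixes f :: "real^'d::finite \<Rightarrow> complex"
  assumes f: "f \<in> schwartz" and e: "e > 0"
  shows "(LINT x|lborel. fourier f x * exp (\<i> * complex_of_real (\<omega> \<bullet> x)) * complex_of_real (gauss (e *\<^sub>R x)))
    = complex_of_real (sqrt (2 * pi) ^ CARD('d)) * (LINT z|lborel. f (\<omega> + e *\<^sub>R z) * complex_of_real (gauss z))"
proof -
  let ?c = "complex_of_real (sqrt (2 * pi) ^ CARD('d))"
  have [measurable]: "f \<in> borel_measurable borel" using f by simp
  have fi: "integrable lborel f" using f by (rule schwartz_integrable)
  have gi: "integrable lborel (\<lambda>x::real^'d. gauss (e *\<^sub>R x))"
    using integrable_lborel_affine[OF gauss_integrable, of e 0] e by simp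
  let ?F = "\<lambda>x y. f y * character x y * exp (\<i> * complex_of_real (\<omega> \<bullet> x)) * complex_of_real (gauss (e *\<^sub>R x))"
  have pair: "integrable (lborel \<Otimes>\<^sub>M lborel) (\<lambda>(x, y). ?F x y)"
  proof (rule Bochner_Integration.integrable_bound)
    show "integrable (lborel \<Otimes>\<^sub>M lborel) (\<lambda>(x::real^'d, y). gauss (e *\<^sub>R x) *\<^sub>R f y)"
      by (rule lborel_pair.Fubini_integrable)
         (auto simp: integrable_norm fi gi integrable_abs[OF gi] intro!: integrable_mult_right integrable_mult_left integrable_norm[OF fi] integrable_norm[OF gi])
  qed (auto simp: norm_mult gauss_bounds)
  have "(LINT x|lborel. fourier f x * exp (\<i> * complex_of_real (\<omega> \<bullet> x)) * complex_of_real (gauss (e *\<^sub>R x)))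
     = (LINT x|lborel. LINT y|lborel. ?F x y)"
    unfolding fourier_def by (simp only: integral_mult_left_zero)
  also have "\<dots> = (LINT y|lborel. LINT x|lborel. ?F x y)"
    using lborel_pair.Fubini_integral[OF pair] by simp
  also have "\<dots> = (LINT y|lborel. f y * (?c * complex_of_real (gauss ((y - \<omega>) /\<^sub>R e)) / complex_of_real (e ^ CARD('d))))"
  proof (rule Bochner_Integration.integral_cong[OF refl])
    fix y
    let ?h = "\<lambda>z. complex_of_real (gauss z) * character ((y - \<omega>) /\<^sub>R e) z"
    have "(LINT x|lborel. ?F x y) = f y * (LINT x|lborel. ?h (0 + e *\<^sub>R x))"
    proof (subst integral_mult_right_zero[symmetric], rule Bochner_Integration.integral_cong[OF refl])
      fix x
      have "((y - \<omega>) /\<^sub>R e) \<bullet> (0 + e *\<^sub>R x) = x \<bullet> y - \<omega> \<bullet> x"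
        using e by (simp add: inner_diff_right inner_commute[of _ x] mult.assoc[symmetric])
      then show "?F x y = f y * ?h (0 + e *\<^sub>R x)"
        by (simp only:) (simp add: exp_add[symmetric] algebra_simps)
    qed
    also have "(LINT x|lborel. ?h (0 + e *\<^sub>R x)) = (LINT x|lborel. ?h x) / complex_of_real (e ^ CARD('d))"
      using integral_lborel_affine[OF gauss_fourier(1)[of "(y - \<omega>) /\<^sub>R e"], of e 0] e
      by (simp add: scaleR_conv_of_real)
    also have "(LINT x|lborel. ?h x) = ?c * complex_of_real (gauss ((y - \<omega>) /\<^sub>R e))"
      unfolding gauss_fourier(2) by simp
    finally show "(LINT x|lborel. ?F x y) = f y * (?c * complex_of_real (gauss ((y - \<omega>) /\<^sub>R e)) / complex_of_real (e ^ CARD('d)))" .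
  qed
  also have "\<dots> = ?c / complex_of_real (e ^ CARD('d)) * (LINT y|lborel. f y * complex_of_real (gauss ((y - \<omega>) /\<^sub>R e)))"
    by (subst integral_mult_right_zero[symmetric]) (simp add: field_simps)
  also have "(LINT y|lborel. f y * complex_of_real (gauss ((y - \<omega>) /\<^sub>R e))) = complex_of_real (e ^ CARD('d)) * (LINT z|lborel. f (\<omega> + e *\<^sub>R z) * complex_of_real (gauss z))"
  proof -
    have "integrable lborel (\<lambda>y. f y * complex_of_real (gauss ((y - \<omega>) /\<^sub>R e)))"
      by (rule Bochner_Integration.integrable_bound[OF fi])
         (auto simp: norm_mult gauss_bounds mult_left_le)
    from integral_lborel_affine[OF this, of e \<omega>] show ?thesis using e by (simp add: scaleR_conv_of_real[where 'a=complex])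
  qed
  finally show ?thesis using e by simp
qed

text \<open>In \<open>fourier_regularized\<close> let the Gaussian factor tend to \<open>1\<close> on the left, while the Gaussian average of
  \<open>f\<close> around \<open>\<omega>\<close> on the right concentrates at \<open>\<omega>\<close>.\<close>

lemma fourier_inversion:
  fixes f :: "real^'d::finite \<Rightarrow> complex"
  assumes f: "f \<in> schwartz"
  shows "(LINT x|lborel. fourier f x * exp (\<i> * complex_of_real (\<omega> \<bullet> x))) = complex_of_real ((2 * pi) ^ CARD('d)) * f \<omega>"
proof -
  let ?c = "complex_of_real (sqrt (2 * pi) ^ CARD('d))"
  let ?t = "\<lambda>n. inverse (real (Suc n))"
  have t0: "?t \<longlonglongrightarrow> 0" by (rule LIMSEQ_inverse_real_of_nat)
  have [measurable]: "f \<in> borel_measurable borel" using f by simp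
  have [measurable]: "fourier f \<in> borel_measurable borel" using fourier_schwartz[OF f] by simp
  have cf: "isCont f x" for x using schwartz_continuous[OF f] continuous_on_eq_continuous_at[OF open_UNIV] by blast
  have cg: "isCont gauss x" for x :: "real^'d" unfolding gauss_def by (intro continuous_intros) auto
  have st: "(\<lambda>n. ?t n *\<^sub>R x) \<longlonglongrightarrow> 0" for x :: "real^'d"
    using tendsto_scaleR[OF t0 tendsto_const[of x]] by simp
  obtain B where B: "\<And>x. cmod (f x) \<le> B"
    using schwartz_rapid[OF f, unfolded rapid_def, THEN spec, of 0] by auto
  have L: "(\<lambda>n. LINT x|lborel. fourier f x * exp (\<i> * complex_of_real (\<omega> \<bullet> x)) * complex_of_real (gauss (?t n *\<^sub>R x)))
     \<longlonglongrightarrow> (LINT x|lborel. fourier f x * exp (\<i> * complex_of_real (\<omega> \<bullet> x)))"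
  proof (rule integral_dominated_convergence)
    show "integrable lborel (\<lambda>x. cmod (fourier f x))"
      by (intro integrable_norm schwartz_integrable fourier_schwartz f)
    show "AE x in lborel. (\<lambda>n. fourier f x * exp (\<i> * complex_of_real (\<omega> \<bullet> x)) * complex_of_real (gauss (?t n *\<^sub>R x))) \<longlonglongrightarrow> fourier f x * exp (\<i> * complex_of_real (\<omega> \<bullet> x))"
    proof (rule AE_I2)
      fix x :: "real^'d"
      have "(\<lambda>n. gauss (?t n *\<^sub>R x)) \<longlonglongrightarrow> gauss (0::real^'d)" by (rule isCont_tendsto_compose[OF cg st])
      then have "(\<lambda>n. fourier f x * exp (\<i> * complex_of_real (\<omega> \<bullet> x)) * complex_of_real (gauss (?t n *\<^sub>R x))) \<longlonglongrightarrow> fourier f x * exp (\<i> * complex_of_real (\<omega> \<bullet> x)) * complex_of_real (gauss (0::real^'d))"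
        by (intro tendsto_intros)
      then show "(\<lambda>n. fourier f x * exp (\<i> * complex_of_real (\<omega> \<bullet> x)) * complex_of_real (gauss (?t n *\<^sub>R x))) \<longlonglongrightarrow> fourier f x * exp (\<i> * complex_of_real (\<omega> \<bullet> x))"
        by (simp add: gauss_def del: of_nat_Suc)
    qed
  qed (auto simp: norm_mult gauss_bounds mult_left_le simp del: of_nat_Suc)
  have R: "(\<lambda>n. LINT z|lborel. f (\<omega> + ?t n *\<^sub>R z) * complex_of_real (gauss z)) \<longlonglongrightarrow> (LINT z|lborel. f \<omega> * complex_of_real (gauss (z::real^'d)))"
  proof (rule integral_dominated_convergence)
    show "integrable lborel (\<lambda>z::real^'d. B * gauss z)" by (intro integrable_mult_right gauss_integrable)
    show "AE z in lborel. (\<lambda>n. f (\<omega> + ?t n *\<^sub>R z) * complex_of_real (gauss z)) \<longlonglongrightarrow> f \<omega> * complex_of_real (gauss z)"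
    proof (rule AE_I2, rule tendsto_mult_right)
      fix z
      have "(\<lambda>n. \<omega> + ?t n *\<^sub>R z) \<longlonglongrightarrow> \<omega> + 0" by (intro tendsto_add tendsto_const st)
      then show "(\<lambda>n. f (\<omega> + ?t n *\<^sub>R z)) \<longlonglongrightarrow> f \<omega>" using isCont_tendsto_compose[OF cf] by simp
    qed
  qed (auto simp: norm_mult gauss_bounds intro!: mult_right_mono B)
  have "(\<lambda>n. ?c * (LINT z|lborel. f (\<omega> + ?t n *\<^sub>R z) * complex_of_real (gauss z))) \<longlonglongrightarrow> ?c * (f \<omega> * ?c)"
    using tendsto_mult_left[OF R, of ?c] unfolding integral_mult_right_zero gauss_integral .
  moreover have "(LINT x|lborel. fourier f x * exp (\<i> * complex_of_real (\<omega> \<bullet> x)) * complex_of_real (gauss (?t n *\<^sub>R x))) = ?c * (LINT z|lborel. f (\<omega> + ?t n *\<^sub>R z) * complex_of_real (gauss z))" for n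
    by (rule fourier_regularized[OF f]) simp
  ultimately have "(LINT x|lborel. fourier f x * exp (\<i> * complex_of_real (\<omega> \<bullet> x))) = ?c * (f \<omega> * ?c)"
    using LIMSEQ_unique[OF L] by simp
  also have "?c * (f \<omega> * ?c) = complex_of_real ((sqrt (2 * pi) * sqrt (2 * pi)) ^ CARD('d)) * f \<omega>"
    unfolding power_mult_distrib of_real_mult by simp
  also have "sqrt (2 * pi) * sqrt (2 * pi) = 2 * pi" by simp
  finally show ?thesis .
qed

section \<open>Continuous functionals on the Schwartz space\<close>

lemma test_functions_schwartz: "f \<in> test_functions \<Longrightarrow> f \<in> schwartz"
  by (simp add: test_functions_def)

lemma test_functions_modulate:
  "f \<in> test_functions \<Longrightarrow> (\<lambda>x. f x * character a x) \<in> test_functions"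
  by (auto simp: test_functions_def intro: schwartz_modulate)

lemma test_functions_scaled_argument:
  fixes f :: "real^'d::finite \<Rightarrow> complex"
  assumes "f \<in> test_functions" "h > 0"
  shows "(\<lambda>x. f (h *\<^sub>R x)) \<in> test_functions"
proof -
  have "{x. f (h *\<^sub>R x) \<noteq> 0} \<subseteq> (\<lambda>x. inverse h *\<^sub>R x) ` {x. f x \<noteq> 0}"
    using assms(2) by (auto intro!: image_eqI[where x="h *\<^sub>R _"])
  moreover have "bounded ((\<lambda>x. inverse h *\<^sub>R x) ` {x. f x \<noteq> 0})"
    using assms by (intro bounded_scaling) (simp add: test_functions_def)
  ultimately have "bounded {x. f (h *\<^sub>R x) \<noteq> 0}" by (rule bounded_subset[rotated])
  then show ?thesis using schwartz_affine[of f h 1 0] assms by (simp add: test_functions_def)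
qed

lemma schwartz_bounded_above:
  assumes "f \<in> schwartz" shows "bdd_above (range (\<lambda>x. norm x ^ m * cmod (partials js f x)))"
  using schwartz_rapid[OF schwartz_partials[OF assms, of js], unfolded rapid_def, THEN spec, of m] by auto

lemma schwartz_seminorm_upper: "f \<in> schwartz \<Longrightarrow> norm x ^ m * cmod (partials js f x) \<le> schwartz_seminorm m js f"
  unfolding schwartz_seminorm_def by (rule cSUP_upper[OF UNIV_I schwartz_bounded_above])

lemma schwartz_seminorm_nonneg: "f \<in> schwartz \<Longrightarrow> 0 \<le> schwartz_seminorm m js f"
  using schwartz_seminorm_upper[of f 0 m js] by (smt (verit) mult_nonneg_nonneg norm_ge_zero zero_le_power)

lemma finite_lists_le: "finite {js :: 'd::finite list. length js \<le> N}"
  using finite_lists_length_le[of "UNIV :: 'd set" N] by simp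

definition schwartz_norm :: "nat \<Rightarrow> (real^'d::finite \<Rightarrow> complex) \<Rightarrow> real" where
  "schwartz_norm N f = (\<Sum>m\<le>N. \<Sum>js\<in>{js. length js \<le> N}. schwartz_seminorm m js f)"

lemma schwartz_seminorm_le_norm:
  assumes f: "f \<in> schwartz" and "m \<le> N" "length js \<le> N"
  shows "schwartz_seminorm m js f \<le> schwartz_norm N f"
proof -
  have "schwartz_seminorm m js f \<le> (\<Sum>js\<in>{js. length js \<le> N}. schwartz_seminorm m js f)"
    using assms by (intro member_le_sum) (auto simp: finite_lists_le schwartz_seminorm_nonneg)
  also have "\<dots> \<le> schwartz_norm N f" unfolding schwartz_norm_def
    using assms by (intro member_le_sum[where f="\<lambda>m. \<Sum>js\<in>{js. length js \<le> N}. schwartz_seminorm m js f"])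
      (auto simp: schwartz_seminorm_nonneg intro!: sum_nonneg)
  finally show ?thesis .
qed

lemma schwartz_norm_nonneg: "f \<in> schwartz \<Longrightarrow> 0 \<le> schwartz_norm N f"
  unfolding schwartz_norm_def by (intro sum_nonneg schwartz_seminorm_nonneg)

lemma tempered_iff: "T \<in> tempered \<longleftrightarrow>
     (\<forall>\<phi>. \<phi> \<notin> schwartz \<longrightarrow> T \<phi> = 0) \<and>
     (\<forall>\<phi>\<in>schwartz. \<forall>\<psi>\<in>schwartz. T (\<lambda>x. \<phi> x + \<psi> x) = T \<phi> + T \<psi>) \<and>
     (\<forall>c. \<forall>\<phi>\<in>schwartz. T (\<lambda>x. c * \<phi> x) = c * T \<phi>) \<and>
     (\<exists>C N. \<forall>\<phi>\<in>schwartz. cmod (T \<phi>) \<le> C * schwartz_norm N \<phi>)"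
  unfolding tempered_def schwartz_norm_def by simp

lemma tempered_bound:
  assumes "T \<in> tempered" 
  obtains C N where "C \<ge> 0" "\<And>f. f \<in> schwartz \<Longrightarrow> cmod (T f) \<le> C * schwartz_norm N f"
proof -
  obtain C N where "\<And>f. f \<in> schwartz \<Longrightarrow> cmod (T f) \<le> C * schwartz_norm N f"
    using assms unfolding tempered_iff by blast
  then have "cmod (T f) \<le> \<bar>C\<bar> * schwartz_norm N f" if "f \<in> schwartz" for f
    using that mult_right_mono[OF abs_ge_self[of C] schwartz_norm_nonneg[OF that, of N]] by (meson order_trans)
  then show ?thesis using that[of "\<bar>C\<bar>" N] by auto
qed

lemma schwartz_norm_mono:
  fixes f :: "real^'d::finite \<Rightarrow> complex"
  assumes f: "f \<in> schwartz" and "M \<le> N" shows "schwartz_norm M f \<le> schwartz_norm N f"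
proof -
  have "(\<Sum>js\<in>{js. length js \<le> M}. schwartz_seminorm m js f) \<le> (\<Sum>js\<in>{js. length js \<le> N}. schwartz_seminorm m js f)" for m
    using assms by (intro sum_mono2) (auto simp: finite_lists_le schwartz_seminorm_nonneg)
  then have "schwartz_norm M f \<le> (\<Sum>m\<le>M. \<Sum>js\<in>{js. length js \<le> N}. schwartz_seminorm m js f)"
    unfolding schwartz_norm_def by (intro sum_mono)
  also have "\<dots> \<le> schwartz_norm N f" unfolding schwartz_norm_def
    using assms by (intro sum_mono2) (auto intro!: sum_nonneg schwartz_seminorm_nonneg)
  finally show ?thesis .
qed

lemma partials_affine:
  assumes "f \<in> schwartz"
  shows "partials js (\<lambda>x. c * f (h *\<^sub>R x + a)) = (\<lambda>x. c * of_real h ^ length js * partials js f (h *\<^sub>R x + a))"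
proof (induction js)
  case (Cons j js)
  show ?case unfolding partials_Cons Cons schwartz_affine_partial_deriv(1)[OF schwartz_partials[OF assms]] by (simp add: mult_ac)
qed simp

text \<open>Dilations and translations are continuous on the Schwartz space. This is what makes the dilates and
  translates of a tempered distribution tempered.\<close>

lemma schwartz_norm_affine:
  fixes a :: "real^'d::finite"
  assumes h: "h > 0"
  obtains C where "C \<ge> 0" "\<And>f. f \<in> schwartz \<Longrightarrow> schwartz_norm N (\<lambda>x. c * f (h *\<^sub>R x + a)) \<le> C * schwartz_norm N f"
proof -
  define K where "K m js = inverse h ^ m * (2 ^ m * (cmod c * h ^ length js) * (1 + norm a ^ m))" for m :: nat and js :: "'d list"
  have K0: "K m js \<ge> 0" for m js unfolding K_def using h by simp
  have le: "schwartz_seminorm m js (\<lambda>x. c * f (h *\<^sub>R x + a)) \<le> K m js * schwartz_norm N f"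
    if f: "f \<in> schwartz" and m: "m \<le> N" and js: "length js \<le> N" for f m js
    unfolding schwartz_seminorm_def
  proof (rule cSUP_least)
    fix x :: "real^'d"
    let ?y = "h *\<^sub>R x + a" and ?P = "cmod (partials js f (h *\<^sub>R x + a))"
    have "norm (h *\<^sub>R x) \<le> norm ?y + norm a" by (metis add_diff_cancel_right' norm_triangle_ineq4)
    then have "norm x \<le> inverse h * (norm ?y + norm a)" using h by (simp add: field_simps)
    then have "norm x ^ m \<le> (inverse h * (norm ?y + norm a)) ^ m" by (intro power_mono) auto
    also have "\<dots> = inverse h ^ m * (norm ?y + norm a) ^ m" by (rule power_mult_distrib)
    also have "(norm ?y + norm a) ^ m \<le> 2 ^ m * (norm ?y ^ m + norm a ^ m)"
    proof -
      have "(norm ?y + norm a) ^ m \<le> (2 * max (norm ?y) (norm a)) ^ m" by (intro power_mono) auto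
      also have "\<dots> = 2 ^ m * max (norm ?y) (norm a) ^ m" by (rule power_mult_distrib)
      also have "\<dots> \<le> 2 ^ m * (norm ?y ^ m + norm a ^ m)" by (intro mult_left_mono) (auto simp: max_def)
      finally show ?thesis .
    qed
    finally have x: "norm x ^ m \<le> inverse h ^ m * (2 ^ m * (norm ?y ^ m + norm a ^ m))" using h by (simp add: mult_left_mono)
    have b1: "norm ?y ^ m * ?P \<le> schwartz_norm N f"
      by (rule order_trans[OF schwartz_seminorm_upper[OF f] schwartz_seminorm_le_norm[OF f m js]])
    have "norm ?y ^ 0 * ?P \<le> schwartz_norm N f"
      by (rule order_trans[OF schwartz_seminorm_upper[OF f] schwartz_seminorm_le_norm[OF f _ js]]) simp
    then have b2: "norm a ^ m * ?P \<le> norm a ^ m * schwartz_norm N f" by (intro mult_left_mono) auto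
    have "norm x ^ m * cmod (partials js (\<lambda>x. c * f (h *\<^sub>R x + a)) x) = norm x ^ m * (cmod c * h ^ length js * ?P)"
      unfolding partials_affine[OF f] using h by (simp add: norm_mult norm_power)
    also have "\<dots> \<le> (inverse h ^ m * (2 ^ m * (norm ?y ^ m + norm a ^ m))) * (cmod c * h ^ length js * ?P)"
      using h by (intro mult_right_mono x) auto
    also have "\<dots> = inverse h ^ m * (2 ^ m * (cmod c * h ^ length js) * (norm ?y ^ m * ?P + norm a ^ m * ?P))"
      by (simp add: algebra_simps)
    also have "\<dots> \<le> inverse h ^ m * (2 ^ m * (cmod c * h ^ length js) * (schwartz_norm N f + norm a ^ m * schwartz_norm N f))"
      using h by (intro mult_left_mono add_mono b1 b2) auto
    also have "\<dots> = K m js * schwartz_norm N f" unfolding K_def by (simp add: algebra_simps)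
    finally show "norm x ^ m * cmod (partials js (\<lambda>x. c * f (h *\<^sub>R x + a)) x) \<le> K m js * schwartz_norm N f" .
  qed simp
  show ?thesis
  proof (rule that)
    show "(\<Sum>m\<le>N. \<Sum>js\<in>{js. length js \<le> N}. K m js) \<ge> 0" by (intro sum_nonneg K0)
    fix f :: "real^'d \<Rightarrow> complex" assume f: "f \<in> schwartz"
    have "schwartz_norm N (\<lambda>x. c * f (h *\<^sub>R x + a)) \<le> (\<Sum>m\<le>N. \<Sum>js\<in>{js. length js \<le> N}. K m js * schwartz_norm N f)"
      unfolding schwartz_norm_def[of N "\<lambda>x. c * f (h *\<^sub>R x + a)"] by (intro sum_mono le f) auto
    then show "schwartz_norm N (\<lambda>x. c * f (h *\<^sub>R x + a)) \<le> (\<Sum>m\<le>N. \<Sum>js\<in>{js. length js \<le> N}. K m js) * schwartz_norm N f"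
      by (simp add: sum_distrib_right)
  qed
qed

lemma schwartz_integral_norm_le:
  obtains C where "C \<ge> 0" "\<And>f. f \<in> schwartz \<Longrightarrow> (LINT x|lborel. cmod (f (x::real^'d::finite))) \<le> C * schwartz_norm (2 * CARD('d)) f"
proof -
  let ?N = "2 * CARD('d)"
  let ?w = "\<lambda>x::real^'d. 1 / (1 + norm x) ^ ?N"
  define C where "C = 2 ^ ?N * 2 * (LINT x|lborel. ?w x)"
  have "C \<ge> 0" unfolding C_def by (intro mult_nonneg_nonneg integral_nonneg_AE) auto
  moreover have "(LINT x|lborel. cmod (f x)) \<le> C * schwartz_norm ?N f" if f: "f \<in> schwartz" for f :: "real^'d \<Rightarrow> complex"
  proof -
    have "cmod (f x) \<le> (2 ^ ?N * 2 * schwartz_norm ?N f) * ?w x" for x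
    proof -
      have b1: "norm x ^ m * cmod (f x) \<le> schwartz_norm ?N f" if "m \<le> ?N" for m
        using order_trans[OF schwartz_seminorm_upper[OF f, of x m "[]"] schwartz_seminorm_le_norm[OF f that, of "[]"]] by simp
      have "(1 + norm x) ^ ?N \<le> (2 * max 1 (norm x)) ^ ?N" by (intro power_mono) auto
      also have "\<dots> = 2 ^ ?N * max 1 (norm x) ^ ?N" by (rule power_mult_distrib)
      also have "\<dots> \<le> 2 ^ ?N * (norm x ^ 0 + norm x ^ ?N)" by (intro mult_left_mono) (auto simp: max_def)
      finally have "(1 + norm x) ^ ?N * cmod (f x) \<le> 2 ^ ?N * (norm x ^ 0 + norm x ^ ?N) * cmod (f x)" by (intro mult_right_mono) auto
      also have "\<dots> = 2 ^ ?N * (norm x ^ 0 * cmod (f x) + norm x ^ ?N * cmod (f x))" by (simp only: distrib_right mult.assoc)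
      also have "\<dots> \<le> 2 ^ ?N * (schwartz_norm ?N f + schwartz_norm ?N f)" by (intro mult_left_mono add_mono b1) auto
      finally have b: "(1 + norm x) ^ ?N * cmod (f x) \<le> 2 ^ ?N * 2 * schwartz_norm ?N f" by simp
      have "(1 + norm x) ^ ?N > 0" by (intro zero_less_power) (simp add: add_pos_nonneg)
      with b show ?thesis by (simp add: field_simps)
    qed
    then have "(LINT x|lborel. cmod (f x)) \<le> (LINT x|lborel. (2 ^ ?N * 2 * schwartz_norm ?N f) * ?w x)"
      by (intro integral_mono integrable_norm schwartz_integrable f integrable_mult_right integrable_decay)
    also have "\<dots> = C * schwartz_norm ?N f" unfolding C_def by (simp only: integral_mult_right_zero) simp
    finally show ?thesis .
  qed
  ultimately show ?thesis by (rule that)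
qed

text \<open>The distribution is the inverse Fourier integral of the indicator, which is a bounded function.
  Pairing it with the Fourier transform of a test function gives back the indicator by Fubini and the
  inversion formula. These distributions are the functions on which an approximation order is tested.\<close>

lemma fourier_preimage_of_indicator:
  fixes A :: "(real^'d::finite) set"
  assumes A[measurable]: "A \<in> sets borel" and "bounded A"
  shows "\<exists>T\<in>tempered. represented_by (dist_fourier T) (\<lambda>\<omega>. indicator A \<omega>)"
proof -
  let ?ind = "\<lambda>\<omega>. indicator A \<omega> :: complex"
  let ?c = "complex_of_real (1 / (2 * pi) ^ CARD('d))"
  have fin: "emeasure lborel A < \<infinity>" using emeasure_bounded_finite[OF assms(2)] by simp
  have Ai: "integrable lborel ?ind" using fin A
    by (intro Bochner_Integration.integrable_bound[of lborel "indicat_real A" ?ind]) (auto simp: integrable_indicator_iff split: split_indicator)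
  define f where "f x = (LINT \<omega>|lborel. ?ind \<omega> * exp (\<i> * complex_of_real (\<omega> \<bullet> x)))" for x :: "real^'d"
  define B where "B = (LINT \<omega>|lborel. cmod (?ind \<omega>))"
  have fB: "cmod (f x) \<le> B" for x
    unfolding f_def B_def by (rule order_trans[OF integral_norm_bound]) (simp add: norm_mult)
  have [measurable]: "f \<in> borel_measurable borel" unfolding f_def by measurable
  define T where "T \<psi> = (if \<psi> \<in> schwartz then ?c * (LINT x|lborel. f x * \<psi> x) else 0)" for \<psi> :: "real^'d \<Rightarrow> complex"
  have fi: "integrable lborel (\<lambda>x. f x * \<psi> x)" if "\<psi> \<in> schwartz" for \<psi>
  proof (rule Bochner_Integration.integrable_bound)
    show "integrable lborel (\<lambda>x. B * cmod (\<psi> x))" by (intro integrable_mult_right integrable_norm schwartz_integrable that)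
    have [measurable]: "\<psi> \<in> borel_measurable borel" using that by simp
    show "(\<lambda>x. f x * \<psi> x) \<in> borel_measurable lborel" by measurable
    show "AE x in lborel. norm (f x * \<psi> x) \<le> norm (B * cmod (\<psi> x))"
      using mult_right_mono[OF order_trans[OF fB abs_ge_self]] by (intro AE_I2) (simp add: norm_mult abs_mult)
  qed
  have "T \<in> tempered" unfolding tempered_iff
  proof (intro conjI ballI allI impI)
    fix \<phi> :: "real^'d \<Rightarrow> complex"
    assume p: "\<phi> \<in> schwartz"
    { fix \<psi> :: "real^'d \<Rightarrow> complex" assume q: "\<psi> \<in> schwartz"
      show "T (\<lambda>x. \<phi> x + \<psi> x) = T \<phi> + T \<psi>"
        unfolding T_def using p q schwartz_add[OF p q] fi by (simp add: distrib_left) }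
    show "T (\<lambda>x. c * \<phi> x) = c * T \<phi>" for c
      unfolding T_def using p schwartz_scale[OF p, of c] by (simp add: mult.left_commute)
  next
    obtain C where C: "C \<ge> 0" "\<And>f. f \<in> schwartz \<Longrightarrow> (LINT x|lborel. cmod (f (x::real^'d::finite))) \<le> C * schwartz_norm (2 * CARD('d)) f"
      using schwartz_integral_norm_le by blast
    have "cmod (T \<phi>) \<le> (cmod ?c * B * C) * schwartz_norm (2 * CARD('d)) \<phi>" if p: "\<phi> \<in> schwartz" for \<phi>
    proof -
      have "cmod (LINT x|lborel. f x * \<phi> x) \<le> (LINT x|lborel. B * cmod (\<phi> x))"
        using fB by (intro Bochner_Integration.integral_norm_bound_integral fi p integrable_mult_right integrable_norm schwartz_integrable)
          (auto simp: norm_mult intro!: mult_right_mono)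
      also have "\<dots> = B * (LINT x|lborel. cmod (\<phi> x))" by simp
      also have "\<dots> \<le> B * (C * schwartz_norm (2 * CARD('d)) \<phi>)"
        by (intro mult_left_mono C p) (simp add: B_def)
      finally have "cmod ?c * cmod (LINT x|lborel. f x * \<phi> x) \<le> cmod ?c * (B * (C * schwartz_norm (2 * CARD('d)) \<phi>))"
        by (intro mult_left_mono) auto
      then show ?thesis unfolding T_def if_P[OF p] by (simp only: norm_mult mult.assoc)
    qed
    then show "\<exists>C N. \<forall>\<phi>\<in>schwartz. cmod (T \<phi>) \<le> C * schwartz_norm N \<phi>" by blast
  qed (simp add: T_def)
  moreover have "represented_by (dist_fourier T) ?ind" unfolding represented_by_def
  proof (intro conjI ballI)
    have "set_integrable lborel K (\<lambda>\<omega>. (cmod (?ind \<omega>))\<^sup>2)" if "compact K" for K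
    proof -
      have "integrable lborel (indicator (K \<inter> A) :: real^'d \<Rightarrow> real)"
        using fin A that emeasure_mono[of "K \<inter> A" A lborel]
        by (auto simp: integrable_indicator_iff compact_imp_closed borel_closed less_top[symmetric] top_unique)
      moreover have "indicat_real K \<omega> * (cmod (?ind \<omega>))\<^sup>2 = indicator (K \<inter> A) \<omega>" for \<omega>
        by (auto simp: indicator_def)
      ultimately show ?thesis unfolding set_integrable_def by simp
    qed
    then show "locally_L2 ?ind" unfolding locally_L2_def by auto
    fix \<phi> :: "real^'d \<Rightarrow> complex" assume "\<phi> \<in> test_functions"
    then have p: "\<phi> \<in> schwartz" by (rule test_functions_schwartz)
    have Fp: "fourier \<phi> \<in> schwartz" using p by (rule fourier_schwartz)
    have [measurable]: "fourier \<phi> \<in> borel_measurable borel" using Fp by simp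
    let ?G = "\<lambda>x \<omega>. ?ind \<omega> * exp (\<i> * complex_of_real (\<omega> \<bullet> x)) * fourier \<phi> x"
    have pair: "integrable (lborel \<Otimes>\<^sub>M lborel) (\<lambda>(x, \<omega>). ?G x \<omega>)"
    proof (rule Bochner_Integration.integrable_bound)
      show "integrable (lborel \<Otimes>\<^sub>M lborel) (\<lambda>(x, \<omega>). cmod (fourier \<phi> x) *\<^sub>R ?ind \<omega>)"
        by (rule lborel_pair.Fubini_integrable)
           (auto intro!: integrable_mult_right integrable_mult_left integrable_norm[OF Ai] Ai integrable_norm[OF schwartz_integrable[OF Fp]])
    qed (auto simp: norm_mult)
    have "dist_fourier T \<phi> = ?c * (LINT x|lborel. f x * fourier \<phi> x)"
      unfolding dist_fourier_def T_def using p Fp by simp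
    also have "(LINT x|lborel. f x * fourier \<phi> x) = (LINT x|lborel. LINT \<omega>|lborel. ?G x \<omega>)"
      unfolding f_def by simp
    also have "\<dots> = (LINT \<omega>|lborel. LINT x|lborel. ?G x \<omega>)" using lborel_pair.Fubini_integral[OF pair] by simp
    also have "\<dots> = (LINT \<omega>|lborel. ?ind \<omega> * (LINT x|lborel. fourier \<phi> x * exp (\<i> * complex_of_real (\<omega> \<bullet> x))))"
      by (subst integral_mult_right_zero[symmetric]) (simp add: mult_ac)
    also have "\<dots> = (LINT \<omega>|lborel. complex_of_real ((2 * pi) ^ CARD('d)) * (?ind \<omega> * \<phi> \<omega>))"
      unfolding fourier_inversion[OF p] by (simp add: mult_ac)
    also have "?c * \<dots> = (LINT \<omega>|lborel. ?ind \<omega> * \<phi> \<omega>)" by simp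
    finally show "dist_fourier T \<phi> = (LINT \<omega>|lborel. ?ind \<omega> * \<phi> \<omega>)" .
  qed
  ultimately show ?thesis by blast
qed

section \<open>Bump functions and uniqueness of representing functions\<close>

definition smooth :: "(real^'d::finite \<Rightarrow> complex) set" where
  "smooth = {f. \<forall>js x. partials js f differentiable (at x)}"

lemma smooth_coinduct:
  assumes "f \<in> X"
    and "\<And>g x. g \<in> X \<Longrightarrow> g differentiable (at x)"
    and "\<And>g j. g \<in> X \<Longrightarrow> partial_deriv j g \<in> X"
  shows "f \<in> smooth"
proof -
  have "partials js f \<in> X" for js
  proof (induction js)
    case (Cons j js)
    then show ?case using assms(3) by (simp add: partials_Cons del: partials.simps)
  qed (use assms in simp)
  then show ?thesis using assms(2) unfolding smooth_def by blast
qed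

lemma smooth_differentiable: "f \<in> smooth \<Longrightarrow> f differentiable (at x)"
  unfolding smooth_def by (metis (mono_tags, lifting) mem_Collect_eq partials.simps(1))

lemma smooth_has_derivative: "f \<in> smooth \<Longrightarrow> (f has_derivative frechet_derivative f (at x)) (at x)"
  using smooth_differentiable frechet_derivative_works by blast

lemma smooth_partial_deriv: "f \<in> smooth \<Longrightarrow> partial_deriv j f \<in> smooth"
  unfolding smooth_def by (auto simp: partials_snoc[symmetric])

text \<open>Sums of products of smooth functions are closed under partial derivatives by the product rule,
  whereas single products are not.\<close>

inductive_set product_sums :: "(real^'d::finite \<Rightarrow> complex) set" where
  mult: "f \<in> smooth \<Longrightarrow> g \<in> smooth \<Longrightarrow> (\<lambda>x. f x * g x) \<in> product_sums"
| add: "u \<in> product_sums \<Longrightarrow> v \<in> product_sums \<Longrightarrow> (\<lambda>x. u x + v x) \<in> product_sums"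

lemma product_sums_closed:
  assumes "u \<in> product_sums"
  shows "(\<forall>x. u differentiable (at x)) \<and> partial_deriv j u \<in> product_sums"
  using assms
proof induction
  case (mult f g)
  have d: "((\<lambda>x. f x * g x) has_derivative (\<lambda>v. f x * frechet_derivative g (at x) v + frechet_derivative f (at x) v * g x)) (at x)" for x
    by (intro has_derivative_mult smooth_has_derivative mult)
  have "(\<lambda>x. f x * partial_deriv j g x + partial_deriv j f x * g x) \<in> product_sums"
    by (intro product_sums.intros mult smooth_partial_deriv)
  then show ?case using d unfolding partial_deriv_eq[OF d] by (auto simp: differentiable_def partial_deriv_def)
next
  case (add u v)
  have "(u has_derivative frechet_derivative u (at x)) (at x)" "(v has_derivative frechet_derivative v (at x)) (at x)" for x
    using add frechet_derivative_works by blast+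
  then have d: "((\<lambda>x. u x + v x) has_derivative (\<lambda>y. frechet_derivative u (at x) y + frechet_derivative v (at x) y)) (at x)" for x
    by (intro has_derivative_add)
  have "(\<lambda>x. partial_deriv j u x + partial_deriv j v x) \<in> product_sums" by (intro product_sums.add) (use add in auto)
  then show ?case using d unfolding partial_deriv_eq[OF d] by (auto simp: differentiable_def partial_deriv_def)
qed

lemma smooth_mult: "f \<in> smooth \<Longrightarrow> g \<in> smooth \<Longrightarrow> (\<lambda>x. f x * g x) \<in> smooth"
  by (rule smooth_coinduct[of _ product_sums, OF product_sums.mult]) (use product_sums_closed in blast)+

lemma smooth_const: "(\<lambda>x. c) \<in> smooth"
  by (rule smooth_coinduct[of _ "range (\<lambda>c x. c)"]) (auto simp: partial_deriv_eq[OF has_derivative_const])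

lemma smooth_prod: "finite I \<Longrightarrow> (\<And>i. i \<in> I \<Longrightarrow> f i \<in> smooth) \<Longrightarrow> (\<lambda>x. \<Prod>i\<in>I. f i x) \<in> smooth"
proof (induction I rule: finite_induct)
  case (insert i I)
  then show ?case using smooth_mult[of "f i" "\<lambda>x. \<Prod>i\<in>I. f i x"] by simp
qed (simp add: smooth_const)

text \<open>The functions \<open>p(1/t) exp(-1/t)\<close>, extended by \<open>0\<close> to \<open>t \<le> 0\<close>, are closed under differentiation. For this
  reason the polynomial \<open>p\<close> is a parameter, although only \<open>p = 1\<close> occurs in the bump functions.\<close>

definition flat :: "real poly \<Rightarrow> real \<Rightarrow> real" where
  "flat p t = (if t > 0 then poly p (1 / t) * exp (- (1 / t)) else 0)"

lemma poly_times_exp_decay: "((\<lambda>u. poly p u * exp (- u)) \<longlongrightarrow> 0) (at_top :: real filter)"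
proof -
  have "((\<lambda>u. \<Sum>i\<le>degree p. coeff p i * (u ^ i / exp u)) \<longlongrightarrow> (\<Sum>i\<le>degree p. coeff p i * 0)) (at_top :: real filter)"
    by (intro tendsto_intros tendsto_power_div_exp_0)
  then show ?thesis by (simp add: poly_altdef sum_distrib_right exp_minus divide_inverse mult.assoc)
qed

lemma flat_deriv: "(flat p has_real_derivative flat ([:0, 0, 1:] * (p - pderiv p)) t) (at t)"
proof -
  consider "t > 0" | "t < 0" | "t = 0" by linarith
  then show ?thesis
  proof cases
    case 1
    have "((\<lambda>t. poly p (1 / t) * exp (- (1 / t))) has_real_derivative flat ([:0, 0, 1:] * (p - pderiv p)) t) (at t)"
      using 1 unfolding flat_def
      by (auto intro!: derivative_eq_intros DERIV_chain2[OF poly_DERIV] simp: field_simps power2_eq_square)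
    then show ?thesis
      by (rule has_field_derivative_transform_within_open[of _ _ _ "{0<..}"]) (use 1 in \<open>auto simp: flat_def\<close>)
  next
    case 2
    have "((\<lambda>t. 0) has_real_derivative flat ([:0, 0, 1:] * (p - pderiv p)) t) (at t)"
      using 2 by (simp add: flat_def)
    then show ?thesis
      by (rule has_field_derivative_transform_within_open[of _ _ _ "{..<0}"]) (use 2 in \<open>auto simp: flat_def\<close>)
  next
    case 3
    have R: "((\<lambda>h. flat p h / h) \<longlongrightarrow> 0) (at_right 0)"
    proof -
      have "((\<lambda>h. poly (pCons 0 p) (inverse h) * exp (- (inverse h))) \<longlongrightarrow> 0) (at_right (0::real))"
        by (rule filterlim_compose[OF poly_times_exp_decay filterlim_inverse_at_top_right])
      then show ?thesis
        by (rule Lim_transform_eventually)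
           (auto simp: eventually_at_filter flat_def divide_inverse mult_ac intro!: always_eventually)
    qed
    have L: "((\<lambda>h. flat p h / h) \<longlongrightarrow> 0) (at_left 0)"
      by (rule Lim_transform_eventually[OF tendsto_const])
         (auto simp: eventually_at_filter flat_def intro!: always_eventually)
    have "((\<lambda>h. flat p h / h) \<longlongrightarrow> 0) (at 0)" using L R filterlim_split_at by blast
    then show ?thesis using 3 by (simp add: DERIV_def flat_def)
  qed
qed

lemma flat_1_bounds: "0 \<le> flat 1 t" "flat 1 t \<le> 1"
  by (auto simp: flat_def)

lemma smooth_flat_coordinate: "(\<lambda>x::real^'d::finite. complex_of_real (flat p (c * x $ j + e))) \<in> smooth"
proof (rule smooth_coinduct)
  let ?X = "{\<lambda>x::real^'d. complex_of_real (k * flat p (c * x $ j + e)) | k p. True}"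
  show "(\<lambda>x::real^'d. complex_of_real (flat p (c * x $ j + e))) \<in> ?X"
    by (intro CollectI exI[of _ 1] exI[of _ p]) simp
  fix u i assume "u \<in> ?X"
  then obtain k p where u: "u = (\<lambda>x. complex_of_real (k * flat p (c * x $ j + e)))" by blast
  let ?q = "[:0, 0, 1:] * (p - pderiv p)"
  have d: "(u has_derivative (\<lambda>v. complex_of_real (k * (c * v $ j * flat ?q (c * x $ j + e))))) (at x)" for x
    unfolding u
  proof (intro has_derivative_of_real has_derivative_mult_right)
    have "((\<lambda>x::real^'d. c * x $ j + e) has_derivative (\<lambda>v. c * v $ j)) (at x)"
      by (auto intro!: derivative_eq_intros bounded_linear.has_derivative[OF bounded_linear_vec_nth])
    from DERIV_compose_FDERIV[OF flat_deriv this]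
    show "((\<lambda>x. flat p (c * x $ j + e)) has_derivative (\<lambda>v. c * v $ j * flat ?q (c * x $ j + e))) (at x)" .
  qed
  then show "u differentiable (at x)" for x by (auto simp: differentiable_def)
  show "partial_deriv i u \<in> ?X" unfolding partial_deriv_eq[OF d]
    by (intro CollectI exI[of _ "k * (c * axis i 1 $ j)"] exI[of _ ?q]) (simp add: mult_ac)
qed

lemma smooth_compact_support_schwartz:
  fixes f :: "real^'d::finite \<Rightarrow> complex"
  assumes "f \<in> smooth" "\<And>x. x \<notin> cbox a b \<Longrightarrow> f x = 0"
  shows "f \<in> test_functions"
proof -
  have "f \<in> schwartz"
  proof (rule schwartz_coinduct)
    let ?X = "{f \<in> smooth. \<forall>x. x \<notin> cbox a b \<longrightarrow> f x = 0}"
    show "f \<in> ?X" using assms by blast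
    fix u j assume u: "u \<in> ?X"
    then show "u differentiable (at x)" for x by (simp add: smooth_differentiable)
    have "continuous_on UNIV u"
      using u by (intro continuous_at_imp_continuous_on ballI differentiable_imp_continuous_within smooth_differentiable) auto
    show "rapid u" unfolding rapid_def
    proof
      fix m
      have "compact ((\<lambda>x. norm x ^ m * cmod (u x)) ` cbox a b)"
        by (intro compact_continuous_image continuous_on_mult continuous_on_power continuous_on_norm
            continuous_on_id continuous_on_subset[OF \<open>continuous_on UNIV u\<close> subset_UNIV] compact_cbox)
      then obtain C where C: "\<And>x. x \<in> cbox a b \<Longrightarrow> \<bar>norm x ^ m * cmod (u x)\<bar> \<le> C"
        using compact_imp_bounded by (fastforce simp: bounded_real)
      have "norm x ^ m * cmod (u x) \<le> max C 0" for x
        using C[of x] u by (cases "x \<in> cbox a b") auto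
      then show "\<exists>C. \<forall>x. norm x ^ m * cmod (u x) \<le> C" by blast
    qed
    have "partial_deriv j u x = 0" if "x \<notin> cbox a b" for x
    proof -
      have "(u has_derivative (\<lambda>_. 0)) (at x)"
        by (rule has_derivative_transform_within_open[OF has_derivative_const[of 0], where s="- cbox a b"])
           (use that u in \<open>auto intro: open_Compl closed_cbox\<close>)
      then show ?thesis unfolding partial_deriv_def using frechet_derivative_at by metis
    qed
    then show "partial_deriv j u \<in> ?X" using u smooth_partial_deriv by auto
  qed
  moreover have "{x. f x \<noteq> 0} \<subseteq> cbox a b" using assms(2) by blast
  ultimately show ?thesis unfolding test_functions_def using bounded_cbox bounded_subset by blast
qed

text \<open>One factor for each face of the box. As \<open>n\<close> grows each factor tends to \<open>1\<close> in the interior of its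
  half-space, while the product keeps vanishing outside the open box. The factor is \<open>Suc n\<close> since \<open>n = 0\<close>
  would make every factor vanish identically.\<close>

definition bump :: "nat \<Rightarrow> real^'d \<Rightarrow> real^'d \<Rightarrow> real^'d::finite \<Rightarrow> complex" where
  "bump n a b x = (\<Prod>j\<in>UNIV. complex_of_real (flat 1 (real (Suc n) * x $ j + - (real (Suc n) * a $ j)))
      * complex_of_real (flat 1 (- real (Suc n) * x $ j + real (Suc n) * b $ j)))"

lemma bump_outside: "x \<notin> box a b \<Longrightarrow> bump n a b x = 0"
proof -
  assume "x \<notin> box a b"
  then obtain j where "x $ j \<le> a $ j \<or> b $ j \<le> x $ j" by (auto simp: mem_box_cart not_less)
  then have "real (Suc n) * x $ j + - (real (Suc n) * a $ j) \<le> 0 \<or> - real (Suc n) * x $ j + real (Suc n) * b $ j \<le> 0"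
    using mult_left_mono[of _ _ "real (Suc n)"] by (auto simp del: of_nat_Suc)
  then have "complex_of_real (flat 1 (real (Suc n) * x $ j + - (real (Suc n) * a $ j)))
      * complex_of_real (flat 1 (- real (Suc n) * x $ j + real (Suc n) * b $ j)) = 0"
    by (auto simp: flat_def simp del: of_nat_Suc)
  then show ?thesis unfolding bump_def by (intro prod_zero) auto
qed

lemma bump_test: "bump n a b \<in> test_functions"
proof (rule smooth_compact_support_schwartz)
  show "bump n a b \<in> smooth" unfolding bump_def by (intro smooth_prod smooth_mult smooth_flat_coordinate) auto
  show "bump n a b x = 0" if "x \<notin> cbox a b" for x
    using that bump_outside box_subset_cbox by blast
qed

lemma bump_bound: "cmod (bump n a b x) \<le> indicator (box a b) x"
proof (cases "x \<in> box a b")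
  case True
  have "cmod (bump n a b x) = (\<Prod>j\<in>UNIV. flat 1 (real (Suc n) * x $ j + - (real (Suc n) * a $ j)) * flat 1 (- real (Suc n) * x $ j + real (Suc n) * b $ j))"
    unfolding bump_def prod_norm[symmetric] norm_mult norm_of_real abs_of_nonneg[OF flat_1_bounds(1)] ..
  also have "\<dots> \<le> 1" by (intro prod_le_1 conjI mult_le_one mult_nonneg_nonneg flat_1_bounds)
  finally have "cmod (bump n a b x) \<le> 1" .
  then show ?thesis using True by simp
qed (simp add: bump_outside)

lemma flat_scaled_limit: "t > 0 \<Longrightarrow> (\<lambda>n. flat 1 (real (Suc n) * t)) \<longlonglongrightarrow> 1"
proof -
  assume t: "t > 0"
  have "(\<lambda>n. exp (- (inverse (real (Suc n)) * inverse t))) \<longlonglongrightarrow> exp (- (0 * inverse t))"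
    by (intro tendsto_intros LIMSEQ_inverse_real_of_nat)
  moreover have "flat 1 (real (Suc n) * t) = exp (- (inverse (real (Suc n)) * inverse t))" for n
    using t by (simp add: flat_def divide_inverse del: of_nat_Suc)
  ultimately show ?thesis by simp
qed

lemma bump_limit: "(\<lambda>n. bump n a b x) \<longlonglongrightarrow> indicator (box a b) x"
proof (cases "x \<in> box a b")
  case True
  have eq: "real (Suc n) * x $ j + - (real (Suc n) * a $ j) = real (Suc n) * (x $ j - a $ j)"
    "- real (Suc n) * x $ j + real (Suc n) * b $ j = real (Suc n) * (b $ j - x $ j)" for n j
    by (simp_all add: algebra_simps)
  have "(\<lambda>n. bump n a b x) \<longlonglongrightarrow> (\<Prod>j\<in>(UNIV::'a set). complex_of_real 1 * complex_of_real 1)"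
    unfolding bump_def eq
  proof (intro tendsto_prod tendsto_mult tendsto_of_real flat_scaled_limit)
    fix j show "x $ j - a $ j > 0" "b $ j - x $ j > 0" using True by (auto simp: mem_box_cart)
  qed
  then show ?thesis using True by simp
qed (simp add: bump_outside)

text \<open>The boxes form an intersection-stable generator of the Borel sets. Hence the integrals over all
  Borel subsets of a box vanish, and so does \<open>f\<close> almost everywhere on that box.\<close>

lemma AE_eq_zero_of_box_integrals:
  fixes f :: "'a::euclidean_space \<Rightarrow> complex"
  assumes int: "\<And>a b. set_integrable lborel (box a b) f"
    and zero: "\<And>a b. set_lebesgue_integral lborel (box a b) f = 0"
  shows "AE x in lborel. f x = 0"
proof -
  have main: "AE x in lborel. indicator (box a b) x *\<^sub>R f x = 0" for a b
  proof (rule sigma_finite_measure.density_zero[OF sigma_finite_lborel])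
    show i: "integrable lborel (\<lambda>x. indicator (box a b) x *\<^sub>R f x)" using int unfolding set_integrable_def .
    fix A :: "'a set" assume "A \<in> sets lborel"
    then have A: "A \<in> sigma_sets UNIV (range (\<lambda>(a, b). box a b))"
      unfolding sets_lborel borel_eq_box by (simp add: sets_measure_of)
    have "Int_stable (range (\<lambda>(a, b). box a b :: 'a set))"
      by (auto simp: Int_stable_def box_Int_box)
    from this subset_Pow_Union[of "range (\<lambda>(a, b). box a b :: 'a set)", THEN order_trans, OF Pow_mono, OF subset_UNIV] A
    show "set_lebesgue_integral lborel A (\<lambda>x. indicator (box a b) x *\<^sub>R f x) = 0"
    proof (induction rule: sigma_sets_induct_disjoint)
      case (basic A)
      then obtain c d where "A = box c d" by auto
      then have "A \<inter> box a b = box (\<Sum>i\<in>Basis. max (a \<bullet> i) (c \<bullet> i) *\<^sub>R i) (\<Sum>i\<in>Basis. min (b \<bullet> i) (d \<bullet> i) *\<^sub>R i)"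
        by (simp add: box_Int_box Int_commute)
      then obtain a' b' where "A \<inter> box a b = box a' b'" by blast
      then have "(\<lambda>x. indicator A x *\<^sub>R indicator (box a b) x *\<^sub>R f x) = (\<lambda>x. indicator (box a' b') x *\<^sub>R f x)"
        by (auto simp: fun_eq_iff indicator_def)
      then show ?case using zero[of a' b'] unfolding set_lebesgue_integral_def by simp
    next
      case empty
      then show ?case by (simp add: set_lebesgue_integral_def)
    next
      case (compl A)
      then have [measurable]: "A \<in> sets borel" unfolding borel_eq_box by (simp add: sets_measure_of)
      let ?g = "\<lambda>x. indicator (box a b) x *\<^sub>R f x"
      have "set_lebesgue_integral lborel (UNIV - A) ?g = (LINT x|lborel. ?g x - indicator A x *\<^sub>R ?g x)"
        unfolding set_lebesgue_integral_def by (intro Bochner_Integration.integral_cong) (auto simp: indicator_def)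
      also have "\<dots> = (LINT x|lborel. ?g x) - set_lebesgue_integral lborel A ?g"
        unfolding set_lebesgue_integral_def
        by (intro Bochner_Integration.integral_diff i integrable_mult_indicator) auto
      also have "\<dots> = 0" using compl zero unfolding set_lebesgue_integral_def by simp
      finally show ?case .
    next
      case (union A)
      then have [measurable]: "A i \<in> sets borel" for i unfolding borel_eq_box by (auto simp: sets_measure_of)
      let ?g = "\<lambda>x. indicator (box a b) x *\<^sub>R f x"
      have "set_integrable lborel (\<Union>i. A i) ?g" unfolding set_integrable_def
        by (intro integrable_mult_indicator i) auto
      then have "set_lebesgue_integral lborel (\<Union>i. A i) ?g = (\<Sum>i. set_lebesgue_integral lborel (A i) ?g)"
        using union(1) by (intro lebesgue_integral_countable_add) (auto simp: disjoint_family_on_def)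
      then show ?case using union by simp
    qed
  qed
  have "AE x in lborel. \<forall>n::nat. indicator (box (- (of_nat n *\<^sub>R One)) (of_nat n *\<^sub>R One)) x *\<^sub>R f x = 0"
    unfolding AE_all_countable using main by blast
  then show ?thesis
  proof (rule AE_mp, intro AE_I2 impI)
    fix x assume H: "\<forall>n::nat. indicator (box (- (of_nat n *\<^sub>R One)) (of_nat n *\<^sub>R One)) x *\<^sub>R f x = 0"
    obtain n where "x \<in> box (- (real n *\<^sub>R One)) (real n *\<^sub>R One)"
      using UN_box_eq_UNIV by blast
    with H[rule_format, of n] show "f x = 0" by simp
  qed
qed

lemma locally_L2_set_integrable:
  assumes "locally_L2 F"
  shows "set_integrable lborel (box a b) F"
proof -
  have [measurable]: "F \<in> borel_measurable borel" using assms by (simp add: locally_L2_def)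
  have "set_integrable lborel (cbox a b) (\<lambda>\<omega>. (cmod (F \<omega>))\<^sup>2)" using assms by (simp add: locally_L2_def)
  then have i: "integrable lborel (\<lambda>\<omega>. indicat_real (cbox a b) \<omega> * (cmod (F \<omega>))\<^sup>2)" by (simp add: set_integrable_def)
  have "integrable lborel (\<lambda>\<omega>. indicat_real (cbox a b) \<omega> + indicat_real (cbox a b) \<omega> * (cmod (F \<omega>))\<^sup>2)"
    by (intro Bochner_Integration.integrable_add i) (simp add: integrable_indicator_iff emeasure_lborel_cbox_eq)
  then show ?thesis unfolding set_integrable_def
  proof (rule Bochner_Integration.integrable_bound)
    have "cmod z \<le> 1 + (cmod z)\<^sup>2" for z
      using sum_squares_bound[of 1 "cmod z"] norm_ge_zero[of z] by (simp add: power2_eq_square) (smt (verit) norm_ge_zero)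
    then show "AE x in lborel. norm (indicat_real (box a b) x *\<^sub>R F x) \<le> norm (indicat_real (cbox a b) x + indicat_real (cbox a b) x * (cmod (F x))\<^sup>2)"
      using box_subset_cbox[of a b] by (intro AE_I2) (auto simp: indicator_def)
  qed measurable
qed

lemma represented_by_box_integral:
  assumes "represented_by T F"
  shows "(\<lambda>n. T (bump n a b)) \<longlonglongrightarrow> set_lebesgue_integral lborel (box a b) F"
proof -
  have L: "locally_L2 F" using assms by (simp add: represented_by_def)
  then have [measurable]: "F \<in> borel_measurable borel" by (simp add: locally_L2_def)
  have [measurable]: "bump n a b \<in> borel_measurable borel" for n
    using schwartz_measurable[OF test_functions_schwartz[OF bump_test]] .
  have "(\<lambda>n. LINT x|lborel. F x * bump n a b x) \<longlonglongrightarrow> (LINT x|lborel. F x * indicator (box a b) x)"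
  proof (rule integral_dominated_convergence)
    show "integrable lborel (\<lambda>x. norm (indicat_real (box a b) x *\<^sub>R F x))"
      using locally_L2_set_integrable[OF L, of a b] unfolding set_integrable_def by (rule integrable_norm)
    show "AE x in lborel. (\<lambda>n. F x * bump n a b x) \<longlonglongrightarrow> F x * indicator (box a b) x"
      by (intro AE_I2 tendsto_mult_left bump_limit)
    show "AE x in lborel. norm (F x * bump n a b x) \<le> norm (indicat_real (box a b) x *\<^sub>R F x)" for n
    proof (rule AE_I2)
      fix x
      show "norm (F x * bump n a b x) \<le> norm (indicat_real (box a b) x *\<^sub>R F x)"
        using mult_left_mono[OF bump_bound[of n a b x], of "cmod (F x)"] by (simp add: norm_mult mult.commute)
    qed
  qed measurable
  moreover have "T (bump n a b) = (LINT x|lborel. F x * bump n a b x)" for n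
    using assms bump_test unfolding represented_by_def by blast
  moreover have "(LINT x|lborel. F x * indicator (box a b) x) = set_lebesgue_integral lborel (box a b) F"
    unfolding set_lebesgue_integral_def by (intro Bochner_Integration.integral_cong) (auto simp: indicator_def)
  ultimately show ?thesis by simp
qed

text \<open>The values of \<open>T\<close> on the bump functions determine the integrals over boxes of any representing
  function. Consequently \<open>hat\<close>, which is an arbitrary choice of a representing function, can be computed
  almost everywhere from any other representing function.\<close>

lemma represented_by_unique:
  assumes F: "represented_by T F" and G: "represented_by T G"
  shows "AE x in lborel. F x = G x"
proof -
  have L: "locally_L2 F" "locally_L2 G" using assms by (auto simp: represented_by_def)
  have i: "set_integrable lborel (box a b) F" "set_integrable lborel (box a b) G" for a b
    using L locally_L2_set_integrable by blast+
  have "AE x in lborel. F x - G x = 0"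
  proof (rule AE_eq_zero_of_box_integrals)
    fix a b
    show "set_integrable lborel (box a b) (\<lambda>x. F x - G x)" by (intro set_integral_diff i)
    have "set_lebesgue_integral lborel (box a b) F = set_lebesgue_integral lborel (box a b) G"
      using LIMSEQ_unique[OF represented_by_box_integral[OF F] represented_by_box_integral[OF G]] .
    then show "set_lebesgue_integral lborel (box a b) (\<lambda>x. F x - G x) = 0" by (simp add: set_integral_diff i)
  qed
  then show ?thesis by simp
qed

section \<open>Weighted energies\<close>

text \<open>Positive quantities within a factor \<open>c\<close> of each other have \<open>p\<close>-th powers within a factor \<open>c\<^sup>|\<^sup>p\<^sup>|\<close>, for
  either sign of \<open>p\<close>. All comparisons of weights below reduce to this.\<close>

lemma powr_compare:
  fixes x y :: real
  assumes "x > 0" "y > 0" "x \<le> c * y" "y \<le> c * x" "c \<ge> 1"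
  shows "x powr p \<le> c powr \<bar>p\<bar> * y powr p"
proof (cases "p \<ge> 0")
  case True
  have "x powr p \<le> (c * y) powr p" using assms True by (intro powr_mono2) auto
  then show ?thesis using True assms by (simp add: powr_mult)
next
  case False
  have "(c * x) powr p \<le> y powr p" using assms False by (intro powr_mono2') auto
  then have "c powr p * x powr p \<le> y powr p" using assms by (simp add: powr_mult)
  then have "c powr (-p) * (c powr p * x powr p) \<le> c powr (-p) * y powr p" by (intro mult_left_mono) auto
  then show ?thesis using False assms by (simp add: mult.assoc[symmetric] powr_add[symmetric])
qed

lemma square_powr: "(y::real) > 0 \<Longrightarrow> y\<^sup>2 powr s = y powr (2 * s)"
  using powr_powr[of y 2 s] by simp

text \<open>Squared weighted norms as elements of \<open>[0,\<infinity>]\<close>, so that neither integrability nor finiteness needs to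
  be carried along.\<close>

definition energy :: "(real^'d::finite \<Rightarrow> real) \<Rightarrow> (real^'d \<Rightarrow> complex) \<Rightarrow> ennreal" where
  "energy w F = (\<integral>\<^sup>+\<omega>. ennreal (w \<omega> * (cmod (F \<omega>))\<^sup>2) \<partial>lborel)"

definition sobolev_weight :: "real \<Rightarrow> real^'d::finite \<Rightarrow> real" where
  "sobolev_weight s \<omega> = (1 + norm \<omega>) powr (2 * s)"

text \<open>The weight of the Gramians. For \<open>h > 0\<close> it is comparable with the Sobolev weight after the frequencies have
  been rescaled by \<open>h\<close>; for \<open>h = 0\<close> it is the weight of the stationary Gramians.\<close>

definition weight :: "real \<Rightarrow> real \<Rightarrow> real^'d::finite \<Rightarrow> real" where
  "weight h s \<omega> = ((norm \<omega>)\<^sup>2 + h\<^sup>2) powr s"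

lemma sobolev_weight_nonneg [simp]: "sobolev_weight s \<omega> \<ge> 0" unfolding sobolev_weight_def by simp
lemma weight_nonneg [simp]: "weight h s \<omega> \<ge> 0" unfolding weight_def by simp
lemma sobolev_weight_measurable [measurable]: "sobolev_weight s \<in> borel_measurable borel" unfolding sobolev_weight_def by measurable
lemma weight_measurable [measurable]: "weight h s \<in> borel_measurable borel" unfolding weight_def by measurable

lemma energy_cong_AE: "AE x in lborel. F x = G x \<Longrightarrow> energy w F = energy w G"
  unfolding energy_def by (rule nn_integral_cong_AE) auto

lemma cmod_add_square_le: "(cmod (a + b))\<^sup>2 \<le> 2 * (cmod a)\<^sup>2 + 2 * (cmod b)\<^sup>2"
proof -
  have "(cmod (a + b))\<^sup>2 \<le> (cmod a + cmod b)\<^sup>2" by (intro power_mono norm_triangle_ineq) auto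
  also have "\<dots> \<le> 2 * (cmod a)\<^sup>2 + 2 * (cmod b)\<^sup>2"
    using sum_squares_bound[of "cmod a" "cmod b"] by (simp add: power2_sum)
  finally show ?thesis .
qed

lemma energy_add_le:
  assumes [measurable]: "F \<in> borel_measurable borel" "G \<in> borel_measurable borel" "w \<in> borel_measurable borel"
    and w: "\<And>x. w x \<ge> 0"
  shows "energy w (\<lambda>x. F x + G x) \<le> 2 * energy w F + 2 * energy w G"
proof -
  have "energy w (\<lambda>x. F x + G x) \<le> (\<integral>\<^sup>+x. ennreal 2 * ennreal (w x * (cmod (F x))\<^sup>2) + ennreal 2 * ennreal (w x * (cmod (G x))\<^sup>2) \<partial>lborel)"
    unfolding energy_def
  proof (rule nn_integral_mono)
    fix x
    have "w x * (cmod (F x + G x))\<^sup>2 \<le> w x * (2 * (cmod (F x))\<^sup>2 + 2 * (cmod (G x))\<^sup>2)"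
      by (intro mult_left_mono cmod_add_square_le w)
    also have "\<dots> = 2 * (w x * (cmod (F x))\<^sup>2) + 2 * (w x * (cmod (G x))\<^sup>2)" by (simp add: algebra_simps)
    finally show "ennreal (w x * (cmod (F x + G x))\<^sup>2) \<le> ennreal 2 * ennreal (w x * (cmod (F x))\<^sup>2) + ennreal 2 * ennreal (w x * (cmod (G x))\<^sup>2)"
      using w by (simp add: ennreal_mult[symmetric] ennreal_plus[symmetric] ennreal_leI del: ennreal_plus ennreal_numeral)
  qed
  also have "\<dots> = 2 * energy w F + 2 * energy w G"
    unfolding energy_def by (subst nn_integral_add) (auto simp: nn_integral_cmult)
  finally show ?thesis .
qed

lemma energy_scale: 
  assumes [measurable]: "F \<in> borel_measurable borel" "w \<in> borel_measurable borel"
  shows "energy w (\<lambda>x. c * F x) = ennreal ((cmod c)\<^sup>2) * energy w F"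
proof -
  have "ennreal (w x * (cmod (c * F x))\<^sup>2) = ennreal ((cmod c)\<^sup>2) * ennreal (w x * (cmod (F x))\<^sup>2)" for x
    by (simp add: norm_mult power_mult_distrib ennreal_mult'[symmetric] mult_ac)
  then show ?thesis unfolding energy_def by (simp add: nn_integral_cmult)
qed

lemma energy_mono_weight:
  assumes [measurable]: "F \<in> borel_measurable borel" "w \<in> borel_measurable borel"
    and "\<And>x. w' x \<le> c * w x" "c \<ge> 0"
  shows "energy w' F \<le> ennreal c * energy w F"
proof -
  have "energy w' F \<le> (\<integral>\<^sup>+x. ennreal c * ennreal (w x * (cmod (F x))\<^sup>2) \<partial>lborel)"
    unfolding energy_def
    using assms mult_right_mono[OF assms(3)]
    by (intro nn_integral_mono) (simp add: ennreal_mult'[symmetric] mult.assoc[symmetric] ennreal_leI)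
  then show ?thesis unfolding energy_def by (simp add: nn_integral_cmult)
qed

lemma ennreal_scale_scale: "a \<ge> 0 \<Longrightarrow> b \<ge> 0 \<Longrightarrow> ennreal a * (ennreal b * E) = ennreal (b * a) * E"
  by (simp add: ennreal_mult mult_ac)

section \<open>Operations on distributions and their Fourier transforms\<close>

lemma locally_L2_measurable: "locally_L2 F \<Longrightarrow> F \<in> borel_measurable borel"
  by (simp add: locally_L2_def)

lemma represented_by_measurable: "represented_by T F \<Longrightarrow> F \<in> borel_measurable borel"
  by (simp add: represented_by_def locally_L2_def)

lemma test_function_bounded_support:
  assumes "\<phi> \<in> test_functions"
  obtains a b C where "\<And>x. cmod (\<phi> x) \<le> C * indicator (box a b) x" "C \<ge> 0"
proof -
  have s: "\<phi> \<in> schwartz" and b: "bounded {x. \<phi> x \<noteq> 0}" using assms by (auto simp: test_functions_def)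
  obtain a where a: "{x. \<phi> x \<noteq> 0} \<subseteq> box (-a) a" using bounded_subset_box_symmetric[OF b] by blast
  obtain C where C: "\<And>x. cmod (\<phi> x) \<le> C"
    using schwartz_rapid[OF s, unfolded rapid_def, THEN spec, of 0] by auto
  have "C \<ge> 0" using C[of 0] norm_ge_zero order_trans by blast
  moreover have "cmod (\<phi> x) \<le> C * indicator (box (- a) a) x" for x
    using a C[of x] by (cases "x \<in> box (- a) a") auto
  ultimately show ?thesis using that by blast
qed

lemma locally_L2_test_integrable:
  assumes F: "locally_L2 F" and p: "\<phi> \<in> test_functions"
  shows "integrable lborel (\<lambda>\<omega>. F \<omega> * \<phi> \<omega>)"
proof -
  obtain a b C where C: "\<And>x. cmod (\<phi> x) \<le> C * indicator (box a b) x" "C \<ge> 0"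
    using test_function_bounded_support[OF p] by metis
  have [measurable]: "F \<in> borel_measurable borel" "\<phi> \<in> borel_measurable borel"
    using locally_L2_measurable[OF F] schwartz_measurable[OF test_functions_schwartz[OF p]] by auto
  have "integrable lborel (\<lambda>x. C *\<^sub>R (indicat_real (box a b) x *\<^sub>R F x))"
    using locally_L2_set_integrable[OF F, of a b] unfolding set_integrable_def by (rule integrable_scaleR_right)
  then show ?thesis
  proof (rule Bochner_Integration.integrable_bound)
    show "AE x in lborel. norm (F x * \<phi> x) \<le> norm (C *\<^sub>R (indicat_real (box a b) x *\<^sub>R F x))"
    proof (rule AE_I2)
      fix x show "norm (F x * \<phi> x) \<le> norm (C *\<^sub>R (indicat_real (box a b) x *\<^sub>R F x))"
        using mult_left_mono[OF C(1)[of x], of "cmod (F x)"] C(2) by (simp add: norm_mult mult_ac)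
    qed
  qed measurable
qed

lemma locally_L2_add:
  assumes F: "locally_L2 F" and G: "locally_L2 G"
  shows "locally_L2 (\<lambda>x. F x + G x)"
proof -
  have [measurable]: "F \<in> borel_measurable borel" "G \<in> borel_measurable borel"
    using F G by (auto simp: locally_L2_def)
  have "set_integrable lborel K (\<lambda>\<omega>. (cmod (F \<omega> + G \<omega>))\<^sup>2)" if "compact K" for K
  proof -
    have [measurable]: "K \<in> sets borel" using that by (simp add: compact_imp_closed borel_closed)
    have "set_integrable lborel K (\<lambda>\<omega>. 2 * (cmod (F \<omega>))\<^sup>2 + 2 * (cmod (G \<omega>))\<^sup>2)"
      using F G that unfolding locally_L2_def by (intro set_integral_add set_integrable_mult_right) auto
    then show ?thesis unfolding set_integrable_def
    proof (rule Bochner_Integration.integrable_bound)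
      show "AE x in lborel. norm (indicat_real K x *\<^sub>R (cmod (F x + G x))\<^sup>2) \<le> norm (indicat_real K x *\<^sub>R (2 * (cmod (F x))\<^sup>2 + 2 * (cmod (G x))\<^sup>2))"
        using cmod_add_square_le by (intro AE_I2) (auto simp: indicator_def)
    qed measurable
  qed
  then show ?thesis unfolding locally_L2_def by auto
qed

lemma locally_L2_mult_bounded:
  assumes F: "locally_L2 F" and [measurable]: "m \<in> borel_measurable borel" and m: "\<And>x. cmod (m x) \<le> B"
  shows "locally_L2 (\<lambda>x. m x * F x)"
proof -
  have [measurable]: "F \<in> borel_measurable borel" using F by (auto simp: locally_L2_def)
  have "set_integrable lborel K (\<lambda>\<omega>. (cmod (m \<omega> * F \<omega>))\<^sup>2)" if "compact K" for K
  proof -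
    have [measurable]: "K \<in> sets borel" using that by (simp add: compact_imp_closed borel_closed)
    have "set_integrable lborel K (\<lambda>\<omega>. B\<^sup>2 * (cmod (F \<omega>))\<^sup>2)"
      using F that unfolding locally_L2_def by (intro set_integrable_mult_right) auto
    then show ?thesis unfolding set_integrable_def
    proof (rule Bochner_Integration.integrable_bound)
      have "(cmod (m x))\<^sup>2 \<le> B\<^sup>2" for x using m by (intro power_mono) auto
      then have "(cmod (m x))\<^sup>2 * (cmod (F x))\<^sup>2 \<le> B\<^sup>2 * (cmod (F x))\<^sup>2" for x by (intro mult_right_mono) auto
      then show "AE x in lborel. norm (indicat_real K x *\<^sub>R (cmod (m x * F x))\<^sup>2) \<le> norm (indicat_real K x *\<^sub>R (B\<^sup>2 * (cmod (F x))\<^sup>2))"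
        by (intro AE_I2) (auto simp: indicator_def norm_mult power_mult_distrib)
    qed measurable
  qed
  then show ?thesis unfolding locally_L2_def by auto
qed

lemma represented_by_fourier_add:
  assumes F: "represented_by (dist_fourier f) F" and G: "represented_by (dist_fourier g) G"
  shows "represented_by (dist_fourier (dist_add f g)) (\<lambda>\<omega>. F \<omega> + G \<omega>)"
  unfolding represented_by_def
proof (intro conjI ballI)
  show "locally_L2 (\<lambda>\<omega>. F \<omega> + G \<omega>)" using F G by (auto simp: represented_by_def intro: locally_L2_add)
  fix \<phi> :: "real^'a \<Rightarrow> complex" assume p: "\<phi> \<in> test_functions"
  have "dist_fourier (dist_add f g) \<phi> = dist_fourier f \<phi> + dist_fourier g \<phi>"
    by (simp add: dist_fourier_def dist_add_def)
  also have "\<dots> = (LINT \<omega>|lborel. F \<omega> * \<phi> \<omega> + G \<omega> * \<phi> \<omega>)"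
    using F G p locally_L2_test_integrable unfolding represented_by_def by (subst Bochner_Integration.integral_add) auto
  finally show "dist_fourier (dist_add f g) \<phi> = (LINT \<omega>|lborel. (F \<omega> + G \<omega>) * \<phi> \<omega>)" by (simp add: distrib_right)
qed

lemma represented_by_fourier_scale:
  assumes F: "represented_by (dist_fourier f) F"
  shows "represented_by (dist_fourier (dist_scale c f)) (\<lambda>\<omega>. c * F \<omega>)"
  unfolding represented_by_def
proof (intro conjI ballI)
  show "locally_L2 (\<lambda>\<omega>. c * F \<omega>)"
    using F by (intro locally_L2_mult_bounded[where B="cmod c"]) (auto simp: represented_by_def)
  fix \<phi> :: "real^'a \<Rightarrow> complex" assume p: "\<phi> \<in> test_functions"
  have "dist_fourier (dist_scale c f) \<phi> = c * dist_fourier f \<phi>"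
    by (simp add: dist_fourier_def dist_scale_def)
  also have "\<dots> = (LINT \<omega>|lborel. c * (F \<omega> * \<phi> \<omega>))"
    using F p unfolding represented_by_def by simp
  finally show "dist_fourier (dist_scale c f) \<phi> = (LINT \<omega>|lborel. c * F \<omega> * \<phi> \<omega>)" by (simp add: mult.assoc)
qed

lemma represented_by_fourier_zero: "represented_by (dist_fourier dist_zero) (\<lambda>\<omega>. 0)"
  by (auto simp: represented_by_def locally_L2_def dist_fourier_def dist_zero_def set_integrable_def)

lemma represented_by_fourier_translate:
  assumes F: "represented_by (dist_fourier f) F"
  shows "represented_by (dist_fourier (dist_translate a f)) (\<lambda>\<omega>. character a \<omega> * F \<omega>)"
  unfolding represented_by_def
proof (intro conjI ballI)
  show "locally_L2 (\<lambda>\<omega>. character a \<omega> * F \<omega>)"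
    using F by (intro locally_L2_mult_bounded[where B=1]) (auto simp: represented_by_def)
  fix \<phi> :: "real^'a \<Rightarrow> complex" assume p: "\<phi> \<in> test_functions"
  let ?\<psi> = "\<lambda>y. \<phi> y * character a y"
  have q: "?\<psi> \<in> test_functions" by (rule test_functions_modulate[OF p])
  have "(\<lambda>x. fourier \<phi> (x + a)) = fourier ?\<psi>"
    unfolding fourier_def character_add by (simp add: mult_ac)
  then have "dist_fourier (dist_translate a f) \<phi> = dist_fourier f ?\<psi>"
    using test_functions_schwartz[OF p] test_functions_schwartz[OF q]
    by (simp add: dist_fourier_def dist_translate_def)
  also have "\<dots> = (LINT \<omega>|lborel. F \<omega> * ?\<psi> \<omega>)" using F q unfolding represented_by_def by blast
  finally show "dist_fourier (dist_translate a f) \<phi> = (LINT \<omega>|lborel. character a \<omega> * F \<omega> * \<phi> \<omega>)"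
    by (simp add: mult_ac)
qed

lemma locally_L2_dilate:
  assumes F: "locally_L2 F" and h: "h > 0"
  shows "locally_L2 (\<lambda>x. F (h *\<^sub>R x))"
proof -
  have [measurable]: "F \<in> borel_measurable borel" using F by (auto simp: locally_L2_def)
  have "set_integrable lborel K (\<lambda>\<omega>. (cmod (F (h *\<^sub>R \<omega>)))\<^sup>2)" if "compact K" for K
  proof -
    let ?K = "(\<lambda>x. h *\<^sub>R x) ` K"
    have "compact ?K" using that by (rule compact_scaling)
    then have "set_integrable lborel ?K (\<lambda>\<omega>. (cmod (F \<omega>))\<^sup>2)" using F by (simp add: locally_L2_def)
    then have i: "integrable lborel (\<lambda>\<omega>. indicat_real ?K \<omega> *\<^sub>R (cmod (F \<omega>))\<^sup>2)" unfolding set_integrable_def .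
    have "integrable lborel (\<lambda>\<omega>. indicat_real ?K (0 + h *\<^sub>R \<omega>) *\<^sub>R (cmod (F (0 + h *\<^sub>R \<omega>)))\<^sup>2)"
      using integrable_lborel_affine[OF i, of h 0] h by simp
    moreover have "indicat_real ?K (0 + h *\<^sub>R \<omega>) = indicat_real K \<omega>" for \<omega>
      using h by (auto simp: indicator_def)
    ultimately show ?thesis unfolding set_integrable_def by simp
  qed
  then show ?thesis unfolding locally_L2_def by auto
qed

lemma represented_by_fourier_dilate:
  fixes f :: "'d::finite dist"
  assumes F: "represented_by (dist_fourier f) F" and h: "h > 0"
  shows "represented_by (dist_fourier (dist_dilate h f)) (\<lambda>\<omega>. complex_of_real (h ^ CARD('d)) * F (h *\<^sub>R \<omega>))"
  unfolding represented_by_def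
proof (intro conjI ballI)
  have L: "locally_L2 F" using F by (simp add: represented_by_def)
  show "locally_L2 (\<lambda>\<omega>. complex_of_real (h ^ CARD('d)) * F (h *\<^sub>R \<omega>))"
    by (intro locally_L2_mult_bounded[where B="h ^ CARD('d)"] locally_L2_dilate L h) (use h in \<open>auto simp: norm_power\<close>)
  fix \<phi> :: "real^'d \<Rightarrow> complex" assume p: "\<phi> \<in> test_functions"
  let ?\<psi> = "\<lambda>y. \<phi> (inverse h *\<^sub>R y)"
  have q: "?\<psi> \<in> test_functions" by (rule test_functions_scaled_argument[OF p]) (use h in simp)
  have "(\<lambda>x. complex_of_real (h ^ CARD('d)) * fourier \<phi> (h *\<^sub>R x)) = fourier ?\<psi>"
  proof
    fix x
    have "integrable lborel (\<lambda>y. ?\<psi> y * character x y)"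
      by (intro integrable_character schwartz_integrable test_functions_schwartz q)
    from integral_lborel_affine[OF this, of h 0] h
    show "complex_of_real (h ^ CARD('d)) * fourier \<phi> (h *\<^sub>R x) = fourier ?\<psi> x"
      unfolding fourier_def by (simp add: scaleR_conv_of_real[where 'a=complex])
  qed
  then have "dist_fourier (dist_dilate h f) \<phi> = dist_fourier f ?\<psi>"
    using test_functions_schwartz[OF p] test_functions_schwartz[OF q]
    by (simp add: dist_fourier_def dist_dilate_def)
  also have "\<dots> = (LINT \<omega>|lborel. F \<omega> * ?\<psi> \<omega>)" using F q unfolding represented_by_def by blast
  also have "\<dots> = complex_of_real (h ^ CARD('d)) * (LINT \<omega>|lborel. F (h *\<^sub>R \<omega>) * \<phi> \<omega>)"
    using integral_lborel_affine[OF locally_L2_test_integrable[OF L q], of h 0] h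
    by (simp add: scaleR_conv_of_real[where 'a=complex])
  finally show "dist_fourier (dist_dilate h f) \<phi> = (LINT \<omega>|lborel. complex_of_real (h ^ CARD('d)) * F (h *\<^sub>R \<omega>) * \<phi> \<omega>)"
    by (simp add: mult.assoc)
qed

lemma tempered_zero: "dist_zero \<in> tempered"
  unfolding tempered_iff dist_zero_def by (auto intro!: exI[of _ 0])

lemma tempered_additive: "T \<in> tempered \<Longrightarrow> f \<in> schwartz \<Longrightarrow> g \<in> schwartz \<Longrightarrow> T (\<lambda>x. f x + g x) = T f + T g"
  by (simp add: tempered_iff)

lemma tempered_homogeneous: "T \<in> tempered \<Longrightarrow> f \<in> schwartz \<Longrightarrow> T (\<lambda>x. c * f x) = c * T f"
  by (simp add: tempered_iff)

lemma tempered_add: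
  assumes "T \<in> tempered" "U \<in> tempered" shows "dist_add T U \<in> tempered"
proof -
  obtain C N where C: "C \<ge> 0" "\<And>f. f \<in> schwartz \<Longrightarrow> cmod (T f) \<le> C * schwartz_norm N f"
    using tempered_bound[OF assms(1)] by metis
  obtain D M where D: "D \<ge> 0" "\<And>f. f \<in> schwartz \<Longrightarrow> cmod (U f) \<le> D * schwartz_norm M f"
    using tempered_bound[OF assms(2)] by metis
  have "cmod (T f + U f) \<le> (C + D) * schwartz_norm (max M N) f" if f: "f \<in> schwartz" for f
  proof -
    have "cmod (T f + U f) \<le> C * schwartz_norm N f + D * schwartz_norm M f"
      using C(2)[OF f] D(2)[OF f] norm_triangle_ineq[of "T f" "U f"] by linarith
    also have "\<dots> \<le> C * schwartz_norm (max M N) f + D * schwartz_norm (max M N) f"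
      by (intro add_mono mult_left_mono schwartz_norm_mono f C D) auto
    finally show ?thesis by (simp add: distrib_right)
  qed
  then have "\<exists>C N. \<forall>\<phi>\<in>schwartz. cmod (dist_add T U \<phi>) \<le> C * schwartz_norm N \<phi>"
    unfolding dist_add_def by blast
  then show ?thesis using assms unfolding tempered_iff by (auto simp: dist_add_def algebra_simps)
qed

lemma tempered_scale:
  assumes "T \<in> tempered" shows "dist_scale c T \<in> tempered"
proof -
  obtain C N where C: "C \<ge> 0" "\<And>f. f \<in> schwartz \<Longrightarrow> cmod (T f) \<le> C * schwartz_norm N f"
    using tempered_bound[OF assms(1)] by metis
  have "cmod (c * T f) \<le> (cmod c * C) * schwartz_norm N f" if f: "f \<in> schwartz" for f
    using mult_left_mono[OF C(2)[OF f], of "cmod c"] by (simp add: norm_mult mult.assoc)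
  then have "\<exists>C N. \<forall>\<phi>\<in>schwartz. cmod (dist_scale c T \<phi>) \<le> C * schwartz_norm N \<phi>"
    unfolding dist_scale_def by blast
  then show ?thesis using assms unfolding tempered_iff by (auto simp: dist_scale_def algebra_simps)
qed

lemma tempered_affine:
  fixes T :: "'d::finite dist"
  assumes T: "T \<in> tempered" and h: "h > 0" and c: "c \<noteq> 0"
  shows "(\<lambda>\<phi>. T (\<lambda>x. c * \<phi> (h *\<^sub>R x + a))) \<in> tempered"
proof -
  obtain C N where C: "C \<ge> 0" "\<And>f. f \<in> schwartz \<Longrightarrow> cmod (T f) \<le> C * schwartz_norm N f"
    using tempered_bound[OF T] by metis
  obtain D where D: "D \<ge> 0" "\<And>f. f \<in> schwartz \<Longrightarrow> schwartz_norm N (\<lambda>x. c * f (h *\<^sub>R x + a)) \<le> D * schwartz_norm N f"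
    using schwartz_norm_affine[OF h] by metis
  have A: "(\<lambda>x. c * f (h *\<^sub>R x + a)) \<in> schwartz" if "f \<in> schwartz" for f using that h by (rule schwartz_affine)
  show ?thesis unfolding tempered_iff
  proof (intro conjI ballI allI impI)
    fix \<phi> :: "real^'d \<Rightarrow> complex" assume n: "\<phi> \<notin> schwartz"
    have "(\<lambda>x. c * \<phi> (h *\<^sub>R x + a)) \<notin> schwartz"
    proof
      assume "(\<lambda>x. c * \<phi> (h *\<^sub>R x + a)) \<in> schwartz"
      from schwartz_affine[OF this, of "inverse h" "inverse c" "- (inverse h *\<^sub>R a)"] h c
      have "\<phi> \<in> schwartz" by (simp add: scaleR_diff_right mult.assoc[symmetric])
      with n show False by simp
    qed
    then show "T (\<lambda>x. c * \<phi> (h *\<^sub>R x + a)) = 0" using T by (simp add: tempered_iff)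
  next
    fix \<phi> \<psi> :: "real^'d \<Rightarrow> complex" assume "\<phi> \<in> schwartz" "\<psi> \<in> schwartz"
    then show "T (\<lambda>x. c * (\<phi> (h *\<^sub>R x + a) + \<psi> (h *\<^sub>R x + a))) = T (\<lambda>x. c * \<phi> (h *\<^sub>R x + a)) + T (\<lambda>x. c * \<psi> (h *\<^sub>R x + a))"
      unfolding distrib_left by (intro tempered_additive[OF T] A)
  next
    fix e and \<phi> :: "real^'d \<Rightarrow> complex" assume "\<phi> \<in> schwartz"
    then show "T (\<lambda>x. c * (e * \<phi> (h *\<^sub>R x + a))) = e * T (\<lambda>x. c * \<phi> (h *\<^sub>R x + a))"
      unfolding mult.left_commute[of c e] by (intro tempered_homogeneous[OF T] A)
  next
    have "cmod (T (\<lambda>x. c * f (h *\<^sub>R x + a))) \<le> (C * D) * schwartz_norm N f" if f: "f \<in> schwartz" for f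
      using order_trans[OF C(2)[OF A[OF f]] mult_left_mono[OF D(2)[OF f] C(1)]] by (simp add: mult.assoc)
    then show "\<exists>C N. \<forall>\<phi>\<in>schwartz. cmod (T (\<lambda>x. c * \<phi> (h *\<^sub>R x + a))) \<le> C * schwartz_norm N \<phi>" by blast
  qed
qed

lemma tempered_translate: "T \<in> tempered \<Longrightarrow> dist_translate a T \<in> tempered"
  using tempered_affine[of T 1 1 a] by (simp add: dist_translate_def)

lemma tempered_dilate: "T \<in> tempered \<Longrightarrow> h > 0 \<Longrightarrow> dist_dilate h T \<in> tempered"
  for T :: "'d::finite dist"
  using tempered_affine[of T h "complex_of_real (h ^ CARD('d))" 0] by (simp add: dist_dilate_def)

section \<open>The spaces W in the frequency domain\<close>

lemma hat_represents: "represented_by (dist_fourier f) F \<Longrightarrow> represented_by (dist_fourier f) (hat f)"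
  unfolding hat_def by (rule someI[where P="represented_by (dist_fourier f)"])

lemma hat_AE: "represented_by (dist_fourier f) F \<Longrightarrow> AE x in lborel. hat f x = F x"
  by (rule represented_by_unique[OF hat_represents])

lemma integrable_iff_energy:
  assumes [measurable]: "F \<in> borel_measurable borel" "w \<in> borel_measurable borel" and w: "\<And>x. w x \<ge> 0"
  shows "integrable lborel (\<lambda>\<omega>. w \<omega> * (cmod (F \<omega>))\<^sup>2) \<longleftrightarrow> energy w F < \<infinity>"
  unfolding integrable_iff_bounded energy_def using w by simp

lemma W_iff: "f \<in> W s \<longleftrightarrow> f \<in> tempered \<and> represented_by (dist_fourier f) (hat f) \<and> energy (sobolev_weight s) (hat f) < \<infinity>"
proof -
  have "(\<exists>F. represented_by (dist_fourier f) F) \<longleftrightarrow> represented_by (dist_fourier f) (hat f)"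
    using hat_represents by blast
  moreover have "represented_by (dist_fourier f) (hat f) \<Longrightarrow> integrable lborel (\<lambda>\<omega>. sobolev_weight s \<omega> * (cmod (hat f \<omega>))\<^sup>2) \<longleftrightarrow> energy (sobolev_weight s) (hat f) < \<infinity>"
    by (intro integrable_iff_energy represented_by_measurable) auto
  ultimately show ?thesis unfolding W_def sobolev_weight_def by auto
qed

lemma W_tempered: "f \<in> W s \<Longrightarrow> f \<in> tempered" by (simp add: W_iff)
lemma W_represented: "f \<in> W s \<Longrightarrow> represented_by (dist_fourier f) (hat f)" by (simp add: W_iff)
lemma W_energy: "f \<in> W s \<Longrightarrow> energy (sobolev_weight s) (hat f) < \<infinity>" by (simp add: W_iff)
lemma hat_measurable: "f \<in> W s \<Longrightarrow> hat f \<in> borel_measurable borel"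
  by (rule represented_by_measurable[OF W_represented])

lemma W_I:
  assumes "f \<in> tempered" "represented_by (dist_fourier f) F" "energy (sobolev_weight s) F < \<infinity>"
  shows "f \<in> W s"
  using assms hat_represents[OF assms(2)] energy_cong_AE[OF hat_AE[OF assms(2)], of "sobolev_weight s"] by (simp add: W_iff)

lemma W_norm_energy: "f \<in> W s \<Longrightarrow> ennreal ((W_norm s f)\<^sup>2) = energy (sobolev_weight s) (hat f)"
proof -
  assume f: "f \<in> W s"
  have i: "integrable lborel (\<lambda>\<omega>. sobolev_weight s \<omega> * (cmod (hat f \<omega>))\<^sup>2)"
    using integrable_iff_energy[of "hat f" "sobolev_weight s"] W_energy[OF f] hat_measurable[OF f] by simp
  have "0 \<le> (LINT \<omega>|lborel. sobolev_weight s \<omega> * (cmod (hat f \<omega>))\<^sup>2)" by (intro integral_nonneg_AE) auto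
  then have "(W_norm s f)\<^sup>2 = (LINT \<omega>|lborel. sobolev_weight s \<omega> * (cmod (hat f \<omega>))\<^sup>2)"
    unfolding W_norm_def sobolev_weight_def by simp
  then show ?thesis unfolding energy_def using nn_integral_eq_integral[OF i] by simp
qed

lemma W_norm_nonneg: "W_norm s f \<ge> 0"
  unfolding W_norm_def by (intro real_sqrt_ge_zero integral_nonneg_AE) auto

lemma W_zero: "dist_zero \<in> W s"
  by (rule W_I[OF tempered_zero represented_by_fourier_zero]) (simp add: energy_def)

lemma
  assumes f: "f \<in> W s" and g: "g \<in> W s"
  shows W_add: "dist_add f g \<in> W s"
    and hat_add: "AE x in lborel. hat (dist_add f g) x = hat f x + hat g x"
proof -
  note r = represented_by_fourier_add[OF W_represented[OF f] W_represented[OF g]]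
  have "energy (sobolev_weight s) (\<lambda>x. hat f x + hat g x) \<le> 2 * energy (sobolev_weight s) (hat f) + 2 * energy (sobolev_weight s) (hat g)"
    by (intro energy_add_le hat_measurable[OF f] hat_measurable[OF g]) auto
  also have "\<dots> < \<infinity>" using W_energy[OF f] W_energy[OF g] by (simp add: ennreal_mult_less_top)
  finally show "dist_add f g \<in> W s" by (rule W_I[OF tempered_add[OF W_tempered[OF f] W_tempered[OF g]] r])
  show "AE x in lborel. hat (dist_add f g) x = hat f x + hat g x" by (rule hat_AE[OF r])
qed

lemma
  assumes f: "f \<in> W s"
  shows W_scale: "dist_scale c f \<in> W s"
    and hat_scale: "AE x in lborel. hat (dist_scale c f) x = c * hat f x"
proof -
  note r = represented_by_fourier_scale[OF W_represented[OF f], of c]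
  have "energy (sobolev_weight s) (\<lambda>x. c * hat f x) < \<infinity>" using W_energy[OF f]
    by (simp add: energy_scale hat_measurable[OF f] ennreal_mult_less_top)
  then show "dist_scale c f \<in> W s" by (rule W_I[OF tempered_scale[OF W_tempered[OF f]] r])
  show "AE x in lborel. hat (dist_scale c f) x = c * hat f x" by (rule hat_AE[OF r])
qed

lemma dist_diff_eq: "dist_diff f g = dist_add f (dist_scale (- 1) g)"
  by (simp add: dist_diff_def dist_add_def dist_scale_def)

lemma
  assumes f: "f \<in> W s" and g: "g \<in> W s"
  shows W_diff: "dist_diff f g \<in> W s"
    and hat_diff: "AE x in lborel. hat (dist_diff f g) x = hat f x - hat g x"
  using W_add[OF f W_scale[OF g]] hat_add[OF f W_scale[OF g, of "- 1"]] hat_scale[OF g, of "- 1"]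
  by (auto simp: dist_diff_eq)

lemma
  assumes f: "f \<in> W s"
  shows W_translate: "dist_translate a f \<in> W s"
    and hat_translate: "AE x in lborel. hat (dist_translate a f) x = character a x * hat f x"
proof -
  note r = represented_by_fourier_translate[OF W_represented[OF f], of a]
  have "energy (sobolev_weight s) (\<lambda>x. character a x * hat f x) = energy (sobolev_weight s) (hat f)"
    by (simp add: energy_def norm_mult)
  then show "dist_translate a f \<in> W s"
    using W_energy[OF f] by (intro W_I[OF tempered_translate[OF W_tempered[OF f]] r]) simp
  show "AE x in lborel. hat (dist_translate a f) x = character a x * hat f x" by (rule hat_AE[OF r])
qed

lemma W_subset: 
  assumes "s \<le> k" shows "W k \<subseteq> W s"
proof
  fix f :: "'d::finite dist" assume f: "f \<in> W k"
  have "energy (sobolev_weight s) (hat f) \<le> ennreal 1 * energy (sobolev_weight k) (hat f)"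
    using assms by (intro energy_mono_weight hat_measurable[OF f]) (auto simp: sobolev_weight_def intro!: powr_mono)
  also have "\<dots> < \<infinity>" using W_energy[OF f] by simp
  finally show "f \<in> W s" by (rule W_I[OF W_tempered[OF f] W_represented[OF f]])
qed

text \<open>Since \<open>1 + |x / h| = (h + |x|) / h\<close>, this is the comparison of \<open>(h + |x|)\<^sup>2\<close> with \<open>|x|\<^sup>2 + h\<^sup>2\<close>. Apart from
  an explicit power of \<open>h\<close> the constants do not depend on \<open>h\<close>, which is essential for a statement that is
  uniform in \<open>h\<close>.\<close>

lemma sobolev_weight_weight_compare:
  assumes h: "h > 0"
  shows "sobolev_weight s (inverse h *\<^sub>R x) \<le> 2 powr \<bar>s\<bar> * h powr (- 2 * s) * weight h s x"
    and "weight h s x \<le> 2 powr \<bar>s\<bar> * h powr (2 * s) * sobolev_weight s (inverse h *\<^sub>R x)"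
proof -
  have hx: "h + norm x > 0" using h by (simp add: add_pos_nonneg)
  have "1 + norm (inverse h *\<^sub>R x) = (h + norm x) / h" using h by (simp add: field_simps)
  then have eq: "sobolev_weight s (inverse h *\<^sub>R x) = h powr (- 2 * s) * (h + norm x)\<^sup>2 powr s"
    unfolding sobolev_weight_def square_powr[OF hx] using h hx by (simp add: powr_divide powr_minus_divide)
  have 1: "(h + norm x)\<^sup>2 \<le> 2 * ((norm x)\<^sup>2 + h\<^sup>2)" using sum_squares_bound[of h "norm x"] by (simp add: power2_sum)
  have 2: "(norm x)\<^sup>2 + h\<^sup>2 \<le> 2 * (h + norm x)\<^sup>2" using h by (simp add: power2_sum)
  have p: "(norm x)\<^sup>2 + h\<^sup>2 > 0" using h by (simp add: add_nonneg_pos)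
  have "(h + norm x)\<^sup>2 powr s \<le> 2 powr \<bar>s\<bar> * weight h s x" unfolding weight_def
    using hx p 1 2 by (intro powr_compare) auto
  then have "h powr (- 2 * s) * (h + norm x)\<^sup>2 powr s \<le> h powr (- 2 * s) * (2 powr \<bar>s\<bar> * weight h s x)" by (intro mult_left_mono) auto
  then show "sobolev_weight s (inverse h *\<^sub>R x) \<le> 2 powr \<bar>s\<bar> * h powr (- 2 * s) * weight h s x"
    unfolding eq by (simp add: mult_ac)
  have "weight h s x \<le> 2 powr \<bar>s\<bar> * (h + norm x)\<^sup>2 powr s" unfolding weight_def
    using hx p 1 2 by (intro powr_compare) auto
  also have "(h + norm x)\<^sup>2 powr s = h powr (2 * s) * sobolev_weight s (inverse h *\<^sub>R x)"
    unfolding eq using h by (simp add: mult.assoc[symmetric] powr_add[symmetric])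
  finally show "weight h s x \<le> 2 powr \<bar>s\<bar> * h powr (2 * s) * sobolev_weight s (inverse h *\<^sub>R x)" by (simp add: mult_ac)
qed

lemma energy_sobolev_weight_rescaled:
  fixes G :: "real^'d::finite \<Rightarrow> complex"
  assumes h: "h > 0" and [measurable]: "G \<in> borel_measurable borel"
  shows "energy (sobolev_weight s) G = ennreal (inverse h ^ CARD('d)) * energy (\<lambda>x. sobolev_weight s (inverse h *\<^sub>R x)) (\<lambda>x. G (inverse h *\<^sub>R x))"
  unfolding energy_def using h by (subst nn_integral_lborel_affine[of _ "inverse h" 0]) auto

lemma energy_sobolev_weight_weight:
  fixes G :: "real^'d::finite \<Rightarrow> complex"
  assumes h: "h > 0" and [measurable]: "G \<in> borel_measurable borel"
  shows "energy (sobolev_weight s) G \<le> ennreal (2 powr \<bar>s\<bar> * h powr (- 2 * s) / h ^ CARD('d)) * energy (weight h s) (\<lambda>x. G (inverse h *\<^sub>R x))"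
    and "energy (weight h s) (\<lambda>x. G (inverse h *\<^sub>R x)) \<le> ennreal (2 powr \<bar>s\<bar> * h powr (2 * s) * h ^ CARD('d)) * energy (sobolev_weight s) G"
proof -
  let ?G = "\<lambda>x. G (inverse h *\<^sub>R x)"
  have "energy (sobolev_weight s) G \<le> ennreal (inverse h ^ CARD('d)) * (ennreal (2 powr \<bar>s\<bar> * h powr (- 2 * s)) * energy (weight h s) ?G)"
    unfolding energy_sobolev_weight_rescaled[OF assms]
    by (intro mult_left_mono energy_mono_weight sobolev_weight_weight_compare h) auto
  then show "energy (sobolev_weight s) G \<le> ennreal (2 powr \<bar>s\<bar> * h powr (- 2 * s) / h ^ CARD('d)) * energy (weight h s) ?G"
    using h by (simp add: ennreal_scale_scale power_inverse divide_inverse)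
  have "energy (weight h s) ?G \<le> ennreal (2 powr \<bar>s\<bar> * h powr (2 * s)) * energy (\<lambda>x. sobolev_weight s (inverse h *\<^sub>R x)) ?G"
    by (intro energy_mono_weight sobolev_weight_weight_compare h) auto
  also have "energy (\<lambda>x. sobolev_weight s (inverse h *\<^sub>R x)) ?G = ennreal (h ^ CARD('d)) * energy (sobolev_weight s) G"
    unfolding energy_sobolev_weight_rescaled[OF assms] using h
    by (simp add: ennreal_scale_scale power_mult_distrib[symmetric])
  finally show "energy (weight h s) ?G \<le> ennreal (2 powr \<bar>s\<bar> * h powr (2 * s) * h ^ CARD('d)) * energy (sobolev_weight s) G"
    using h by (simp add: ennreal_mult mult_ac)
qed

text \<open>For a fixed \<open>h\<close> the two weights define the same topology. The constant depends on \<open>h\<close>; this comparison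
  serves closures and finiteness, but not the estimates of the order.\<close>

lemma weight_sobolev_weight_compare:
  assumes h: "h > 0"
  obtains c where "c > 0" "\<And>x::real^'d::finite. weight h s x \<le> c * sobolev_weight s x" "\<And>x::real^'d. sobolev_weight s x \<le> c * weight h s x"
proof -
  define c where "c = 2 * max (h\<^sup>2) (max 1 (inverse (h\<^sup>2)))"
  have c: "c \<ge> 1" unfolding c_def by linarith
  have 1: "(norm x)\<^sup>2 + h\<^sup>2 \<le> c * (1 + norm x)\<^sup>2" for x :: "real^'d"
  proof -
    have "(norm x)\<^sup>2 \<le> max (h\<^sup>2) (max 1 (inverse (h\<^sup>2))) * (1 + norm x)\<^sup>2"
      using mult_mono[of 1 "max (h\<^sup>2) (max 1 (inverse (h\<^sup>2)))" "(norm x)\<^sup>2" "(1 + norm x)\<^sup>2"] by (auto intro: power_mono)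
    moreover have "h\<^sup>2 \<le> max (h\<^sup>2) (max 1 (inverse (h\<^sup>2))) * (1 + norm x)\<^sup>2"
      using mult_mono[of "h\<^sup>2" "max (h\<^sup>2) (max 1 (inverse (h\<^sup>2)))" 1 "(1 + norm x)\<^sup>2"] by (simp add: one_le_power)
    ultimately show ?thesis unfolding c_def by linarith
  qed
  have 2: "(1 + norm x)\<^sup>2 \<le> c * ((norm x)\<^sup>2 + h\<^sup>2)" for x :: "real^'d"
  proof -
    have "(norm x)\<^sup>2 \<le> max (h\<^sup>2) (max 1 (inverse (h\<^sup>2))) * (norm x)\<^sup>2"
      using mult_right_mono[of 1 "max (h\<^sup>2) (max 1 (inverse (h\<^sup>2)))" "(norm x)\<^sup>2"] by simp
    moreover have "1 \<le> max (h\<^sup>2) (max 1 (inverse (h\<^sup>2))) * h\<^sup>2"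
      using mult_right_mono[of "inverse (h\<^sup>2)" "max (h\<^sup>2) (max 1 (inverse (h\<^sup>2)))" "h\<^sup>2"] h by simp
    moreover have "(1 + norm x)\<^sup>2 \<le> 2 * (1 + (norm x)\<^sup>2)" using sum_squares_bound[of 1 "norm x"] by (simp add: power2_sum)
    ultimately show ?thesis unfolding c_def by (simp add: distrib_left)
  qed
  have p: "(norm x)\<^sup>2 + h\<^sup>2 > 0" "(1 + norm x)\<^sup>2 > 0" for x :: "real^'d"
    using h by (auto simp: add_nonneg_pos add_pos_nonneg add_nonneg_eq_0_iff)
  have eq: "sobolev_weight s x = (1 + norm x)\<^sup>2 powr s" for x :: "real^'d"
    unfolding sobolev_weight_def by (subst square_powr) (simp_all add: add_pos_nonneg)
  show ?thesis
  proof (rule that[of "c powr \<bar>s\<bar>"])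
    show "weight h s x \<le> c powr \<bar>s\<bar> * sobolev_weight s x" "sobolev_weight s x \<le> c powr \<bar>s\<bar> * weight h s x" for x :: "real^'d"
      unfolding eq unfolding weight_def using 1 2 c p by (auto intro!: powr_compare)
  qed (use c in simp)
qed

lemma
  fixes f :: "'d::finite dist"
  assumes f: "f \<in> W s" and h: "h > 0"
  shows W_dilate: "dist_dilate h f \<in> W s"
    and hat_dilate: "AE x in lborel. hat (dist_dilate h f) x = complex_of_real (h ^ CARD('d)) * hat f (h *\<^sub>R x)"
proof -
  note r = represented_by_fourier_dilate[OF W_represented[OF f] h]
  have [measurable]: "hat f \<in> borel_measurable borel" by (rule hat_measurable[OF f])
  obtain c where c: "c > 0" "\<And>x::real^'d. weight h s x \<le> c * sobolev_weight s x" using weight_sobolev_weight_compare[OF h] by metis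
  let ?G = "\<lambda>x. complex_of_real (h ^ CARD('d)) * hat f (h *\<^sub>R x)"
  have "energy (weight h s) (\<lambda>x. ?G (inverse h *\<^sub>R x)) = ennreal ((cmod (complex_of_real (h ^ CARD('d))))\<^sup>2) * energy (weight h s) (hat f)"
    using h by (subst energy_scale[symmetric]) auto
  also have "\<dots> < \<infinity>"
    using energy_mono_weight[of "hat f" "sobolev_weight s" "weight h s" c] c W_energy[OF f]
    by (auto simp: ennreal_mult_less_top intro: le_less_trans)
  finally have "energy (sobolev_weight s) ?G < \<infinity>"
    using energy_sobolev_weight_weight(1)[OF h, of ?G s] by (auto simp: ennreal_mult_less_top intro: le_less_trans)
  then show "dist_dilate h f \<in> W s" by (rule W_I[OF tempered_dilate[OF W_tempered[OF f] h] r])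
  show "AE x in lborel. hat (dist_dilate h f) x = complex_of_real (h ^ CARD('d)) * hat f (h *\<^sub>R x)" by (rule hat_AE[OF r])
qed

lemma W_norm_less_iff:
  assumes f: "f \<in> W s" and e: "e > 0"
  shows "W_norm s f < e \<longleftrightarrow> energy (sobolev_weight s) (hat f) < ennreal (e\<^sup>2)"
proof -
  have "W_norm s f < e \<longleftrightarrow> (W_norm s f)\<^sup>2 < e\<^sup>2"
    using W_norm_nonneg[of s f] e by (meson less_imp_le power2_less_imp_less power_strict_mono zero_less_numeral)
  also have "\<dots> \<longleftrightarrow> energy (sobolev_weight s) (hat f) < ennreal (e\<^sup>2)"
    unfolding W_norm_energy[OF f, symmetric] by (simp add: ennreal_less_iff)
  finally show ?thesis .
qed

lemma energy_diff:
  assumes "f \<in> W s" "g \<in> W s"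
  shows "energy w (hat (dist_diff f g)) = energy w (\<lambda>x. hat f x - hat g x)"
  by (rule energy_cong_AE[OF hat_diff[OF assms]])

section \<open>Closed shift-invariant subspaces and their dilates\<close>

text \<open>Closedness in terms of energies of Fourier transforms instead of norms of distributions.\<close>

lemma closed_W_subspaceI:
  assumes "V \<subseteq> W s" "dist_zero \<in> V" "\<And>f g. f \<in> V \<Longrightarrow> g \<in> V \<Longrightarrow> dist_add f g \<in> V"
    "\<And>c f. f \<in> V \<Longrightarrow> dist_scale c f \<in> V"
    and cl: "\<And>f. f \<in> W s \<Longrightarrow> (\<And>e. e > 0 \<Longrightarrow> \<exists>g\<in>V. energy (sobolev_weight s) (\<lambda>x. hat f x - hat g x) < ennreal e) \<Longrightarrow> f \<in> V"
  shows "closed_W_subspace s V"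
  unfolding closed_W_subspace_def
proof (intro conjI ballI allI impI)
  fix f assume f: "f \<in> W s" and ap: "\<forall>e>0. \<exists>g\<in>V. W_norm s (dist_diff f g) < e"
  show "f \<in> V"
  proof (rule cl[OF f])
    fix e :: real assume e: "e > 0"
    then obtain g where g: "g \<in> V" "W_norm s (dist_diff f g) < sqrt e" using ap real_sqrt_gt_zero by blast
    have gW: "g \<in> W s" using g assms(1) by blast
    show "\<exists>g\<in>V. energy (sobolev_weight s) (\<lambda>x. hat f x - hat g x) < ennreal e"
      using g W_norm_less_iff[OF W_diff[OF f gW], of "sqrt e"] e unfolding energy_diff[OF f gW] by auto
  qed
qed (use assms in auto)

lemma closed_W_subspaceD:
  assumes V: "closed_W_subspace s V" and f: "f \<in> W s"
    and ap: "\<And>e. e > 0 \<Longrightarrow> \<exists>g\<in>V. energy (sobolev_weight s) (\<lambda>x. hat f x - hat g x) < ennreal e"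
  shows "f \<in> V"
proof -
  have "\<exists>g\<in>V. W_norm s (dist_diff f g) < e" if e: "e > 0" for e
  proof -
    obtain g where g: "g \<in> V" "energy (sobolev_weight s) (\<lambda>x. hat f x - hat g x) < ennreal (e\<^sup>2)" using ap[of "e\<^sup>2"] e by auto
    then have gW: "g \<in> W s" using V by (auto simp: closed_W_subspace_def)
    show ?thesis using g W_norm_less_iff[OF W_diff[OF f gW] e] unfolding energy_diff[OF f gW] by auto
  qed
  then show ?thesis using V f unfolding closed_W_subspace_def by blast
qed

lemma closed_W_subspace_subset: "closed_W_subspace s V \<Longrightarrow> V \<subseteq> W s" by (simp add: closed_W_subspace_def)
lemma closed_W_subspace_zero: "closed_W_subspace s V \<Longrightarrow> dist_zero \<in> V" by (simp add: closed_W_subspace_def)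
lemma closed_W_subspace_add: "closed_W_subspace s V \<Longrightarrow> f \<in> V \<Longrightarrow> g \<in> V \<Longrightarrow> dist_add f g \<in> V" by (simp add: closed_W_subspace_def)
lemma closed_W_subspace_scale: "closed_W_subspace s V \<Longrightarrow> f \<in> V \<Longrightarrow> dist_scale c f \<in> V" by (simp add: closed_W_subspace_def)

lemma closed_W_subspace_W: "closed_W_subspace s (W s)"
  by (rule closed_W_subspaceI) (auto intro: W_zero W_add W_scale)

lemma closed_W_subspace_Inter:
  assumes "\<V> \<noteq> {}" "\<And>V. V \<in> \<V> \<Longrightarrow> closed_W_subspace s V"
  shows "closed_W_subspace s (\<Inter>\<V>)"
proof -
  have cl: "f \<in> V" if "f \<in> W s" "\<forall>e>0. \<exists>g\<in>\<Inter>\<V>. W_norm s (dist_diff f g) < e" "V \<in> \<V>" for f V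
  proof -
    have "\<forall>e>0. \<exists>g\<in>V. W_norm s (dist_diff f g) < e" using that(2,3) by blast
    then show ?thesis using assms(2)[OF that(3)] that(1) unfolding closed_W_subspace_def by blast
  qed
  obtain V0 where "V0 \<in> \<V>" using assms(1) by blast
  then have "\<Inter>\<V> \<subseteq> W s" using closed_W_subspace_subset[OF assms(2)] by blast
  then show ?thesis unfolding closed_W_subspace_def
  proof (intro conjI ballI allI impI InterI)
    fix V assume V: "V \<in> \<V>"
    note cV = assms(2)[OF V]
    show "dist_zero \<in> V" by (rule closed_W_subspace_zero[OF cV])
    show "dist_scale c f \<in> V" if "f \<in> \<Inter>\<V>" for c f
      using closed_W_subspace_scale[OF cV] that V by blast
    show "dist_add f g \<in> V" if "f \<in> \<Inter>\<V>" "g \<in> \<Inter>\<V>" for f g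
      using closed_W_subspace_add[OF cV] that V by blast
    show "f \<in> V" if "f \<in> W s" "\<forall>e>0. \<exists>g\<in>\<Inter>\<V>. W_norm s (dist_diff f g) < e" for f
      using cl that V by blast
  qed
qed

lemma
  assumes "\<Phi> \<subseteq> W s"
  shows closed_fsi_space: "closed_W_subspace s (fsi_space s \<Phi>)"
    and shift_invariant_fsi_space: "shift_invariant 1 (fsi_space s \<Phi>)"
    and fsi_space_contains: "\<Phi> \<subseteq> fsi_space s \<Phi>"
proof -
  have "W s \<in> {V. closed_W_subspace s V \<and> shift_invariant 1 V \<and> \<Phi> \<subseteq> V}"
    using assms closed_W_subspace_W W_translate unfolding shift_invariant_def by blast
  then show "closed_W_subspace s (fsi_space s \<Phi>)"
    unfolding fsi_space_def by (rule closed_W_subspace_Inter[OF ex_in_conv[THEN iffD1], OF exI]) simp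
qed (auto simp: fsi_space_def shift_invariant_def)

lemma fsi_space_least:
  "closed_W_subspace s V \<Longrightarrow> shift_invariant 1 V \<Longrightarrow> \<Phi> \<subseteq> V \<Longrightarrow> fsi_space s \<Phi> \<subseteq> V"
  unfolding fsi_space_def by blast

lemma dist_dilate_inverse: "h > 0 \<Longrightarrow> dist_dilate h (dist_dilate (inverse h) f) = f"
  for f :: "'d::finite dist"
proof
  fix \<phi> :: "real^'d \<Rightarrow> complex"
  assume h: "h > 0"
  have "complex_of_real (inverse h ^ CARD('d)) * (complex_of_real (h ^ CARD('d)) * z) = z" for z
    using h by (simp add: mult.assoc[symmetric] power_mult_distrib[symmetric])
  then show "dist_dilate h (dist_dilate (inverse h) f) \<phi> = f \<phi>"
    unfolding dist_dilate_def using h by (simp add: mult.assoc[symmetric] power_mult_distrib[symmetric])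
qed

lemma dist_dilate_diff: "dist_dilate h (dist_diff f g) = dist_diff (dist_dilate h f) (dist_dilate h g)"
  by (simp add: dist_dilate_def dist_diff_def)

lemma dist_dilate_translate: "dist_translate (h *\<^sub>R a) (dist_dilate h f) = dist_dilate h (dist_translate a f)"
  by (simp add: dist_translate_def dist_dilate_def scaleR_add_right)

text \<open>The constant depends on \<open>h\<close>: the Sobolev norms are not homogeneous.\<close>

lemma dilate_bounded:
  fixes f :: "'d::finite dist"
  assumes h: "h > 0"
  obtains c where "c > 0" "\<And>f::'d dist. f \<in> W s \<Longrightarrow> energy (sobolev_weight s) (hat (dist_dilate h f)) \<le> ennreal c * energy (sobolev_weight s) (hat f)"
proof -
  obtain c where c: "c > 0" "\<And>x::real^'d. weight h s x \<le> c * sobolev_weight s x" using weight_sobolev_weight_compare[OF h] by metis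
  let ?a = "2 powr \<bar>s\<bar> * h powr (- 2 * s) / h ^ CARD('d)"
  let ?h = "complex_of_real (h ^ CARD('d))"
  have a: "?a > 0" using h by simp
  have h2: "(cmod ?h)\<^sup>2 > 0" using h by simp
  show ?thesis
  proof (rule that[of "?a * ((cmod ?h)\<^sup>2 * c)"])
    show "?a * ((cmod ?h)\<^sup>2 * c) > 0" by (intro mult_pos_pos a h2 c(1))
    fix f :: "'d dist" assume f: "f \<in> W s"
    have [measurable]: "hat f \<in> borel_measurable borel" by (rule hat_measurable[OF f])
    have "energy (sobolev_weight s) (hat (dist_dilate h f)) = energy (sobolev_weight s) (\<lambda>x. ?h * hat f (h *\<^sub>R x))"
      by (rule energy_cong_AE[OF hat_dilate[OF f h]])
    also have "\<dots> \<le> ennreal ?a * energy (weight h s) (\<lambda>x. ?h * hat f (h *\<^sub>R (inverse h *\<^sub>R x)))"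
      by (rule energy_sobolev_weight_weight(1)[OF h]) measurable
    also have "energy (weight h s) (\<lambda>x. ?h * hat f (h *\<^sub>R (inverse h *\<^sub>R x))) = ennreal ((cmod ?h)\<^sup>2) * energy (weight h s) (hat f)"
      using h by (subst energy_scale[symmetric]) auto
    also have "ennreal ?a * \<dots> \<le> ennreal ?a * (ennreal ((cmod ?h)\<^sup>2) * (ennreal c * energy (sobolev_weight s) (hat f)))"
      using c by (intro mult_left_mono energy_mono_weight) auto
    also have "\<dots> = ennreal (?a * ((cmod ?h)\<^sup>2 * c)) * energy (sobolev_weight s) (hat f)"
      using a c(1) by (simp only: ennreal_mult less_imp_le zero_le_power2 mult_nonneg_nonneg mult.assoc)
    finally show "energy (sobolev_weight s) (hat (dist_dilate h f)) \<le> ennreal (?a * ((cmod ?h)\<^sup>2 * c)) * energy (sobolev_weight s) (hat f)" .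
  qed
qed

lemma closed_dilated_subspace:
  fixes V :: "'d::finite dist set"
  assumes V: "closed_W_subspace s V" and h: "h > 0"
  shows "closed_W_subspace s (dist_dilate h ` V)"
proof (rule closed_W_subspaceI)
  have VW: "V \<subseteq> W s" using V by (rule closed_W_subspace_subset)
  then show "dist_dilate h ` V \<subseteq> W s" using W_dilate h by blast
  show "dist_zero \<in> dist_dilate h ` V"
    using closed_W_subspace_zero[OF V] by (intro image_eqI[of _ _ dist_zero]) (auto simp: dist_zero_def dist_dilate_def)
  show "dist_add f g \<in> dist_dilate h ` V" if fg: "f \<in> dist_dilate h ` V" "g \<in> dist_dilate h ` V" for f g
  proof -
    obtain f' g' where f': "f' \<in> V" "f = dist_dilate h f'" and g': "g' \<in> V" "g = dist_dilate h g'" using fg by blast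
    then show ?thesis using closed_W_subspace_add[OF V f'(1) g'(1)]
      by (intro image_eqI[of _ _ "dist_add f' g'"]) (auto simp: dist_add_def dist_dilate_def)
  qed
  show "dist_scale c f \<in> dist_dilate h ` V" if f: "f \<in> dist_dilate h ` V" for c f
  proof -
    obtain f' where f': "f' \<in> V" "f = dist_dilate h f'" using f by blast
    then show ?thesis using closed_W_subspace_scale[OF V f'(1), of c]
      by (intro image_eqI[of _ _ "dist_scale c f'"]) (auto simp: dist_scale_def dist_dilate_def)
  qed
  fix f :: "'d dist" assume f: "f \<in> W s"
    and ap: "\<And>e. e > 0 \<Longrightarrow> \<exists>g\<in>dist_dilate h ` V. energy (sobolev_weight s) (\<lambda>x. hat f x - hat g x) < ennreal e"
  have ih: "inverse h > 0" using h by simp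
  have "dist_dilate (inverse h) f \<in> V"
  proof (rule closed_W_subspaceD[OF V W_dilate[OF f ih]])
    fix e :: real assume e: "e > 0"
    obtain c where c: "c > 0" "\<And>f::'d dist. f \<in> W s \<Longrightarrow> energy (sobolev_weight s) (hat (dist_dilate (inverse h) f)) \<le> ennreal c * energy (sobolev_weight s) (hat f)"
      using dilate_bounded[OF ih] by metis
    obtain g where g: "g \<in> V" "energy (sobolev_weight s) (\<lambda>x. hat f x - hat (dist_dilate h g) x) < ennreal (e / c)"
      using ap[of "e / c"] e c(1) by auto
    have gW: "g \<in> W s" using g VW by blast
    note dW = W_dilate[OF gW h]
    have "dist_dilate (inverse h) (dist_dilate h g) = g" using dist_dilate_inverse[OF ih, of g] by simp
    then have "energy (sobolev_weight s) (\<lambda>x. hat (dist_dilate (inverse h) f) x - hat g x) = energy (sobolev_weight s) (hat (dist_dilate (inverse h) (dist_diff f (dist_dilate h g))))"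
      unfolding dist_dilate_diff by (simp add: energy_diff[OF W_dilate[OF f ih] gW])
    also have "\<dots> \<le> ennreal c * energy (sobolev_weight s) (\<lambda>x. hat f x - hat (dist_dilate h g) x)"
      using c(2)[OF W_diff[OF f dW]] by (simp add: energy_diff[OF f dW])
    also have "\<dots> < ennreal c * ennreal (e / c)" using g(2) c(1) by (intro ennreal_mult_strict_left_mono) auto
    also have "\<dots> = ennreal e" using c(1) e by (simp add: ennreal_mult[symmetric])
    finally show "\<exists>g\<in>V. energy (sobolev_weight s) (\<lambda>x. hat (dist_dilate (inverse h) f) x - hat g x) < ennreal e" using g(1) by blast
  qed
  then show "f \<in> dist_dilate h ` V" using dist_dilate_inverse[OF h, of f] by (metis image_eqI)
qed

lemma ladder_dilates:
  assumes "\<And>h. h > 0 \<Longrightarrow> closed_W_subspace s (V h) \<and> shift_invariant 1 (V h)"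
  shows "ladder s (\<lambda>h. dist_dilate h ` V h)"
  unfolding ladder_def
proof (intro allI impI conjI)
  fix h :: real assume h: "h > 0"
  then show "closed_W_subspace s (dist_dilate h ` V h)" using assms closed_dilated_subspace by blast
  have "dist_translate a f \<in> V h" if "a \<in> integer_lattice" "f \<in> V h" for a f
    using assms[OF h] that unfolding shift_invariant_def by force
  then show "shift_invariant h (dist_dilate h ` V h)"
    unfolding shift_invariant_def by (auto simp: dist_dilate_translate)
qed

text \<open>Dilation by \<open>h\<close> multiplies the Fourier transform by \<open>h\<^sup>d\<close>, which is compensated by the scalar multiple of \<open>g\<close>.
  Both bounds are needed: one for each direction of \<open>approximation_order_iff_energy\<close>.\<close>

lemma
  fixes f g :: "'d::finite dist"
  assumes f: "f \<in> W s" and g: "g \<in> W s" and h: "h > 0"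
  defines "E \<equiv> energy (weight h s) (\<lambda>x. hat f (inverse h *\<^sub>R x) - hat (dist_scale (complex_of_real (h ^ CARD('d))) g) x)"
  shows W_norm_dilate_le: "ennreal ((W_norm s (dist_diff f (dist_dilate h g)))\<^sup>2) \<le> ennreal (2 powr \<bar>s\<bar> * h powr (- 2 * s) / h ^ CARD('d)) * E"
    and W_norm_dilate_ge: "E \<le> ennreal (2 powr \<bar>s\<bar> * h powr (2 * s) * h ^ CARD('d)) * ennreal ((W_norm s (dist_diff f (dist_dilate h g)))\<^sup>2)"
proof -
  let ?h = "complex_of_real (h ^ CARD('d))"
  let ?G = "\<lambda>x. hat f x - ?h * hat g (h *\<^sub>R x)"
  have [measurable]: "hat f \<in> borel_measurable borel" "hat g \<in> borel_measurable borel"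
    using f g by (auto intro: hat_measurable)
  note dW = W_dilate[OF g h]
  have "energy (sobolev_weight s) (hat (dist_diff f (dist_dilate h g))) = energy (sobolev_weight s) ?G"
    unfolding energy_diff[OF f dW] by (rule energy_cong_AE) (use hat_dilate[OF g h] in auto)
  then have 1: "ennreal ((W_norm s (dist_diff f (dist_dilate h g)))\<^sup>2) = energy (sobolev_weight s) ?G"
    by (simp add: W_norm_energy[OF W_diff[OF f dW]])
  have 2: "E = energy (weight h s) (\<lambda>x. ?G (inverse h *\<^sub>R x))"
    unfolding E_def by (rule energy_cong_AE) (use hat_scale[OF g, of ?h] h in auto)
  show "ennreal ((W_norm s (dist_diff f (dist_dilate h g)))\<^sup>2) \<le> ennreal (2 powr \<bar>s\<bar> * h powr (- 2 * s) / h ^ CARD('d)) * E"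
    unfolding 1 2 by (rule energy_sobolev_weight_weight(1)[OF h]) measurable
  show "E \<le> ennreal (2 powr \<bar>s\<bar> * h powr (2 * s) * h ^ CARD('d)) * ennreal ((W_norm s (dist_diff f (dist_dilate h g)))\<^sup>2)"
    unfolding 1 2 by (rule energy_sobolev_weight_weight(2)[OF h]) measurable
qed

lemma sum_squares_le_square_sum: "(a::real) \<ge> 0 \<Longrightarrow> b \<ge> 0 \<Longrightarrow> a\<^sup>2 + b\<^sup>2 \<le> (a + b)\<^sup>2"
  by (simp add: power2_sum)

lemma ennreal_affine:
  "a \<ge> 0 \<Longrightarrow> b \<ge> 0 \<Longrightarrow> c \<ge> 0 \<Longrightarrow> n \<ge> 0 \<Longrightarrow> e \<ge> 0 \<Longrightarrow>
   ennreal a * (ennreal c * (ennreal b * ennreal n) + ennreal e) = ennreal (a * (c * (b * n) + e))"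
  by (simp add: ennreal_mult ennreal_plus)

text \<open>Replacing \<open>hat f\<close> by \<open>hat f(x / h)\<close> turns the norms of order \<open>s\<close> and \<open>k\<close> into energies with the weights
  \<open>(|x|\<^sup>2 + h\<^sup>2)\<^sup>s\<close> and \<open>(|x|\<^sup>2 + h\<^sup>2)\<^sup>k\<close>, up to powers of \<open>h\<close> whose quotient is exactly \<open>h\<^sup>2\<^sup>(\<^sup>k\<^sup>-\<^sup>s\<^sup>)\<close>. The factor
  \<open>h powr (k - s)\<close> in the definition of the order is thereby absorbed, and the undilated spaces \<open>V h\<close> appear.
  The additive \<open>e\<close> expresses that the infimum over \<open>V h\<close> need not be attained.\<close>

lemma approximation_order_iff_energy:
  fixes V :: "real \<Rightarrow> 'd::finite dist set"
  assumes ks: "s < k"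
    and V: "\<And>h. h > 0 \<Longrightarrow> closed_W_subspace s (V h) \<and> shift_invariant 1 (V h)"
  shows "approximation_order s k (\<lambda>h. dist_dilate h ` V h) \<longleftrightarrow>
    (\<exists>C\<ge>0. \<forall>f\<in>W k. \<forall>h>0. \<forall>e>0. \<exists>g\<in>V h.
       energy (weight h s) (\<lambda>x. hat f (inverse h *\<^sub>R x) - hat g x)
        \<le> ennreal C * energy (weight h k) (\<lambda>x. hat f (inverse h *\<^sub>R x)) + ennreal e)"
    (is "?A \<longleftrightarrow> (\<exists>C\<ge>0. ?B C)")
proof
  let ?d = "CARD('d)"
  let ?a = "\<lambda>s h. 2 powr \<bar>s\<bar> * h powr (- 2 * s) / h ^ ?d"
  let ?b = "\<lambda>s h. 2 powr \<bar>s\<bar> * h powr (2 * s) * h ^ ?d"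
  (* The powers of h of the two norm comparisons combine to the factor of the order condition. *)
  have ab: "?a s h * ?b k h = 2 powr \<bar>s\<bar> * 2 powr \<bar>k\<bar> * (h powr (k - s))\<^sup>2" if h: "h > 0" for s k h :: real
  proof -
    have "h powr (- 2 * s) * h powr (2 * k) = (h powr (k - s))\<^sup>2"
      by (simp add: power2_eq_square powr_add[symmetric])
    then have "2 powr \<bar>s\<bar> * 2 powr \<bar>k\<bar> * (h powr (k - s))\<^sup>2 = 2 powr \<bar>s\<bar> * 2 powr \<bar>k\<bar> * (h powr (- 2 * s) * h powr (2 * k))" by simp
    also have "\<dots> = ?a s h * ?b k h" using h by simp
    finally show ?thesis by simp
  qed
  have VW: "V h \<subseteq> W s" if "h > 0" for h using V[OF that] closed_W_subspace_subset by blast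
  have ne: "dist_zero \<in> V h" if "h > 0" for h using V[OF that] closed_W_subspace_zero by blast
  have en_le: "energy (weight h k) (\<lambda>x. hat f (inverse h *\<^sub>R x)) \<le> ennreal (?b k h) * ennreal ((W_norm k f)\<^sup>2)"
    and en_ge: "ennreal ((W_norm k f)\<^sup>2) \<le> ennreal (?a k h) * energy (weight h k) (\<lambda>x. hat f (inverse h *\<^sub>R x))"
    if "f \<in> W k" "h > 0" for f :: "'d dist" and h
    using energy_sobolev_weight_weight[OF that(2) hat_measurable[OF that(1)], of k] W_norm_energy[OF that(1)] by auto
  have INF_le: "(INF g\<in>dist_dilate h ` V h. W_norm s (dist_diff f g)) < r \<longleftrightarrow> (\<exists>g\<in>V h. W_norm s (dist_diff f (dist_dilate h g)) < r)"
    if "h > 0" for f h r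
    using ne[OF that] W_norm_nonneg by (subst cINF_less_iff) (auto intro!: bdd_belowI2[of _ 0])
  {
    assume ?A
    then obtain C where C: "\<And>f h. f \<in> W k \<Longrightarrow> h > 0 \<Longrightarrow> (INF g\<in>dist_dilate h ` V h. W_norm s (dist_diff f g)) \<le> C * h powr (k - s) * W_norm k f"
      unfolding approximation_order_def by blast
    (* The 2 comes from squaring the sum of the main term and the slack eta; the powers of 2
       are the constants of the two weight comparisons. *)
    define K where "K = 2 * C\<^sup>2 * (2 powr \<bar>s\<bar> * 2 powr \<bar>k\<bar>)"
    have "?B K"
    proof (intro ballI allI impI)
      fix f :: "'d dist" and h e :: real assume f: "f \<in> W k" and h: "h > 0" and e: "e > 0"
      have fs: "f \<in> W s" using f W_subset[of s k] ks by auto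
      have b: "?b s h > 0" using h by simp
      (* The slack is chosen such that its contribution to the energy is exactly e. *)
      define \<eta> where "\<eta> = sqrt (e / (2 * ?b s h))"
      have \<eta>: "\<eta> > 0" "\<eta>\<^sup>2 = e / (2 * ?b s h)" unfolding \<eta>_def using e b by auto
      let ?M = "C * h powr (k - s) * W_norm k f"
      have "(INF g\<in>dist_dilate h ` V h. W_norm s (dist_diff f g)) < ?M + \<eta>" using C[OF f h] \<eta>(1) by linarith
      then obtain g where g: "g \<in> V h" "W_norm s (dist_diff f (dist_dilate h g)) < ?M + \<eta>" using INF_le[OF h] by blast
      let ?w = "W_norm s (dist_diff f (dist_dilate h g))"
      have "?w\<^sup>2 \<le> (?M + \<eta>)\<^sup>2" using g(2) W_norm_nonneg by (intro power_mono) auto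
      also have "\<dots> \<le> 2 * ?M\<^sup>2 + 2 * \<eta>\<^sup>2" using sum_squares_bound[of ?M \<eta>] by (simp add: power2_sum)
      finally have "?b s h * ?w\<^sup>2 \<le> ?b s h * (2 * ?M\<^sup>2 + 2 * \<eta>\<^sup>2)" using b by (intro mult_left_mono) auto
      also have "\<dots> = (?b s h * 2 * C\<^sup>2 * (h powr (k - s))\<^sup>2) * (W_norm k f)\<^sup>2 + e"
      proof -
        have "?b s h * (2 * ?M\<^sup>2 + 2 * \<eta>\<^sup>2) = (?b s h * 2 * C\<^sup>2 * (h powr (k - s))\<^sup>2) * (W_norm k f)\<^sup>2 + (2 * ?b s h) * \<eta>\<^sup>2"
          by (simp only: power_mult_distrib distrib_left mult_ac)
        also have "(2 * ?b s h) * \<eta>\<^sup>2 = e" unfolding \<eta>(2) using b by (metis less_irrefl mult_pos_pos nonzero_mult_div_cancel_left times_divide_eq_right zero_less_numeral)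
        finally show ?thesis .
      qed
      finally have le: "?b s h * ?w\<^sup>2 \<le> (?b s h * 2 * C\<^sup>2 * (h powr (k - s))\<^sup>2) * (W_norm k f)\<^sup>2 + e" .
      let ?c = "?b s h * 2 * C\<^sup>2 * (h powr (k - s))\<^sup>2"
      have c0: "?c \<ge> 0" using b by simp
      let ?g = "dist_scale (complex_of_real (h ^ CARD('d))) g"
      have "energy (weight h s) (\<lambda>x. hat f (inverse h *\<^sub>R x) - hat ?g x) \<le> ennreal (?b s h) * ennreal (?w\<^sup>2)"
        using g(1) VW[OF h] by (intro W_norm_dilate_ge fs h) auto
      also have "\<dots> = ennreal (?b s h * ?w\<^sup>2)" using b by (subst ennreal_mult) auto
      also have "\<dots> \<le> ennreal (?c * (W_norm k f)\<^sup>2 + e)" by (rule ennreal_leI[OF le])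
      also have "\<dots> = ennreal ?c * ennreal ((W_norm k f)\<^sup>2) + ennreal e"
        using c0 e by (subst ennreal_plus) (auto simp: ennreal_mult)
      also have "\<dots> \<le> ennreal ?c * (ennreal (?a k h) * energy (weight h k) (\<lambda>x. hat f (inverse h *\<^sub>R x))) + ennreal e"
        by (intro add_mono mult_left_mono en_ge f h) auto
      also have "ennreal ?c * (ennreal (?a k h) * energy (weight h k) (\<lambda>x. hat f (inverse h *\<^sub>R x))) = ennreal (?a k h * ?c) * energy (weight h k) (\<lambda>x. hat f (inverse h *\<^sub>R x))"
        using c0 h by (intro ennreal_scale_scale) auto
      also have "?a k h * ?c = K"
      proof -
        have "?a k h * ?c = (?a k h * ?b s h) * (2 * C\<^sup>2 * (h powr (k - s))\<^sup>2)" by simp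
        also have "\<dots> = 2 powr \<bar>k\<bar> * 2 powr \<bar>s\<bar> * (2 * C\<^sup>2) * (h powr (s - k) * h powr (k - s))\<^sup>2"
          unfolding ab[OF h] by (simp add: power_mult_distrib)
        also have "h powr (s - k) * h powr (k - s) = 1" using h by (simp add: powr_add[symmetric])
        finally show ?thesis by (simp add: K_def)
      qed
      finally show "\<exists>g\<in>V h. energy (weight h s) (\<lambda>x. hat f (inverse h *\<^sub>R x) - hat g x) \<le> ennreal K * energy (weight h k) (\<lambda>x. hat f (inverse h *\<^sub>R x)) + ennreal e"
        using closed_W_subspace_scale[OF conjunct1[OF V[OF h]] g(1)] by blast
    qed
    moreover have "K \<ge> 0" unfolding K_def by simp
    ultimately show "\<exists>C\<ge>0. ?B C" by blast
  next
    assume "\<exists>C\<ge>0. ?B C"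
    then obtain C where C0: "C \<ge> 0" and C: "?B C" by blast
    define K where "K = sqrt (2 powr \<bar>s\<bar> * 2 powr \<bar>k\<bar> * C)"
    have K: "K \<ge> 0" "K\<^sup>2 = 2 powr \<bar>s\<bar> * 2 powr \<bar>k\<bar> * C" unfolding K_def using C0 by auto
    have "(INF g\<in>dist_dilate h ` V h. W_norm s (dist_diff f g)) \<le> K * h powr (k - s) * W_norm k f"
      if f: "f \<in> W k" and h: "h > 0" for f :: "'d dist" and h
    proof (rule field_le_epsilon)
      fix \<eta> :: real assume \<eta>: "\<eta> > 0"
      have fs: "f \<in> W s" using f W_subset[of s k] ks by auto
      let ?M = "K * h powr (k - s) * W_norm k f"
      have M0: "?M \<ge> 0" by (intro mult_nonneg_nonneg K(1) W_norm_nonneg) simp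
      have a: "?a s h > 0" using h by simp
      (* An energy slack of this size costs at most eta/2 in norm; the other half turns a weak
         inequality into a strict one. *)
      define e where "e = (\<eta> / 2)\<^sup>2 / ?a s h"
      have e: "e > 0" unfolding e_def using \<eta> by (intro divide_pos_pos[OF zero_less_power a]) auto
      have e2: "?a s h * e = (\<eta> / 2)\<^sup>2" unfolding e_def using a by (metis less_irrefl nonzero_mult_div_cancel_left times_divide_eq_right)
      obtain g' where g': "g' \<in> V h" "energy (weight h s) (\<lambda>x. hat f (inverse h *\<^sub>R x) - hat g' x) \<le> ennreal C * energy (weight h k) (\<lambda>x. hat f (inverse h *\<^sub>R x)) + ennreal e"
        using C f h e by blast
      define g where "g = dist_scale (inverse (complex_of_real (h ^ CARD('d)))) g'"
      have g: "g \<in> V h" unfolding g_def using closed_W_subspace_scale[OF conjunct1[OF V[OF h]] g'(1)] .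
      have sg: "dist_scale (complex_of_real (h ^ CARD('d))) g = g'"
        unfolding g_def dist_scale_def using h by (simp add: mult.assoc[symmetric])
      let ?w = "W_norm s (dist_diff f (dist_dilate h g))"
      have "ennreal (?w\<^sup>2) \<le> ennreal (?a s h) * energy (weight h s) (\<lambda>x. hat f (inverse h *\<^sub>R x) - hat g' x)"
        using W_norm_dilate_le[OF fs _ h, of g] g VW[OF h] unfolding sg by blast
      also have "\<dots> \<le> ennreal (?a s h) * (ennreal C * (ennreal (?b k h) * ennreal ((W_norm k f)\<^sup>2)) + ennreal e)"
        by (intro mult_left_mono order_trans[OF g'(2)] add_mono en_le f h) auto
      also have "\<dots> = ennreal (?a s h * (C * (?b k h * (W_norm k f)\<^sup>2) + e))"
        using C0 h e a by (intro ennreal_affine) auto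
      finally have "?w\<^sup>2 \<le> ?a s h * (C * (?b k h * (W_norm k f)\<^sup>2) + e)"
        using C0 h e a by (subst (asm) ennreal_le_iff) (auto intro!: mult_nonneg_nonneg add_nonneg_nonneg less_imp_le[OF a])
      also have "\<dots> = (?a s h * ?b k h) * C * (W_norm k f)\<^sup>2 + ?a s h * e" by (simp only: distrib_left mult_ac)
      also have "\<dots> = ?M\<^sup>2 + (\<eta> / 2)\<^sup>2" unfolding ab[OF h] e2 power_mult_distrib K(2) by (simp only: mult_ac)
      also have "\<dots> \<le> (?M + \<eta> / 2)\<^sup>2" by (rule sum_squares_le_square_sum) (use M0 \<eta> in auto)
      finally have "?w \<le> ?M + \<eta> / 2" by (rule power2_le_imp_le) (use M0 \<eta> in simp)
      then have "?w < ?M + \<eta>" using \<eta> by simp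
      then show "(INF g\<in>dist_dilate h ` V h. W_norm s (dist_diff f g)) \<le> ?M + \<eta>" using INF_le[OF h] g by (meson less_imp_le)
    qed
    then show ?A unfolding approximation_order_def using ladder_dilates[where V=V and s=s] V by blast
  }
qed

section \<open>Fibers over the dual lattice\<close>

lemma countable_integer_lattice: "countable (integer_lattice :: (real^'d::finite) set)"
proof -
  have "a \<in> range (\<lambda>f::'d \<Rightarrow> int. \<chi> j. of_int (f j))" if "a \<in> integer_lattice" for a :: "real^'d"
  proof -
    have "\<forall>j. \<exists>n::int. a $ j = of_int n" using that by (auto simp: integer_lattice_def Ints_def)
    then obtain f where "\<And>j. a $ j = of_int (f j)" by metis
    then show ?thesis by (intro image_eqI[of _ _ f]) (auto simp: vec_eq_iff)
  qed
  then show ?thesis by (intro countable_subset[of integer_lattice, OF subsetI countable_image[OF countableI_type]])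
qed

lemma countable_dual_lattice: "countable (dual_lattice :: (real^'d::finite) set)"
  unfolding dual_lattice_def by (intro countable_image countable_integer_lattice)

lemma dual_lattice_iff: "\<alpha> \<in> dual_lattice \<longleftrightarrow> (\<forall>j. \<exists>n::int. \<alpha> $ j = 2 * pi * of_int n)"
proof
  assume R: "\<forall>j. \<exists>n::int. \<alpha> $ j = 2 * pi * of_int n"
  have "inverse (2 * pi) *\<^sub>R \<alpha> \<in> integer_lattice"
    unfolding integer_lattice_def
  proof (intro CollectI allI)
    fix j
    obtain n :: int where "\<alpha> $ j = 2 * pi * of_int n" using R by blast
    then have "(inverse (2 * pi) *\<^sub>R \<alpha>) $ j = of_int n" by simp
    then show "(inverse (2 * pi) *\<^sub>R \<alpha>) $ j \<in> \<int>" by simp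
  qed
  then show "\<alpha> \<in> dual_lattice" unfolding dual_lattice_def by (intro image_eqI[of _ _ "inverse (2 * pi) *\<^sub>R \<alpha>"]) auto
next
  assume "\<alpha> \<in> dual_lattice"
  then obtain a where a: "a \<in> integer_lattice" "\<alpha> = (2 * pi) *\<^sub>R a" unfolding dual_lattice_def by blast
  show "\<forall>j. \<exists>n::int. \<alpha> $ j = 2 * pi * of_int n"
  proof
    fix j
    have "a $ j \<in> \<int>" using a by (simp add: integer_lattice_def)
    then obtain n where "a $ j = of_int n" by (auto simp: Ints_def)
    then show "\<exists>n::int. \<alpha> $ j = 2 * pi * of_int n" using a by auto
  qed
qed

lemma dual_lattice_zero [simp]: "0 \<in> dual_lattice" by (auto simp: dual_lattice_iff intro: exI[of _ 0])

lemma dual_lattice_uminus: "\<alpha> \<in> dual_lattice \<Longrightarrow> - \<alpha> \<in> dual_lattice"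
  unfolding dual_lattice_iff by (metis minus_mult_right of_int_minus uminus_vec_def vec_lambda_beta)

lemma dual_lattice_add:
  assumes "\<alpha> \<in> dual_lattice" "\<beta> \<in> dual_lattice" shows "\<alpha> + \<beta> \<in> dual_lattice"
  unfolding dual_lattice_iff
proof
  fix j
  obtain n m :: int where "\<alpha> $ j = 2 * pi * of_int n" "\<beta> $ j = 2 * pi * of_int m" using assms unfolding dual_lattice_iff by metis
  then have "(\<alpha> + \<beta>) $ j = 2 * pi * of_int (n + m)" by (simp add: distrib_left)
  then show "\<exists>n::int. (\<alpha> + \<beta>) $ j = 2 * pi * of_int n" by blast
qed

definition cell :: "(real^'d::finite) set" where
  "cell = {\<omega>. \<forall>j. - pi < \<omega> $ j \<and> \<omega> $ j \<le> pi}"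

lemma cell_measurable [measurable]: "(cell :: (real^'d::finite) set) \<in> sets borel"
  unfolding cell_def by measurable

text \<open>A Borel inverse of \<open>cis\<close> on \<open>(-\<pi>,\<pi>]\<close>. The clipping makes both branches continuous on the whole
  plane, which gives measurability.\<close>

definition circle_arg :: "complex \<Rightarrow> real" where
  "circle_arg z = (if Im z \<ge> 0 then arccos (max (-1) (min 1 (Re z))) else - arccos (max (-1) (min 1 (Re z))))"

lemma circle_arg_measurable [measurable]: "circle_arg \<in> borel_measurable borel"
proof -
  have "continuous_on UNIV (\<lambda>z::complex. arccos (max (-1) (min 1 (Re z))))"
    by (rule continuous_on_compose2[OF continuous_on_arccos'[of]]) (auto intro!: continuous_intros)
  then have [measurable]: "(\<lambda>z::complex. arccos (max (-1) (min 1 (Re z)))) \<in> borel_measurable borel"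
    by (rule borel_measurable_continuous_onI)
  show ?thesis unfolding circle_arg_def by measurable
qed

lemma circle_arg_cis: "- pi < t \<Longrightarrow> t \<le> pi \<Longrightarrow> circle_arg (cis t) = t"
proof -
  assume t: "- pi < t" "t \<le> pi"
  have c: "max (-1) (min 1 (cos t)) = cos t" using cos_ge_minus_one[of t] cos_le_one[of t] by linarith
  show ?thesis
  proof (cases "t \<ge> 0")
    case True
    then show ?thesis using t c sin_ge_zero[of t] arccos_cos[of t] by (simp add: circle_arg_def)
  next
    case False
    then have "sin (- t) > 0" using t by (intro sin_gt_zero) auto
    moreover have "arccos (cos (- t)) = - t" using t False by (intro arccos_cos) auto
    ultimately show ?thesis using c by (simp add: circle_arg_def)
  qed
qed

lemma cis_add_2pi_int: "cis (t + 2 * pi * of_int n) = cis t"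
  by (simp add: complex_eq_iff cos_add sin_add)

lemma circle_arg_cis_ex: "\<exists>n::int. circle_arg (cis t) = t + 2 * pi * of_int n \<and> - pi < circle_arg (cis t) \<and> circle_arg (cis t) \<le> pi"
proof -
  define n where "n = - \<lceil>(t - pi) / (2 * pi)\<rceil>"
  have "(t - pi) / (2 * pi) \<le> - of_int n" "- of_int n < (t - pi) / (2 * pi) + 1" unfolding n_def by linarith+
  then have b: "t + 2 * pi * of_int n \<le> pi" "- pi < t + 2 * pi * of_int n" by (simp_all add: field_simps)
  have "circle_arg (cis t) = circle_arg (cis (t + 2 * pi * of_int n))" by (simp only: cis_add_2pi_int)
  also have "\<dots> = t + 2 * pi * of_int n" using b by (intro circle_arg_cis)
  finally show ?thesis using b by auto
qed

text \<open>Periodic functions are functions on the torus. A frequency is reduced to \<open>cell\<close> by passing through the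
  torus, so that Borel functions of the reduced frequency are Borel functions on the torus.\<close>

definition torus :: "real^'d::finite \<Rightarrow> complex^'d" where "torus \<omega> = (\<chi> j. cis (\<omega> $ j))"
definition torus_arg :: "complex^'d::finite \<Rightarrow> real^'d" where "torus_arg z = (\<chi> j. circle_arg (z $ j))"
definition reduce :: "real^'d::finite \<Rightarrow> real^'d" where "reduce \<omega> = torus_arg (torus \<omega>)"

lemma measurable_vec_lambda:
  fixes f :: "'m \<Rightarrow> 'b::finite \<Rightarrow> 'a::euclidean_space"
  assumes "\<And>j. (\<lambda>x. f x j) \<in> borel_measurable M"
  shows "(\<lambda>x. \<chi> j. f x j) \<in> borel_measurable M"
proof (rule borel_measurable_euclidean_space[THEN iffD2], intro ballI)
  fix i :: "'a^'b" assume "i \<in> Basis"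
  then obtain j b where "i = axis j b" "b \<in> Basis" by (auto simp: Basis_vec_def)
  then have "(\<lambda>x. (\<chi> j. f x j) \<bullet> i) = (\<lambda>x. f x j \<bullet> b)" by (auto simp: inner_axis)
  then show "(\<lambda>x. (\<chi> j. f x j) \<bullet> i) \<in> borel_measurable M" using assms by simp
qed

lemma borel_measurable_vec_nth': "(\<lambda>x::'a::euclidean_space^'n::finite. x $ j) \<in> borel_measurable borel"
  by (intro borel_measurable_continuous_onI continuous_intros)

lemma torus_measurable [measurable]: "torus \<in> borel_measurable borel"
proof -
  have "continuous_on UNIV cis" by (simp add: cis_conv_exp[abs_def]) (intro continuous_intros)
  then have [measurable]: "cis \<in> borel_measurable borel" by (rule borel_measurable_continuous_onI)
  show ?thesis unfolding torus_def by (intro measurable_vec_lambda) measurable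
qed

lemma torus_arg_measurable [measurable]: "torus_arg \<in> borel_measurable borel"
  unfolding torus_arg_def
  by (intro measurable_vec_lambda measurable_compose[OF borel_measurable_vec_nth' circle_arg_measurable])

lemma reduce_measurable [measurable]: "reduce \<in> borel_measurable borel"
  unfolding reduce_def by measurable

lemma reduce_in_cell: "reduce \<omega> \<in> cell"
  using circle_arg_cis_ex by (auto simp: cell_def reduce_def torus_arg_def torus_def)

lemma reduce_diff: "reduce \<omega> - \<omega> \<in> dual_lattice"
  unfolding dual_lattice_iff
proof
  fix j
  show "\<exists>n::int. (reduce \<omega> - \<omega>) $ j = 2 * pi * of_int n"
    using circle_arg_cis_ex[of "\<omega> $ j"] by (auto simp: reduce_def torus_arg_def torus_def)
qed

lemma torus_periodic: "\<alpha> \<in> dual_lattice \<Longrightarrow> torus (\<omega> + \<alpha>) = torus \<omega>"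
proof -
  assume a: "\<alpha> \<in> dual_lattice"
  have "cis ((\<omega> + \<alpha>) $ j) = cis (\<omega> $ j)" for j
  proof -
    obtain n :: int where "\<alpha> $ j = 2 * pi * of_int n" using a unfolding dual_lattice_iff by blast
    then show ?thesis using cis_add_2pi_int by simp
  qed
  then show ?thesis by (simp add: torus_def)
qed

lemma reduce_cell: "\<omega> \<in> cell \<Longrightarrow> reduce \<omega> = \<omega>"
  by (simp add: reduce_def torus_arg_def torus_def cell_def vec_eq_iff circle_arg_cis)

lemma reduce_shift: "\<omega> \<in> cell \<Longrightarrow> \<alpha> \<in> dual_lattice \<Longrightarrow> reduce (\<omega> + \<alpha>) = \<omega>"
  using reduce_cell by (simp add: reduce_def torus_periodic)

lemma cell_shift_iff: "\<omega> \<in> cell \<Longrightarrow> \<alpha> \<in> dual_lattice \<Longrightarrow> \<omega> + \<alpha> \<in> cell \<longleftrightarrow> \<alpha> = 0"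
  using reduce_shift[of \<omega> \<alpha>] reduce_cell[of "\<omega> + \<alpha>"] by auto

lemma cell_neighbourhood: "r \<le> pi \<Longrightarrow> ball 0 r \<subseteq> cell"
proof
  fix x :: "real^'d" assume "r \<le> pi" "x \<in> ball 0 r"
  then have "\<bar>x $ j\<bar> < pi" for j using component_le_norm_cart[of x j] by simp
  then show "x \<in> cell" unfolding cell_def using abs_less_iff by (smt (verit) mem_Collect_eq)
qed

lemma cell_bounded: "bounded cell"
proof (rule bounded_subset)
  show "bounded (cbox (\<chi> j. - pi) (\<chi> j. pi) :: (real^'d::finite) set)" by (rule bounded_cbox)
  show "cell \<subseteq> cbox (\<chi> j. - pi) (\<chi> j. pi)" by (auto simp: cell_def mem_box_cart less_imp_le)
qed

lemma norm_outside_cell: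
  assumes "\<omega> \<in> cell" "\<alpha> \<in> dual_lattice" "\<alpha> \<noteq> 0"
  shows "pi \<le> norm (\<omega> + \<alpha>)"
proof -
  have "\<omega> + \<alpha> \<notin> cell" using assms cell_shift_iff by blast
  then obtain j where "\<not> (- pi < (\<omega> + \<alpha>) $ j \<and> (\<omega> + \<alpha>) $ j \<le> pi)" by (auto simp: cell_def)
  then have "pi \<le> \<bar>(\<omega> + \<alpha>) $ j\<bar>" by linarith
  then show ?thesis using component_le_norm_cart order_trans by blast
qed

definition fiber_sum :: "(real^'d::finite) set \<Rightarrow> (real^'d \<Rightarrow> ennreal) \<Rightarrow> real^'d \<Rightarrow> ennreal" where
  "fiber_sum A P \<omega> = (\<integral>\<^sup>+\<alpha>. P (\<omega> + \<alpha>) \<partial>count_space A)"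

lemma fiber_sum_measurable:
  assumes [measurable]: "P \<in> borel_measurable borel" and A: "countable A"
  shows "fiber_sum A P \<in> borel_measurable borel"
proof cases
  assume "finite A" then show ?thesis
    by (simp add: fiber_sum_def[abs_def] nn_integral_count_space_finite)
next
  assume inf: "infinite A"
  note * = bij_betw_from_nat_into[OF A inf]
  have "fiber_sum A P = (\<lambda>\<omega>. \<Sum>n. P (\<omega> + from_nat_into A n))"
    by (simp add: fiber_sum_def[abs_def] nn_integral_bij_count_space[symmetric, OF *] nn_integral_count_space_nat)
  then show ?thesis by simp
qed

lemma fiber_sum_split_zero:
  "fiber_sum dual_lattice P \<omega> = P \<omega> + fiber_sum (dual_lattice - {0}) P \<omega>"
proof -
  have "fiber_sum dual_lattice P \<omega> = (\<integral>\<^sup>+\<alpha>. P (\<omega> + \<alpha>) * indicator {0} \<alpha> + P (\<omega> + \<alpha>) * indicator (dual_lattice - {0}) \<alpha> \<partial>count_space dual_lattice)"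
    unfolding fiber_sum_def by (intro nn_integral_cong) (auto simp: indicator_def)
  also have "\<dots> = (\<integral>\<^sup>+\<alpha>. P (\<omega> + \<alpha>) * indicator {0} \<alpha> \<partial>count_space dual_lattice) + (\<integral>\<^sup>+\<alpha>. P (\<omega> + \<alpha>) * indicator (dual_lattice - {0}) \<alpha> \<partial>count_space dual_lattice)"
    by (rule nn_integral_add) auto
  also have "(\<integral>\<^sup>+\<alpha>. P (\<omega> + \<alpha>) * indicator {0} \<alpha> \<partial>count_space dual_lattice) = P \<omega>"
    by (subst nn_integral_indicator_singleton) (auto simp: one_ennreal_def[symmetric])
  also have "(\<integral>\<^sup>+\<alpha>. P (\<omega> + \<alpha>) * indicator (dual_lattice - {0}) \<alpha> \<partial>count_space dual_lattice) = fiber_sum (dual_lattice - {0}) P \<omega>"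
    unfolding fiber_sum_def by (simp add: nn_integral_count_space_indicator nn_integral_restrict_space restrict_count_space)
      (auto intro!: nn_integral_cong simp: indicator_def)
  finally show ?thesis .
qed

text \<open>The translates of \<open>cell\<close> by the dual lattice tile the space: \<open>\<omega> - reduce \<omega>\<close> is the only lattice point
  whose translate contains \<open>\<omega>\<close>.\<close>

lemma nn_integral_fibers:
  fixes P :: "real^'d::finite \<Rightarrow> ennreal"
  assumes [measurable]: "P \<in> borel_measurable borel"
  shows "(\<integral>\<^sup>+x. P x \<partial>lborel) = (\<integral>\<^sup>+\<omega>. fiber_sum dual_lattice P \<omega> * indicator cell \<omega> \<partial>lborel)"
proof -
  have "(\<integral>\<^sup>+\<omega>. fiber_sum dual_lattice P \<omega> * indicator cell \<omega> \<partial>lborel) = (\<integral>\<^sup>+\<omega>. \<integral>\<^sup>+\<alpha>. P (\<omega> + \<alpha>) * indicator cell \<omega> \<partial>count_space dual_lattice \<partial>lborel)"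
    unfolding fiber_sum_def by (intro nn_integral_cong nn_integral_multc[symmetric]) auto
  also have "\<dots> = (\<integral>\<^sup>+\<alpha>. \<integral>\<^sup>+\<omega>. P (\<omega> + \<alpha>) * indicator cell \<omega> \<partial>lborel \<partial>count_space dual_lattice)"
    by (intro nn_integral_count_space_nn_integral countable_dual_lattice) auto
  also have "\<dots> = (\<integral>\<^sup>+\<alpha>. \<integral>\<^sup>+\<omega>. P \<omega> * indicator cell (\<omega> - \<alpha>) \<partial>lborel \<partial>count_space dual_lattice)"
  proof (rule nn_integral_cong)
    fix \<alpha> :: "real^'d"
    show "(\<integral>\<^sup>+\<omega>. P (\<omega> + \<alpha>) * indicator cell \<omega> \<partial>lborel) = (\<integral>\<^sup>+\<omega>. P \<omega> * indicator cell (\<omega> - \<alpha>) \<partial>lborel)"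
      by (subst (2) nn_integral_lborel_affine[of _ 1 \<alpha>]) (auto simp: add.commute)
  qed
  also have "\<dots> = (\<integral>\<^sup>+\<omega>. \<integral>\<^sup>+\<alpha>. P \<omega> * indicator cell (\<omega> - \<alpha>) \<partial>count_space dual_lattice \<partial>lborel)"
    by (intro nn_integral_count_space_nn_integral[symmetric] countable_dual_lattice) auto
  also have "\<dots> = (\<integral>\<^sup>+\<omega>. P \<omega> \<partial>lborel)"
  proof (rule nn_integral_cong)
    fix \<omega> :: "real^'d"
    let ?\<alpha> = "\<omega> - reduce \<omega>"
    have a: "?\<alpha> \<in> dual_lattice" using dual_lattice_uminus[OF reduce_diff[of \<omega>]] by simp
    have "indicator cell (\<omega> - \<alpha>) = (indicator {?\<alpha>} \<alpha> :: ennreal)" if "\<alpha> \<in> dual_lattice" for \<alpha>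
    proof -
      have "?\<alpha> + - \<alpha> \<in> dual_lattice" by (intro dual_lattice_add a dual_lattice_uminus that)
      from cell_shift_iff[OF reduce_in_cell[of \<omega>] this] show ?thesis by (auto simp: indicator_def)
    qed
    then have "(\<integral>\<^sup>+\<alpha>. P \<omega> * indicator cell (\<omega> - \<alpha>) \<partial>count_space dual_lattice) = (\<integral>\<^sup>+\<alpha>. P \<omega> * indicator {?\<alpha>} \<alpha> \<partial>count_space dual_lattice)"
      by (intro nn_integral_cong) auto
    also have "\<dots> = P \<omega>" using a by (subst nn_integral_cmult) (auto simp: one_ennreal_def[symmetric])
    finally show "(\<integral>\<^sup>+\<alpha>. P \<omega> * indicator cell (\<omega> - \<alpha>) \<partial>count_space dual_lattice) = P \<omega>" .
  qed
  finally show ?thesis by simp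
qed

section \<open>Periodic multipliers of shift-invariant spaces\<close>

lemma ennreal_two_quarters:
  assumes "a < ennreal (e / 4)" "b < ennreal (e / 4)" "e > 0"
  shows "2 * a + 2 * b < ennreal e"
proof -
  obtain x where x: "x \<ge> 0" "a = ennreal x" using assms(1) by (cases a) auto
  obtain y where y: "y \<ge> 0" "b = ennreal y" using assms(2) by (cases b) auto
  have "x < e / 4" "y < e / 4" using assms x y by (simp_all add: ennreal_less_iff)
  then have "2 * x + 2 * y < e" by simp
  moreover have "2 * a + 2 * b = ennreal (2 * x + 2 * y)"
    unfolding x(2) y(2) using x(1) y(1) ennreal_mult[of 2 x] ennreal_mult[of 2 y]
    by (simp add: ennreal_plus)
  ultimately show ?thesis using x(1) y(1) by (simp add: ennreal_less_iff del: ennreal_plus)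
qed

text \<open>Functions \<open>P\<close> in the closure of the Fourier transforms of \<open>V\<close>. They are functions rather than
  distributions, so that closure arguments take place in the weighted \<open>L\<^sub>2\<close> space.\<close>

definition approximable :: "real \<Rightarrow> 'd::finite dist set \<Rightarrow> (real^'d \<Rightarrow> complex) \<Rightarrow> bool" where
  "approximable s V P \<longleftrightarrow> P \<in> borel_measurable borel \<and>
     (\<forall>e>0. \<exists>g\<in>V. energy (sobolev_weight s) (\<lambda>x. P x - hat g x) < ennreal e)"

lemma approximable_measurable: "approximable s V P \<Longrightarrow> P \<in> borel_measurable borel"
  by (simp add: approximable_def)

context
  fixes s :: real and V :: "'d::finite dist set"
  assumes V: "closed_W_subspace s V" and SI: "shift_invariant 1 V"
begin

lemma V_measurable: "g \<in> V \<Longrightarrow> hat g \<in> borel_measurable borel"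
  using closed_W_subspace_subset[OF V] hat_measurable by blast

lemma V_W: "g \<in> V \<Longrightarrow> g \<in> W s" using closed_W_subspace_subset[OF V] by blast

lemma approximable_hat: "g \<in> V \<Longrightarrow> approximable s V (hat g)"
  unfolding approximable_def by (auto simp: V_measurable energy_def intro!: bexI[of _ g])

lemma approximable_zero: "approximable s V (\<lambda>x. 0)"
proof -
  have "energy (sobolev_weight s) (\<lambda>x. 0 - hat (dist_zero :: 'd dist) x) = energy (sobolev_weight s) (\<lambda>x::real^'d. 0)"
    by (rule energy_cong_AE) (use hat_AE[OF represented_by_fourier_zero] in auto)
  then show ?thesis unfolding approximable_def using closed_W_subspace_zero[OF V]
    by (auto simp: energy_def intro!: bexI[of _ dist_zero])
qed

lemma energy_add_small:
  assumes "F \<in> borel_measurable borel" "G \<in> borel_measurable borel" "e > 0"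
    and "energy (sobolev_weight s) F < ennreal (e / 4)" "energy (sobolev_weight s) G < ennreal (e / 4)"
  shows "energy (sobolev_weight s) (\<lambda>x. F x + G x) < ennreal e"
proof -
  have "energy (sobolev_weight s) (\<lambda>x. F x + G x) \<le> 2 * energy (sobolev_weight s) F + 2 * energy (sobolev_weight s) G"
    by (intro energy_add_le assms) auto
  also have "\<dots> < ennreal e" by (rule ennreal_two_quarters[OF assms(4,5,3)])
  finally show ?thesis .
qed

lemma approximable_add:
  assumes P: "approximable s V P" and Q: "approximable s V Q"
  shows "approximable s V (\<lambda>x. P x + Q x)"
  unfolding approximable_def
proof (intro conjI allI impI)
  have [measurable]: "P \<in> borel_measurable borel" "Q \<in> borel_measurable borel"
    using P Q approximable_measurable by blast+
  show "(\<lambda>x. P x + Q x) \<in> borel_measurable borel" by measurable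
  fix e :: real assume e: "e > 0"
  then have e4: "e / 4 > 0" by simp
  obtain f where f: "f \<in> V" "energy (sobolev_weight s) (\<lambda>x. P x - hat f x) < ennreal (e / 4)" using P e4 unfolding approximable_def by blast
  obtain g where g: "g \<in> V" "energy (sobolev_weight s) (\<lambda>x. Q x - hat g x) < ennreal (e / 4)" using Q e4 unfolding approximable_def by blast
  have [measurable]: "hat f \<in> borel_measurable borel" "hat g \<in> borel_measurable borel" using f g V_measurable by auto
  have "energy (sobolev_weight s) (\<lambda>x. P x + Q x - hat (dist_add f g) x) = energy (sobolev_weight s) (\<lambda>x. (P x - hat f x) + (Q x - hat g x))"
    by (rule energy_cong_AE) (use hat_add[OF V_W[OF f(1)] V_W[OF g(1)]] in \<open>auto simp: algebra_simps\<close>)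
  also have "\<dots> < ennreal e" by (intro energy_add_small e f g) measurable
  finally show "\<exists>g\<in>V. energy (sobolev_weight s) (\<lambda>x. P x + Q x - hat g x) < ennreal e"
    using closed_W_subspace_add[OF V f(1) g(1)] by blast
qed

text \<open>An operator on \<open>V\<close> that acts on the Fourier transform as multiplication by a bounded function also
  acts on the closure.\<close>

lemma approximable_image:
  assumes P: "approximable s V P" and [measurable]: "m \<in> borel_measurable borel" and m: "\<And>x. cmod (m x) \<le> B"
    and T: "\<And>g. g \<in> V \<Longrightarrow> T g \<in> V \<and> (AE x in lborel. hat (T g) x = m x * hat g x)"
  shows "approximable s V (\<lambda>x. m x * P x)"
  unfolding approximable_def
proof (intro conjI allI impI)
  have [measurable]: "P \<in> borel_measurable borel" using P approximable_measurable by blast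
  show "(\<lambda>x. m x * P x) \<in> borel_measurable borel" by measurable
  fix e :: real assume e: "e > 0"
  let ?B = "1 + B\<^sup>2"
  have B: "?B > 0" by (simp add: add_pos_nonneg)
  obtain g where g: "g \<in> V" "energy (sobolev_weight s) (\<lambda>x. P x - hat g x) < ennreal (e / ?B)" using P e B unfolding approximable_def by (meson divide_pos_pos)
  have [measurable]: "hat g \<in> borel_measurable borel" using g V_measurable by auto
  have "energy (sobolev_weight s) (\<lambda>x. m x * P x - hat (T g) x) = energy (\<lambda>x. sobolev_weight s x * (cmod (m x))\<^sup>2) (\<lambda>x. P x - hat g x)"
  proof -
    have "energy (sobolev_weight s) (\<lambda>x. m x * P x - hat (T g) x) = energy (sobolev_weight s) (\<lambda>x. m x * (P x - hat g x))"
      by (rule energy_cong_AE) (use T[OF g(1)] in \<open>auto simp: algebra_simps\<close>)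
    then show ?thesis unfolding energy_def by (simp add: norm_mult power_mult_distrib mult.assoc)
  qed
  also have "\<dots> \<le> ennreal ?B * energy (sobolev_weight s) (\<lambda>x. P x - hat g x)"
  proof (rule energy_mono_weight)
    fix x
    have "(cmod (m x))\<^sup>2 \<le> B\<^sup>2" using m by (intro power_mono) auto
    then have "(cmod (m x))\<^sup>2 \<le> ?B" by simp
    from mult_left_mono[OF this, of "sobolev_weight s x"] show "sobolev_weight s x * (cmod (m x))\<^sup>2 \<le> ?B * sobolev_weight s x" by (simp add: mult.commute)
  qed (use B in auto)
  also have "\<dots> < ennreal ?B * ennreal (e / ?B)" using g(2) B by (intro ennreal_mult_strict_left_mono) (auto simp del: ennreal_plus)
  also have "\<dots> = ennreal e" using B e by (subst ennreal_mult[symmetric]) auto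
  finally show "\<exists>g\<in>V. energy (sobolev_weight s) (\<lambda>x. m x * P x - hat g x) < ennreal e" using T[OF g(1)] by blast
qed

lemma approximable_scale: "approximable s V P \<Longrightarrow> approximable s V (\<lambda>x. c * P x)"
  by (rule approximable_image[where T="dist_scale c" and B="cmod c"])
     (auto simp: closed_W_subspace_scale[OF V] hat_scale[OF V_W])

lemma approximable_character:
  assumes "approximable s V P" "a \<in> integer_lattice"
  shows "approximable s V (\<lambda>x. character a x * P x)"
proof (rule approximable_image[OF assms(1), where T="dist_translate a" and B=1])
  show "dist_translate a g \<in> V \<and> (AE x in lborel. hat (dist_translate a g) x = character a x * hat g x)" if "g \<in> V" for g
    using SI that assms(2) hat_translate[OF V_W[OF that], of a] unfolding shift_invariant_def by auto
qed auto

lemma approximable_limit: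
  assumes [measurable]: "P \<in> borel_measurable borel"
    and lim: "\<And>e. e > 0 \<Longrightarrow> \<exists>Q. approximable s V Q \<and> energy (sobolev_weight s) (\<lambda>x. P x - Q x) < ennreal e"
  shows "approximable s V P"
  unfolding approximable_def
proof (intro conjI allI impI)
  fix e :: real assume e: "e > 0"
  then have e4: "e / 4 > 0" by simp
  obtain Q where Q: "approximable s V Q" "energy (sobolev_weight s) (\<lambda>x. P x - Q x) < ennreal (e / 4)" using lim[OF e4] by blast
  obtain g where g: "g \<in> V" "energy (sobolev_weight s) (\<lambda>x. Q x - hat g x) < ennreal (e / 4)" using Q(1) e4 unfolding approximable_def by blast
  have [measurable]: "hat g \<in> borel_measurable borel" "Q \<in> borel_measurable borel" using g V_measurable Q approximable_measurable by auto
  have "energy (sobolev_weight s) (\<lambda>x. (P x - Q x) + (Q x - hat g x)) < ennreal e"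
    by (intro energy_add_small e Q g) measurable
  then show "\<exists>g\<in>V. energy (sobolev_weight s) (\<lambda>x. P x - hat g x) < ennreal e" using g(1) by auto
qed (rule assms(1))

lemma approximable_sum: "finite I \<Longrightarrow> (\<And>i. i \<in> I \<Longrightarrow> approximable s V (P i)) \<Longrightarrow> approximable s V (\<lambda>x. \<Sum>i\<in>I. P i x)"
  by (induction I rule: finite_induct) (auto simp: approximable_zero approximable_add)

text \<open>Dominated convergence with the majorant \<open>4 B\<^sup>2 |P|\<^sup>2\<close>. Through this lemma the class of admissible
  periodic multipliers grows from trigonometric polynomials to bounded Borel functions.\<close>

lemma approximable_bounded_limit:
  assumes [measurable]: "P \<in> borel_measurable borel" "m \<in> borel_measurable borel" "\<And>n. M n \<in> borel_measurable borel"
    and P: "energy (sobolev_weight s) P < \<infinity>"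
    and B: "\<And>n x. cmod (M n x) \<le> B" "\<And>x. cmod (m x) \<le> B"
    and lim: "\<And>x. (\<lambda>n. M n x) \<longlonglongrightarrow> m x"
    and A: "\<And>n. approximable s V (\<lambda>x. M n x * P x)"
  shows "approximable s V (\<lambda>x. m x * P x)"
proof (rule approximable_limit)
  fix e :: real assume e: "e > 0"
  have "(\<lambda>n. \<integral>\<^sup>+x. ennreal (sobolev_weight s x * (cmod (m x * P x - M n x * P x))\<^sup>2) \<partial>lborel) \<longlonglongrightarrow> (\<integral>\<^sup>+x. 0 \<partial>(lborel :: (real^'d) measure))"
  proof (rule nn_integral_dominated_convergence)
    show "AE x in lborel. ennreal (sobolev_weight s x * (cmod (m x * P x - M n x * P x))\<^sup>2) \<le> ennreal ((2 * B)\<^sup>2) * ennreal (sobolev_weight s x * (cmod (P x))\<^sup>2)" for n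
    proof (rule AE_I2)
      fix x
      have "cmod (m x - M n x) \<le> 2 * B" using norm_triangle_ineq4[of "m x" "M n x"] B(1)[of n x] B(2)[of x] by linarith
      then have "(cmod (m x - M n x))\<^sup>2 \<le> (2 * B)\<^sup>2" by (intro power_mono) auto
      then have "sobolev_weight s x * ((cmod (m x - M n x))\<^sup>2 * (cmod (P x))\<^sup>2) \<le> sobolev_weight s x * ((2 * B)\<^sup>2 * (cmod (P x))\<^sup>2)"
        by (intro mult_left_mono mult_right_mono) auto
      also have "m x * P x - M n x * P x = (m x - M n x) * P x" by (simp add: algebra_simps)
      then have "sobolev_weight s x * ((cmod (m x - M n x))\<^sup>2 * (cmod (P x))\<^sup>2) = sobolev_weight s x * (cmod (m x * P x - M n x * P x))\<^sup>2"
        by (simp add: norm_mult power_mult_distrib)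
      finally show "ennreal (sobolev_weight s x * (cmod (m x * P x - M n x * P x))\<^sup>2) \<le> ennreal ((2 * B)\<^sup>2) * ennreal (sobolev_weight s x * (cmod (P x))\<^sup>2)"
        by (subst ennreal_mult[symmetric]) (auto simp: mult_ac intro!: ennreal_leI)
    qed
    show "(\<integral>\<^sup>+x. ennreal ((2 * B)\<^sup>2) * ennreal (sobolev_weight s x * (cmod (P x))\<^sup>2) \<partial>lborel) < \<infinity>"
      using P unfolding energy_def by (simp add: nn_integral_cmult ennreal_mult_less_top)
    show "AE x in lborel. (\<lambda>n. ennreal (sobolev_weight s x * (cmod (m x * P x - M n x * P x))\<^sup>2)) \<longlonglongrightarrow> 0"
    proof (rule AE_I2)
      fix x
      have "(\<lambda>n. sobolev_weight s x * (cmod (m x * P x - M n x * P x))\<^sup>2) \<longlonglongrightarrow> sobolev_weight s x * (cmod (m x * P x - m x * P x))\<^sup>2"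
        by (intro tendsto_intros lim)
      from tendsto_ennrealI[OF this] show "(\<lambda>n. ennreal (sobolev_weight s x * (cmod (m x * P x - M n x * P x))\<^sup>2)) \<longlonglongrightarrow> 0" by simp
    qed
  qed measurable
  then have "(\<lambda>n. energy (sobolev_weight s) (\<lambda>x. m x * P x - M n x * P x)) \<longlonglongrightarrow> 0" by (simp add: energy_def)
  then have "\<forall>\<^sub>F n in sequentially. energy (sobolev_weight s) (\<lambda>x. m x * P x - M n x * P x) < ennreal e"
    by (rule order_tendstoD(2)) (use e in simp)
  then obtain n where "energy (sobolev_weight s) (\<lambda>x. m x * P x - M n x * P x) < ennreal e"
    using eventually_happens sequentially_bot by blast
  then show "\<exists>Q. approximable s V Q \<and> energy (sobolev_weight s) (\<lambda>x. m x * P x - Q x) < ennreal e" using A by blast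
qed measurable

end

inductive trig_polynomial :: "(real^'d::finite \<Rightarrow> complex) \<Rightarrow> bool" where
  character: "a \<in> integer_lattice \<Longrightarrow> trig_polynomial (\<lambda>\<omega>. c * character a \<omega>)"
| add: "trig_polynomial p \<Longrightarrow> trig_polynomial q \<Longrightarrow> trig_polynomial (\<lambda>\<omega>. p \<omega> + q \<omega>)"

lemma integer_lattice_add: "a \<in> integer_lattice \<Longrightarrow> b \<in> integer_lattice \<Longrightarrow> a + b \<in> integer_lattice"
  by (simp add: integer_lattice_def)

lemma trig_polynomial_const: "trig_polynomial (\<lambda>\<omega>. c)"
  using trig_polynomial.character[of 0 c] by (simp add: integer_lattice_def)

lemma trig_polynomial_mult: assumes "trig_polynomial p" "trig_polynomial q" shows "trig_polynomial (\<lambda>\<omega>. p \<omega> * q \<omega>)"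
  using assms(1)
proof induction
  case (character a c)
  note a = character
  show ?case using assms(2)
  proof induction
    case (character b e)
    have "c * character a \<omega> * (e * character b \<omega>) = (c * e) * character (a + b) \<omega>" for \<omega>
      unfolding character_add by (simp add: mult_ac)
    then show ?case using trig_polynomial.character[OF integer_lattice_add[OF a character], of "c * e"] by (simp only:)
  next
    case (add p q)
    then show ?case using trig_polynomial.add by (simp add: distrib_left)
  qed
next
  case (add p q)
  then show ?case using trig_polynomial.add by (simp add: distrib_right)
qed

lemma trig_polynomial_sum: "finite I \<Longrightarrow> (\<And>i. i \<in> I \<Longrightarrow> trig_polynomial (p i)) \<Longrightarrow> trig_polynomial (\<lambda>\<omega>. \<Sum>i\<in>I. p i \<omega>)"
  by (induction I rule: finite_induct) (auto simp: trig_polynomial_const intro: trig_polynomial.add)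

lemma trig_polynomial_coordinate:
  "trig_polynomial (\<lambda>\<omega>. complex_of_real (cos (\<omega> $ j)))" "trig_polynomial (\<lambda>\<omega>. complex_of_real (sin (\<omega> $ j)))"
proof -
  let ?e = "\<lambda>\<omega>. character (axis j 1) \<omega>" and ?f = "\<lambda>\<omega>. character (axis j (-1)) \<omega>"
  have lat: "axis j 1 \<in> integer_lattice" "axis j (-1) \<in> integer_lattice"
    by (auto simp: integer_lattice_def axis_def)
  have e: "character (axis j 1) \<omega> = cis (- (\<omega> $ j))" "character (axis j (-1)) \<omega> = cis (\<omega> $ j)" for \<omega>
    by (simp_all add: inner_commute[of _ \<omega>] inner_axis cis_conv_exp)
  have "trig_polynomial (\<lambda>\<omega>. 1/2 * character (axis j 1) \<omega> + 1/2 * character (axis j (-1)) \<omega>)"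
    by (intro trig_polynomial.add trig_polynomial.character lat)
  moreover have "(\<lambda>\<omega>::real^'a. 1/2 * cis (- (\<omega> $ j)) + 1/2 * cis (\<omega> $ j)) = (\<lambda>\<omega>. complex_of_real (cos (\<omega> $ j)))"
    by (auto simp: fun_eq_iff complex_eq_iff)
  ultimately show "trig_polynomial (\<lambda>\<omega>::real^'a. complex_of_real (cos (\<omega> $ j)))" unfolding e by simp
  have "trig_polynomial (\<lambda>\<omega>. \<i>/2 * character (axis j 1) \<omega> + (-\<i>/2) * character (axis j (-1)) \<omega>)"
    by (intro trig_polynomial.add trig_polynomial.character lat)
  moreover have "(\<lambda>\<omega>::real^'a. \<i>/2 * cis (- (\<omega> $ j)) + (-\<i>/2) * cis (\<omega> $ j)) = (\<lambda>\<omega>. complex_of_real (sin (\<omega> $ j)))"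
    by (auto simp: fun_eq_iff complex_eq_iff)
  ultimately show "trig_polynomial (\<lambda>\<omega>::real^'a. complex_of_real (sin (\<omega> $ j)))" unfolding e by simp
qed

lemma trig_polynomial_torus_linear:
  fixes f :: "complex^'d::finite \<Rightarrow> real"
  assumes "bounded_linear f"
  shows "trig_polynomial (\<lambda>\<omega>. complex_of_real (f (torus \<omega>)))"
proof -
  interpret f: bounded_linear f by fact
  have eq: "f (torus \<omega>) = (\<Sum>j\<in>UNIV. cos (\<omega> $ j) * f (axis j 1) + sin (\<omega> $ j) * f (axis j \<i>))" for \<omega>
  proof -
    have "torus \<omega> = (\<Sum>j\<in>UNIV. cos (\<omega> $ j) *\<^sub>R axis j 1 + sin (\<omega> $ j) *\<^sub>R axis j \<i>)"
    proof (subst vec_eq_iff, rule allI)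
      fix i
      have "(\<Sum>j\<in>UNIV. cos (\<omega> $ j) *\<^sub>R axis j 1 + sin (\<omega> $ j) *\<^sub>R axis j \<i>) $ i = (\<Sum>j\<in>UNIV. if i = j then cis (\<omega> $ j) else 0)"
        unfolding sum_component by (intro sum.cong) (auto simp: axis_def complex_eq_iff)
      then show "torus \<omega> $ i = (\<Sum>j\<in>UNIV. cos (\<omega> $ j) *\<^sub>R axis j 1 + sin (\<omega> $ j) *\<^sub>R axis j \<i>) $ i"
        by (simp add: torus_def)
    qed
    then show ?thesis by (simp add: f.sum f.add f.scaleR)
  qed
  have "trig_polynomial (\<lambda>\<omega>. \<Sum>j\<in>UNIV. complex_of_real (cos (\<omega> $ j)) * complex_of_real (f (axis j 1)) + complex_of_real (sin (\<omega> $ j)) * complex_of_real (f (axis j \<i>)))"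
    by (intro trig_polynomial_sum trig_polynomial.add trig_polynomial_mult trig_polynomial_coordinate trig_polynomial_const) auto
  then show ?thesis unfolding eq by simp
qed

text \<open>Real polynomials on the torus are trigonometric polynomials, which makes the Stone-Weierstrass theorem on
  a ball that contains the torus applicable.\<close>

lemma trig_polynomial_of_torus_polynomial:
  assumes "real_polynomial_function p"
  shows "trig_polynomial (\<lambda>\<omega>. complex_of_real (p (torus \<omega>)))"
  using assms
proof induction
  case (add f g)
  then show ?case using trig_polynomial.add by simp
next
  case (mult f g)
  then show ?case using trig_polynomial_mult by simp
qed (auto intro: trig_polynomial_torus_linear trig_polynomial_const)

lemma torus_bounded: "torus \<omega> \<in> cball 0 (real CARD('d))" for \<omega> :: "real^'d::finite"
proof -
  have "norm (torus \<omega>) \<le> (\<Sum>j\<in>(UNIV::'d set). norm (torus \<omega> $ j))"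
    unfolding norm_vec_def by (rule L2_set_le_sum) simp
  then show ?thesis by (simp add: torus_def)
qed

context
  fixes s :: real and V :: "'d::finite dist set" and P :: "real^'d \<Rightarrow> complex"
  assumes V: "closed_W_subspace s V" and SI: "shift_invariant 1 V"
    and P: "approximable s V P" and EP: "energy (sobolev_weight s) P < \<infinity>"
begin

lemma P_measurable [measurable]: "P \<in> borel_measurable borel"
  using P by (rule approximable_measurable)

lemma approximable_trig_polynomial: "trig_polynomial m \<Longrightarrow> approximable s V (\<lambda>x. m x * P x)"
proof (induction rule: trig_polynomial.induct)
  case (character a c)
  then show ?case using approximable_scale[OF V SI approximable_character[OF V SI P character], of c] by (simp add: mult.assoc)
next
  case (add p q)
  then show ?case using approximable_add[OF V SI] by (simp add: distrib_right)
qed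

lemma approximable_torus_continuous:
  fixes q :: "complex^'d \<Rightarrow> real"
  assumes q: "continuous_on UNIV q"
  shows "approximable s V (\<lambda>x. complex_of_real (q (torus x)) * P x)"
proof (rule approximable_limit[OF V SI])
  have [measurable]: "q \<in> borel_measurable borel" using q by (rule borel_measurable_continuous_onI)
  show "(\<lambda>x. complex_of_real (q (torus x)) * P x) \<in> borel_measurable borel" by measurable
  fix e :: real assume e: "e > 0"
  obtain r where r: "r \<ge> 0" "energy (sobolev_weight s) P = ennreal r" using EP by (cases "energy (sobolev_weight s) P") auto
  define \<delta> where "\<delta> = sqrt (e / (r + 1))"
  have \<delta>: "\<delta> > 0" "\<delta>\<^sup>2 = e / (r + 1)" unfolding \<delta>_def using e r by auto
  obtain p where p: "real_polynomial_function p" "\<And>z. z \<in> cball 0 (real CARD('d)) \<Longrightarrow> \<bar>q z - p z\<bar> < \<delta>"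
    using Stone_Weierstrass_real_polynomial_function[OF compact_cball continuous_on_subset[OF q subset_UNIV] \<delta>(1)] by metis
  have [measurable]: "p \<in> borel_measurable borel"
    using continuous_on_polymonial_function[of p UNIV] p(1) by (intro borel_measurable_continuous_onI) (simp add: real_polynomial_function_eq)
  have "energy (sobolev_weight s) (\<lambda>x. complex_of_real (q (torus x)) * P x - complex_of_real (p (torus x)) * P x)
      = energy (\<lambda>x. sobolev_weight s x * (q (torus x) - p (torus x))\<^sup>2) P"
  proof -
    have "cmod (complex_of_real (q (torus x)) * P x - complex_of_real (p (torus x)) * P x) = \<bar>q (torus x) - p (torus x)\<bar> * cmod (P x)" for x
    proof -
      have "complex_of_real (q (torus x)) * P x - complex_of_real (p (torus x)) * P x = complex_of_real (q (torus x) - p (torus x)) * P x"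
        by (simp add: algebra_simps)
      then show ?thesis by (simp only: norm_mult norm_of_real)
    qed
    then show ?thesis unfolding energy_def by (simp add: power_mult_distrib mult.assoc)
  qed
  also have "\<dots> \<le> ennreal (\<delta>\<^sup>2) * energy (sobolev_weight s) P"
  proof (rule energy_mono_weight)
    fix x
    have "(q (torus x) - p (torus x))\<^sup>2 \<le> \<delta>\<^sup>2"
      using p(2)[OF torus_bounded[of x]] \<delta>(1) by (intro abs_le_square_iff[THEN iffD1]) auto
    from mult_left_mono[OF this, of "sobolev_weight s x"] show "sobolev_weight s x * (q (torus x) - p (torus x))\<^sup>2 \<le> \<delta>\<^sup>2 * sobolev_weight s x" by (simp add: mult.commute)
  qed auto
  also have "\<dots> = ennreal (\<delta>\<^sup>2 * r)" unfolding r(2) using r(1) by (simp add: ennreal_mult)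
  also have "\<dots> < ennreal e"
  proof -
    have "e * r < e * (r + 1)" using e by (intro mult_strict_left_mono) auto
    then have "\<delta>\<^sup>2 * r < e" using r(1) unfolding \<delta>(2) by (simp add: field_simps)
    then show ?thesis using e r(1) by (simp add: ennreal_less_iff)
  qed
  finally show "\<exists>Q. approximable s V Q \<and> energy (sobolev_weight s) (\<lambda>x. complex_of_real (q (torus x)) * P x - Q x) < ennreal e"
    using approximable_trig_polynomial[OF trig_polynomial_of_torus_polynomial[OF p(1)]] by blast
qed

lemma approximable_torus_open:
  assumes U: "open U"
  shows "approximable s V (\<lambda>x. indicator U (torus x) * P x)"
proof (cases "U = UNIV")
  case True
  then show ?thesis using P by simp
next
  case False
  have [measurable]: "U \<in> sets borel" using U by simp
  define q where "q n z = min 1 (real n * infdist z (- U))" for n and z :: "complex^'d"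
  have q: "continuous_on UNIV (q n)" for n unfolding q_def by (intro continuous_intros)
  have [measurable]: "q n \<in> borel_measurable borel" for n using q by (rule borel_measurable_continuous_onI)
  have b: "0 \<le> q n z" "q n z \<le> 1" for n z unfolding q_def by (auto simp: infdist_nonneg)
  have lim: "(\<lambda>n. q n z) \<longlonglongrightarrow> indicator U z" for z
  proof (cases "z \<in> U")
    case True
    have "infdist z (- U) \<noteq> 0"
      using True U False in_closed_iff_infdist_zero[of "- U" z] by auto
    then have i: "infdist z (- U) > 0" using infdist_nonneg[of z "- U"] by linarith
    obtain N :: nat where N: "real N > 1 / infdist z (- U)" using reals_Archimedean2 by blast
    have "\<forall>\<^sub>F n in sequentially. 1 = q n z"
      using eventually_ge_at_top[of N]
    proof eventually_elim
      case (elim n)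
      then have "1 / infdist z (- U) < real n" using N by linarith
      then have "1 < real n * infdist z (- U)" using i by (simp add: field_simps)
      then show ?case by (simp add: q_def)
    qed
    then show ?thesis using True by (simp add: tendsto_cong[THEN iffD1, OF _ tendsto_const])
  next
    case z: False
    then have "infdist z (- U) = 0" using infdist_zero by blast
    then show ?thesis using z by (simp add: q_def)
  qed
  have limc: "(\<lambda>n. complex_of_real (q n z)) \<longlonglongrightarrow> indicator U z" for z
    using tendsto_of_real[OF lim[of z], where 'a=complex] by (cases "z \<in> U") simp_all
  show ?thesis
  proof (rule approximable_bounded_limit[OF V SI, where M="\<lambda>n x. complex_of_real (q n (torus x))" and B=1])
    show "cmod (complex_of_real (q n (torus x))) \<le> 1" for n x using b by simp
    show "cmod (indicator U (torus x)) \<le> 1" for x by (simp add: indicator_def)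
    show "approximable s V (\<lambda>x. complex_of_real (q n (torus x)) * P x)" for n by (rule approximable_torus_continuous[OF q])
    show "(\<lambda>n. complex_of_real (q n (torus x))) \<longlonglongrightarrow> indicator U (torus x)" for x by (rule limc)
    show "(\<lambda>x. indicator U (torus x) :: complex) \<in> borel_measurable borel" by measurable
    show "energy (sobolev_weight s) P < \<infinity>" by (rule EP)
  qed measurable
qed

lemma approximable_torus_borel:
  assumes "B \<in> sets borel"
  shows "approximable s V (\<lambda>x. indicator B (torus x) * P x)"
proof -
  have "Int_stable {U :: (complex^'d) set. open U}" by (auto simp: Int_stable_def)
  moreover have "{U :: (complex^'d) set. open U} \<subseteq> Pow UNIV" by simp
  moreover have "B \<in> sigma_sets UNIV {U. open U}" using assms by (simp add: borel_def sets_measure_of)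
  ultimately show ?thesis
  proof (induction rule: sigma_sets_induct_disjoint)
    case (basic U)
    then show ?case by (simp add: approximable_torus_open)
  next
    case empty
    then show ?case by (simp add: approximable_zero[OF V SI])
  next
    case (compl A)
    have "(\<lambda>x. indicator (UNIV - A) (torus x) * P x) = (\<lambda>x. P x + (- 1) * (indicator A (torus x) * P x))"
      by (auto simp: indicator_def)
    then show ?case using approximable_add[OF V SI P approximable_scale[OF V SI compl(2), of "- 1"]] by simp
  next
    case (union A)
    then have A[measurable]: "A i \<in> sets borel" for i by (auto simp: borel_def sets_measure_of)
    have f: "approximable s V (\<lambda>x. indicator (\<Union>i<n. A i) (torus x) * P x)" for n
    proof -
      have "disjoint_family_on A {..<n}" using union(1) by (auto simp: disjoint_family_on_def)
      then have "(\<lambda>x. indicator (\<Union>i<n. A i) (torus x) * P x) = (\<lambda>x. \<Sum>i<n. indicator (A i) (torus x) * P x)"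
        by (auto simp: indicator_UN_disjoint sum_distrib_right)
      then show ?thesis using approximable_sum[OF V SI finite_lessThan union(3)] by (simp only:)
    qed
    show ?case
    proof (rule approximable_bounded_limit[OF V SI, where M="\<lambda>n x. indicator (\<Union>i<n. A i) (torus x)" and B=1])
      show "cmod (indicator (\<Union>i<n. A i) (torus x)) \<le> 1" for n x by (simp add: indicator_def)
      show "cmod (indicator (\<Union>i. A i) (torus x)) \<le> 1" for x by (simp add: indicator_def)
      show "approximable s V (\<lambda>x. indicator (\<Union>i<n. A i) (torus x) * P x)" for n by (rule f)
      show "(\<lambda>n. indicator (\<Union>i<n. A i) (torus x) :: complex) \<longlonglongrightarrow> indicator (\<Union>i. A i) (torus x)" for x by (rule LIMSEQ_indicator_UN)
      have mi: "(\<lambda>x. indicator B (torus x) :: complex) \<in> borel_measurable borel" if [measurable]: "B \<in> sets borel" for B :: "(complex^'d) set"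
        by measurable
      show "(\<lambda>x. indicator (\<Union>i. A i) (torus x) :: complex) \<in> borel_measurable borel" by (rule mi) (use A in auto)
      show "(\<lambda>x. indicator (\<Union>i<n. A i) (torus x) :: complex) \<in> borel_measurable borel" for n by (rule mi) (use A in auto)
    qed (rule P_measurable EP)+
  qed
qed

lemma approximable_torus_bounded:
  fixes m :: "complex^'d \<Rightarrow> complex"
  assumes m[measurable]: "m \<in> borel_measurable borel" and B: "\<And>z. cmod (m z) \<le> B"
  shows "approximable s V (\<lambda>x. m (torus x) * P x)"
proof -
  obtain S where S: "\<And>i. simple_function borel (S i)" "\<And>z. (\<lambda>i. S i z) \<longlonglongrightarrow> m z" "\<And>i z. dist (S i z) 0 \<le> 2 * dist (m z) 0"
    using borel_measurable_implies_sequence_metric[OF m, of 0] by auto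
  have [measurable]: "S i \<in> borel_measurable borel" for i using S(1) by (rule borel_measurable_simple_function)
  have A: "approximable s V (\<lambda>x. S i (torus x) * P x)" for i
  proof -
    have fin: "finite (range (S i))" using simple_functionD(1)[OF S(1)[of i]] by simp
    have eq: "(\<lambda>x. S i (torus x) * P x) = (\<lambda>x. \<Sum>y\<in>range (S i). y * (indicator (S i -` {y}) (torus x) * P x))"
    proof
      fix x
      have "(\<Sum>y\<in>range (S i). y * (indicator (S i -` {y}) (torus x) * P x)) = (\<Sum>y\<in>range (S i). if y = S i (torus x) then y * P x else 0)"
        by (intro sum.cong) (auto simp: indicator_def)
      then show "S i (torus x) * P x = (\<Sum>y\<in>range (S i). y * (indicator (S i -` {y}) (torus x) * P x))"
        using fin by simp
    qed
    show ?thesis unfolding eq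
    proof (intro approximable_sum[OF V SI] fin approximable_scale[OF V SI] approximable_torus_borel)
      fix y show "S i -` {y} \<in> sets borel" using simple_functionD(2)[OF S(1)[of i], of "{y}"] by simp
    qed
  qed
  have B0: "B \<ge> 0" using B[of 0] norm_ge_zero order_trans by blast
  show ?thesis
  proof (rule approximable_bounded_limit[OF V SI, where M="\<lambda>i x. S i (torus x)" and B="2 * B"])
    show "cmod (S i (torus x)) \<le> 2 * B" for i x using S(3)[of i "torus x"] B[of "torus x"] by simp
    show "cmod (m (torus x)) \<le> 2 * B" for x using B[of "torus x"] B0 by simp
  qed (use EP in \<open>auto intro: A S(2)\<close>)
qed

text \<open>A shift-invariant space is, on the Fourier side, a module over the trigonometric polynomials. Its closure
  is a module over all bounded Borel periodic functions: continuous functions on the torus are uniform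
  limits of trigonometric polynomials, indicators of open sets are monotone limits of continuous functions, the sets
  whose indicators are admissible form a Dynkin system, and simple functions approximate the rest.\<close>

lemma approximable_reduce:
  fixes m :: "real^'d \<Rightarrow> complex"
  assumes [measurable]: "m \<in> borel_measurable borel" and B: "\<And>x. cmod (m x) \<le> B"
  shows "approximable s V (\<lambda>x. m (reduce x) * P x)"
  unfolding reduce_def
  by (rule approximable_torus_bounded[of "\<lambda>z. m (torus_arg z)", OF _ B]) measurable

end

section \<open>Approximation from fiberwise data\<close>

definition fiber_energy :: "(real^'d::finite \<Rightarrow> real) \<Rightarrow> (real^'d \<Rightarrow> complex) \<Rightarrow> real^'d \<Rightarrow> ennreal" where
  "fiber_energy w F = fiber_sum dual_lattice (\<lambda>x. ennreal (w x * (cmod (F x))\<^sup>2))"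

text \<open>The function \<open>v\<^sup>* \<Phi>\<close> on the Fourier side. The conjugate matches the one in \<open>hermitian_form\<close>, which makes
  \<open>v\<^sup>* G v\<close> the energy of the combination on a fiber.\<close>

definition combination :: "'d::finite dist set \<Rightarrow> ('d dist \<Rightarrow> complex) \<Rightarrow> real^'d \<Rightarrow> complex" where
  "combination \<Phi> v x = (\<Sum>\<phi>\<in>\<Phi>. cnj (v \<phi>) * hat \<phi> x)"

text \<open>At \<open>\<omega>\<close> in \<open>cell\<close> the indicator of \<open>cell\<close> restricts to the unit vector at \<open>\<alpha> = 0\<close> on the fiber through
  \<open>\<omega>\<close>. This is the squared distance of that unit vector from a linear combination of the generators.\<close>

definition fiber_error :: "real \<Rightarrow> real \<Rightarrow> 'd::finite dist set \<Rightarrow> ('d dist \<Rightarrow> complex) \<Rightarrow> real^'d \<Rightarrow> ennreal" where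
  "fiber_error h s \<Phi> v = fiber_energy (weight h s) (\<lambda>x. indicator cell x - combination \<Phi> v x)"

lemma fiber_energy_measurable [measurable]:
  assumes [measurable]: "w \<in> borel_measurable borel" "F \<in> borel_measurable borel"
  shows "fiber_energy w F \<in> borel_measurable borel"
  unfolding fiber_energy_def by (intro fiber_sum_measurable countable_dual_lattice) measurable

lemma energy_fibers:
  assumes [measurable]: "w \<in> borel_measurable borel" "F \<in> borel_measurable borel"
  shows "energy w F = (\<integral>\<^sup>+\<omega>. fiber_energy w F \<omega> * indicator cell \<omega> \<partial>lborel)"
  unfolding energy_def fiber_energy_def by (rule nn_integral_fibers) measurable

lemma fiber_energy_cong:
  "(\<And>\<alpha>. \<alpha> \<in> dual_lattice \<Longrightarrow> F (\<omega> + \<alpha>) = G (\<omega> + \<alpha>)) \<Longrightarrow> fiber_energy w F \<omega> = fiber_energy w G \<omega>"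
  unfolding fiber_energy_def fiber_sum_def by (intro nn_integral_cong) auto

lemma fiber_energy_add_le:
  assumes w: "\<And>x. w x \<ge> 0"
  shows "fiber_energy w (\<lambda>x. F x + G x) \<omega> \<le> 2 * fiber_energy w F \<omega> + 2 * fiber_energy w G \<omega>"
proof -
  have "fiber_energy w (\<lambda>x. F x + G x) \<omega> \<le> (\<integral>\<^sup>+\<alpha>. ennreal 2 * ennreal (w (\<omega> + \<alpha>) * (cmod (F (\<omega> + \<alpha>)))\<^sup>2) + ennreal 2 * ennreal (w (\<omega> + \<alpha>) * (cmod (G (\<omega> + \<alpha>)))\<^sup>2) \<partial>count_space dual_lattice)"
    unfolding fiber_energy_def fiber_sum_def
  proof (rule nn_integral_mono)
    fix \<alpha>
    let ?x = "\<omega> + \<alpha>"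
    have "w ?x * (cmod (F ?x + G ?x))\<^sup>2 \<le> w ?x * (2 * (cmod (F ?x))\<^sup>2 + 2 * (cmod (G ?x))\<^sup>2)"
      by (intro mult_left_mono cmod_add_square_le w)
    also have "\<dots> = 2 * (w ?x * (cmod (F ?x))\<^sup>2) + 2 * (w ?x * (cmod (G ?x))\<^sup>2)" by (simp add: algebra_simps)
    finally show "ennreal (w ?x * (cmod (F ?x + G ?x))\<^sup>2) \<le> ennreal 2 * ennreal (w ?x * (cmod (F ?x))\<^sup>2) + ennreal 2 * ennreal (w ?x * (cmod (G ?x))\<^sup>2)"
      using w by (simp add: ennreal_mult[symmetric] ennreal_plus[symmetric] ennreal_leI del: ennreal_plus ennreal_numeral)
  qed
  also have "\<dots> = 2 * fiber_energy w F \<omega> + 2 * fiber_energy w G \<omega>"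
    unfolding fiber_energy_def fiber_sum_def by (subst nn_integral_add) (auto simp: nn_integral_cmult)
  finally show ?thesis .
qed

lemma fiber_energy_scale:
  assumes "\<And>\<alpha>. \<alpha> \<in> dual_lattice \<Longrightarrow> G (\<omega> + \<alpha>) = c * F (\<omega> + \<alpha>)"
  shows "fiber_energy w G \<omega> = ennreal ((cmod c)\<^sup>2) * fiber_energy w F \<omega>"
proof -
  have "ennreal (w (\<omega> + \<alpha>) * (cmod (G (\<omega> + \<alpha>)))\<^sup>2) = ennreal ((cmod c)\<^sup>2) * ennreal (w (\<omega> + \<alpha>) * (cmod (F (\<omega> + \<alpha>)))\<^sup>2)" if "\<alpha> \<in> dual_lattice" for \<alpha>
    unfolding assms[OF that] by (simp add: norm_mult power_mult_distrib ennreal_mult'[symmetric] mult_ac)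
  then have "fiber_energy w G \<omega> = (\<integral>\<^sup>+\<alpha>. ennreal ((cmod c)\<^sup>2) * ennreal (w (\<omega> + \<alpha>) * (cmod (F (\<omega> + \<alpha>)))\<^sup>2) \<partial>count_space dual_lattice)"
    unfolding fiber_energy_def fiber_sum_def by (intro nn_integral_cong) auto
  also have "\<dots> = ennreal ((cmod c)\<^sup>2) * fiber_energy w F \<omega>"
    unfolding fiber_energy_def fiber_sum_def by (rule nn_integral_cmult) simp
  finally show ?thesis .
qed

lemma fiber_energy_mono_weight:
  assumes "\<And>\<alpha>. \<alpha> \<in> dual_lattice \<Longrightarrow> w' (\<omega> + \<alpha>) \<le> c * w (\<omega> + \<alpha>)" "c \<ge> 0"
  shows "fiber_energy w' F \<omega> \<le> ennreal c * fiber_energy w F \<omega>"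
proof -
  have "fiber_energy w' F \<omega> \<le> (\<integral>\<^sup>+\<alpha>. ennreal c * ennreal (w (\<omega> + \<alpha>) * (cmod (F (\<omega> + \<alpha>)))\<^sup>2) \<partial>count_space dual_lattice)"
    unfolding fiber_energy_def fiber_sum_def
    using assms mult_right_mono[OF assms(1)]
    by (intro nn_integral_mono) (simp add: ennreal_mult'[symmetric] mult.assoc[symmetric] ennreal_leI)
  also have "\<dots> = ennreal c * fiber_energy w F \<omega>"
    unfolding fiber_energy_def fiber_sum_def by (rule nn_integral_cmult) simp
  finally show ?thesis .
qed

lemma AE_shift_dual_lattice:
  fixes P :: "real^'d::finite \<Rightarrow> bool"
  assumes "AE x in lborel. P x"
  shows "AE \<omega> in lborel. \<forall>\<alpha>\<in>dual_lattice. P (\<omega> + \<alpha>)"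
proof -
  have "AE \<omega> in lborel. P (\<omega> + \<alpha>)" for \<alpha> :: "real^'d"
    using AE_lborel_affine[OF assms, of 1 \<alpha>] by (simp add: add.commute)
  then show ?thesis by (intro AE_ball_countable[THEN iffD2] countable_dual_lattice) auto
qed

lemma cell_indicator_shift:
  "\<omega> \<in> cell \<Longrightarrow> \<alpha> \<in> dual_lattice \<Longrightarrow> indicator cell (\<omega> + \<alpha>) = (if \<alpha> = 0 then 1 else 0)"
  by (simp add: indicator_def cell_shift_iff)

lemma combination_measurable: "\<Phi> \<subseteq> W s \<Longrightarrow> combination \<Phi> v \<in> borel_measurable borel"
  unfolding combination_def[abs_def] using hat_measurable by (intro borel_measurable_sum borel_measurable_times) auto

lemma combination_zero: "combination \<Phi> (\<lambda>_. 0) x = 0" by (simp add: combination_def)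

lemma combination_scale: "combination \<Phi> (\<lambda>\<phi>. c * v \<phi>) x = cnj c * combination \<Phi> v x"
  by (simp add: combination_def sum_distrib_left mult.assoc)

lemma combination_add: "combination \<Phi> (\<lambda>\<phi>. u \<phi> + v \<phi>) x = combination \<Phi> u x + combination \<Phi> v x"
  by (simp add: combination_def distrib_right sum.distrib)

lemma weight_outside_cell:
  assumes "s \<le> k" "x \<notin> cell" shows "weight h s x \<le> weight h k x"
proof -
  have "x \<notin> ball 0 pi" using assms(2) cell_neighbourhood[of pi] by auto
  then have "1 \<le> norm x" using pi_gt3 by simp
  then have "1 \<le> (norm x)\<^sup>2" by (simp add: one_le_power)
  then have "1 \<le> (norm x)\<^sup>2 + h\<^sup>2" by (simp add: add_increasing2)
  then show ?thesis unfolding weight_def using assms(1) by (intro powr_mono)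
qed

lemma weight_mono_exponent:
  assumes "s \<le> k" "h > 0" shows "weight h s x \<le> (h\<^sup>2) powr (s - k) * weight h k x"
proof -
  have "weight h s x = ((norm x)\<^sup>2 + h\<^sup>2) powr (s - k) * weight h k x" unfolding weight_def by (simp add: powr_add[symmetric])
  also have "\<dots> \<le> (h\<^sup>2) powr (s - k) * weight h k x"
    using assms by (intro mult_right_mono powr_mono2') auto
  finally show ?thesis .
qed

lemma approximable_energy_finite:
  assumes V: "closed_W_subspace s V" and P: "approximable s V P"
  shows "energy (sobolev_weight s) P < \<infinity>"
proof -
  obtain g where g: "g \<in> V" "energy (sobolev_weight s) (\<lambda>x. P x - hat g x) < ennreal 1"
    using P unfolding approximable_def by (meson zero_less_one)
  have gW: "g \<in> W s" using g V closed_W_subspace_subset by blast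
  have [measurable]: "P \<in> borel_measurable borel" "hat g \<in> borel_measurable borel"
    using approximable_measurable[OF P] hat_measurable[OF gW] by auto
  have "energy (sobolev_weight s) (\<lambda>x. (P x - hat g x) + hat g x) \<le> 2 * energy (sobolev_weight s) (\<lambda>x. P x - hat g x) + 2 * energy (sobolev_weight s) (hat g)"
    by (intro energy_add_le) auto
  also have "\<dots> < \<infinity>" using g(2) W_energy[OF gW] by (auto simp: ennreal_mult_less_top intro: less_trans)
  finally show ?thesis by simp
qed

lemma approximable_combination:
  assumes V: "closed_W_subspace s V" and SI: "shift_invariant 1 V" and "finite \<Phi>" "\<Phi> \<subseteq> V"
  shows "approximable s V (combination \<Phi> v)"
  unfolding combination_def[abs_def]
  using assms by (intro approximable_sum[OF V SI] approximable_scale[OF V SI] approximable_hat[OF V SI]) auto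

text \<open>Where the coefficients \<open>v\<close> have a small error at \<open>\<omega>\<close>, the combination \<open>F(\<omega>) v\<^sup>* \<Phi>\<close> approximates the
  restriction of \<open>F\<close> to the fiber, which is \<open>F(\<omega>)\<close> times the unit vector. Such a choice of coefficients, made
  measurably in \<open>\<omega>\<close> and extended periodically, is admissible as long as it is bounded and uses finitely many
  coefficient vectors; the general case follows by truncation.\<close>

lemma low_frequency_approximation:
  fixes \<Phi> :: "'d::finite dist set"
  assumes V: "closed_W_subspace s V" and SI: "shift_invariant 1 V" and fin: "finite \<Phi>" and \<Phi>: "\<Phi> \<subseteq> V"
    and sk: "s \<le> k" and h: "h > 0" and K: "K \<ge> 0" and Q: "countable Q"
    and H: "AE \<omega> in lborel. \<omega> \<in> cell \<longrightarrow> (\<exists>v\<in>Q. fiber_error h s \<Phi> v \<omega> \<le> ennreal (K * weight h k \<omega>))"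
    and F [measurable]: "F \<in> borel_measurable borel" and EF: "energy (weight h k) F < \<infinity>" and e: "e > 0"
  shows "\<exists>P. approximable s V P \<and> energy (weight h s) (\<lambda>x. indicator cell x * F x - P x) \<le> ennreal K * energy (weight h k) F + ennreal e"
proof -
  have \<Phi>W: "\<Phi> \<subseteq> W s" using \<Phi> closed_W_subspace_subset[OF V] by blast
  (* The zero vector makes the index set nonempty, so that it can be enumerated. *)
  define Q' where "Q' = insert (\<lambda>_. 0) Q"
  have Q': "countable Q'" "Q' \<noteq> {}" unfolding Q'_def using Q by auto
  define v where "v = from_nat_into Q'"
  have rv: "range v = Q'" unfolding v_def by (rule range_from_nat_into[OF Q'(2,1)])
  have [measurable]: "combination \<Phi> u \<in> borel_measurable borel" for u by (rule combination_measurable[OF \<Phi>W])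
  have [measurable]: "fiber_error h s \<Phi> u \<in> borel_measurable borel" for u unfolding fiber_error_def by measurable
  define G where "G n = {\<omega> \<in> cell. fiber_error h s \<Phi> (v n) \<omega> \<le> ennreal (K * weight h k \<omega>)}" for n
  have G [measurable]: "G n \<in> sets borel" for n unfolding G_def by measurable
  (* The first coefficient vector of the enumeration with a small error is used at each frequency. *)
  define B where "B = disjointed G"
  have B [measurable]: "B n \<in> sets borel" for n unfolding B_def using sets.range_disjointed_sets[of G borel] G by blast
  have Bdisj: "disjoint_family B" unfolding B_def by (rule disjoint_family_disjointed)
  have BG: "B n \<subseteq> G n" for n unfolding B_def by (rule disjointed_subset)
  have BU: "(\<Union>n. B n) = (\<Union>n. G n)" unfolding B_def by (rule UN_disjointed_eq)
  (* Truncation in size: F itself need not be bounded. *)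
  define M where "M N n \<omega> = (if \<omega> \<in> B n \<and> cmod (F \<omega>) \<le> real N then F \<omega> else 0)" for N n :: nat and \<omega>
  have [measurable]: "M N n \<in> borel_measurable borel" for N n unfolding M_def by measurable
  have MB: "cmod (M N n \<omega>) \<le> real N" for N n \<omega> unfolding M_def by auto
  (* Truncation in number: the periodic coefficients of the first N coefficient vectors. *)
  define P where "P N x = (\<Sum>n<N. M N n (reduce x) * combination \<Phi> (v n) x)" for N x
  have PA: "approximable s V (P N)" for N
    unfolding P_def[abs_def]
  proof (intro approximable_sum[OF V SI])
    fix n
    note a = approximable_combination[OF V SI fin \<Phi>, of "v n"]
    show "approximable s V (\<lambda>x. M N n (reduce x) * combination \<Phi> (v n) x)"
      by (rule approximable_reduce[OF V SI a approximable_energy_finite[OF V a] _ MB]) measurable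
  qed simp
  have PM [measurable]: "P N \<in> borel_measurable borel" for N using approximable_measurable[OF PA] .
  (* The error of the zero approximant, which is made where the truncation takes effect. *)
  define U where "U = fiber_energy (weight h s) (\<lambda>x. indicator cell x * F x)"
  have [measurable]: "U \<in> borel_measurable borel" unfolding U_def by measurable
  define D where "D N = {\<omega> \<in> cell. cmod (F \<omega>) \<le> real N \<and> (\<exists>n<N. \<omega> \<in> B n)}" for N :: nat
  have [measurable]: "D N \<in> sets borel" for N unfolding D_def by measurable
  have fib: "fiber_energy (weight h s) (\<lambda>x. indicator cell x * F x - P N x) \<omega> * indicator cell \<omega>
      \<le> ennreal K * ennreal (weight h k \<omega> * (cmod (F \<omega>))\<^sup>2) + U \<omega> * indicator (cell - D N) \<omega>" for N \<omega>
  proof (cases "\<omega> \<in> cell")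
    case c: True
    have Pval: "P N (\<omega> + \<alpha>) = (\<Sum>n<N. M N n \<omega> * combination \<Phi> (v n) (\<omega> + \<alpha>))" if "\<alpha> \<in> dual_lattice" for \<alpha>
      unfolding P_def using reduce_shift[OF c that] by simp
    show ?thesis
    proof (cases "\<omega> \<in> D N")
      case True
      then obtain n where n: "n < N" "\<omega> \<in> B n" and FN: "cmod (F \<omega>) \<le> real N" unfolding D_def by blast
      have other: "M N m \<omega> = 0" if "m \<noteq> n" for m
        using Bdisj n(2) that unfolding M_def disjoint_family_on_def by auto
      have "indicator cell (\<omega> + \<alpha>) * F (\<omega> + \<alpha>) - P N (\<omega> + \<alpha>) = F \<omega> * (indicator cell (\<omega> + \<alpha>) - combination \<Phi> (v n) (\<omega> + \<alpha>))"
        if a: "\<alpha> \<in> dual_lattice" for \<alpha>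
      proof -
        have "(\<Sum>m<N. M N m \<omega> * combination \<Phi> (v m) (\<omega> + \<alpha>)) = (\<Sum>m<N. if m = n then F \<omega> * combination \<Phi> (v n) (\<omega> + \<alpha>) else 0)"
          using other n(2) FN by (intro sum.cong) (auto simp: M_def)
        then have "P N (\<omega> + \<alpha>) = F \<omega> * combination \<Phi> (v n) (\<omega> + \<alpha>)" using n(1) by (simp add: Pval[OF a])
        then show ?thesis unfolding cell_indicator_shift[OF c a] by (simp add: algebra_simps)
      qed
      then have "fiber_energy (weight h s) (\<lambda>x. indicator cell x * F x - P N x) \<omega> = ennreal ((cmod (F \<omega>))\<^sup>2) * fiber_error h s \<Phi> (v n) \<omega>"
        unfolding fiber_error_def by (rule fiber_energy_scale)
      also have "\<dots> \<le> ennreal ((cmod (F \<omega>))\<^sup>2) * ennreal (K * weight h k \<omega>)"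
        using n(2) BG[of n] by (intro mult_left_mono) (auto simp: G_def)
      also have "\<dots> = ennreal K * ennreal (weight h k \<omega> * (cmod (F \<omega>))\<^sup>2)"
        using K by (simp add: ennreal_mult mult_ac)
      finally show ?thesis using True c by (simp add: add_increasing2)
    next
      case False
      have "M N n \<omega> = 0" if "n < N" for n using False c that unfolding M_def D_def by auto
      then have "P N (\<omega> + \<alpha>) = 0" if "\<alpha> \<in> dual_lattice" for \<alpha> by (simp add: Pval[OF that])
      then have "fiber_energy (weight h s) (\<lambda>x. indicator cell x * F x - P N x) \<omega> = U \<omega>"
        unfolding U_def by (intro fiber_energy_cong) simp
      then show ?thesis using False c by simp
    qed
  qed simp
  have EU: "(\<integral>\<^sup>+\<omega>. U \<omega> * indicator cell \<omega> \<partial>lborel) < \<infinity>"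
  proof -
    have "(\<integral>\<^sup>+\<omega>. U \<omega> * indicator cell \<omega> \<partial>lborel) = energy (weight h s) (\<lambda>x. indicator cell x * F x)"
      unfolding U_def by (rule energy_fibers[symmetric]) measurable
    also have "\<dots> \<le> energy (weight h s) F" unfolding energy_def
      by (intro nn_integral_mono ennreal_leI mult_left_mono) (auto simp: indicator_def)
    also have "\<dots> \<le> ennreal ((h\<^sup>2) powr (s - k)) * energy (weight h k) F"
      by (intro energy_mono_weight weight_mono_exponent sk h) auto
    also have "\<dots> < \<infinity>" using EF by (simp add: ennreal_mult_less_top)
    finally show ?thesis .
  qed
  (* Almost every frequency of the cell is eventually in D N. *)
  have "(\<lambda>N. \<integral>\<^sup>+\<omega>. U \<omega> * indicator (cell - D N) \<omega> \<partial>lborel) \<longlonglongrightarrow> (\<integral>\<^sup>+\<omega>. 0 \<partial>(lborel :: (real^'d) measure))"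
  proof (rule nn_integral_dominated_convergence[OF _ _ _ _ EU])
    show "AE \<omega> in lborel. U \<omega> * indicator (cell - D N) \<omega> \<le> U \<omega> * indicator cell \<omega>" for N
      by (intro AE_I2 mult_left_mono) (auto simp: indicator_def)
    show "AE \<omega> in lborel. (\<lambda>N. U \<omega> * indicator (cell - D N) \<omega>) \<longlonglongrightarrow> 0"
      using H
    proof eventually_elim
      case (elim \<omega>)
      show ?case
      proof (cases "\<omega> \<in> cell")
        case True
        then obtain u where "u \<in> Q" "fiber_error h s \<Phi> u \<omega> \<le> ennreal (K * weight h k \<omega>)" using elim by blast
        moreover obtain n where "u = v n" using rv \<open>u \<in> Q\<close> unfolding Q'_def by (metis insertCI rangeE)
        ultimately have "\<omega> \<in> (\<Union>n. B n)" unfolding BU G_def using True by blast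
        then obtain n0 where n0: "\<omega> \<in> B n0" by blast
        obtain N0 :: nat where N0: "cmod (F \<omega>) \<le> real N0" using real_arch_simple by blast
        have "\<forall>\<^sub>F N in sequentially. 0 = U \<omega> * indicator (cell - D N) \<omega>"
          using eventually_ge_at_top[of "max (Suc n0) N0"]
        proof eventually_elim
          case (elim N)
          then have "\<omega> \<in> D N" unfolding D_def using True n0 N0 by (auto intro: order_trans intro!: exI[of _ n0])
          then show ?case by simp
        qed
        then show ?thesis by (rule Lim_transform_eventually[OF tendsto_const])
      qed simp
    qed
  qed measurable
  then have "(\<lambda>N. \<integral>\<^sup>+\<omega>. U \<omega> * indicator (cell - D N) \<omega> \<partial>lborel) \<longlonglongrightarrow> 0" by simp
  then have "\<forall>\<^sub>F N in sequentially. (\<integral>\<^sup>+\<omega>. U \<omega> * indicator (cell - D N) \<omega> \<partial>lborel) < ennreal e"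
    by (rule order_tendstoD(2)) (use e in simp)
  then obtain N where N: "(\<integral>\<^sup>+\<omega>. U \<omega> * indicator (cell - D N) \<omega> \<partial>lborel) < ennreal e"
    using eventually_happens sequentially_bot by blast
  have "energy (weight h s) (\<lambda>x. indicator cell x * F x - P N x) = (\<integral>\<^sup>+\<omega>. fiber_energy (weight h s) (\<lambda>x. indicator cell x * F x - P N x) \<omega> * indicator cell \<omega> \<partial>lborel)"
    by (rule energy_fibers) measurable
  also have "\<dots> \<le> (\<integral>\<^sup>+\<omega>. ennreal K * ennreal (weight h k \<omega> * (cmod (F \<omega>))\<^sup>2) + U \<omega> * indicator (cell - D N) \<omega> \<partial>lborel)"
    by (intro nn_integral_mono fib)
  also have "\<dots> = ennreal K * energy (weight h k) F + (\<integral>\<^sup>+\<omega>. U \<omega> * indicator (cell - D N) \<omega> \<partial>lborel)"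
    unfolding energy_def by (subst nn_integral_add) (auto simp: nn_integral_cmult)
  also have "\<dots> \<le> ennreal K * energy (weight h k) F + ennreal e" using N by (intro add_left_mono) simp
  finally show ?thesis using PA by blast
qed

text \<open>Outside \<open>cell\<close> we have \<open>|x| \<ge> 1\<close>, hence there the weight of exponent \<open>s\<close> is at most that of exponent \<open>k\<close>, and
  approximating \<open>F\<close> by \<open>0\<close> is good enough.\<close>

lemma fsi_approximation:
  fixes \<Phi> :: "'d::finite dist set"
  assumes V: "closed_W_subspace s V" and SI: "shift_invariant 1 V" and fin: "finite \<Phi>" and \<Phi>: "\<Phi> \<subseteq> V"
    and sk: "s \<le> k" and h: "h > 0" and K: "K \<ge> 0" and Q: "countable Q"
    and H: "AE \<omega> in lborel. \<omega> \<in> cell \<longrightarrow> (\<exists>v\<in>Q. fiber_error h s \<Phi> v \<omega> \<le> ennreal (K * weight h k \<omega>))"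
    and F [measurable]: "F \<in> borel_measurable borel" and EF: "energy (weight h k) F < \<infinity>" and e: "e > 0"
  shows "\<exists>g\<in>V. energy (weight h s) (\<lambda>x. F x - hat g x) \<le> ennreal (2 + 4 * K) * energy (weight h k) F + ennreal e"
proof -
  (* The final quasi-triangle inequalities multiply each of two slacks of size e/8 by 4. *)
  have e8: "e / 8 > 0" using e by simp
  obtain P where P: "approximable s V P" "energy (weight h s) (\<lambda>x. indicator cell x * F x - P x) \<le> ennreal K * energy (weight h k) F + ennreal (e / 8)"
    using low_frequency_approximation[OF V SI fin \<Phi> sk h K Q H F EF e8] by blast
  obtain c where c: "c > 0" "\<And>x::real^'d. weight h s x \<le> c * sobolev_weight s x" using weight_sobolev_weight_compare[OF h] by metis
  obtain g where g: "g \<in> V" "energy (sobolev_weight s) (\<lambda>x. P x - hat g x) < ennreal (e / 8 / c)"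
    using P(1) e8 c(1) unfolding approximable_def by (meson divide_pos_pos)
  have [measurable]: "P \<in> borel_measurable borel" "hat g \<in> borel_measurable borel"
    using approximable_measurable[OF P(1)] g(1) closed_W_subspace_subset[OF V] hat_measurable by auto
  have "energy (weight h s) (\<lambda>x. P x - hat g x) \<le> ennreal c * energy (sobolev_weight s) (\<lambda>x. P x - hat g x)"
    using c by (intro energy_mono_weight) auto
  also have "\<dots> \<le> ennreal c * ennreal (e / 8 / c)" using g(2) by (intro mult_left_mono) auto
  also have "\<dots> = ennreal (e / 8)" using c(1) e by (simp add: ennreal_mult[symmetric])
  finally have E1: "energy (weight h s) (\<lambda>x. P x - hat g x) \<le> ennreal (e / 8)" .
  have E2: "energy (weight h s) (\<lambda>x. (1 - indicator cell x) * F x) \<le> energy (weight h k) F"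
    unfolding energy_def
  proof (intro nn_integral_mono ennreal_leI)
    fix x show "weight h s x * (cmod ((1 - indicator cell x) * F x))\<^sup>2 \<le> weight h k x * (cmod (F x))\<^sup>2"
      using weight_outside_cell[OF sk, of x h] by (cases "x \<in> cell") (auto intro: mult_right_mono)
  qed
  obtain r where r: "r \<ge> 0" "energy (weight h k) F = ennreal r" using EF by (cases "energy (weight h k) F") auto
  have "energy (weight h s) (\<lambda>x. F x - hat g x) = energy (weight h s) (\<lambda>x. (1 - indicator cell x) * F x + ((indicator cell x * F x - P x) + (P x - hat g x)))"
    by (simp add: algebra_simps)
  also have "\<dots> \<le> 2 * energy (weight h s) (\<lambda>x. (1 - indicator cell x) * F x) + 2 * energy (weight h s) (\<lambda>x. (indicator cell x * F x - P x) + (P x - hat g x))"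
    by (intro energy_add_le) auto
  also have "\<dots> \<le> 2 * energy (weight h s) (\<lambda>x. (1 - indicator cell x) * F x) + 2 * (2 * energy (weight h s) (\<lambda>x. indicator cell x * F x - P x) + 2 * energy (weight h s) (\<lambda>x. P x - hat g x))"
    by (intro add_left_mono mult_left_mono energy_add_le) auto
  also have "\<dots> \<le> 2 * ennreal r + 2 * (2 * (ennreal K * ennreal r + ennreal (e / 8)) + 2 * ennreal (e / 8))"
    using E1 E2 P(2) unfolding r(2) by (intro add_mono mult_left_mono) auto
  also have "\<dots> = ennreal ((2 + 4 * K) * r + e)"
  proof -
    have 2: "2 * ennreal x = ennreal (2 * x)" if "x \<ge> 0" for x using that ennreal_mult[of 2 x] by simp
    show ?thesis using K r(1) e
      by (simp add: 2 ennreal_mult[symmetric] ennreal_plus[symmetric] del: ennreal_plus) (simp add: algebra_simps)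
  qed
  also have "\<dots> = ennreal (2 + 4 * K) * energy (weight h k) F + ennreal e"
    unfolding r(2) using K r(1) e by (simp add: ennreal_mult[symmetric] ennreal_plus[symmetric] del: ennreal_plus)
  finally show ?thesis using g(1) by blast
qed

section \<open>Fibers of finitely generated shift-invariant spaces\<close>

text \<open>The restriction of \<open>F\<close> to the fiber through \<open>\<omega>\<close> lies in the closure of the span of the restrictions of the
  generators. The closure of the span, rather than the span, is used because it is stable under limits
  of \<open>F\<close>.\<close>

definition in_fiber_closure :: "real \<Rightarrow> 'd::finite dist set \<Rightarrow> (real^'d \<Rightarrow> complex) \<Rightarrow> real^'d \<Rightarrow> bool" where
  "in_fiber_closure s \<Phi> F \<omega> \<longleftrightarrow> (\<forall>e>0. \<exists>v. fiber_energy (sobolev_weight s) (\<lambda>x. F x - combination \<Phi> v x) \<omega> < ennreal e)"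

lemma in_fiber_closure_cong:
  "(\<And>\<alpha>. \<alpha> \<in> dual_lattice \<Longrightarrow> F (\<omega> + \<alpha>) = G (\<omega> + \<alpha>)) \<Longrightarrow> in_fiber_closure s \<Phi> F \<omega> = in_fiber_closure s \<Phi> G \<omega>"
  unfolding in_fiber_closure_def using fiber_energy_cong[where F="\<lambda>x. F x - combination \<Phi> _ x" and G="\<lambda>x. G x - combination \<Phi> _ x"] by simp

lemma in_fiber_closure_combination: "in_fiber_closure s \<Phi> (combination \<Phi> v) \<omega>"
  unfolding in_fiber_closure_def by (auto intro!: exI[of _ v] simp: fiber_energy_def fiber_sum_def)

lemma in_fiber_closure_add:
  assumes "in_fiber_closure s \<Phi> F \<omega>" "in_fiber_closure s \<Phi> G \<omega>"
  shows "in_fiber_closure s \<Phi> (\<lambda>x. F x + G x) \<omega>"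
  unfolding in_fiber_closure_def
proof (intro allI impI)
  fix e :: real assume e: "e > 0"
  then have e4: "e / 4 > 0" by simp
  obtain u where u: "fiber_energy (sobolev_weight s) (\<lambda>x. F x - combination \<Phi> u x) \<omega> < ennreal (e / 4)" using assms(1) e4 unfolding in_fiber_closure_def by blast
  obtain v where v: "fiber_energy (sobolev_weight s) (\<lambda>x. G x - combination \<Phi> v x) \<omega> < ennreal (e / 4)" using assms(2) e4 unfolding in_fiber_closure_def by blast
  have "fiber_energy (sobolev_weight s) (\<lambda>x. F x + G x - combination \<Phi> (\<lambda>\<phi>. u \<phi> + v \<phi>) x) \<omega> = fiber_energy (sobolev_weight s) (\<lambda>x. (F x - combination \<Phi> u x) + (G x - combination \<Phi> v x)) \<omega>"
    by (simp add: combination_add algebra_simps)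
  also have "\<dots> \<le> 2 * fiber_energy (sobolev_weight s) (\<lambda>x. F x - combination \<Phi> u x) \<omega> + 2 * fiber_energy (sobolev_weight s) (\<lambda>x. G x - combination \<Phi> v x) \<omega>"
    by (rule fiber_energy_add_le) simp
  also have "\<dots> < ennreal e" by (rule ennreal_two_quarters[OF u v e])
  finally show "\<exists>v. fiber_energy (sobolev_weight s) (\<lambda>x. F x + G x - combination \<Phi> v x) \<omega> < ennreal e" by blast
qed

lemma in_fiber_closure_scale:
  assumes "in_fiber_closure s \<Phi> F \<omega>" and G: "\<And>\<alpha>. \<alpha> \<in> dual_lattice \<Longrightarrow> G (\<omega> + \<alpha>) = c * F (\<omega> + \<alpha>)"
  shows "in_fiber_closure s \<Phi> G \<omega>"
  unfolding in_fiber_closure_def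
proof (intro allI impI)
  fix e :: real assume e: "e > 0"
  let ?B = "1 + (cmod c)\<^sup>2"
  have B: "?B > 0" by (simp add: add_pos_nonneg)
  then have "e / ?B > 0" using e by simp
  then obtain u where u: "fiber_energy (sobolev_weight s) (\<lambda>x. F x - combination \<Phi> u x) \<omega> < ennreal (e / ?B)" using assms(1) unfolding in_fiber_closure_def by blast
  have "fiber_energy (sobolev_weight s) (\<lambda>x. G x - combination \<Phi> (\<lambda>\<phi>. cnj c * u \<phi>) x) \<omega> = ennreal ((cmod c)\<^sup>2) * fiber_energy (sobolev_weight s) (\<lambda>x. F x - combination \<Phi> u x) \<omega>"
    by (rule fiber_energy_scale) (simp add: G combination_scale right_diff_distrib)
  also have "\<dots> \<le> ennreal ?B * fiber_energy (sobolev_weight s) (\<lambda>x. F x - combination \<Phi> u x) \<omega>" by (intro mult_right_mono ennreal_leI) auto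
  also have "\<dots> < ennreal ?B * ennreal (e / ?B)" using u B by (intro ennreal_mult_strict_left_mono) (auto simp del: ennreal_plus)
  also have "\<dots> = ennreal e" using B e by (subst ennreal_mult[symmetric]) auto
  finally show "\<exists>v. fiber_energy (sobolev_weight s) (\<lambda>x. G x - combination \<Phi> v x) \<omega> < ennreal e" by blast
qed

lemma in_fiber_closure_limit:
  assumes "\<And>e. e > 0 \<Longrightarrow> \<exists>G. in_fiber_closure s \<Phi> G \<omega> \<and> fiber_energy (sobolev_weight s) (\<lambda>x. F x - G x) \<omega> < ennreal e"
  shows "in_fiber_closure s \<Phi> F \<omega>"
  unfolding in_fiber_closure_def
proof (intro allI impI)
  fix e :: real assume e: "e > 0"
  then have e4: "e / 4 > 0" by simp
  obtain G where G: "in_fiber_closure s \<Phi> G \<omega>" "fiber_energy (sobolev_weight s) (\<lambda>x. F x - G x) \<omega> < ennreal (e / 4)" using assms[OF e4] by blast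
  obtain v where v: "fiber_energy (sobolev_weight s) (\<lambda>x. G x - combination \<Phi> v x) \<omega> < ennreal (e / 4)" using G(1) e4 unfolding in_fiber_closure_def by blast
  have "fiber_energy (sobolev_weight s) (\<lambda>x. F x - combination \<Phi> v x) \<omega> = fiber_energy (sobolev_weight s) (\<lambda>x. (F x - G x) + (G x - combination \<Phi> v x)) \<omega>" by simp
  also have "\<dots> \<le> 2 * fiber_energy (sobolev_weight s) (\<lambda>x. F x - G x) \<omega> + 2 * fiber_energy (sobolev_weight s) (\<lambda>x. G x - combination \<Phi> v x) \<omega>"
    by (rule fiber_energy_add_le) simp
  also have "\<dots> < ennreal e" by (rule ennreal_two_quarters[OF G(2) v e])
  finally show "\<exists>v. fiber_energy (sobolev_weight s) (\<lambda>x. F x - combination \<Phi> v x) \<omega> < ennreal e" by blast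
qed

lemma character_dual_lattice:
  assumes "a \<in> integer_lattice" "\<alpha> \<in> dual_lattice"
  shows "character a (\<omega> + \<alpha>) = character a \<omega>"
proof -
  obtain b where b: "b \<in> integer_lattice" "\<alpha> = (2 * pi) *\<^sub>R b" using assms(2) unfolding dual_lattice_def by blast
  have "a \<bullet> b \<in> \<int>" using assms(1) b(1) unfolding inner_vec_def integer_lattice_def by (auto intro!: Ints_sum)
  then obtain n where n: "a \<bullet> b = of_int n" by (auto simp: Ints_def)
  have "- (\<i> * complex_of_real (a \<bullet> (\<omega> + \<alpha>))) = - (\<i> * complex_of_real (a \<bullet> \<omega>)) + complex_of_real (2 * real_of_int (- n) * pi) * \<i>"
    by (simp add: b(2) inner_add_right n algebra_simps)
  then show ?thesis unfolding exp_eq by (intro exI[of _ "- n"]) simp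
qed

text \<open>The elements of \<open>W s\<close> with this property form a closed shift-invariant subspace that contains \<open>\<Phi>\<close>. It is
  shift-invariant because the characters of integer points are constant on fibers.\<close>

lemma fsi_space_fibers:
  fixes \<Phi> :: "'d::finite dist set"
  assumes fin: "finite \<Phi>" and \<Phi>: "\<Phi> \<subseteq> W s" and g: "g \<in> fsi_space s \<Phi>"
  shows "AE \<omega> in lborel. \<omega> \<in> cell \<longrightarrow> in_fiber_closure s \<Phi> (hat g) \<omega>"
proof -
  let ?C = "\<lambda>F \<omega>. \<omega> \<in> cell \<longrightarrow> in_fiber_closure s \<Phi> F \<omega>"
  define V where "V = {g \<in> W s. AE \<omega> in lborel. ?C (hat g) \<omega>}"
  have VI: "g \<in> V" if g: "g \<in> W s" and eq: "AE x in lborel. hat g x = F x" and F: "AE \<omega> in lborel. ?C F \<omega>" for g F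
  proof -
    have "AE \<omega> in lborel. ?C (hat g) \<omega>"
      using AE_shift_dual_lattice[OF eq] F
    proof eventually_elim
      case (elim \<omega>)
      then show ?case using in_fiber_closure_cong[of "hat g" \<omega> F] by auto
    qed
    then show ?thesis unfolding V_def using g by simp
  qed
  have "closed_W_subspace s V"
  proof (rule closed_W_subspaceI)
    show "V \<subseteq> W s" unfolding V_def by blast
    have "?C (\<lambda>x. 0) \<omega>" for \<omega>
      using in_fiber_closure_combination[of s \<Phi> "\<lambda>_. 0" \<omega>] by (simp add: combination_zero[abs_def])
    then show "dist_zero \<in> V" by (intro VI[OF W_zero hat_AE[OF represented_by_fourier_zero]]) auto
    show "dist_add f g \<in> V" if f: "f \<in> V" and g: "g \<in> V" for f g
    proof -
      have fg: "f \<in> W s" "g \<in> W s" using f g by (auto simp: V_def)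
      have "AE \<omega> in lborel. ?C (hat f) \<omega>" "AE \<omega> in lborel. ?C (hat g) \<omega>" using f g by (auto simp: V_def)
      then have "AE \<omega> in lborel. ?C (\<lambda>x. hat f x + hat g x) \<omega>"
        by eventually_elim (auto intro: in_fiber_closure_add)
      then show ?thesis by (rule VI[OF W_add[OF fg] hat_add[OF fg]])
    qed
    show "dist_scale c f \<in> V" if f: "f \<in> V" for c f
    proof -
      have fW: "f \<in> W s" using f by (auto simp: V_def)
      have "AE \<omega> in lborel. ?C (hat f) \<omega>" using f by (auto simp: V_def)
      then have "AE \<omega> in lborel. ?C (\<lambda>x. c * hat f x) \<omega>"
        by eventually_elim (auto intro: in_fiber_closure_scale[of s \<Phi> "hat f" _ "\<lambda>x. c * hat f x" c])
      then show ?thesis by (rule VI[OF W_scale[OF fW] hat_scale[OF fW]])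
    qed
    fix f :: "'d dist" assume f: "f \<in> W s" and ap: "\<And>e. e > 0 \<Longrightarrow> \<exists>g\<in>V. energy (sobolev_weight s) (\<lambda>x. hat f x - hat g x) < ennreal e"
    have "\<exists>g. \<forall>n::nat. g n \<in> V \<and> energy (sobolev_weight s) (\<lambda>x. hat f x - hat (g n) x) < ennreal (inverse (Suc n))"
      using ap[of "inverse (Suc _)"] by (intro choice) (auto simp del: of_nat_Suc)
    then obtain g where g: "\<And>n. g n \<in> V" "\<And>n::nat. energy (sobolev_weight s) (\<lambda>x. hat f x - hat (g n) x) < ennreal (inverse (Suc n))" by blast
    have gW: "g n \<in> W s" for n using g(1)[of n] by (simp add: V_def)
    have [measurable]: "hat f \<in> borel_measurable borel" "hat (g n) \<in> borel_measurable borel" for n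
      using f gW hat_measurable by auto
    let ?u = "\<lambda>n. fiber_energy (sobolev_weight s) (\<lambda>x. hat f x - hat (g n) x)"
    (* Convergence of energies gives fiberwise convergence only along a subsequence; but closeness
       to some member suffices, and the infimum of the fiber energies has integral zero. *)
    have "(\<integral>\<^sup>+\<omega>. (INF n. ?u n \<omega> * indicator cell \<omega>) \<partial>lborel) \<le> 0"
    proof (rule ennreal_le_epsilon)
      fix e :: real assume e: "e > 0"
      obtain n where n: "inverse (real (Suc n)) < e" using reals_Archimedean[OF e] by blast
      have "(\<integral>\<^sup>+\<omega>. (INF n. ?u n \<omega> * indicator cell \<omega>) \<partial>lborel) \<le> (\<integral>\<^sup>+\<omega>. ?u n \<omega> * indicator cell \<omega> \<partial>lborel)"
        by (intro nn_integral_mono INF_lower) simp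
      also have "\<dots> = energy (sobolev_weight s) (\<lambda>x. hat f x - hat (g n) x)" by (rule energy_fibers[symmetric]) measurable
      also have "\<dots> \<le> ennreal e" using g(2)[of n] n by (meson ennreal_leI less_imp_le order_trans)
      finally show "(\<integral>\<^sup>+\<omega>. (INF n. ?u n \<omega> * indicator cell \<omega>) \<partial>lborel) \<le> 0 + ennreal e" by simp
    qed
    then have "AE \<omega> in lborel. (INF n. ?u n \<omega> * indicator cell \<omega>) = 0"
      by (subst (asm) le_zero_eq, subst (asm) nn_integral_0_iff_AE) auto
    moreover have "AE \<omega> in lborel. \<forall>n. ?C (hat (g n)) \<omega>"
      unfolding AE_all_countable using g(1) by (simp add: V_def)
    ultimately have "AE \<omega> in lborel. ?C (hat f) \<omega>"
    proof eventually_elim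
      case (elim \<omega>)
      show ?case
      proof (intro impI in_fiber_closure_limit)
        fix e :: real assume c: "\<omega> \<in> cell" and e: "e > 0"
        have "(INF n. ?u n \<omega> * indicator cell \<omega>) < ennreal e" using elim(1) e by simp
        then obtain n where "?u n \<omega> < ennreal e" unfolding INF_less_iff using c by auto
        then show "\<exists>G. in_fiber_closure s \<Phi> G \<omega> \<and> fiber_energy (sobolev_weight s) (\<lambda>x. hat f x - G x) \<omega> < ennreal e" using elim(2) c by blast
      qed
    qed
    then show "f \<in> V" using f by (simp add: V_def)
  qed
  moreover have "shift_invariant 1 V"
    unfolding shift_invariant_def
  proof (intro ballI)
    fix a :: "real^'d" and f assume a: "a \<in> integer_lattice" and f: "f \<in> V"
    have fW: "f \<in> W s" using f by (auto simp: V_def)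
    have "AE \<omega> in lborel. ?C (hat f) \<omega>" using f by (auto simp: V_def)
    then have "AE \<omega> in lborel. ?C (\<lambda>x. character a x * hat f x) \<omega>"
    proof eventually_elim
      case (elim \<omega>)
      show ?case
      proof
        assume "\<omega> \<in> cell"
        then have i: "in_fiber_closure s \<Phi> (hat f) \<omega>" using elim by blast
        show "in_fiber_closure s \<Phi> (\<lambda>x. character a x * hat f x) \<omega>"
          by (rule in_fiber_closure_scale[OF i]) (simp only: character_dual_lattice[OF a])
      qed
    qed
    then have "dist_translate a f \<in> V" by (rule VI[OF W_translate[OF fW] hat_translate[OF fW]])
    then show "dist_translate (1 *\<^sub>R a) f \<in> V" by simp
  qed
  moreover have "\<Phi> \<subseteq> V"
  proof
    fix \<phi> assume p: "\<phi> \<in> \<Phi>"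
    have "combination \<Phi> (\<lambda>\<psi>. if \<psi> = \<phi> then 1 else 0) = hat \<phi>"
    proof
      fix x
      have "combination \<Phi> (\<lambda>\<psi>. if \<psi> = \<phi> then 1 else 0) x = (\<Sum>\<psi>\<in>\<Phi>. if \<psi> = \<phi> then hat \<phi> x else 0)"
        unfolding combination_def by (intro sum.cong) auto
      then show "combination \<Phi> (\<lambda>\<psi>. if \<psi> = \<phi> then 1 else 0) x = hat \<phi> x" using fin p by simp
    qed
    then have "in_fiber_closure s \<Phi> (hat \<phi>) \<omega>" for \<omega> using in_fiber_closure_combination by metis
    then show "\<phi> \<in> V" unfolding V_def using p \<Phi> by auto
  qed
  ultimately have "fsi_space s \<Phi> \<subseteq> V" by (rule fsi_space_least)
  then show ?thesis using g unfolding V_def by blast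
qed

text \<open>On the fibers through \<open>A\<close> the indicator of \<open>A\<close> is the unit vector at \<open>\<alpha> = 0\<close>, whose distance from
  every combination is at least \<open>R\<close>, while \<open>hat g\<close> is a limit of combinations. The factor \<open>2\<close> comes from the
  quasi-triangle inequality for squared norms.\<close>

lemma fsi_lower_bound:
  fixes \<Phi> :: "'d::finite dist set" and R :: "real^'d \<Rightarrow> ennreal"
  assumes fin: "finite \<Phi>" and \<Phi>: "\<Phi> \<subseteq> W s" and g: "g \<in> fsi_space s \<Phi>" and h: "h > 0"
    and R: "AE \<omega> in lborel. \<omega> \<in> cell \<longrightarrow> (\<forall>v. R \<omega> \<le> fiber_error h s \<Phi> v \<omega>)"
    and A [measurable]: "A \<in> sets borel" and "A \<subseteq> cell"
  shows "(\<integral>\<^sup>+\<omega>. R \<omega> * indicator A \<omega> \<partial>lborel) \<le> 2 * energy (weight h s) (\<lambda>x. indicator A x - hat g x)"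
proof -
  have "g \<in> W s" using g closed_fsi_space[OF \<Phi>] closed_W_subspace_subset by blast
  then have [measurable]: "hat g \<in> borel_measurable borel" by (rule hat_measurable)
  obtain c where c: "c > 0" "\<And>x::real^'d. weight h s x \<le> c * sobolev_weight s x" using weight_sobolev_weight_compare[OF h] by metis
  let ?E = "fiber_energy (weight h s) (\<lambda>x. indicator A x - hat g x)"
  have "AE \<omega> in lborel. R \<omega> * indicator A \<omega> \<le> 2 * (?E \<omega> * indicator cell \<omega>)"
    using R fsi_space_fibers[OF fin \<Phi> g]
  proof eventually_elim
    case (elim \<omega>)
    show ?case
    proof (cases "\<omega> \<in> A")
      case True
      then have w: "\<omega> \<in> cell" using \<open>A \<subseteq> cell\<close> by blast
      have eqA: "indicator A (\<omega> + \<alpha>) = (indicator cell (\<omega> + \<alpha>) :: complex)" if "\<alpha> \<in> dual_lattice" for \<alpha>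
        using True \<open>A \<subseteq> cell\<close> cell_shift_iff[OF w that] by (cases "\<alpha> = 0") (auto simp: indicator_def)
      have "R \<omega> \<le> 2 * ?E \<omega>"
      proof (rule ennreal_le_epsilon)
        fix e :: real assume e: "e > 0"
        then have "e / (2 * c) > 0" using c(1) by simp
        then obtain v where v: "fiber_energy (sobolev_weight s) (\<lambda>x. hat g x - combination \<Phi> v x) \<omega> < ennreal (e / (2 * c))"
          using elim(2) w unfolding in_fiber_closure_def by blast
        have "fiber_energy (weight h s) (\<lambda>x. hat g x - combination \<Phi> v x) \<omega> \<le> ennreal c * fiber_energy (sobolev_weight s) (\<lambda>x. hat g x - combination \<Phi> v x) \<omega>"
          using c by (intro fiber_energy_mono_weight) auto
        also have "\<dots> \<le> ennreal c * ennreal (e / (2 * c))" using v by (intro mult_left_mono) auto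
        also have "\<dots> = ennreal (e / 2)" using c(1) e by (subst ennreal_mult[symmetric]) auto
        finally have b: "fiber_energy (weight h s) (\<lambda>x. hat g x - combination \<Phi> v x) \<omega> \<le> ennreal (e / 2)" .
        have "R \<omega> \<le> fiber_error h s \<Phi> v \<omega>" using elim(1) w by blast
        also have "\<dots> = fiber_energy (weight h s) (\<lambda>x. (indicator A x - hat g x) + (hat g x - combination \<Phi> v x)) \<omega>"
          unfolding fiber_error_def using eqA by (intro fiber_energy_cong) simp
        also have "\<dots> \<le> 2 * ?E \<omega> + 2 * fiber_energy (weight h s) (\<lambda>x. hat g x - combination \<Phi> v x) \<omega>"
          by (rule fiber_energy_add_le) simp
        also have "\<dots> \<le> 2 * ?E \<omega> + 2 * ennreal (e / 2)" by (intro add_left_mono mult_left_mono b) simp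
        also have "2 * ennreal (e / 2) = ennreal e" using e ennreal_mult[of 2 "e / 2"] by simp
        finally show "R \<omega> \<le> 2 * ?E \<omega> + ennreal e" .
      qed
      then show ?thesis using True w by simp
    qed simp
  qed
  then have "(\<integral>\<^sup>+\<omega>. R \<omega> * indicator A \<omega> \<partial>lborel) \<le> (\<integral>\<^sup>+\<omega>. 2 * (?E \<omega> * indicator cell \<omega>) \<partial>lborel)" by (rule nn_integral_mono_AE)
  also have "\<dots> = 2 * energy (weight h s) (\<lambda>x. indicator A x - hat g x)"
    by (subst nn_integral_cmult) (auto simp: energy_fibers)
  finally show ?thesis .
qed

section \<open>Gramians\<close>

lemma nn_integral_count_space_summable:
  fixes f :: "'a \<Rightarrow> real"
  assumes nn: "\<And>x. x \<in> A \<Longrightarrow> f x \<ge> 0" and fin: "(\<integral>\<^sup>+x. ennreal (f x) \<partial>count_space A) < \<infinity>"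
  shows "f summable_on A"
proof -
  have "integrable (count_space A) f"
    using nn fin by (intro integrableI_nonneg) (auto simp: AE_count_space)
  then have "Infinite_Set_Sum.abs_summable_on f A" unfolding abs_summable_on_def .
  then show ?thesis using abs_summable_equivalent abs_summable_summable by blast
qed

lemma nn_integral_count_space_has_sum:
  fixes f :: "'a \<Rightarrow> real"
  assumes nn: "\<And>x. x \<in> A \<Longrightarrow> f x \<ge> 0" and f: "(f has_sum S) A"
  shows "(\<integral>\<^sup>+x. ennreal (f x) \<partial>count_space A) = ennreal S"
proof -
  have "Infinite_Set_Sum.abs_summable_on f A"
    using has_sum_imp_summable[OF f] summable_on_iff_abs_summable_on_real abs_summable_equivalent by blast
  then show ?thesis
    using nn_integral_conv_infsetsum[of f A] nn infsetsum_infsum[of f A] infsumI[OF f] by simp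
qed

lemma has_sum_finite_sum:
  fixes f :: "'i \<Rightarrow> 'a \<Rightarrow> 'b :: topological_comm_monoid_add"
  shows "finite I \<Longrightarrow> (\<And>i. i \<in> I \<Longrightarrow> (f i has_sum S i) A) \<Longrightarrow> ((\<lambda>x. \<Sum>i\<in>I. f i x) has_sum (\<Sum>i\<in>I. S i)) A"
  by (induction I rule: finite_induct) (auto intro!: has_sum_add)

text \<open>Exchanging the sum over the lattice with the finite sums over the generators shows that \<open>v\<^sup>* G v\<close> is the
  sum over the fiber of the weighted squares of \<open>v\<^sup>* \<Phi>\<close>. The diagonal entries dominate the others by the
  arithmetic-geometric mean inequality, so their finiteness gives absolute convergence.\<close>

lemma hermitian_form_gramian:
  fixes \<Phi> :: "'d::finite dist set"
  assumes fin: "finite \<Phi>" and w: "\<And>x. w x \<ge> 0"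
    and F: "\<And>\<phi>. \<phi> \<in> \<Phi> \<Longrightarrow> fiber_sum A (\<lambda>x. ennreal (w x * (cmod (hat \<phi> x))\<^sup>2)) \<omega> < \<infinity>"
  shows "ennreal (hermitian_form \<Phi> (gramian A w \<omega>) v) = fiber_sum A (\<lambda>x. ennreal (w x * (cmod (combination \<Phi> v x))\<^sup>2)) \<omega>"
    and "hermitian_form \<Phi> (gramian A w \<omega>) v \<ge> 0"
proof -
  let ?t = "\<lambda>\<phi> \<psi> \<alpha>. hat \<phi> (\<omega> + \<alpha>) * cnj (hat \<psi> (\<omega> + \<alpha>)) * complex_of_real (w (\<omega> + \<alpha>))"
  have S: "(\<lambda>\<alpha>. w (\<omega> + \<alpha>) * (cmod (hat \<phi> (\<omega> + \<alpha>)))\<^sup>2) summable_on A" if "\<phi> \<in> \<Phi>" for \<phi>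
    using F[OF that] w unfolding fiber_sum_def by (intro nn_integral_count_space_summable) auto
  have t: "(?t \<phi> \<psi> has_sum gramian A w \<omega> \<phi> \<psi>) A" if p: "\<phi> \<in> \<Phi>" "\<psi> \<in> \<Phi>" for \<phi> \<psi>
  proof -
    have "(\<lambda>\<alpha>. cmod (?t \<phi> \<psi> \<alpha>)) summable_on A"
    proof (rule Infinite_Sum.abs_summable_on_comparison_test')
      show "(\<lambda>\<alpha>. w (\<omega> + \<alpha>) * (cmod (hat \<phi> (\<omega> + \<alpha>)))\<^sup>2 + w (\<omega> + \<alpha>) * (cmod (hat \<psi> (\<omega> + \<alpha>)))\<^sup>2) summable_on A"
        by (intro summable_on_add S p)
      fix \<alpha>
      let ?a = "cmod (hat \<phi> (\<omega> + \<alpha>))" and ?b = "cmod (hat \<psi> (\<omega> + \<alpha>))"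
      have "2 * (?a * ?b) \<le> ?a\<^sup>2 + ?b\<^sup>2" using sum_squares_bound[of ?a ?b] by simp
      then have "?a * ?b \<le> ?a\<^sup>2 + ?b\<^sup>2" using mult_nonneg_nonneg[OF norm_ge_zero norm_ge_zero, of "hat \<phi> (\<omega> + \<alpha>)" "hat \<psi> (\<omega> + \<alpha>)"] by linarith
      from mult_left_mono[OF this w[of "\<omega> + \<alpha>"]]
      show "cmod (?t \<phi> \<psi> \<alpha>) \<le> w (\<omega> + \<alpha>) * ?a\<^sup>2 + w (\<omega> + \<alpha>) * ?b\<^sup>2"
        using w[of "\<omega> + \<alpha>"] by (simp add: norm_mult distrib_left mult_ac)
    qed
    then have "?t \<phi> \<psi> summable_on A" by (rule abs_summable_summable)
    then show ?thesis unfolding gramian_def by (rule has_sum_infsum)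
  qed
  have "((\<lambda>\<alpha>. \<Sum>\<phi>\<in>\<Phi>. \<Sum>\<psi>\<in>\<Phi>. cnj (v \<phi>) * ?t \<phi> \<psi> \<alpha> * v \<psi>) has_sum (\<Sum>\<phi>\<in>\<Phi>. \<Sum>\<psi>\<in>\<Phi>. cnj (v \<phi>) * gramian A w \<omega> \<phi> \<psi> * v \<psi>)) A"
    by (intro has_sum_finite_sum fin has_sum_cmult_left has_sum_cmult_right t)
  from has_sum_bounded_linear[OF bounded_linear_Re this]
  have "((\<lambda>\<alpha>. Re (\<Sum>\<phi>\<in>\<Phi>. \<Sum>\<psi>\<in>\<Phi>. cnj (v \<phi>) * ?t \<phi> \<psi> \<alpha> * v \<psi>)) has_sum hermitian_form \<Phi> (gramian A w \<omega>) v) A"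
    unfolding hermitian_form_def .
  moreover have "Re (\<Sum>\<phi>\<in>\<Phi>. \<Sum>\<psi>\<in>\<Phi>. cnj (v \<phi>) * ?t \<phi> \<psi> \<alpha> * v \<psi>) = w (\<omega> + \<alpha>) * (cmod (combination \<Phi> v (\<omega> + \<alpha>)))\<^sup>2" for \<alpha>
  proof -
    have "(\<Sum>\<phi>\<in>\<Phi>. \<Sum>\<psi>\<in>\<Phi>. cnj (v \<phi>) * ?t \<phi> \<psi> \<alpha> * v \<psi>) = complex_of_real (w (\<omega> + \<alpha>)) * (combination \<Phi> v (\<omega> + \<alpha>) * cnj (combination \<Phi> v (\<omega> + \<alpha>)))"
      unfolding combination_def by (simp add: sum_product sum_distrib_left mult_ac)
    also have "\<dots> = complex_of_real (w (\<omega> + \<alpha>) * (cmod (combination \<Phi> v (\<omega> + \<alpha>)))\<^sup>2)"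
      by (simp only: complex_norm_square of_real_mult)
    finally show ?thesis by simp
  qed
  ultimately have hs: "((\<lambda>\<alpha>. w (\<omega> + \<alpha>) * (cmod (combination \<Phi> v (\<omega> + \<alpha>)))\<^sup>2) has_sum hermitian_form \<Phi> (gramian A w \<omega>) v) A" by simp
  show "ennreal (hermitian_form \<Phi> (gramian A w \<omega>) v) = fiber_sum A (\<lambda>x. ennreal (w x * (cmod (combination \<Phi> v x))\<^sup>2)) \<omega>"
    unfolding fiber_sum_def by (rule nn_integral_count_space_has_sum[OF _ hs, symmetric]) (simp add: w)
  show "hermitian_form \<Phi> (gramian A w \<omega>) v \<ge> 0"
    by (rule has_sum_nonneg[OF hs]) (simp add: w)
qed

lemma hermitian_form_scale: "hermitian_form \<Phi> G (\<lambda>\<phi>. c * v \<phi>) = (cmod c)\<^sup>2 * hermitian_form \<Phi> G v"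
proof -
  have "(\<Sum>\<phi>\<in>\<Phi>. \<Sum>\<psi>\<in>\<Phi>. cnj (c * v \<phi>) * G \<phi> \<psi> * (c * v \<psi>)) = complex_of_real ((cmod c)\<^sup>2) * (\<Sum>\<phi>\<in>\<Phi>. \<Sum>\<psi>\<in>\<Phi>. cnj (v \<phi>) * G \<phi> \<psi> * v \<psi>)"
    unfolding complex_norm_square by (simp add: sum_distrib_left mult_ac)
  then show ?thesis unfolding hermitian_form_def by simp
qed

lemma hermitian_form_tendsto:
  assumes "\<And>\<phi>. \<phi> \<in> \<Phi> \<Longrightarrow> (\<lambda>n. u n \<phi>) \<longlonglongrightarrow> v \<phi>"
  shows "(\<lambda>n. hermitian_form \<Phi> G (u n)) \<longlonglongrightarrow> hermitian_form \<Phi> G v"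
  unfolding hermitian_form_def by (intro tendsto_intros assms)

lemma combination_tendsto:
  assumes "\<And>\<phi>. \<phi> \<in> \<Phi> \<Longrightarrow> (\<lambda>n. u n \<phi>) \<longlonglongrightarrow> v \<phi>"
  shows "(\<lambda>n. combination \<Phi> (u n) x) \<longlonglongrightarrow> combination \<Phi> v x"
  unfolding combination_def by (intro tendsto_intros assms)

text \<open>Frequencies at which all Gramians with the weights \<open>weight h s\<close> converge, for \<open>h = 0\<close> as well. The origin is
  excluded because there the weight with \<open>h = 0\<close> is not comparable with the Sobolev weight.\<close>

definition regular_frequency :: "real \<Rightarrow> 'd::finite dist set \<Rightarrow> real^'d \<Rightarrow> bool" where
  "regular_frequency s \<Phi> \<omega> \<longleftrightarrow> \<omega> \<in> cell \<and> \<omega> \<noteq> 0 \<and> (\<forall>\<phi>\<in>\<Phi>. fiber_energy (sobolev_weight s) (hat \<phi>) \<omega> < \<infinity>)"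

lemma AE_regular_frequency:
  fixes \<Phi> :: "'d::finite dist set"
  assumes "finite \<Phi>" "\<Phi> \<subseteq> W s"
  shows "AE \<omega> in lborel. \<omega> \<in> cell \<longrightarrow> regular_frequency s \<Phi> \<omega>"
proof -
  have "AE \<omega> in lborel. \<forall>\<phi>\<in>\<Phi>. \<omega> \<in> cell \<longrightarrow> fiber_energy (sobolev_weight s) (hat \<phi>) \<omega> < \<infinity>"
  proof (intro AE_finite_allI assms)
    fix \<phi> assume "\<phi> \<in> \<Phi>"
    then have p: "\<phi> \<in> W s" using assms by blast
    then have [measurable]: "hat \<phi> \<in> borel_measurable borel" by (rule hat_measurable)
    have "(\<integral>\<^sup>+\<omega>. fiber_energy (sobolev_weight s) (hat \<phi>) \<omega> * indicator cell \<omega> \<partial>lborel) \<noteq> \<infinity>"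
      using W_energy[OF p] by (subst energy_fibers[symmetric]) auto
    then have "AE \<omega> in lborel. fiber_energy (sobolev_weight s) (hat \<phi>) \<omega> * indicator cell \<omega> \<noteq> \<infinity>"
      by (intro nn_integral_PInf_AE) auto
    then show "AE \<omega> in lborel. \<omega> \<in> cell \<longrightarrow> fiber_energy (sobolev_weight s) (hat \<phi>) \<omega> < \<infinity>"
      by eventually_elim (auto simp: less_top)
  qed
  moreover have "AE \<omega> in lborel. \<omega> \<noteq> (0 :: real^'d)" by (rule AE_lborel_singleton)
  ultimately show ?thesis by eventually_elim (auto simp: regular_frequency_def)
qed

text \<open>In contrast to \<open>weight_sobolev_weight_compare\<close> the case \<open>h = 0\<close> is included.\<close>

lemma weight_sobolev_weight_away_from_zero:
  assumes r: "r > 0"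
  obtains c where "c > 0" "\<And>x::real^'d::finite. r \<le> norm x \<Longrightarrow> weight h s x \<le> c * sobolev_weight s x"
proof -
  define c where "c = 1 + h\<^sup>2 + (1 / r + 1)\<^sup>2"
  have c: "c \<ge> 1" unfolding c_def by simp
  have "weight h s x \<le> c powr \<bar>s\<bar> * sobolev_weight s x" if x: "r \<le> norm x" for x :: "real^'d"
  proof -
    have n: "norm x > 0" using r x by linarith
    have 1: "(norm x)\<^sup>2 + h\<^sup>2 \<le> c * (1 + norm x)\<^sup>2"
    proof -
      have "1 \<le> (1 + norm x)\<^sup>2" by (simp add: one_le_power)
      then have "h\<^sup>2 * 1 \<le> h\<^sup>2 * (1 + norm x)\<^sup>2" by (intro mult_left_mono) auto
      moreover have "(norm x)\<^sup>2 \<le> (1 + norm x)\<^sup>2" by (intro power_mono) auto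
      moreover have "0 \<le> (1 / r + 1)\<^sup>2 * (1 + norm x)\<^sup>2" by simp
      ultimately show ?thesis unfolding c_def distrib_right by linarith
    qed
    have 2: "(1 + norm x)\<^sup>2 \<le> c * ((norm x)\<^sup>2 + h\<^sup>2)"
    proof -
      have "1 \<le> norm x / r" using x r by simp
      then have "1 + norm x \<le> (1 / r + 1) * norm x" by (simp add: distrib_right)
      then have "(1 + norm x)\<^sup>2 \<le> ((1 / r + 1) * norm x)\<^sup>2" by (intro power_mono) auto
      also have "\<dots> = (1 / r + 1)\<^sup>2 * (norm x)\<^sup>2" by (rule power_mult_distrib)
      also have "\<dots> \<le> c * ((norm x)\<^sup>2 + h\<^sup>2)" unfolding c_def by (intro mult_mono) auto
      finally show ?thesis .
    qed
    have eq: "sobolev_weight s x = (1 + norm x)\<^sup>2 powr s"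
      unfolding sobolev_weight_def by (subst square_powr) (simp_all add: add_pos_nonneg)
    have "(norm x)\<^sup>2 + h\<^sup>2 > 0" using n by (simp add: add_pos_nonneg)
    moreover have "(1 + norm x)\<^sup>2 > 0" by (intro zero_less_power add_pos_nonneg) auto
    ultimately show ?thesis unfolding eq unfolding weight_def by (intro powr_compare 1 2 c)
  qed
  then show ?thesis using c by (intro that[of "c powr \<bar>s\<bar>"]) auto
qed

lemma regular_frequency_fiber_norm:
  assumes "regular_frequency s \<Phi> \<omega>" "\<alpha> \<in> dual_lattice" shows "min (norm \<omega>) pi \<le> norm (\<omega> + \<alpha>)"
  using assms norm_outside_cell[of \<omega> \<alpha>] unfolding regular_frequency_def by (cases "\<alpha> = 0") auto

lemma regular_frequency_finite:
  assumes g: "regular_frequency s \<Phi> \<omega>" and p: "\<phi> \<in> \<Phi>" and A: "A \<subseteq> dual_lattice"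
  shows "fiber_sum A (\<lambda>x. ennreal (weight h s x * (cmod (hat \<phi> x))\<^sup>2)) \<omega> < \<infinity>"
proof -
  let ?P = "\<lambda>x. ennreal (weight h s x * (cmod (hat \<phi> x))\<^sup>2)"
  have r: "min (norm \<omega>) pi > 0" using g by (simp add: regular_frequency_def)
  obtain c where c: "c > 0" "\<And>x::real^'a. min (norm \<omega>) pi \<le> norm x \<Longrightarrow> weight h s x \<le> c * sobolev_weight s x"
    using weight_sobolev_weight_away_from_zero[OF r] by metis
  have "fiber_sum A ?P \<omega> = (\<integral>\<^sup>+\<alpha>. ?P (\<omega> + \<alpha>) * indicator A \<alpha> \<partial>count_space UNIV)"
    unfolding fiber_sum_def by (rule nn_integral_count_space_indicator) (simp add: NO_MATCH_def)
  also have "\<dots> \<le> (\<integral>\<^sup>+\<alpha>. ?P (\<omega> + \<alpha>) * indicator dual_lattice \<alpha> \<partial>count_space UNIV)"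
    using A by (intro nn_integral_mono) (auto simp: indicator_def)
  also have "\<dots> = fiber_energy (weight h s) (hat \<phi>) \<omega>"
    unfolding fiber_energy_def fiber_sum_def by (rule nn_integral_count_space_indicator[symmetric]) (simp add: NO_MATCH_def)
  also have "\<dots> \<le> ennreal c * fiber_energy (sobolev_weight s) (hat \<phi>) \<omega>"
    using c by (intro fiber_energy_mono_weight c(2) regular_frequency_fiber_norm[OF g]) auto
  also have "\<dots> < \<infinity>" using g p by (simp add: regular_frequency_def ennreal_mult_less_top)
  finally show ?thesis .
qed

abbreviation form :: "real \<Rightarrow> real \<Rightarrow> 'd::finite dist set \<Rightarrow> real^'d \<Rightarrow> ('d dist \<Rightarrow> complex) \<Rightarrow> real" where
  "form h s \<Phi> \<omega> v \<equiv> hermitian_form \<Phi> (gramian dual_lattice (weight h s) \<omega>) v"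

abbreviation form0 :: "real \<Rightarrow> real \<Rightarrow> 'd::finite dist set \<Rightarrow> real^'d \<Rightarrow> ('d dist \<Rightarrow> complex) \<Rightarrow> real" where
  "form0 h s \<Phi> \<omega> v \<equiv> hermitian_form \<Phi> (gramian (dual_lattice - {0}) (weight h s) \<omega>) v"

context
  fixes s h :: real and \<Phi> :: "'d::finite dist set" and \<omega> :: "real^'d"
  assumes fin: "finite \<Phi>" and g: "regular_frequency s \<Phi> \<omega>"
begin

lemma form_fiber_sum:
  "ennreal (form h s \<Phi> \<omega> v) = fiber_sum dual_lattice (\<lambda>x. ennreal (weight h s x * (cmod (combination \<Phi> v x))\<^sup>2)) \<omega>"
  "ennreal (form0 h s \<Phi> \<omega> v) = fiber_sum (dual_lattice - {0}) (\<lambda>x. ennreal (weight h s x * (cmod (combination \<Phi> v x))\<^sup>2)) \<omega>"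
  "form h s \<Phi> \<omega> v \<ge> 0" "form0 h s \<Phi> \<omega> v \<ge> 0"
  by (auto intro!: hermitian_form_gramian fin regular_frequency_finite[OF g])

lemma form_split: "form h s \<Phi> \<omega> v = weight h s \<omega> * (cmod (combination \<Phi> v \<omega>))\<^sup>2 + form0 h s \<Phi> \<omega> v"
proof -
  have "ennreal (form h s \<Phi> \<omega> v) = ennreal (weight h s \<omega> * (cmod (combination \<Phi> v \<omega>))\<^sup>2) + ennreal (form0 h s \<Phi> \<omega> v)"
    unfolding form_fiber_sum by (rule fiber_sum_split_zero)
  also have "\<dots> = ennreal (weight h s \<omega> * (cmod (combination \<Phi> v \<omega>))\<^sup>2 + form0 h s \<Phi> \<omega> v)"
    using form_fiber_sum(4) by (simp add: ennreal_plus)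
  finally show ?thesis using form_fiber_sum(3,4) by (simp add: ennreal_inj del: ennreal_plus)
qed

text \<open>For \<open>\<alpha> \<noteq> 0\<close> the unit vector vanishes and the error is the combination itself.\<close>

lemma fiber_error_form: "fiber_error h s \<Phi> v \<omega> = ennreal (weight h s \<omega> * (cmod (1 - combination \<Phi> v \<omega>))\<^sup>2 + form0 h s \<Phi> \<omega> v)"
proof -
  have c: "\<omega> \<in> cell" using g by (simp add: regular_frequency_def)
  have "fiber_sum (dual_lattice - {0}) (\<lambda>x. ennreal (weight h s x * (cmod (indicator cell x - combination \<Phi> v x))\<^sup>2)) \<omega>
     = fiber_sum (dual_lattice - {0}) (\<lambda>x. ennreal (weight h s x * (cmod (combination \<Phi> v x))\<^sup>2)) \<omega>"
    unfolding fiber_sum_def by (intro nn_integral_cong) (auto simp: cell_indicator_shift[OF c])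
  then show ?thesis
    unfolding fiber_error_def fiber_energy_def fiber_sum_split_zero
    using c form_fiber_sum(4) by (simp add: form_fiber_sum(2)[symmetric] ennreal_plus)
qed

lemma gramian_ratio_eq: "gramian_ratio \<Phi> (weight h s) \<omega> = (INF v\<in>{v. form h s \<Phi> \<omega> v \<noteq> 0}. ennreal (form0 h s \<Phi> \<omega> v / form h s \<Phi> \<omega> v))"
  unfolding gramian_ratio_def by (simp add: Let_def)

text \<open>With \<open>W\<close> the weight at \<open>\<omega>\<close>, \<open>x\<close> the value of the combination at \<open>\<omega>\<close> and \<open>C = v\<^sup>* G\<^sup>0 v\<close>, the ratio is at most
  \<open>C / (W |x|\<^sup>2 + C)\<close> and the error is \<open>W |1 - x|\<^sup>2 + C\<close>. The claim is \<open>W C \<le> (W |1 - x|\<^sup>2 + C) (W |x|\<^sup>2 + C)\<close>, an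
  instance of the Cauchy-Schwarz inequality. If \<open>v\<^sup>* G v = 0\<close>, then \<open>W x = 0\<close> and the error is at least \<open>W\<close>;
  this is where the minimum with \<open>1\<close> is used.\<close>

lemma ratio_le_fiber_error: "ennreal (weight h s \<omega>) * min 1 (gramian_ratio \<Phi> (weight h s) \<omega>) \<le> fiber_error h s \<Phi> v \<omega>"
proof -
  let ?W = "weight h s \<omega>" and ?B = "form h s \<Phi> \<omega> v" and ?C = "form0 h s \<Phi> \<omega> v"
  let ?a = "cmod (combination \<Phi> v \<omega>)" and ?b = "cmod (1 - combination \<Phi> v \<omega>)"
  have ab: "1 \<le> ?a + ?b" using norm_triangle_ineq[of "combination \<Phi> v \<omega>" "1 - combination \<Phi> v \<omega>"] by simp
  show ?thesis
  proof (cases "?B = 0")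
    case True
    have "0 = ?W * ?a\<^sup>2 + ?C" unfolding form_split[symmetric] by (rule True[symmetric])
    moreover have "?W * ?a\<^sup>2 \<ge> 0" by simp
    ultimately have z: "?W * ?a\<^sup>2 = 0" using form_fiber_sum(4)[of v] by linarith
    have "?W * 1 \<le> ?W * ?b\<^sup>2"
    proof (cases "?W = 0")
      case False
      then have "?a = 0" using z by simp
      then show ?thesis by simp
    qed simp
    then have "ennreal ?W \<le> fiber_error h s \<Phi> v \<omega>" unfolding fiber_error_form using form_fiber_sum(4)[of v] by (intro ennreal_leI) simp
    moreover have "ennreal ?W * min 1 (gramian_ratio \<Phi> (weight h s) \<omega>) \<le> ennreal ?W * 1" by (intro mult_left_mono) auto
    ultimately show ?thesis by simp
  next
    case False
    then have B: "?B > 0" using form_fiber_sum(3)[of v] by simp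
    have B0: "?C \<ge> 0" by (rule form_fiber_sum(4))
    have "gramian_ratio \<Phi> (weight h s) \<omega> \<le> ennreal (?C / ?B)"
      unfolding gramian_ratio_eq using False by (intro INF_lower) simp
    then have "ennreal ?W * min 1 (gramian_ratio \<Phi> (weight h s) \<omega>) \<le> ennreal ?W * ennreal (?C / ?B)"
      by (intro mult_left_mono) (auto intro: min.coboundedI2)
    also have "\<dots> = ennreal (?W * (?C / ?B))" using B B0 by (intro ennreal_mult[symmetric]) auto
    also have "\<dots> \<le> fiber_error h s \<Phi> v \<omega>" unfolding fiber_error_form
    proof (rule ennreal_leI)
      (* From 1 <= (a + b)^2 and 2 W a b C <= (W a b)^2 + C^2. *)
      have "?W * ?C * 1 \<le> ?W * ?C * (?a + ?b)\<^sup>2"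
        using B0 ab by (intro mult_left_mono one_le_power) auto
      also have "\<dots> = ?W * ?C * (?a\<^sup>2 + ?b\<^sup>2) + 2 * (?W * ?a * ?b) * ?C" by (simp add: power2_sum algebra_simps)
      also have "\<dots> \<le> ?W * ?C * (?a\<^sup>2 + ?b\<^sup>2) + ((?W * ?a * ?b)\<^sup>2 + ?C\<^sup>2)"
        using sum_squares_bound[of "?W * ?a * ?b" ?C] by simp
      also have "\<dots> = (?W * ?b\<^sup>2 + ?C) * (?W * ?a\<^sup>2 + ?C)" by (simp add: power2_eq_square algebra_simps)
      finally have "?W * ?C \<le> (?W * ?b\<^sup>2 + ?C) * ?B" unfolding form_split[of v] by simp
      then show "?W * (?C / ?B) \<le> ?W * ?b\<^sup>2 + ?C" using B by (simp add: field_simps)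
    qed
    finally show ?thesis .
  qed
qed

text \<open>The Cauchy-Schwarz inequality in \<open>ratio_le_fiber_error\<close> becomes an equality for a suitable multiple of \<open>v\<close>,
  while \<open>v = 0\<close> has error \<open>W\<close>. Thus the squared distance of the unit vector from the span is exactly \<open>W\<close> times
  the minimum of \<open>1\<close> and the ratio.\<close>

lemma fiber_error_lt_of_ratio:
  assumes W: "weight h s \<omega> > 0" and q: "q > 0" and R: "min 1 (gramian_ratio \<Phi> (weight h s) \<omega>) \<le> ennreal q"
  shows "\<exists>v. fiber_error h s \<Phi> v \<omega> < ennreal (2 * q * weight h s \<omega>)"
proof (cases "q \<ge> 1")
  case True
  have "form0 h s \<Phi> \<omega> (\<lambda>_. 0) = 0" by (simp add: hermitian_form_def)
  then have "fiber_error h s \<Phi> (\<lambda>_. 0) \<omega> = ennreal (weight h s \<omega>)" unfolding fiber_error_form by (simp add: combination_zero)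
  moreover have "1 * weight h s \<omega> < 2 * q * weight h s \<omega>" using W True by (intro mult_strict_right_mono) auto
  ultimately show ?thesis using W q by (intro exI[of _ "\<lambda>_. 0"]) (simp add: ennreal_less_iff)
next
  case False
  let ?W = "weight h s \<omega>"
  have "gramian_ratio \<Phi> (weight h s) \<omega> \<le> ennreal q"
    using R False by (auto simp: min_def split: if_splits)
  also have "\<dots> < ennreal (2 * q)" using q by (simp add: ennreal_less_iff)
  finally obtain v where v: "form h s \<Phi> \<omega> v \<noteq> 0" "ennreal (form0 h s \<Phi> \<omega> v / form h s \<Phi> \<omega> v) < ennreal (2 * q)"
    unfolding gramian_ratio_eq INF_less_iff by auto
  let ?B = "form h s \<Phi> \<omega> v" and ?C = "form0 h s \<Phi> \<omega> v" and ?x = "combination \<Phi> v \<omega>"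
  have B: "?B > 0" using v(1) form_fiber_sum(3)[of v] by simp
  have B0: "?C \<ge> 0" by (rule form_fiber_sum(4))
  have lt: "?C / ?B < 2 * q" using v(2) B B0 q by (simp add: ennreal_less_iff)
  (* The minimiser of W |1 - t x|^2 + |t|^2 C is t = W cnj x / B, and scaling v by c scales
     the combination by the conjugate of c. *)
  define c where "c = complex_of_real (?W / ?B) * ?x"
  let ?u = "\<lambda>\<phi>. c * v \<phi>"
  have xx: "?W * (cmod ?x)\<^sup>2 = ?B - ?C" using form_split[of v] by simp
  have "combination \<Phi> ?u \<omega> = complex_of_real ((?B - ?C) / ?B)"
  proof -
    have "combination \<Phi> ?u \<omega> = complex_of_real (?W / ?B) * (?x * cnj ?x)" unfolding combination_scale c_def by simp
    also have "\<dots> = complex_of_real (?W * (cmod ?x)\<^sup>2 / ?B)" by (simp only: complex_norm_square[symmetric]) simp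
    finally show ?thesis unfolding xx .
  qed
  then have "1 - combination \<Phi> ?u \<omega> = complex_of_real (1 - (?B - ?C) / ?B)" by (simp only: of_real_diff of_real_1)
  also have "1 - (?B - ?C) / ?B = ?C / ?B" using B by (simp add: field_simps)
  finally have "(cmod (1 - combination \<Phi> ?u \<omega>))\<^sup>2 = (?C / ?B)\<^sup>2" by (simp only: norm_of_real power2_abs)
  moreover have "form0 h s \<Phi> \<omega> ?u = (?W / ?B)\<^sup>2 * (cmod ?x)\<^sup>2 * ?C"
    unfolding hermitian_form_scale c_def by (simp only: norm_mult norm_of_real power_mult_distrib power2_abs)
  ultimately have "?W * (cmod (1 - combination \<Phi> ?u \<omega>))\<^sup>2 + form0 h s \<Phi> \<omega> ?u = ?W * (?C / ?B)\<^sup>2 + ?W / ?B\<^sup>2 * (?W * (cmod ?x)\<^sup>2) * ?C"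
    by (simp add: power_divide power2_eq_square)
  also have "\<dots> = ?W * (?C / ?B)" unfolding xx using B by (simp add: field_simps power2_eq_square)
  also have "\<dots> < ?W * (2 * q)" using lt W by (intro mult_strict_left_mono)
  finally have "fiber_error h s \<Phi> ?u \<omega> < ennreal (2 * q * ?W)" unfolding fiber_error_form using W q
    by (subst ennreal_less_iff) (auto simp: mult_ac intro!: add_nonneg_nonneg form_fiber_sum)
  then show ?thesis by blast
qed

lemma fiber_error_tendsto:
  assumes "\<And>\<phi>. \<phi> \<in> \<Phi> \<Longrightarrow> (\<lambda>n. u n \<phi>) \<longlonglongrightarrow> v \<phi>"
  shows "(\<lambda>n. fiber_error h s \<Phi> (u n) \<omega>) \<longlonglongrightarrow> fiber_error h s \<Phi> v \<omega>"
  unfolding fiber_error_form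
  by (intro tendsto_ennrealI tendsto_intros combination_tendsto hermitian_form_tendsto assms)

end

text \<open>A countable dense set of coefficient vectors. The values outside \<open>\<Phi>\<close> are irrelevant for combinations, and
  fixing them, as \<open>PiE\<close> does, makes the set countable.\<close>

definition dense_coefficients :: "'d::finite dist set \<Rightarrow> ('d dist \<Rightarrow> complex) set" where
  "dense_coefficients \<Phi> = PiE \<Phi> (\<lambda>_. SOME D. countable D \<and> (\<forall>X. open X \<longrightarrow> X \<noteq> {} \<longrightarrow> (\<exists>d\<in>D. d \<in> X)))"

lemma
  assumes "finite \<Phi>"
  shows countable_dense_coefficients: "countable (dense_coefficients \<Phi>)"
    and dense_coefficients_sequence: "\<exists>u. (\<forall>n. u n \<in> dense_coefficients \<Phi>) \<and> (\<forall>\<phi>\<in>\<Phi>. (\<lambda>n. u n \<phi>) \<longlonglongrightarrow> v \<phi>)"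
proof -
  define D :: "complex set" where "D = (SOME D. countable D \<and> (\<forall>X. open X \<longrightarrow> X \<noteq> {} \<longrightarrow> (\<exists>d\<in>D. d \<in> X)))"
  have "\<exists>D :: complex set. countable D \<and> (\<forall>X. open X \<longrightarrow> X \<noteq> {} \<longrightarrow> (\<exists>d\<in>D. d \<in> X))"
    using countable_dense_exists by blast
  from someI_ex[OF this] have D: "countable D" "\<And>X. open X \<Longrightarrow> X \<noteq> {} \<Longrightarrow> \<exists>d\<in>D. d \<in> X" unfolding D_def by auto
  have eq: "dense_coefficients \<Phi> = PiE \<Phi> (\<lambda>_. D)" unfolding dense_coefficients_def D_def ..
  show "countable (dense_coefficients \<Phi>)" unfolding eq using assms D(1) by (intro countable_PiE) auto
  have "\<exists>d\<in>D. dist d z < inverse (real (Suc n))" for z n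
  proof -
    have "\<exists>d\<in>D. d \<in> ball z (inverse (real (Suc n)))" by (rule D(2)) (auto simp del: of_nat_Suc)
    then show ?thesis by (auto simp: dist_commute)
  qed
  then obtain d where d: "\<And>z n. d z n \<in> D" "\<And>z n. dist (d z n) z < inverse (real (Suc n))" by metis
  have lim: "d z \<longlonglongrightarrow> z" for z
  proof (rule metric_tendsto_imp_tendsto[OF LIMSEQ_inverse_real_of_nat])
    show "\<forall>\<^sub>F n in sequentially. dist (d z n) z \<le> dist (inverse (real (Suc n))) 0"
      using d(2)[of z] by (intro always_eventually allI) (simp add: less_imp_le del: of_nat_Suc)
  qed
  let ?u = "\<lambda>n. restrict (\<lambda>\<phi>. d (v \<phi>) n) \<Phi>"
  show "\<exists>u. (\<forall>n. u n \<in> dense_coefficients \<Phi>) \<and> (\<forall>\<phi>\<in>\<Phi>. (\<lambda>n. u n \<phi>) \<longlonglongrightarrow> v \<phi>)"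
    unfolding eq using d(1) lim by (intro exI[of _ ?u]) auto
qed

text \<open>The function \<open>gramian_ratio\<close> involves unconditional sums and an uncountable infimum. This Borel function
  agrees with it at regular frequencies: the forms are written as sums in \<open>[0,\<infinity>]\<close> and the infimum extends over a
  countable set only.\<close>

definition measurable_ratio :: "real \<Rightarrow> real \<Rightarrow> 'd::finite dist set \<Rightarrow> real^'d \<Rightarrow> ennreal" where
  "measurable_ratio h s \<Phi> \<omega> = (INF u\<in>dense_coefficients \<Phi>.
     if fiber_sum dual_lattice (\<lambda>x. ennreal (weight h s x * (cmod (combination \<Phi> u x))\<^sup>2)) \<omega> = 0 then \<infinity>
     else fiber_sum (dual_lattice - {0}) (\<lambda>x. ennreal (weight h s x * (cmod (combination \<Phi> u x))\<^sup>2)) \<omega> /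
          fiber_sum dual_lattice (\<lambda>x. ennreal (weight h s x * (cmod (combination \<Phi> u x))\<^sup>2)) \<omega>)"

lemma measurable_ratio_measurable:
  assumes "finite \<Phi>" "\<Phi> \<subseteq> W s"
  shows "measurable_ratio h s \<Phi> \<in> borel_measurable borel"
proof -
  have [measurable]: "combination \<Phi> u \<in> borel_measurable borel" for u by (rule combination_measurable[OF assms(2)])
  have [measurable]: "fiber_sum dual_lattice (\<lambda>x. ennreal (weight h s x * (cmod (combination \<Phi> u x))\<^sup>2)) \<in> borel_measurable borel" 
    "fiber_sum (dual_lattice - {0}) (\<lambda>x. ennreal (weight h s x * (cmod (combination \<Phi> u x))\<^sup>2)) \<in> borel_measurable borel" for u
    by (intro fiber_sum_measurable countable_Diff countable_dual_lattice, measurable)+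
  show ?thesis unfolding measurable_ratio_def[abs_def]
    by (intro borel_measurable_INF countable_dense_coefficients assms) measurable
qed

text \<open>The quotient depends continuously on \<open>v\<close> wherever its denominator is nonzero.\<close>

lemma measurable_ratio_eq:
  assumes fin: "finite \<Phi>" and g: "regular_frequency s \<Phi> \<omega>"
  shows "measurable_ratio h s \<Phi> \<omega> = gramian_ratio \<Phi> (weight h s) \<omega>"
proof -
  note ff = form_fiber_sum[OF fin g, of h]
  let ?r = "\<lambda>v. ennreal (form0 h s \<Phi> \<omega> v / form h s \<Phi> \<omega> v)"
  have M: "measurable_ratio h s \<Phi> \<omega> = (INF u\<in>dense_coefficients \<Phi>. if form h s \<Phi> \<omega> u = 0 then \<infinity> else ?r u)"
    unfolding measurable_ratio_def ff(1,2)[symmetric]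
  proof (intro INF_cong refl)
    fix u
    show "(if ennreal (form h s \<Phi> \<omega> u) = 0 then \<infinity> else ennreal (form0 h s \<Phi> \<omega> u) / ennreal (form h s \<Phi> \<omega> u))
       = (if form h s \<Phi> \<omega> u = 0 then \<infinity> else ?r u)"
      using ff(3,4)[of u] by (auto simp: divide_ennreal)
  qed
  show ?thesis
  proof (rule antisym)
    show "measurable_ratio h s \<Phi> \<omega> \<le> gramian_ratio \<Phi> (weight h s) \<omega>"
      unfolding gramian_ratio_eq[OF fin g]
    proof (rule INF_greatest)
      fix v assume "v \<in> {v. form h s \<Phi> \<omega> v \<noteq> 0}"
      then have v: "form h s \<Phi> \<omega> v \<noteq> 0" by simp
      obtain u where u: "\<And>n. u n \<in> dense_coefficients \<Phi>" "\<And>\<phi>. \<phi> \<in> \<Phi> \<Longrightarrow> (\<lambda>n. u n \<phi>) \<longlonglongrightarrow> v \<phi>"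
        using dense_coefficients_sequence[OF fin, of v] by blast
      have l: "(\<lambda>n. form h s \<Phi> \<omega> (u n)) \<longlonglongrightarrow> form h s \<Phi> \<omega> v" "(\<lambda>n. form0 h s \<Phi> \<omega> (u n)) \<longlonglongrightarrow> form0 h s \<Phi> \<omega> v"
        by (rule hermitian_form_tendsto, rule u(2), assumption)+
      have "(\<lambda>n. ?r (u n)) \<longlonglongrightarrow> ?r v" using v by (intro tendsto_ennrealI tendsto_divide l)
      moreover have "\<forall>\<^sub>F n in sequentially. form h s \<Phi> \<omega> (u n) \<noteq> 0"
        using l(1) v by (rule tendsto_imp_eventually_ne)
      then have "\<forall>\<^sub>F n in sequentially. measurable_ratio h s \<Phi> \<omega> \<le> ?r (u n)"
      proof eventually_elim
        case (elim n)
        then show ?case unfolding M using u(1)[of n] by (intro INF_lower2[of "u n"]) auto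
      qed
      ultimately show "measurable_ratio h s \<Phi> \<omega> \<le> ?r v" by (rule tendsto_lowerbound) simp
    qed
    show "gramian_ratio \<Phi> (weight h s) \<omega> \<le> measurable_ratio h s \<Phi> \<omega>"
      unfolding M
    proof (rule INF_greatest)
      fix u show "gramian_ratio \<Phi> (weight h s) \<omega> \<le> (if form h s \<Phi> \<omega> u = 0 then \<infinity> else ?r u)"
        unfolding gramian_ratio_eq[OF fin g] by (auto intro: INF_lower)
    qed
  qed
qed

section \<open>Approximation order as a condition on almost every fiber\<close>

lemma indicator_in_W:
  fixes A :: "(real^'d::finite) set"
  assumes A[measurable]: "A \<in> sets borel" and bA: "bounded A"
  obtains f where "f \<in> W k" "AE x in lborel. hat f x = indicator A x"
proof -
  obtain f where f: "f \<in> tempered" "represented_by (dist_fourier f) (\<lambda>\<omega>. indicator A \<omega>)"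
    using fourier_preimage_of_indicator[OF A bA] by blast
  obtain b where b: "\<And>x. x \<in> A \<Longrightarrow> norm x \<le> b" using bA by (auto simp: bounded_iff)
  let ?c = "(1 + \<bar>b\<bar>) powr (2 * \<bar>k\<bar>)"
  have "energy (sobolev_weight k) (\<lambda>x. indicator A x) \<le> (\<integral>\<^sup>+x. ennreal ?c * indicator A x \<partial>lborel)"
    unfolding energy_def
  proof (rule nn_integral_mono)
    fix x :: "real^'d"
    have "sobolev_weight k x \<le> ?c" if "x \<in> A"
    proof -
      have "sobolev_weight k x \<le> (1 + norm x) powr (2 * \<bar>k\<bar>)" unfolding sobolev_weight_def by (intro powr_mono) auto
      also have "\<dots> \<le> ?c" using b[OF that] by (intro powr_mono2) auto
      finally show ?thesis .
    qed
    then show "ennreal (sobolev_weight k x * (cmod (indicator A x))\<^sup>2) \<le> ennreal ?c * indicator A x"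
      by (cases "x \<in> A") (auto intro: ennreal_leI)
  qed
  also have "\<dots> = ennreal ?c * emeasure lborel A" by (simp add: nn_integral_cmult)
  also have "\<dots> < \<infinity>" using emeasure_bounded_finite[OF bA] by (simp add: ennreal_mult_less_top)
  finally have "f \<in> W k" by (rule W_I[OF f])
  then show ?thesis using that hat_AE[OF f(2)] by blast
qed

lemma AE_le_of_set_integrals_le:
  fixes f g :: "real^'d::finite \<Rightarrow> ennreal"
  assumes [measurable]: "f \<in> borel_measurable borel" "g \<in> borel_measurable borel" and C[measurable]: "C \<in> sets borel"
    and fin: "(\<integral>\<^sup>+x. g x * indicator C x \<partial>lborel) < \<infinity>"
    and le: "\<And>A. A \<in> sets borel \<Longrightarrow> A \<subseteq> C \<Longrightarrow> (\<integral>\<^sup>+x. f x * indicator A x \<partial>lborel) \<le> (\<integral>\<^sup>+x. g x * indicator A x \<partial>lborel)"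
  shows "AE x in lborel. x \<in> C \<longrightarrow> f x \<le> g x"
proof -
  define A where "A = {x \<in> C. g x < f x}"
  have [measurable]: "A \<in> sets borel" unfolding A_def by measurable
  have lefin: "(\<integral>\<^sup>+x. g x * indicator A x \<partial>lborel) \<noteq> \<infinity>"
  proof -
    have "(\<integral>\<^sup>+x. g x * indicator A x \<partial>lborel) \<le> (\<integral>\<^sup>+x. g x * indicator C x \<partial>lborel)"
      by (intro nn_integral_mono mult_left_mono) (auto simp: A_def indicator_def)
    then show ?thesis using fin by (auto simp: top_unique)
  qed
  have "AE x in lborel. f x * indicator A x \<le> g x * indicator A x"
  proof (rule ccontr)
    assume n: "\<not> (AE x in lborel. f x * indicator A x \<le> g x * indicator A x)"
    have "(\<integral>\<^sup>+x. g x * indicator A x \<partial>lborel) < (\<integral>\<^sup>+x. f x * indicator A x \<partial>lborel)"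
      using lefin n by (intro nn_integral_less) (auto simp: A_def indicator_def intro: less_imp_le)
    moreover have "(\<integral>\<^sup>+x. f x * indicator A x \<partial>lborel) \<le> (\<integral>\<^sup>+x. g x * indicator A x \<partial>lborel)"
      by (rule le) (auto simp: A_def)
    ultimately show False by simp
  qed
  then show ?thesis
  proof eventually_elim
    case (elim x)
    then show ?case by (cases "x \<in> A") (auto simp: A_def not_less)
  qed
qed

lemma weight_pos: "h > 0 \<Longrightarrow> weight h s x > 0"
  unfolding weight_def by (simp add: add_nonneg_eq_0_iff)

lemma weight_add: "weight h (a + b) x = weight h a x * weight h b x"
  unfolding weight_def by (simp add: powr_add)

text \<open>The hypothesis is tested on the functions whose rescaled Fourier transforms are the indicators of the
  Borel subsets \<open>A\<close> of \<open>cell\<close>. By \<open>fsi_lower_bound\<close> this yields, for all such \<open>A\<close>, an inequality between the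
  integrals over \<open>A\<close> of the two sides multiplied by \<open>weight h s\<close>, and thus the inequality almost everywhere.\<close>

lemma ratio_necessary:
  fixes \<Phi> :: "'d::finite dist set"
  assumes fin: "finite \<Phi>" and \<Phi>: "\<Phi> \<subseteq> W s" and sk: "s < k" and h: "h > 0" and C: "C \<ge> 0"
    and ap: "\<And>f e. f \<in> W k \<Longrightarrow> e > 0 \<Longrightarrow> \<exists>g\<in>fsi_space s \<Phi>.
       energy (weight h s) (\<lambda>x. hat f (inverse h *\<^sub>R x) - hat g x)
        \<le> ennreal C * energy (weight h k) (\<lambda>x. hat f (inverse h *\<^sub>R x)) + ennreal e"
  shows "AE \<omega> in lborel. \<omega> \<in> cell \<longrightarrow> min 1 (gramian_ratio \<Phi> (weight h s) \<omega>) \<le> ennreal (2 * C * weight h (k - s) \<omega>)"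
proof -
  define R where "R \<omega> = ennreal (weight h s \<omega>) * min 1 (measurable_ratio h s \<Phi> \<omega>)" for \<omega>
  have [measurable]: "measurable_ratio h s \<Phi> \<in> borel_measurable borel" by (rule measurable_ratio_measurable[OF fin \<Phi>])
  have RM [measurable]: "R \<in> borel_measurable borel" unfolding R_def by measurable
  have regular_frequency: "AE \<omega> in lborel. \<omega> \<in> cell \<longrightarrow> regular_frequency s \<Phi> \<omega>" by (rule AE_regular_frequency[OF fin \<Phi>])
  have Rerr: "AE \<omega> in lborel. \<omega> \<in> cell \<longrightarrow> (\<forall>v. R \<omega> \<le> fiber_error h s \<Phi> v \<omega>)"
    using regular_frequency by eventually_elim (auto simp: R_def measurable_ratio_eq[OF fin] ratio_le_fiber_error[OF fin])
  have main: "(\<integral>\<^sup>+x. R x * indicator A x \<partial>lborel) \<le> (\<integral>\<^sup>+x. ennreal (2 * C * weight h k x) * indicator A x \<partial>lborel)"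
    if A [measurable]: "A \<in> sets borel" and Ac: "A \<subseteq> cell" for A
  proof -
    (* The frequencies of f are scaled by h relative to those of its rescaled transform. *)
    let ?A = "(\<lambda>x. h *\<^sub>R x) -` A"
    have "(\<lambda>x. h *\<^sub>R x) -` A \<inter> space borel \<in> sets borel" by (rule measurable_sets[OF _ A]) simp
    then have 1: "?A \<in> sets borel" by simp
    have "?A \<subseteq> (\<lambda>x. inverse h *\<^sub>R x) ` cell" using Ac h by (auto intro!: image_eqI[where x="h *\<^sub>R _"])
    then have 2: "bounded ?A" using bounded_scaling[OF cell_bounded] bounded_subset by blast
    obtain f where f: "f \<in> W k" "AE x in lborel. hat f x = indicator ?A x" using indicator_in_W[OF 1 2] by metis
    have fA: "AE x in lborel. hat f (inverse h *\<^sub>R x) = indicator A x"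
    proof -
      have "AE x in lborel. hat f (0 + inverse h *\<^sub>R x) = indicator ?A (0 + inverse h *\<^sub>R x)"
        by (rule AE_lborel_affine[OF f(2)]) (use h in simp)
      then show ?thesis using h by (simp add: indicator_def)
    qed
    have eA: "energy (weight h k) (\<lambda>x. hat f (inverse h *\<^sub>R x)) = energy (weight h k) (\<lambda>x. indicator A x)"
      by (rule energy_cong_AE[OF fA])
    have "(\<integral>\<^sup>+x. R x * indicator A x \<partial>lborel) \<le> 2 * (ennreal C * energy (weight h k) (\<lambda>x. indicator A x))"
    proof (rule ennreal_le_epsilon)
      fix e :: real assume e: "e > 0"
      then have "e / 2 > 0" by simp
      then obtain g where g: "g \<in> fsi_space s \<Phi>" "energy (weight h s) (\<lambda>x. hat f (inverse h *\<^sub>R x) - hat g x)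
        \<le> ennreal C * energy (weight h k) (\<lambda>x. hat f (inverse h *\<^sub>R x)) + ennreal (e / 2)"
        using ap[OF f(1)] by blast
      have eg: "energy (weight h s) (\<lambda>x. hat f (inverse h *\<^sub>R x) - hat g x) = energy (weight h s) (\<lambda>x. indicator A x - hat g x)"
        by (rule energy_cong_AE) (use fA in auto)
      have "(\<integral>\<^sup>+x. R x * indicator A x \<partial>lborel) \<le> 2 * energy (weight h s) (\<lambda>x. indicator A x - hat g x)"
        by (rule fsi_lower_bound[OF fin \<Phi> g(1) h Rerr A Ac])
      also have "\<dots> \<le> 2 * (ennreal C * energy (weight h k) (\<lambda>x. indicator A x) + ennreal (e / 2))"
        using g(2) unfolding eA eg by (intro mult_left_mono) auto
      also have "\<dots> = 2 * (ennreal C * energy (weight h k) (\<lambda>x. indicator A x)) + ennreal e"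
        using e ennreal_mult[of 2 "e / 2"] by (simp add: distrib_left)
      finally show "(\<integral>\<^sup>+x. R x * indicator A x \<partial>lborel) \<le> 2 * (ennreal C * energy (weight h k) (\<lambda>x. indicator A x)) + ennreal e" .
    qed
    also have "2 * (ennreal C * energy (weight h k) (\<lambda>x. indicator A x)) = ennreal (2 * C) * energy (weight h k) (\<lambda>x. indicator A x)"
      using C ennreal_mult[of 2 C] by (simp add: mult.assoc)
    also have "\<dots> = (\<integral>\<^sup>+x. ennreal (2 * C) * ennreal (weight h k x * (cmod (indicator A x))\<^sup>2) \<partial>lborel)"
      unfolding energy_def by (rule nn_integral_cmult[symmetric]) measurable
    also have "\<dots> = (\<integral>\<^sup>+x. ennreal (2 * C * weight h k x) * indicator A x \<partial>lborel)"
      using C by (intro nn_integral_cong) (auto simp: indicator_def ennreal_mult)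
    finally show ?thesis .
  qed
  have fin2: "(\<integral>\<^sup>+x. ennreal (2 * C * weight h k x) * indicator cell x \<partial>(lborel :: (real^'d) measure)) < \<infinity>"
  proof -
    obtain c where c: "c > 0" "\<And>x::real^'d. weight h k x \<le> c * sobolev_weight k x" using weight_sobolev_weight_compare[OF h] by metis
    obtain f where f: "f \<in> W k" "AE x in lborel. hat f x = indicator (cell :: (real^'d) set) x"
      using indicator_in_W[OF cell_measurable cell_bounded] by metis
    have "(\<integral>\<^sup>+x. ennreal (2 * C * weight h k x) * indicator cell x \<partial>(lborel :: (real^'d) measure))
        = (\<integral>\<^sup>+x. ennreal (2 * C) * ennreal (weight h k x * (cmod (indicator (cell :: (real^'d) set) x))\<^sup>2) \<partial>lborel)"
      using C by (intro nn_integral_cong) (auto simp: indicator_def ennreal_mult)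
    also have "\<dots> = ennreal (2 * C) * energy (weight h k) (\<lambda>x. indicator (cell :: (real^'d) set) x)"
      unfolding energy_def by (rule nn_integral_cmult) measurable
    also have "\<dots> \<le> ennreal (2 * C) * (ennreal c * energy (sobolev_weight k) (\<lambda>x. indicator (cell :: (real^'d) set) x))"
      using c by (intro mult_left_mono energy_mono_weight) auto
    also have "energy (sobolev_weight k) (\<lambda>x. indicator (cell :: (real^'d) set) x) = energy (sobolev_weight k) (hat f)"
      by (rule energy_cong_AE) (use f(2) in auto)
    also have "ennreal (2 * C) * (ennreal c * energy (sobolev_weight k) (hat f)) < \<infinity>"
      using W_energy[OF f(1)] by (simp add: ennreal_mult_less_top)
    finally show ?thesis .
  qed
  have "AE x in lborel. x \<in> cell \<longrightarrow> R x \<le> ennreal (2 * C * weight h k x)"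
  proof (rule AE_le_of_set_integrals_le[OF _ _ cell_measurable fin2])
    show "(\<integral>\<^sup>+x. R x * indicator A x \<partial>lborel) \<le> (\<integral>\<^sup>+x. ennreal (2 * C * weight h k x) * indicator A x \<partial>lborel)"
      if "A \<in> sets borel" "A \<subseteq> cell" for A using that by (rule main)
  qed measurable
  then show ?thesis using regular_frequency
  proof eventually_elim
    case (elim \<omega>)
    show ?case
    proof
      assume c: "\<omega> \<in> cell"
      let ?m = "min 1 (gramian_ratio \<Phi> (weight h s) \<omega>)"
      have "ennreal (weight h s \<omega>) * ?m \<le> ennreal (2 * C * weight h k \<omega>)"
        using elim c by (simp add: R_def measurable_ratio_eq[OF fin])
      also have "2 * C * weight h k \<omega> = weight h s \<omega> * (2 * C * weight h (k - s) \<omega>)"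
        using weight_add[of h s "k - s" \<omega>] by simp
      also have "ennreal \<dots> = ennreal (weight h s \<omega>) * ennreal (2 * C * weight h (k - s) \<omega>)"
        using C by (intro ennreal_mult) auto
      finally show "?m \<le> ennreal (2 * C * weight h (k - s) \<omega>)"
        using weight_pos[OF h, of s \<omega>] by (subst (asm) ennreal_mult_le_mult_iff) auto
    qed
  qed
qed

text \<open>The scale-free criterion common to the stationary and the nonstationary case. The minimum with \<open>1\<close>
  reflects that \<open>0\<close> is always available as an approximant; in particular the criterion is vacuous where
  \<open>K (|\<omega>|\<^sup>2 + h\<^sup>2)\<^sup>k\<^sup>-\<^sup>s \<ge> 1\<close>.\<close>

lemma approximation_order_iff_ratio:
  fixes \<Psi> :: "real \<Rightarrow> 'd::finite dist set"
  assumes sk: "s < k" and \<Psi>: "\<And>h. h > 0 \<Longrightarrow> finite (\<Psi> h) \<and> \<Psi> h \<subseteq> W s"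
  shows "approximation_order s k (\<lambda>h. dist_dilate h ` fsi_space s (\<Psi> h)) \<longleftrightarrow>
    (\<exists>K\<ge>0. \<forall>h>0. AE \<omega> in lborel. \<omega> \<in> cell \<longrightarrow> min 1 (gramian_ratio (\<Psi> h) (weight h s) \<omega>) \<le> ennreal (K * weight h (k - s) \<omega>))"
proof -
  have V: "closed_W_subspace s (fsi_space s (\<Psi> h)) \<and> shift_invariant 1 (fsi_space s (\<Psi> h))" if "h > 0" for h
    using \<Psi>[OF that] closed_fsi_space shift_invariant_fsi_space by blast
  have iff: "approximation_order s k (\<lambda>h. dist_dilate h ` fsi_space s (\<Psi> h)) \<longleftrightarrow>
    (\<exists>C\<ge>0. \<forall>f\<in>W k. \<forall>h>0. \<forall>e>0. \<exists>g\<in>fsi_space s (\<Psi> h). energy (weight h s) (\<lambda>x. hat f (inverse h *\<^sub>R x) - hat g x)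
        \<le> ennreal C * energy (weight h k) (\<lambda>x. hat f (inverse h *\<^sub>R x)) + ennreal e)"
    by (rule approximation_order_iff_energy[OF sk]) (rule V)
  show ?thesis unfolding iff
  proof
    assume "\<exists>C\<ge>0. \<forall>f\<in>W k. \<forall>h>0. \<forall>e>0. \<exists>g\<in>fsi_space s (\<Psi> h). energy (weight h s) (\<lambda>x. hat f (inverse h *\<^sub>R x) - hat g x)
        \<le> ennreal C * energy (weight h k) (\<lambda>x. hat f (inverse h *\<^sub>R x)) + ennreal e"
    then obtain C where C: "C \<ge> 0" "\<And>f h e. f \<in> W k \<Longrightarrow> h > 0 \<Longrightarrow> e > 0 \<Longrightarrow> \<exists>g\<in>fsi_space s (\<Psi> h). energy (weight h s) (\<lambda>x. hat f (inverse h *\<^sub>R x) - hat g x)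
        \<le> ennreal C * energy (weight h k) (\<lambda>x. hat f (inverse h *\<^sub>R x)) + ennreal e" by blast
    have "AE \<omega> in lborel. \<omega> \<in> cell \<longrightarrow> min 1 (gramian_ratio (\<Psi> h) (weight h s) \<omega>) \<le> ennreal (2 * C * weight h (k - s) \<omega>)" if h: "h > 0" for h
      using \<Psi>[OF h] by (intro ratio_necessary sk h C) auto
    then show "\<exists>K\<ge>0. \<forall>h>0. AE \<omega> in lborel. \<omega> \<in> cell \<longrightarrow> min 1 (gramian_ratio (\<Psi> h) (weight h s) \<omega>) \<le> ennreal (K * weight h (k - s) \<omega>)"
      using C(1) by (intro exI[of _ "2 * C"]) auto
  next
    assume "\<exists>K\<ge>0. \<forall>h>0. AE \<omega> in lborel. \<omega> \<in> cell \<longrightarrow> min 1 (gramian_ratio (\<Psi> h) (weight h s) \<omega>) \<le> ennreal (K * weight h (k - s) \<omega>)"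
    then obtain K where K: "K \<ge> 0" "\<And>h. h > 0 \<Longrightarrow> AE \<omega> in lborel. \<omega> \<in> cell \<longrightarrow> min 1 (gramian_ratio (\<Psi> h) (weight h s) \<omega>) \<le> ennreal (K * weight h (k - s) \<omega>)" by blast
    (* The 2 is lost in the passage from an infimum to a member; K + 1 ensures positivity. *)
    let ?K = "2 * (K + 1)"
    have "\<exists>g\<in>fsi_space s (\<Psi> h). energy (weight h s) (\<lambda>x. hat f (inverse h *\<^sub>R x) - hat g x)
        \<le> ennreal (2 + 4 * ?K) * energy (weight h k) (\<lambda>x. hat f (inverse h *\<^sub>R x)) + ennreal e"
      if f: "f \<in> W k" and h: "h > 0" and e: "e > 0" for f :: "'d dist" and h e
    proof (rule fsi_approximation[where Q="dense_coefficients (\<Psi> h)"])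
      have fin: "finite (\<Psi> h)" and PW: "\<Psi> h \<subseteq> W s" using \<Psi>[OF h] by auto
      have [measurable]: "hat f \<in> borel_measurable borel" using f by (rule hat_measurable)
      show "closed_W_subspace s (fsi_space s (\<Psi> h))" "shift_invariant 1 (fsi_space s (\<Psi> h))" using V[OF h] by auto
      show "\<Psi> h \<subseteq> fsi_space s (\<Psi> h)" by (rule fsi_space_contains[OF PW])
      show "countable (dense_coefficients (\<Psi> h))" by (rule countable_dense_coefficients[OF fin])
      show "(\<lambda>x. hat f (inverse h *\<^sub>R x)) \<in> borel_measurable borel" by measurable
      have "energy (weight h k) (\<lambda>x. hat f (inverse h *\<^sub>R x)) \<le> ennreal (2 powr \<bar>k\<bar> * h powr (2 * k) * h ^ CARD('d)) * energy (sobolev_weight k) (hat f)"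
        by (rule energy_sobolev_weight_weight(2)[OF h]) measurable
      also have "\<dots> < \<infinity>" using W_energy[OF f] by (simp add: ennreal_mult_less_top)
      finally show "energy (weight h k) (\<lambda>x. hat f (inverse h *\<^sub>R x)) < \<infinity>" .
      show "AE \<omega> in lborel. \<omega> \<in> cell \<longrightarrow> (\<exists>v\<in>dense_coefficients (\<Psi> h). fiber_error h s (\<Psi> h) v \<omega> \<le> ennreal (?K * weight h k \<omega>))"
        using K(2)[OF h] AE_regular_frequency[OF fin PW]
      proof eventually_elim
        case (elim \<omega>)
        show ?case
        proof
          assume c: "\<omega> \<in> cell"
          then have g: "regular_frequency s (\<Psi> h) \<omega>" using elim by blast
          let ?q = "(K + 1) * weight h (k - s) \<omega>"
          have W: "weight h s \<omega> > 0" "weight h (k - s) \<omega> > 0" by (rule weight_pos[OF h])+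
          have q: "?q > 0" using W K(1) by simp
          have "min 1 (gramian_ratio (\<Psi> h) (weight h s) \<omega>) \<le> ennreal (K * weight h (k - s) \<omega>)" using elim c by blast
          also have "\<dots> \<le> ennreal ?q" using W by (intro ennreal_leI mult_right_mono) auto
          finally obtain v where v: "fiber_error h s (\<Psi> h) v \<omega> < ennreal (2 * ?q * weight h s \<omega>)"
            using fiber_error_lt_of_ratio[OF fin g W(1) q] by blast
          have eq: "2 * ?q * weight h s \<omega> = ?K * weight h k \<omega>" using weight_add[of h s "k - s" \<omega>] by simp
          obtain u where u: "\<And>n. u n \<in> dense_coefficients (\<Psi> h)" "\<And>\<phi>. \<phi> \<in> \<Psi> h \<Longrightarrow> (\<lambda>n. u n \<phi>) \<longlonglongrightarrow> v \<phi>"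
            using dense_coefficients_sequence[OF fin, of v] by blast
          have "(\<lambda>n. fiber_error h s (\<Psi> h) (u n) \<omega>) \<longlonglongrightarrow> fiber_error h s (\<Psi> h) v \<omega>" by (rule fiber_error_tendsto[OF fin g u(2)])
          then have "\<forall>\<^sub>F n in sequentially. fiber_error h s (\<Psi> h) (u n) \<omega> < ennreal (2 * ?q * weight h s \<omega>)" using v by (rule order_tendstoD(2))
          then obtain n where "fiber_error h s (\<Psi> h) (u n) \<omega> < ennreal (2 * ?q * weight h s \<omega>)" using eventually_happens sequentially_bot by blast
          then show "\<exists>v\<in>dense_coefficients (\<Psi> h). fiber_error h s (\<Psi> h) v \<omega> \<le> ennreal (?K * weight h k \<omega>)"
            unfolding eq using u(1) less_imp_le by blast
        qed
      qed
    qed (use \<Psi>[OF h] sk h e K(1) in auto)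
    then show "\<exists>C\<ge>0. \<forall>f\<in>W k. \<forall>h>0. \<forall>e>0. \<exists>g\<in>fsi_space s (\<Psi> h). energy (weight h s) (\<lambda>x. hat f (inverse h *\<^sub>R x) - hat g x)
        \<le> ennreal C * energy (weight h k) (\<lambda>x. hat f (inverse h *\<^sub>R x)) + ennreal e"
      using K(1) by (intro exI[of _ "2 + 4 * ?K"]) auto
  qed
qed

section \<open>Conditions near the origin\<close>

lemma AE_lebesgue_on_iff:
  assumes "\<Omega> \<in> sets borel"
  shows "(AE x in lebesgue_on \<Omega>. P x) \<longleftrightarrow> (AE x in lborel. x \<in> \<Omega> \<longrightarrow> P x)"
proof -
  have "\<Omega> \<inter> space lebesgue \<in> sets lebesgue" using assms by simp
  then show ?thesis by (simp add: AE_restrict_space_iff AE_completion_iff)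
qed

text \<open>Completeness of the Lebesgue measure makes every modification on a null set measurable. Measurability
  matters, since the essential supremum of a nonmeasurable function is \<open>\<infinity>\<close> by convention.\<close>

lemma measurable_lebesgue_on_of_AE_eq:
  fixes f g :: "'a::euclidean_space \<Rightarrow> ennreal"
  assumes [measurable]: "g \<in> borel_measurable borel" "\<Omega> \<in> sets borel"
    and eq: "AE x in lborel. x \<in> \<Omega> \<longrightarrow> f x = g x"
  shows "f \<in> borel_measurable (lebesgue_on \<Omega>)"
proof -
  obtain N where "{x \<in> space lborel. \<not> (x \<in> \<Omega> \<longrightarrow> f x = g x)} \<subseteq> N" "emeasure lborel N = 0" "N \<in> sets lborel"
    using AE_E[OF eq] by blast
  then have N: "N \<in> null_sets lborel" "{x \<in> \<Omega>. f x \<noteq> g x} \<subseteq> N" by (auto simp: null_sets_def)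
  then have [measurable]: "N \<in> sets borel" by auto
  show ?thesis
  proof (rule measurableI)
    fix A :: "ennreal set" assume [measurable]: "A \<in> sets borel"
    have "f -` A \<inter> \<Omega> = ((g -` A \<inter> \<Omega>) - N) \<union> (f -` A \<inter> \<Omega> \<inter> N)" using N(2) by auto
    moreover have "(g -` A \<inter> \<Omega>) - N \<in> sets lebesgue"
    proof -
      have "g -` A \<inter> space borel \<in> sets borel" by (rule measurable_sets) measurable
      then have "(g -` A \<inter> \<Omega>) - N \<in> sets borel" by auto
      then show ?thesis by simp
    qed
    moreover have "f -` A \<inter> \<Omega> \<inter> N \<in> sets lebesgue"
      using completion.complete2[of "f -` A \<inter> \<Omega> \<inter> N" N lborel] null_sets_completionI[OF N(1)] by auto
    ultimately have "f -` A \<inter> \<Omega> \<in> sets lebesgue" by (metis sets.Un)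
    then have "f -` A \<inter> \<Omega> \<in> sets (lebesgue_on \<Omega>)" by (simp add: sets_restrict_space_iff)
    then show "f -` A \<inter> space (lebesgue_on \<Omega>) \<in> sets (lebesgue_on \<Omega>)" by simp
  qed simp
qed

lemma ratio_measurable_AE:
  fixes \<Phi> :: "'d::finite dist set"
  assumes fin: "finite \<Phi>" and \<Phi>: "\<Phi> \<subseteq> W s" and [measurable]: "q \<in> borel_measurable borel"
    and \<Omega>: "\<Omega> \<in> sets borel" "\<Omega> \<subseteq> cell"
  shows "(\<lambda>\<omega>. q \<omega> * gramian_ratio \<Phi> (weight h s) \<omega>) \<in> borel_measurable (lebesgue_on \<Omega>)"
proof (rule measurable_lebesgue_on_of_AE_eq)
  have [measurable]: "measurable_ratio h s \<Phi> \<in> borel_measurable borel" by (rule measurable_ratio_measurable[OF fin \<Phi>])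
  show "(\<lambda>\<omega>. q \<omega> * measurable_ratio h s \<Phi> \<omega>) \<in> borel_measurable borel" by measurable
  show "AE \<omega> in lborel. \<omega> \<in> \<Omega> \<longrightarrow> q \<omega> * gramian_ratio \<Phi> (weight h s) \<omega> = q \<omega> * measurable_ratio h s \<Phi> \<omega>"
    using AE_regular_frequency[OF fin \<Phi>] by eventually_elim (use \<Omega>(2) measurable_ratio_eq[OF fin] in auto)
qed (rule \<Omega>)

lemma nonstationary_quotient_eq:
  "nonstationary_quotient s k h \<Phi> \<omega> = ennreal (1 / weight h (k - s) \<omega>) * gramian_ratio \<Phi> (weight h s) \<omega>"
  unfolding nonstationary_quotient_def weight_def[abs_def] ..

lemma weight_zero: "weight 0 s = (\<lambda>x. norm x powr (2 * s))"
proof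
  fix x :: "real^'a" show "weight 0 s x = norm x powr (2 * s)"
    unfolding weight_def by (cases "x = 0") (simp_all add: square_powr)
qed

lemma stationary_quotient_eq:
  "stationary_quotient s k \<Phi> \<omega> = ennreal (1 / weight 0 (k - s) \<omega>) * gramian_ratio \<Phi> (weight 0 s) \<omega>"
  unfolding stationary_quotient_def weight_zero by (simp add: right_diff_distrib)

lemma quotient_le_iff:
  fixes R :: ennreal
  assumes "w > 0" "K \<ge> 0"
  shows "ennreal (1 / w) * R \<le> ennreal K \<longleftrightarrow> R \<le> ennreal (K * w)"
proof
  assume "ennreal (1 / w) * R \<le> ennreal K"
  then have "ennreal w * (ennreal (1 / w) * R) \<le> ennreal w * ennreal K" by (rule mult_left_mono) simp
  moreover have "ennreal w * (ennreal (1 / w) * R) = R"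
    using assms(1) by (simp add: mult.assoc[symmetric] ennreal_mult[symmetric])
  ultimately show "R \<le> ennreal (K * w)" using assms by (simp add: ennreal_mult mult.commute)
next
  assume "R \<le> ennreal (K * w)"
  then have "ennreal (1 / w) * R \<le> ennreal (1 / w) * ennreal (K * w)" by (rule mult_left_mono) simp
  also have "\<dots> = ennreal K" using assms by (subst ennreal_mult[symmetric]) auto
  finally show "ennreal (1 / w) * R \<le> ennreal K" .
qed

lemma ratio_le_of_min:
  "min 1 (R::ennreal) \<le> ennreal q \<Longrightarrow> q < 1 \<Longrightarrow> R \<le> ennreal q"
  by (auto simp: min_def split: if_splits)

lemma powr_small:
  assumes p: "p > 0" and K: "K \<ge> 0"
  obtains r where "r > 0" "\<And>t. 0 \<le> t \<Longrightarrow> t < r \<Longrightarrow> K * t powr p < (1::real)"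
proof -
  define r where "r = (1 / (K + 1)) powr (1 / p)"
  have "K * t powr p < 1" if t: "0 \<le> t" "t < r" for t
  proof -
    have "t powr p \<le> r powr p" using t p by (intro powr_mono2) auto
    also have "r powr p = 1 / (K + 1)" unfolding r_def using K p by (simp add: powr_powr)
    finally have "K * t powr p \<le> K * (1 / (K + 1))" using K by (intro mult_left_mono)
    also have "\<dots> < 1" using K by simp
    finally show ?thesis .
  qed
  then show ?thesis using that[of r] K unfolding r_def by simp
qed

lemma ratio_bound_far:
  assumes sk: "s < k" and c: "c > 0" and far: "c \<le> (norm \<omega>)\<^sup>2 + h\<^sup>2" and K: "1 / c powr (k - s) \<le> K"
  shows "min 1 R \<le> ennreal (K * weight h (k - s) \<omega>)"
proof -
  have "c powr (k - s) \<le> weight h (k - s) \<omega>" unfolding weight_def using far c sk by (intro powr_mono2) auto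
  moreover have "0 < 1 / c powr (k - s)" using c by simp
  then have "0 \<le> K" using K by linarith
  ultimately have "1 / c powr (k - s) * c powr (k - s) \<le> K * weight h (k - s) \<omega>"
    using K by (intro mult_mono) auto
  then have "1 \<le> K * weight h (k - s) \<omega>" using c by simp
  then have "1 \<le> ennreal (K * weight h (k - s) \<omega>)" using ennreal_leI by fastforce
  then show ?thesis by (rule min.coboundedI1)
qed

text \<open>Near the origin of the \<open>(\<omega>,h)\<close>-space \<open>K (|\<omega>|\<^sup>2 + h\<^sup>2)\<^sup>k\<^sup>-\<^sup>s < 1\<close>, so that the minimum with \<open>1\<close> is the ratio; away
  from it \<open>K (|\<omega>|\<^sup>2 + h\<^sup>2)\<^sup>k\<^sup>-\<^sup>s \<ge> 1\<close> for large \<open>K\<close>, and nothing is required.\<close>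

lemma nonstationary_condition_iff:
  fixes \<Psi> :: "real \<Rightarrow> 'd::finite dist set"
  assumes sk: "s < k" and \<Psi>: "\<And>h. h > 0 \<Longrightarrow> finite (\<Psi> h) \<and> \<Psi> h \<subseteq> W s"
  shows "(\<exists>K\<ge>0. \<forall>h>0. AE \<omega> in lborel. \<omega> \<in> cell \<longrightarrow> min 1 (gramian_ratio (\<Psi> h) (weight h s) \<omega>) \<le> ennreal (K * weight h (k - s) \<omega>)) \<longleftrightarrow>
    (\<exists>\<Omega> h0. open \<Omega> \<and> 0 \<in> \<Omega> \<and> h0 > 0 \<and>
           (\<exists>M::real. \<forall>h. 0 < h \<and> h < h0 \<longrightarrow>
              esssup (lebesgue_on \<Omega>) (nonstationary_quotient s k h (\<Psi> h)) \<le> ennreal M))"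
proof
  assume "\<exists>K\<ge>0. \<forall>h>0. AE \<omega> in lborel. \<omega> \<in> cell \<longrightarrow> min 1 (gramian_ratio (\<Psi> h) (weight h s) \<omega>) \<le> ennreal (K * weight h (k - s) \<omega>)"
  then obtain K where K: "K \<ge> 0" "\<And>h. h > 0 \<Longrightarrow> AE \<omega> in lborel. \<omega> \<in> cell \<longrightarrow> min 1 (gramian_ratio (\<Psi> h) (weight h s) \<omega>) \<le> ennreal (K * weight h (k - s) \<omega>)" by blast
  obtain r where r: "r > 0" "\<And>t. 0 \<le> t \<Longrightarrow> t < r \<Longrightarrow> K * t powr (k - s) < 1"
    using powr_small[of "k - s" K] sk K(1) by (metis diff_gt_0_iff_gt)
  (* The ball lies in the cell, and for h < a its points satisfy |w|^2 + h^2 < r. *)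
  define a where "a = min pi (sqrt (r / 2))"
  have a: "a > 0" "a \<le> pi" unfolding a_def using r(1) by auto
  have "a\<^sup>2 \<le> (sqrt (r / 2))\<^sup>2" using a(1) by (intro power_mono) (auto simp: a_def)
  then have a3: "a\<^sup>2 \<le> r / 2" using r(1) by simp
  let ?\<Omega> = "ball 0 a :: (real^'d) set"
  have \<Omega>c: "?\<Omega> \<subseteq> cell" using cell_neighbourhood a(2) by blast
  have "esssup (lebesgue_on ?\<Omega>) (nonstationary_quotient s k h (\<Psi> h)) \<le> ennreal K" if h: "0 < h" "h < a" for h
  proof (rule esssup_I)
    show "nonstationary_quotient s k h (\<Psi> h) \<in> borel_measurable (lebesgue_on ?\<Omega>)"
      unfolding nonstationary_quotient_eq[abs_def] using \<Psi>[OF h(1)] \<Omega>c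
      by (intro ratio_measurable_AE) auto
    show "AE \<omega> in lebesgue_on ?\<Omega>. nonstationary_quotient s k h (\<Psi> h) \<omega> \<le> ennreal K"
      unfolding AE_lebesgue_on_iff[OF borel_open[OF open_ball]] using K(2)[OF h(1)]
    proof eventually_elim
      case (elim \<omega>)
      show ?case
      proof
        assume w: "\<omega> \<in> ?\<Omega>"
        have "(norm \<omega>)\<^sup>2 < a\<^sup>2" "h\<^sup>2 < a\<^sup>2" using w h by (auto intro!: power_strict_mono)
        then have "(norm \<omega>)\<^sup>2 + h\<^sup>2 < r" using a3 by linarith
        then have lt: "K * weight h (k - s) \<omega> < 1" unfolding weight_def by (intro r(2)) auto
        have "min 1 (gramian_ratio (\<Psi> h) (weight h s) \<omega>) \<le> ennreal (K * weight h (k - s) \<omega>)" using elim w \<Omega>c by blast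
        then have "gramian_ratio (\<Psi> h) (weight h s) \<omega> \<le> ennreal (K * weight h (k - s) \<omega>)" using lt by (rule ratio_le_of_min)
        then show "nonstationary_quotient s k h (\<Psi> h) \<omega> \<le> ennreal K"
          by (simp only: nonstationary_quotient_eq quotient_le_iff[OF weight_pos[OF h(1)] K(1)])
      qed
    qed
  qed
  then show "\<exists>\<Omega> h0. open \<Omega> \<and> 0 \<in> \<Omega> \<and> h0 > 0 \<and>
           (\<exists>M::real. \<forall>h. 0 < h \<and> h < h0 \<longrightarrow>
              esssup (lebesgue_on \<Omega>) (nonstationary_quotient s k h (\<Psi> h)) \<le> ennreal M)"
    using a(1) by (intro exI[of _ ?\<Omega>] exI[of _ a]) auto
next
  assume "\<exists>\<Omega> h0. open \<Omega> \<and> 0 \<in> \<Omega> \<and> h0 > 0 \<and>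
           (\<exists>M::real. \<forall>h. 0 < h \<and> h < h0 \<longrightarrow>
              esssup (lebesgue_on \<Omega>) (nonstationary_quotient s k h (\<Psi> h)) \<le> ennreal M)"
  then obtain \<Omega> h0 M where \<Omega>: "open \<Omega>" "0 \<in> \<Omega>" and h0: "h0 > 0"
    and M: "\<And>h. 0 < h \<Longrightarrow> h < h0 \<Longrightarrow> esssup (lebesgue_on \<Omega>) (nonstationary_quotient s k h (\<Psi> h)) \<le> ennreal M" by blast
  obtain r where r: "r > 0" "ball 0 r \<subseteq> \<Omega>" using \<Omega> open_contains_ball by blast
  (* If |w|^2 + h^2 < c, then h < h0 and |w| < r, so that the hypothesis applies. *)
  define c where "c = (min r h0)\<^sup>2"
  have c: "c > 0" unfolding c_def using r h0 by simp
  define K where "K = max (max M 0) (1 / c powr (k - s))"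
  have K0: "K \<ge> 0" "M \<le> K" "1 / c powr (k - s) \<le> K" unfolding K_def by auto
  have "AE \<omega> in lborel. \<omega> \<in> cell \<longrightarrow> min 1 (gramian_ratio (\<Psi> h) (weight h s) \<omega>) \<le> ennreal (K * weight h (k - s) \<omega>)" if h: "h > 0" for h
  proof -
    have far: "min 1 (gramian_ratio (\<Psi> h) (weight h s) \<omega>) \<le> ennreal (K * weight h (k - s) \<omega>)" if "c \<le> (norm \<omega>)\<^sup>2 + h\<^sup>2" for \<omega>
      by (rule ratio_bound_far[OF sk c that K0(3)])
    show ?thesis
    proof (cases "h < h0")
      case False
      have "c \<le> (norm \<omega>)\<^sup>2 + h\<^sup>2" for \<omega> :: "real^'d"
      proof -
        have "c \<le> h\<^sup>2" unfolding c_def using False r h0 by (intro power_mono) auto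
        then show ?thesis by (simp add: add_increasing)
      qed
      then show ?thesis using far by simp
    next
      case True
      have "AE \<omega> in lebesgue_on \<Omega>. nonstationary_quotient s k h (\<Psi> h) \<omega> \<le> ennreal M"
        using esssup_AE[where M="lebesgue_on \<Omega>" and f="nonstationary_quotient s k h (\<Psi> h)"]
        by eventually_elim (rule order_trans[OF _ M[OF h True]])
      then have "AE \<omega> in lborel. \<omega> \<in> \<Omega> \<longrightarrow> nonstationary_quotient s k h (\<Psi> h) \<omega> \<le> ennreal M"
        unfolding AE_lebesgue_on_iff[OF borel_open[OF \<Omega>(1)]] .
      then show ?thesis
      proof eventually_elim
        case (elim \<omega>)
        show ?case
        proof (cases "norm \<omega> < r")
          case True
          then have "nonstationary_quotient s k h (\<Psi> h) \<omega> \<le> ennreal M" using elim r(2) by auto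
          also have "\<dots> \<le> ennreal K" using K0 by (intro ennreal_leI)
          finally have "gramian_ratio (\<Psi> h) (weight h s) \<omega> \<le> ennreal (K * weight h (k - s) \<omega>)"
            by (simp only: nonstationary_quotient_eq quotient_le_iff[OF weight_pos[OF h] K0(1)])
          then show ?thesis by (auto intro: min.coboundedI2)
        next
          case False
          have "c \<le> (norm \<omega>)\<^sup>2" unfolding c_def using False r h0 by (intro power_mono) auto
          then have "c \<le> (norm \<omega>)\<^sup>2 + h\<^sup>2" by (simp add: add_increasing2)
          then show ?thesis using far by blast
        qed
      qed
    qed
  qed
  then show "\<exists>K\<ge>0. \<forall>h>0. AE \<omega> in lborel. \<omega> \<in> cell \<longrightarrow> min 1 (gramian_ratio (\<Psi> h) (weight h s) \<omega>) \<le> ennreal (K * weight h (k - s) \<omega>)"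
    using K0(1) by blast
qed

lemma form_mono:
  assumes fin: "finite \<Phi>" and g: "regular_frequency s \<Phi> \<omega>" and A: "A \<subseteq> dual_lattice" and c: "c \<ge> 0"
    and w: "\<And>\<alpha>. \<alpha> \<in> A \<Longrightarrow> weight h s (\<omega> + \<alpha>) \<le> c * weight h' s (\<omega> + \<alpha>)"
  shows "hermitian_form \<Phi> (gramian A (weight h s) \<omega>) v \<le> c * hermitian_form \<Phi> (gramian A (weight h' s) \<omega>) v"
proof -
  have e: "ennreal (hermitian_form \<Phi> (gramian A (weight h s) \<omega>) v) = fiber_sum A (\<lambda>x. ennreal (weight h s x * (cmod (combination \<Phi> v x))\<^sup>2)) \<omega>"
    and nn: "hermitian_form \<Phi> (gramian A (weight h s) \<omega>) v \<ge> 0" for h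
    by (intro hermitian_form_gramian fin regular_frequency_finite[OF g _ A] weight_nonneg; assumption)+
  have "ennreal (hermitian_form \<Phi> (gramian A (weight h s) \<omega>) v) \<le> (\<integral>\<^sup>+\<alpha>. ennreal c * ennreal (weight h' s (\<omega> + \<alpha>) * (cmod (combination \<Phi> v (\<omega> + \<alpha>)))\<^sup>2) \<partial>count_space A)"
    unfolding e fiber_sum_def
    using c mult_right_mono[OF w] by (intro nn_integral_mono) (simp add: ennreal_mult'[symmetric] mult.assoc[symmetric] ennreal_leI)
  also have "\<dots> = ennreal c * ennreal (hermitian_form \<Phi> (gramian A (weight h' s) \<omega>) v)"
    unfolding e fiber_sum_def by (rule nn_integral_cmult) simp
  also have "\<dots> = ennreal (c * hermitian_form \<Phi> (gramian A (weight h' s) \<omega>) v)" using c nn by (simp add: ennreal_mult)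
  finally show ?thesis using c nn by (subst (asm) ennreal_le_iff) auto
qed

lemma weight_compare_zero:
  assumes "x \<noteq> 0" "0 \<le> h" "h \<le> norm x"
  shows "weight h s x \<le> 2 powr \<bar>s\<bar> * weight 0 s x" "weight 0 s x \<le> 2 powr \<bar>s\<bar> * weight h s x"
proof -
  have "h\<^sup>2 \<le> (norm x)\<^sup>2" using assms by (intro power_mono) auto
  moreover have "(norm x)\<^sup>2 > 0" using assms by simp
  ultimately show "weight h s x \<le> 2 powr \<bar>s\<bar> * weight 0 s x" "weight 0 s x \<le> 2 powr \<bar>s\<bar> * weight h s x"
    unfolding weight_def by (auto intro!: powr_compare add_pos_nonneg)
qed

lemma weight_zero_pos: "x \<noteq> 0 \<Longrightarrow> weight 0 s x > 0"
  unfolding weight_def by simp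

text \<open>If \<open>h \<le> |\<omega>|\<close>, then \<open>h\<close> is at most the norm of every point of the fiber, hence \<open>|x|\<^sup>2\<close> and \<open>|x|\<^sup>2 + h\<^sup>2\<close> agree on
  the fiber up to a factor \<open>2\<close>, and the two ratios agree up to a constant.\<close>

lemma stationary_ratio_le:
  assumes fin: "finite \<Phi>" and g: "regular_frequency s \<Phi> \<omega>" and h: "0 < h" "h \<le> norm \<omega>" "norm \<omega> \<le> pi"
    and q: "q > 0" and R: "gramian_ratio \<Phi> (weight h s) \<omega> \<le> ennreal q"
  shows "gramian_ratio \<Phi> (weight 0 s) \<omega> \<le> ennreal ((2 powr \<bar>s\<bar>)\<^sup>2 * (2 * q))"
proof -
  let ?c = "2 powr \<bar>s\<bar>"
  have w: "weight h s (\<omega> + \<alpha>) \<le> ?c * weight 0 s (\<omega> + \<alpha>)" "weight 0 s (\<omega> + \<alpha>) \<le> ?c * weight h s (\<omega> + \<alpha>)" if "\<alpha> \<in> dual_lattice" for \<alpha>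
  proof -
    have "norm \<omega> \<le> norm (\<omega> + \<alpha>)" using regular_frequency_fiber_norm[OF g that] h(3) by simp
    then show "weight h s (\<omega> + \<alpha>) \<le> ?c * weight 0 s (\<omega> + \<alpha>)" "weight 0 s (\<omega> + \<alpha>) \<le> ?c * weight h s (\<omega> + \<alpha>)"
      using h by (auto intro!: weight_compare_zero)
  qed
  have "gramian_ratio \<Phi> (weight h s) \<omega> < ennreal (2 * q)" using R q by (rule_tac le_less_trans) (auto simp: ennreal_less_iff)
  then obtain v where v: "form h s \<Phi> \<omega> v \<noteq> 0" "ennreal (form0 h s \<Phi> \<omega> v / form h s \<Phi> \<omega> v) < ennreal (2 * q)"
    unfolding gramian_ratio_eq[OF fin g] INF_less_iff by auto
  note nn = form_fiber_sum(3,4)[OF fin g]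
  have B: "form h s \<Phi> \<omega> v > 0" using v(1) nn(1)[of h v] by simp
  have "form0 h s \<Phi> \<omega> v / form h s \<Phi> \<omega> v < 2 * q" using v(2) nn[of h v] q by (simp add: ennreal_less_iff)
  then have lt: "form0 h s \<Phi> \<omega> v < 2 * q * form h s \<Phi> \<omega> v" using B by (simp add: field_simps)
  have 1: "form h s \<Phi> \<omega> v \<le> ?c * form 0 s \<Phi> \<omega> v" by (rule form_mono[OF fin g]) (auto intro: w)
  have 2: "form0 0 s \<Phi> \<omega> v \<le> ?c * form0 h s \<Phi> \<omega> v" by (rule form_mono[OF fin g]) (auto intro: w)
  have pos: "form 0 s \<Phi> \<omega> v > 0" using B 1 by (smt (verit) mult_nonneg_nonpos powr_ge_zero)
  have "form0 0 s \<Phi> \<omega> v \<le> ?c * (2 * q * form h s \<Phi> \<omega> v)" using 2 lt by (smt (verit) mult_left_mono powr_ge_zero)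
  also have "\<dots> \<le> ?c * (2 * q * (?c * form 0 s \<Phi> \<omega> v))" using q by (intro mult_left_mono 1) auto
  finally have "form0 0 s \<Phi> \<omega> v / form 0 s \<Phi> \<omega> v \<le> ?c\<^sup>2 * (2 * q)" using pos by (simp add: field_simps power2_eq_square)
  then have "ennreal (form0 0 s \<Phi> \<omega> v / form 0 s \<Phi> \<omega> v) \<le> ennreal (?c\<^sup>2 * (2 * q))" by (rule ennreal_leI)
  moreover have "gramian_ratio \<Phi> (weight 0 s) \<omega> \<le> ennreal (form0 0 s \<Phi> \<omega> v / form 0 s \<Phi> \<omega> v)"
    unfolding gramian_ratio_eq[OF fin g] using pos by (intro INF_lower) auto
  ultimately show ?thesis by (rule order_trans[rotated])
qed

text \<open>If \<open>h\<close> is much larger than \<open>|\<omega>|\<close>, the two weights differ considerably, but only at \<open>\<alpha> = 0\<close>. A small stationary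
  ratio forces the term with \<open>\<alpha> = 0\<close> to dominate \<open>v\<^sup>* G v\<close>; this gives \<open>v\<^sup>* G\<^sup>0 v \<le> 4 M |\<omega>|\<^sup>2\<^sup>k |v\<^sup>* \<Phi>(\<omega>)|\<^sup>2\<close>. Here
  \<open>|\<omega>|\<^sup>2\<^sup>k\<close> may be increased to \<open>(|\<omega>|\<^sup>2 + h\<^sup>2)\<^sup>k\<close>, because \<open>k\<close> is nonnegative, and division by
  \<open>(|\<omega>|\<^sup>2 + h\<^sup>2)\<^sup>s |v\<^sup>* \<Phi>(\<omega>)|\<^sup>2\<close> gives the claim.\<close>

lemma nonstationary_ratio_le:
  assumes fin: "finite \<Phi>" and g: "regular_frequency s \<Phi> \<omega>" and h: "0 < h" "h \<le> 1" and k: "0 \<le> k"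
    and M: "M > 0" "4 * M * weight 0 (k - s) \<omega> < 1" and R: "gramian_ratio \<Phi> (weight 0 s) \<omega> \<le> ennreal (M * weight 0 (k - s) \<omega>)"
  shows "gramian_ratio \<Phi> (weight h s) \<omega> \<le> ennreal (4 * 2 powr \<bar>s\<bar> * M * weight h (k - s) \<omega>)"
proof -
  let ?c = "2 powr \<bar>s\<bar>" and ?X = "M * weight 0 (k - s) \<omega>"
  have w0: "\<omega> \<noteq> 0" using g by (simp add: regular_frequency_def)
  have X: "?X > 0" using M(1) weight_zero_pos[OF w0] by simp
  have "gramian_ratio \<Phi> (weight 0 s) \<omega> < ennreal (2 * ?X)" using R X by (rule_tac le_less_trans) (auto simp: ennreal_less_iff)
  then obtain v where v: "form 0 s \<Phi> \<omega> v \<noteq> 0" "ennreal (form0 0 s \<Phi> \<omega> v / form 0 s \<Phi> \<omega> v) < ennreal (2 * ?X)"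
    unfolding gramian_ratio_eq[OF fin g] INF_less_iff by auto
  note nn = form_fiber_sum(3,4)[OF fin g]
  define B where "B = form 0 s \<Phi> \<omega> v"
  define B0 where "B0 = form0 0 s \<Phi> \<omega> v"
  define x where "x = (cmod (combination \<Phi> v \<omega>))\<^sup>2"
  have B: "B > 0" using v(1) nn(1)[of 0 v] by (simp add: B_def)
  have B0: "B0 \<ge> 0" using nn(2) by (simp add: B0_def)
  have x0: "x \<ge> 0" by (simp add: x_def)
  have split: "B = weight 0 s \<omega> * x + B0" unfolding B_def B0_def x_def by (rule form_split[OF fin g])
  have "B0 / B < 2 * ?X" using v(2) B B0 X unfolding B_def[symmetric] B0_def[symmetric] by (subst (asm) ennreal_less_iff) auto
  then have lt: "B0 < 2 * ?X * B" using B by (simp add: field_simps)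
  have "2 * ?X * B < 1 / 2 * B" using M(2) B by (intro mult_strict_right_mono) auto
  then have B2: "B < 2 * (weight 0 s \<omega> * x)" using lt split by linarith
  have xpos: "x > 0" using B2 B x0 by (cases "x = 0") auto
  have "2 * ?X * B < 2 * ?X * (2 * (weight 0 s \<omega> * x))" using B2 X by (intro mult_strict_left_mono) auto
  with lt have "B0 \<le> 4 * M * (weight 0 s \<omega> * weight 0 (k - s) \<omega>) * x" by (simp add: mult_ac)
  also have "weight 0 s \<omega> * weight 0 (k - s) \<omega> = weight 0 k \<omega>" using weight_add[of 0 s "k - s" \<omega>] by simp
  also have "4 * M * weight 0 k \<omega> * x \<le> 4 * M * weight h k \<omega> * x"
  proof -
    have "weight 0 k \<omega> \<le> weight h k \<omega>" unfolding weight_def using k by (intro powr_mono2) auto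
    then show ?thesis using M(1) x0 by (intro mult_right_mono mult_left_mono) auto
  qed
  finally have B0le: "B0 \<le> 4 * M * weight h k \<omega> * x" .
  have 2: "form0 h s \<Phi> \<omega> v \<le> ?c * B0" unfolding B0_def
  proof (rule form_mono[OF fin g])
    fix \<alpha> :: "real^'a" assume a: "\<alpha> \<in> dual_lattice - {0}"
    have "pi \<le> norm (\<omega> + \<alpha>)" using a g by (intro norm_outside_cell) (auto simp: regular_frequency_def)
    then have "1 \<le> norm (\<omega> + \<alpha>)" using pi_gt3 by simp
    then show "weight h s (\<omega> + \<alpha>) \<le> ?c * weight 0 s (\<omega> + \<alpha>)" using h by (intro weight_compare_zero) auto
  qed auto
  have Wh: "weight h s \<omega> > 0" by (rule weight_pos[OF h(1)])
  have 1: "weight h s \<omega> * x \<le> form h s \<Phi> \<omega> v" unfolding form_split[OF fin g] x_def using nn(2) by simp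
  have pos: "0 < weight h s \<omega> * x" using Wh xpos by simp
  then have Bh: "form h s \<Phi> \<omega> v > 0" using 1 by linarith
  have "form0 h s \<Phi> \<omega> v / form h s \<Phi> \<omega> v \<le> (?c * (4 * M * weight h k \<omega> * x)) / (weight h s \<omega> * x)"
  proof (rule frac_le)
    show "form0 h s \<Phi> \<omega> v \<le> ?c * (4 * M * weight h k \<omega> * x)" by (rule order_trans[OF 2 mult_left_mono[OF B0le]]) simp
    show "0 \<le> ?c * (4 * M * weight h k \<omega> * x)" using M(1) x0 by simp
  qed (use 1 pos in auto)
  also have "\<dots> = 4 * ?c * M * weight h (k - s) \<omega>" using xpos Wh weight_add[of h s "k - s" \<omega>] by (simp add: field_simps)
  finally have "ennreal (form0 h s \<Phi> \<omega> v / form h s \<Phi> \<omega> v) \<le> ennreal (4 * ?c * M * weight h (k - s) \<omega>)" by (rule ennreal_leI)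
  moreover have "gramian_ratio \<Phi> (weight h s) \<omega> \<le> ennreal (form0 h s \<Phi> \<omega> v / form h s \<Phi> \<omega> v)"
    unfolding gramian_ratio_eq[OF fin g] using Bh by (intro INF_lower) auto
  ultimately show ?thesis by (rule order_trans[rotated])
qed

text \<open>The stationary weight is singled out from the family of weights by choosing \<open>h\<close> of the size of \<open>|\<omega>|\<close>; in the
  other direction one stationary bound has to serve all \<open>h\<close>.\<close>

lemma stationary_condition_iff:
  fixes \<Phi> :: "'d::finite dist set"
  assumes sk: "s < k" and k: "0 \<le> k" and fin: "finite \<Phi>" and \<Phi>: "\<Phi> \<subseteq> W s"
  shows "(\<exists>K\<ge>0. \<forall>h>0. AE \<omega> in lborel. \<omega> \<in> cell \<longrightarrow> min 1 (gramian_ratio \<Phi> (weight h s) \<omega>) \<le> ennreal (K * weight h (k - s) \<omega>)) \<longleftrightarrow>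
    (\<exists>\<Omega>. open \<Omega> \<and> 0 \<in> \<Omega> \<and> esssup (lebesgue_on \<Omega>) (stationary_quotient s k \<Phi>) < \<infinity>)"
proof
  assume "\<exists>K\<ge>0. \<forall>h>0. AE \<omega> in lborel. \<omega> \<in> cell \<longrightarrow> min 1 (gramian_ratio \<Phi> (weight h s) \<omega>) \<le> ennreal (K * weight h (k - s) \<omega>)"
  then obtain K where K: "K \<ge> 0" "\<And>h. h > 0 \<Longrightarrow> AE \<omega> in lborel. \<omega> \<in> cell \<longrightarrow> min 1 (gramian_ratio \<Phi> (weight h s) \<omega>) \<le> ennreal (K * weight h (k - s) \<omega>)" by blast
  obtain r where r: "r > 0" "\<And>t. 0 \<le> t \<Longrightarrow> t < r \<Longrightarrow> K * t powr (k - s) < 1"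
    using powr_small[of "k - s" K] sk K(1) by (metis diff_gt_0_iff_gt)
  define a where "a = min pi (sqrt (r / 2))"
  have a: "a > 0" "a \<le> pi" unfolding a_def using r(1) by auto
  have "a\<^sup>2 \<le> (sqrt (r / 2))\<^sup>2" using a(1) by (intro power_mono) (auto simp: a_def)
  then have a3: "a\<^sup>2 \<le> r / 2" using r(1) by simp
  let ?\<Omega> = "ball 0 a :: (real^'d) set"
  have \<Omega>c: "?\<Omega> \<subseteq> cell" using cell_neighbourhood a(2) by blast
  let ?e = "2 powr \<bar>k - s\<bar>"
  let ?M = "(2 powr \<bar>s\<bar>)\<^sup>2 * (2 * ((K + 1) * ?e))"
  have M0: "?M \<ge> 0" using K(1) by simp
  (* The exceptional null set depends on h, and h will be chosen depending on the frequency: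
     only countably many values of h are allowed. *)
  have rat: "AE \<omega> in lborel. \<forall>h\<in>\<rat> \<inter> {0<..}. \<omega> \<in> cell \<longrightarrow> min 1 (gramian_ratio \<Phi> (weight h s) \<omega>) \<le> ennreal (K * weight h (k - s) \<omega>)"
    by (intro AE_ball_countable[THEN iffD2] countable_Int1 countable_rat ballI K(2)) auto
  have "esssup (lebesgue_on ?\<Omega>) (stationary_quotient s k \<Phi>) \<le> ennreal ?M"
  proof (rule esssup_I)
    show "stationary_quotient s k \<Phi> \<in> borel_measurable (lebesgue_on ?\<Omega>)"
      unfolding stationary_quotient_eq[abs_def] using fin \<Phi> \<Omega>c by (intro ratio_measurable_AE) auto
    show "AE \<omega> in lebesgue_on ?\<Omega>. stationary_quotient s k \<Phi> \<omega> \<le> ennreal ?M"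
      unfolding AE_lebesgue_on_iff[OF borel_open[OF open_ball]] using rat AE_regular_frequency[OF fin \<Phi>]
    proof eventually_elim
      case (elim \<omega>)
      show ?case
      proof
        assume w: "\<omega> \<in> ?\<Omega>"
        then have c: "\<omega> \<in> cell" using \<Omega>c by blast
        then have g: "regular_frequency s \<Phi> \<omega>" using elim by blast
        then have w0: "\<omega> \<noteq> 0" by (simp add: regular_frequency_def)
        then have "norm \<omega> / 2 < norm \<omega>" by simp
        (* A value of h of the order of |w|, so that all weights with h and with 0 are comparable. *)
        then obtain h where h: "h \<in> \<rat>" "norm \<omega> / 2 < h" "h < norm \<omega>" using Rats_dense_in_real by blast
        have "0 < norm \<omega> / 2" using w0 by simp
        then have h0: "h > 0" using h(2) by linarith
        have "(norm \<omega>)\<^sup>2 < a\<^sup>2" "h\<^sup>2 < a\<^sup>2" using w h h0 by (auto intro!: power_strict_mono)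
        then have "(norm \<omega>)\<^sup>2 + h\<^sup>2 < r" using a3 by linarith
        then have lt: "K * weight h (k - s) \<omega> < 1" unfolding weight_def by (intro r(2)) auto
        have "min 1 (gramian_ratio \<Phi> (weight h s) \<omega>) \<le> ennreal (K * weight h (k - s) \<omega>)" using elim c h(1) h0 by blast
        then have "gramian_ratio \<Phi> (weight h s) \<omega> \<le> ennreal (K * weight h (k - s) \<omega>)" using lt by (rule ratio_le_of_min)
        also have "K * weight h (k - s) \<omega> \<le> (K + 1) * (?e * weight 0 (k - s) \<omega>)"
          using K(1) h h0 w0 by (intro mult_mono weight_compare_zero) auto
        finally have R: "gramian_ratio \<Phi> (weight h s) \<omega> \<le> ennreal ((K + 1) * (?e * weight 0 (k - s) \<omega>))" by (simp add: ennreal_leI)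
        have q: "(K + 1) * (?e * weight 0 (k - s) \<omega>) > 0" using K(1) weight_zero_pos[OF w0] by simp
        have "norm \<omega> \<le> pi" using w a(2) by simp
        from stationary_ratio_le[OF fin g h0 less_imp_le[OF h(3)] this q R]
        have "gramian_ratio \<Phi> (weight 0 s) \<omega> \<le> ennreal (?M * weight 0 (k - s) \<omega>)" by (simp add: mult.assoc)
        then show "stationary_quotient s k \<Phi> \<omega> \<le> ennreal ?M"
          by (simp only: stationary_quotient_eq quotient_le_iff[OF weight_zero_pos[OF w0] M0])
      qed
    qed
  qed
  then have "esssup (lebesgue_on ?\<Omega>) (stationary_quotient s k \<Phi>) < \<infinity>" by (rule le_less_trans) simp
  then show "\<exists>\<Omega>. open \<Omega> \<and> 0 \<in> \<Omega> \<and> esssup (lebesgue_on \<Omega>) (stationary_quotient s k \<Phi>) < \<infinity>"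
    using a(1) by (intro exI[of _ ?\<Omega>]) simp
next
  assume "\<exists>\<Omega>. open \<Omega> \<and> 0 \<in> \<Omega> \<and> esssup (lebesgue_on \<Omega>) (stationary_quotient s k \<Phi>) < \<infinity>"
  then obtain \<Omega> where \<Omega>: "open \<Omega>" "0 \<in> \<Omega>" and E: "esssup (lebesgue_on \<Omega>) (stationary_quotient s k \<Phi>) < \<infinity>" by blast
  obtain M' where M': "M' \<ge> 0" "esssup (lebesgue_on \<Omega>) (stationary_quotient s k \<Phi>) = ennreal M'"
    using E by (cases "esssup (lebesgue_on \<Omega>) (stationary_quotient s k \<Phi>)") auto
  (* Positivity of the constant is needed to select a vector strictly below twice the bound. *)
  define M where "M = M' + 1"
  have M: "M > 0" unfolding M_def using M'(1) by simp
  have "AE \<omega> in lebesgue_on \<Omega>. stationary_quotient s k \<Phi> \<omega> \<le> ennreal M"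
    using esssup_AE[where M="lebesgue_on \<Omega>" and f="stationary_quotient s k \<Phi>"]
  proof eventually_elim
    case (elim \<omega>)
    also have "esssup (lebesgue_on \<Omega>) (stationary_quotient s k \<Phi>) \<le> ennreal M" unfolding M'(2) M_def by (rule ennreal_leI) simp
    finally show ?case .
  qed
  then have Q: "AE \<omega> in lborel. \<omega> \<in> \<Omega> \<longrightarrow> stationary_quotient s k \<Phi> \<omega> \<le> ennreal M"
    unfolding AE_lebesgue_on_iff[OF borel_open[OF \<Omega>(1)]] .
  obtain r where r: "r > 0" "ball 0 r \<subseteq> \<Omega>" using \<Omega> open_contains_ball by blast
  obtain t0 where t0: "t0 > 0" "\<And>t. 0 \<le> t \<Longrightarrow> t < t0 \<Longrightarrow> (4 * M) * t powr (k - s) < 1"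
    using powr_small[of "k - s" "4 * M"] sk M by (metis diff_gt_0_iff_gt less_imp_le mult_nonneg_nonneg zero_le_numeral)
  (* The bound r puts the frequency into the neighbourhood, 1 keeps h below the norms on the
     rest of the fiber, and t0 makes the stationary ratio small. *)
  define a where "a = min (min r 1) (sqrt t0)"
  have a: "a > 0" "a \<le> r" "a \<le> 1" unfolding a_def using r(1) t0(1) by auto
  have "a\<^sup>2 \<le> (sqrt t0)\<^sup>2" using a(1) by (intro power_mono) (auto simp: a_def)
  then have a2: "a\<^sup>2 \<le> t0" using t0(1) by simp
  have c: "a\<^sup>2 > 0" using a(1) by simp
  let ?c = "2 powr \<bar>s\<bar>"
  define K where "K = max (1 / (a\<^sup>2) powr (k - s)) (4 * ?c * M)"
  have K: "1 / (a\<^sup>2) powr (k - s) \<le> K" "4 * ?c * M \<le> K" unfolding K_def by auto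
  have "0 \<le> 4 * ?c * M" using M by simp
  then have K0: "K \<ge> 0" using K(2) by linarith
  have "AE \<omega> in lborel. \<omega> \<in> cell \<longrightarrow> min 1 (gramian_ratio \<Phi> (weight h s) \<omega>) \<le> ennreal (K * weight h (k - s) \<omega>)" if h: "h > 0" for h
    using Q AE_regular_frequency[OF fin \<Phi>]
  proof eventually_elim
    case (elim \<omega>)
    show ?case
    proof
      assume cl: "\<omega> \<in> cell"
      then have g: "regular_frequency s \<Phi> \<omega>" using elim by blast
      then have w0: "\<omega> \<noteq> 0" by (simp add: regular_frequency_def)
      show "min 1 (gramian_ratio \<Phi> (weight h s) \<omega>) \<le> ennreal (K * weight h (k - s) \<omega>)"
      proof (cases "norm \<omega> < a \<and> h < a")
        case False
        have "a\<^sup>2 \<le> (norm \<omega>)\<^sup>2 + h\<^sup>2"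
        proof (cases "norm \<omega> < a")
          case True
          then have "a\<^sup>2 \<le> h\<^sup>2" using False a(1) by (intro power_mono) auto
          then show ?thesis by (simp add: add_increasing)
        next
          case False
          then have "a\<^sup>2 \<le> (norm \<omega>)\<^sup>2" using a(1) by (intro power_mono) auto
          then show ?thesis by (simp add: add_increasing2)
        qed
        then show ?thesis by (rule ratio_bound_far[OF sk c _ K(1)])
      next
        case True
        then have "\<omega> \<in> \<Omega>" using r(2) a(2) by auto
        then have "stationary_quotient s k \<Phi> \<omega> \<le> ennreal M" using elim by blast
        then have R: "gramian_ratio \<Phi> (weight 0 s) \<omega> \<le> ennreal (M * weight 0 (k - s) \<omega>)"
          by (simp only: stationary_quotient_eq quotient_le_iff[OF weight_zero_pos[OF w0] less_imp_le[OF M]])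
        have "(norm \<omega>)\<^sup>2 < a\<^sup>2" using True by (intro power_strict_mono) auto
        then have "4 * M * weight 0 (k - s) \<omega> < 1" unfolding weight_def using a2 by (intro t0(2)) auto
        from nonstationary_ratio_le[OF fin g h _ k M this R]
        have "gramian_ratio \<Phi> (weight h s) \<omega> \<le> ennreal (4 * ?c * M * weight h (k - s) \<omega>)" using True a(3) by simp
        also have "\<dots> \<le> ennreal (K * weight h (k - s) \<omega>)" by (intro ennreal_leI mult_right_mono K(2)) simp
        finally show ?thesis by (rule min.coboundedI2)
      qed
    qed
  qed
  then show "\<exists>K\<ge>0. \<forall>h>0. AE \<omega> in lborel. \<omega> \<in> cell \<longrightarrow> min 1 (gramian_ratio \<Phi> (weight h s) \<omega>) \<le> ennreal (K * weight h (k - s) \<omega>)"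
    using K0 by blast
qed

theorem theorem21:
  fixes s k :: real
    and \<Phi> :: "'d::finite dist set"
    and \<Psi> :: "real \<Rightarrow> 'd dist set"
  assumes "k > s"
  shows
    "(finite \<Phi> \<and> \<Phi> \<subseteq> W s \<and> k > 0 \<longrightarrow>
       (approximation_order s k (\<lambda>h. dist_dilate h ` fsi_space s \<Phi>) \<longleftrightarrow>
        (\<exists>\<Omega>. open \<Omega> \<and> 0 \<in> \<Omega> \<and>
           esssup (lebesgue_on \<Omega>) (stationary_quotient s k \<Phi>) < \<infinity>)))
     \<and>
     ((\<forall>h>0. finite (\<Psi> h) \<and> \<Psi> h \<subseteq> W s) \<and> k \<ge> 0 \<longrightarrow>
       (approximation_order s k (\<lambda>h. dist_dilate h ` fsi_space s (\<Psi> h)) \<longleftrightarrow>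
        (\<exists>\<Omega> h0. open \<Omega> \<and> 0 \<in> \<Omega> \<and> h0 > 0 \<and>
           (\<exists>M::real. \<forall>h. 0 < h \<and> h < h0 \<longrightarrow>
              esssup (lebesgue_on \<Omega>) (nonstationary_quotient s k h (\<Psi> h)) \<le> ennreal M))))"
proof (intro conjI impI)
  assume H: "finite \<Phi> \<and> \<Phi> \<subseteq> W s \<and> k > 0"
  then have "approximation_order s k (\<lambda>h. dist_dilate h ` fsi_space s \<Phi>) \<longleftrightarrow>
    (\<exists>K\<ge>0. \<forall>h>0. AE \<omega> in lborel. \<omega> \<in> cell \<longrightarrow> min 1 (gramian_ratio \<Phi> (weight h s) \<omega>) \<le> ennreal (K * weight h (k - s) \<omega>))"
    by (intro approximation_order_iff_ratio[OF assms]) simp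
  also have "\<dots> \<longleftrightarrow> (\<exists>\<Omega>. open \<Omega> \<and> 0 \<in> \<Omega> \<and> esssup (lebesgue_on \<Omega>) (stationary_quotient s k \<Phi>) < \<infinity>)"
    using H by (intro stationary_condition_iff[OF assms]) auto
  finally show "approximation_order s k (\<lambda>h. dist_dilate h ` fsi_space s \<Phi>) \<longleftrightarrow>
    (\<exists>\<Omega>. open \<Omega> \<and> 0 \<in> \<Omega> \<and> esssup (lebesgue_on \<Omega>) (stationary_quotient s k \<Phi>) < \<infinity>)" .
next
  assume H: "(\<forall>h>0. finite (\<Psi> h) \<and> \<Psi> h \<subseteq> W s) \<and> k \<ge> 0"
  then have \<Psi>: "finite (\<Psi> h) \<and> \<Psi> h \<subseteq> W s" if "h > 0" for h using that by blast
  show "approximation_order s k (\<lambda>h. dist_dilate h ` fsi_space s (\<Psi> h)) \<longleftrightarrow>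
        (\<exists>\<Omega> h0. open \<Omega> \<and> 0 \<in> \<Omega> \<and> h0 > 0 \<and>
           (\<exists>M::real. \<forall>h. 0 < h \<and> h < h0 \<longrightarrow>
              esssup (lebesgue_on \<Omega>) (nonstationary_quotient s k h (\<Psi> h)) \<le> ennreal M))"
    using approximation_order_iff_ratio[of s k \<Psi>] nonstationary_condition_iff[of s k \<Psi>] assms \<Psi> by simp
qed

end
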